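(* Let $Q$ be a symmetric quiver. The isomorphism of graded vector spaces $F:\mathcal P_Q^\vee\to\mathcal H_Q$, given on $\xi\in\mathcal P_{Q,\mathbf d}^\vee$ by $$F_\xi=\prod_{k<l}(z_k-z_l)^{\mathcal N(i_k,i_l)}\cdot\langle\xi,\,Y(i_1,z_1)\cdots Y(i_p,z_p)\mathbf 1\rangle\Big|_{z_{\mathbf d_1+\dots+\mathbf d_{j-1}+k}=x_{j,k}},$$ sends the product $\delta^\vee$ of the commutative associative algebra $\mathcal P_Q^\vee$ (dual to the coproduct $\delta$ of $\mathcal P_Q$) to the shuffle product of $\mathcal H_Q$; that is, $F_{\delta^\vee(\zeta\otimes\xi)}=F_\zeta*F_\xi$ for all $\zeta,\xi\in\mathcal P_Q^\vee$.
   Context: The ground field is $\mathbb Q$. $Q$ is a finite quiver with vertex set $I$ which is symmetric (as many arrows $i\to j$ as $j\to i$). $L=\mathbb Z^I$ has standard basis $(e_i)$ and Euler form $\chi(\mathbf d,\mathbf e)=\sum_i\mathbf d_i\mathbf e_i-\sum_{a:i\to j}\mathbf d_i\mathbf e_j$. $L$-graded vector spaces have braiding $a\otimes b\mapsto(-1)^{\chi(\alpha,\beta)}b\otimes a$ for $a,b$ of $L$-degrees $\alpha,\beta$; Lie algebras, enveloping algebras, coproducts and tensor products of modules, (co)commutativity are taken in this symmetric monoidal category. Shifts: $M[k]^n=M^{n+k}$. $\mathcal N(i,j)=-\chi(e_i,e_j)$, $\mathcal N_+=\max(\mathcal N,0)$. $\mathfrak L$ is the Lie algebra generated by symbols $i(n)$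 ($i\in I$, $n\in\mathbb Z$) of $L$-degree $e_i$ and weight $\frac12\chi(e_i,e_i)-n-1$, with relations $\sum_{k=0}^N(-1)^k\binom Nk[i(m-k),j(n+k)]=0$, $N=\mathcal N_+(i,j)$, for all $i,j\in I$, $m,n\in\mathbb Z$. The principal free vertex algebra is $\mathcal P_Q=U(\mathfrak L)/U(\mathfrak L)\{i(n):i\in I,n\ge0\}$ with cyclic vector (vacuum) $\mathbf 1$ of degree $0$, and $Y(i,z)=\sum_{n\in\mathbb Z}i(n)z^{-n-1}$ acting on $\mathcal P_Q$. Cohomological degree is $-2$ times weight; $\mathcal P_Q=\bigoplus_{\mathbf d\in\mathbb N^I,n\in\mathbb Z}\mathcal P_{Q,\mathbf d}^n$ has finite-dimensional components and the graded dual is $\mathcal P_Q^\vee=\bigoplus_{\mathbf d}\mathcal P_{Q,\mathbf d}^\vee$, $\mathcal P_{Q,\mathbf d}^\vee=\bigoplus_n(\mathcal P_{Q,\mathbf d}^{-n})^\vee$. $\delta:\mathcal P_Q\to\mathcal P_Q\otimes\mathcal P_Q$ is the unique $U(\mathfrak L)$-module morphism with $\delta(\mathbf 1)=\mathbf 1\otimes\mathbf 1$, where $U(\mathfrak L)$ acts on the tensor product through its canonical coproduct (elements of $\mathfrak L$ primitive); it makes $\mathcal P_Q$ a cocommutative coassociative coalgebra. The dual product is defined by $\langle\delta^\vee(\zeta\otimes\xi),u\rangle=\langle\zeta\otimes\xi,\delta(u)\rangle$, where the pairing follows the braiding: $\langle\zeta\otimes\xi,u\otimes v\rangle=(-1)^{\chi(\mathbf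 d,\mathbf e)}\langle\zeta,u\rangle\langle\xi,v\rangle$ for $\zeta\in\mathcal P_{Q,\mathbf d}^\vee$, $\xi\in\mathcal P_{Q,\mathbf e}^\vee$, $u\in\mathcal P_{Q,\mathbf d}$, $v\in\mathcal P_{Q,\mathbf e}$ (and zero on other components). $\mathcal H_Q=\bigoplus_{\mathbf d\in\mathbb N^I}\mathcal H_{Q,\mathbf d}$, $\mathcal H_{Q,\mathbf d}=\Lambda_{\mathbf d}[-\chi(\mathbf d,\mathbf d)]$, with $\Lambda_{\mathbf d}=\mathbb Q[x_{i,k}:i\in I,1\le k\le\mathbf d_i]^{\Sigma_{\mathbf d}}$, $\Sigma_{\mathbf d}=\prod_i\Sigma_{\mathbf d_i}$, $\deg x_{i,k}=2$. The product (cohomological Hall algebra product) of $f\in\mathcal H_{Q,\mathbf d}$, $g\in\mathcal H_{Q,\mathbf e}$ is the shuffle product $f*g=\sum_\sigma\sigma(f(x)g(y)K(x,y))$, $K=\prod_{i,j\in I}\prod_{k=1}^{\mathbf d_i}\prod_{\ell=1}^{\mathbf e_j}(y_{j,\ell}-x_{i,k})^{-\chi(e_i,e_j)}$, where $x_{i,k}$ are the first $\mathbf d_i$ and $y_{i,\ell}$ the last $\mathbf e_i$ of the $\mathbf d_i+\mathbf e_i$ variables of colour $i$, and $\sigma\in\Sigma_{\mathbf d+\mathbf e}$ runs over $(\mathbf d,\mathbf e)$-shuffles (each $\sigma_i$ increasing on $\{1,\dots,\mathbf d_i\}$ and on $\{\mathbf d_i+1,\dots,\mathbf d_i+\mathbf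 e_i\}$). In the formula for $F_\xi$, $I=\{1,\dots,r\}$ via a chosen order, $p=\sum_i\mathbf d_i$, $i_{\mathbf d_1+\dots+\mathbf d_{j-1}+k}=j$ for $1\le k\le\mathbf d_j$, and negative powers of $z_k-z_l$ ($k<l$) are expanded in non-negative powers of $z_l$. *)

theory Defs
  imports
    "Graph_Theory.Digraph"
    "HOL-Library.Poly_Mapping"
    "HOL-Library.Product_Lexorder"
    "HOL-Combinatorics.Permutations"
    "HOL-Computational_Algebra.Polynomial_Factorial"
begin

section \<open>Symmetric quivers and the braiding\<close>

text \<open>
  A finite quiver is a \<^locale>\<open>fin_digraph\<close> (loops and multiple arrows are allowed) whose vertices
  are the elements of a finite type \<open>'i\<close>; the linear order of \<open>'i\<close> is the chosen order on the
  vertices. The lattice \<open>\<int>\<^sup>I\<close> is \<open>'i \<Rightarrow> int\<close>, the monoid \<open>\<nat>\<^sup>I\<close> is \<open>'i \<Rightarrow> nat\<close>.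
\<close>

definition symmetric_quiver :: "('i, 'a) pre_digraph \<Rightarrow> bool" where
  "symmetric_quiver Q \<longleftrightarrow>
     (\<forall>i j. card {a \<in> arcs Q. tail Q a = i \<and> head Q a = j} =
            card {a \<in> arcs Q. tail Q a = j \<and> head Q a = i})"

definition basis_vec :: "'i \<Rightarrow> 'i \<Rightarrow> int" where
  "basis_vec i = (\<lambda>j. if j = i then 1 else 0)"

definition euler :: "('i, 'a) pre_digraph \<Rightarrow> ('i \<Rightarrow> int) \<Rightarrow> ('i \<Rightarrow> int) \<Rightarrow> int" where
  "euler Q d e = (\<Sum>i\<in>verts Q. d i * e i) - (\<Sum>a\<in>arcs Q. d (tail Q a) * e (head Q a))"

definition braid :: "('i, 'a) pre_digraph \<Rightarrow> ('i \<Rightarrow> int) \<Rightarrow> ('i \<Rightarrow> int) \<Rightarrow> rat" where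
  "braid Q d e = (-1) powi euler Q d e"

definition locN :: "('i, 'a) pre_digraph \<Rightarrow> 'i \<Rightarrow> 'i \<Rightarrow> int" where
  "locN Q i j = - euler Q (basis_vec i) (basis_vec j)"

section \<open>The Lie algebra of modes\<close>

text \<open>
  \<open>Mode i n\<close> is the generator \<open>i(n)\<close>. Finitely supported functions on \<open>'i lie_word\<close> form the free
  nonassociative algebra on the generators, and the Lie algebra \<open>\<LL>\<close> is its quotient by
  the ideal \<open>lie_rel Q\<close> spanned by the consequences of antisymmetry and the Jacobi identity (both
  with the signs of the braiding) and of the defining relations.
\<close>

datatype 'i lie_word = Mode 'i int | Brk "'i lie_word" "'i lie_word"

type_synonym 'i lie_vec = "'i lie_word \<Rightarrow>\<^sub>0 rat"

primrec lie_deg :: "'i lie_word \<Rightarrow> 'i \<Rightarrow> int" where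
  "lie_deg (Mode i n) = basis_vec i"
| "lie_deg (Brk a b) = (\<lambda>i. lie_deg a i + lie_deg b i)"

primrec lie_weight :: "('i, 'a) pre_digraph \<Rightarrow> 'i lie_word \<Rightarrow> rat" where
  "lie_weight Q (Mode i n) =
     of_int (euler Q (basis_vec i) (basis_vec i)) / 2 - of_int n - 1"
| "lie_weight Q (Brk a b) = lie_weight Q a + lie_weight Q b"

definition lie_bracket :: "'i lie_vec \<Rightarrow> 'i lie_vec \<Rightarrow> 'i lie_vec" where
  "lie_bracket u v =
     (\<Sum>a\<in>Poly_Mapping.keys u. \<Sum>b\<in>Poly_Mapping.keys v.
        Poly_Mapping.single (Brk a b) (Poly_Mapping.lookup u a * Poly_Mapping.lookup v b))"

inductive_set lie_rel :: "('i, 'a) pre_digraph \<Rightarrow> 'i lie_vec set"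
  for Q :: "('i, 'a) pre_digraph" where
  zero: "0 \<in> lie_rel Q"
| add: "u \<in> lie_rel Q \<Longrightarrow> v \<in> lie_rel Q \<Longrightarrow> u + v \<in> lie_rel Q"
| scale: "u \<in> lie_rel Q \<Longrightarrow> Poly_Mapping.map ((*) c) u \<in> lie_rel Q"
| left: "u \<in> lie_rel Q \<Longrightarrow> lie_bracket v u \<in> lie_rel Q"
| right: "u \<in> lie_rel Q \<Longrightarrow> lie_bracket u v \<in> lie_rel Q"
| antisymmetry:
    "Poly_Mapping.single (Brk a b) 1
       + Poly_Mapping.single (Brk b a) (braid Q (lie_deg a) (lie_deg b)) \<in> lie_rel Q"
| jacobi:
    "Poly_Mapping.single (Brk a (Brk b c)) 1 - Poly_Mapping.single (Brk (Brk a b) c) 1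
       - Poly_Mapping.single (Brk b (Brk a c)) (braid Q (lie_deg a) (lie_deg b)) \<in> lie_rel Q"
| locality:
    "N = nat (max (locN Q i j) 0) \<Longrightarrow>
     (\<Sum>k\<le>N. Poly_Mapping.single (Brk (Mode i (m - int k)) (Mode j (n + int k)))
        ((-1) ^ k * of_nat (N choose k))) \<in> lie_rel Q"

section \<open>The enveloping algebra and the principal free vertex algebra\<close>

text \<open>
  The free monoid, written additively so that finitely supported functions on it, with the
  convolution product of \<^theory>\<open>HOL-Library.Poly_Mapping\<close>, form the free associative algebra.
\<close>

datatype 'g word = Word (letters: "'g list")

instantiation word :: (type) monoid_add
begin

definition zero_word :: "'a word" where
  "zero_word = Word []"

definition plus_word :: "'a word \<Rightarrow> 'a word \<Rightarrow> 'a word" where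
  "plus_word v w = Word (letters v @ letters w)"

instance
  by standard (simp_all add: zero_word_def plus_word_def)

end

text \<open>
  \<open>'i tensor_alg\<close> is the tensor algebra of the free nonassociative algebra. The quotient by the
  two-sided ideal \<open>env_ideal Q\<close> is \<open>U(\<LL>)\<close>; the further quotient by the left ideal generated by
  the \<open>i(n)\<close> with \<open>n \<ge> 0\<close> is \<open>\<P>\<^sub>Q\<close>, whose elements are the cosets \<open>vac_class Q u\<close>,
  where \<open>u\<close> is any representative.
\<close>

type_synonym 'i tensor_alg = "'i lie_word word \<Rightarrow>\<^sub>0 rat"

abbreviation mono_word :: "'g list \<Rightarrow> 'g word \<Rightarrow>\<^sub>0 rat" where
  "mono_word xs \<equiv> Poly_Mapping.single (Word xs) 1"

definition lie_incl :: "'i lie_vec \<Rightarrow> 'i tensor_alg" where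
  "lie_incl u =
     (\<Sum>a\<in>Poly_Mapping.keys u. Poly_Mapping.single (Word [a]) (Poly_Mapping.lookup u a))"

inductive_set env_ideal :: "('i, 'a) pre_digraph \<Rightarrow> 'i tensor_alg set"
  for Q :: "('i, 'a) pre_digraph" where
  zero: "0 \<in> env_ideal Q"
| add: "u \<in> env_ideal Q \<Longrightarrow> v \<in> env_ideal Q \<Longrightarrow> u + v \<in> env_ideal Q"
| left: "u \<in> env_ideal Q \<Longrightarrow> x * u \<in> env_ideal Q"
| right: "u \<in> env_ideal Q \<Longrightarrow> u * x \<in> env_ideal Q"
| lie: "r \<in> lie_rel Q \<Longrightarrow> lie_incl r \<in> env_ideal Q"
| commutator:
    "mono_word [a, b] - Poly_Mapping.single (Word [b, a]) (braid Q (lie_deg a) (lie_deg b))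
       - mono_word [Brk a b] \<in> env_ideal Q"

inductive_set vac_ideal :: "('i, 'a) pre_digraph \<Rightarrow> 'i tensor_alg set"
  for Q :: "('i, 'a) pre_digraph" where
  env: "u \<in> env_ideal Q \<Longrightarrow> u \<in> vac_ideal Q"
| add: "u \<in> vac_ideal Q \<Longrightarrow> v \<in> vac_ideal Q \<Longrightarrow> u + v \<in> vac_ideal Q"
| annihilate: "n \<ge> 0 \<Longrightarrow> x * mono_word [Mode i n] \<in> vac_ideal Q"

definition vac_class :: "('i, 'a) pre_digraph \<Rightarrow> 'i tensor_alg \<Rightarrow> 'i tensor_alg set" where
  "vac_class Q u = {v. v - u \<in> vac_ideal Q}"

definition PQ :: "('i, 'a) pre_digraph \<Rightarrow> 'i tensor_alg set set" where
  "PQ Q = range (vac_class Q)"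

definition word_deg :: "'i lie_word word \<Rightarrow> 'i \<Rightarrow> int" where
  "word_deg w i = (\<Sum>a\<leftarrow>letters w. lie_deg a i)"

definition word_weight :: "('i, 'a) pre_digraph \<Rightarrow> 'i lie_word word \<Rightarrow> rat" where
  "word_weight Q w = (\<Sum>a\<leftarrow>letters w. lie_weight Q a)"

definition PQ_comp :: "('i, 'a) pre_digraph \<Rightarrow> ('i \<Rightarrow> nat) \<Rightarrow> int \<Rightarrow> 'i tensor_alg set set" where
  "PQ_comp Q d n =
     vac_class Q ` {u. \<forall>w\<in>Poly_Mapping.keys u.
                         word_deg w = (\<lambda>i. int (d i)) \<and> - 2 * word_weight Q w = of_int n}"

section \<open>The coproduct\<close>

text \<open>
  Finitely supported functions on pairs of words are the tensor square of the tensor algebra, with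
  the braided multiplication
  \<open>(u \<otimes> v)(u' \<otimes> v') = (-1)\<^bsup>\<chi>(|v|,|u'|)\<^esup> uu' \<otimes> vv'\<close>. The canonical coproduct of \<open>U(\<LL>)\<close> lifts
  to \<open>env_coprod Q\<close>, the morphism of algebras for which the letters are primitive.
  \<open>\<P>\<^sub>Q \<otimes> \<P>\<^sub>Q\<close> is the quotient by \<open>K \<otimes> T + T \<otimes> K\<close>, with \<open>T\<close> the tensor algebra and
  \<open>K = vac_ideal Q\<close>.
\<close>

type_synonym 'i tensor_sq = "('i lie_word word \<times> 'i lie_word word) \<Rightarrow>\<^sub>0 rat"

definition tens :: "'i tensor_alg \<Rightarrow> 'i tensor_alg \<Rightarrow> 'i tensor_sq" where
  "tens u v =
     (\<Sum>a\<in>Poly_Mapping.keys u. \<Sum>b\<in>Poly_Mapping.keys v.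
        Poly_Mapping.single (a, b) (Poly_Mapping.lookup u a * Poly_Mapping.lookup v b))"

definition tens_mult :: "('i, 'a) pre_digraph \<Rightarrow> 'i tensor_sq \<Rightarrow> 'i tensor_sq \<Rightarrow> 'i tensor_sq" where
  "tens_mult Q s t =
     (\<Sum>(u, v)\<in>Poly_Mapping.keys s. \<Sum>(u', v')\<in>Poly_Mapping.keys t.
        Poly_Mapping.single (u + u', v + v')
          (braid Q (word_deg v) (word_deg u')
             * Poly_Mapping.lookup s (u, v) * Poly_Mapping.lookup t (u', v')))"

definition env_coprod :: "('i, 'a) pre_digraph \<Rightarrow> 'i tensor_alg \<Rightarrow> 'i tensor_sq" where
  "env_coprod Q x =
     (\<Sum>w\<in>Poly_Mapping.keys x.
        tens_mult Q (Poly_Mapping.single (0, 0) (Poly_Mapping.lookup x w))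
          (foldr (\<lambda>a. tens_mult Q (tens (mono_word [a]) 1 + tens 1 (mono_word [a])))
             (letters w) (tens 1 1)))"

inductive_set vac_ideal2 :: "('i, 'a) pre_digraph \<Rightarrow> 'i tensor_sq set"
  for Q :: "('i, 'a) pre_digraph" where
  left: "u \<in> vac_ideal Q \<Longrightarrow> tens u v \<in> vac_ideal2 Q"
| right: "v \<in> vac_ideal Q \<Longrightarrow> tens u v \<in> vac_ideal2 Q"
| add: "s \<in> vac_ideal2 Q \<Longrightarrow> t \<in> vac_ideal2 Q \<Longrightarrow> s + t \<in> vac_ideal2 Q"

definition vac_class2 :: "('i, 'a) pre_digraph \<Rightarrow> 'i tensor_sq \<Rightarrow> 'i tensor_sq set" where
  "vac_class2 Q s = {t. t - s \<in> vac_ideal2 Q}"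

text \<open>
  Compatibility with scalars is the case of a scalar \<open>x\<close> in the fourth clause. Outside the carrier
  \<open>PQ Q\<close> the value is fixed to make the map unique.
\<close>

definition is_vac_coprod ::
  "('i, 'a) pre_digraph \<Rightarrow> ('i tensor_alg set \<Rightarrow> 'i tensor_sq set) \<Rightarrow> bool" where
  "is_vac_coprod Q \<delta> \<longleftrightarrow>
     (\<forall>X. X \<notin> PQ Q \<longrightarrow> \<delta> X = {}) \<and>
     (\<forall>X\<in>PQ Q. \<delta> X \<in> range (vac_class2 Q)) \<and>
     (\<forall>u v s t. \<delta> (vac_class Q u) = vac_class2 Q s \<and> \<delta> (vac_class Q v) = vac_class2 Q t \<longrightarrow>
        \<delta> (vac_class Q (u + v)) = vac_class2 Q (s + t)) \<and>
     (\<forall>x u t. \<delta> (vac_class Q u) = vac_class2 Q t \<longrightarrow>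
        \<delta> (vac_class Q (x * u)) = vac_class2 Q (tens_mult Q (env_coprod Q x) t)) \<and>
     \<delta> (vac_class Q 1) = vac_class2 Q (tens 1 1)"

definition vac_coprod :: "('i, 'a) pre_digraph \<Rightarrow> 'i tensor_alg set \<Rightarrow> 'i tensor_sq set" where
  "vac_coprod Q = (THE \<delta>. is_vac_coprod Q \<delta>)"

section \<open>The graded dual and its product\<close>

text \<open>
  An element of \<open>\<P>\<^sub>Q\<^sup>\<or>\<close> is a linear form on \<open>\<P>\<^sub>Q\<close> that vanishes on all but finitely many
  components; as a function on cosets it is set to \<open>0\<close> outside the carrier.
\<close>

type_synonym 'i vac_form = "'i tensor_alg set \<Rightarrow> rat"

definition PQ_dual :: "('i, 'a) pre_digraph \<Rightarrow> 'i vac_form set" where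
  "PQ_dual Q =
     {\<xi>. (\<forall>X. X \<notin> PQ Q \<longrightarrow> \<xi> X = 0) \<and>
         (\<forall>u v. \<xi> (vac_class Q (u + v)) = \<xi> (vac_class Q u) + \<xi> (vac_class Q v)) \<and>
         (\<forall>c u. \<xi> (vac_class Q (Poly_Mapping.map ((*) c) u)) = c * \<xi> (vac_class Q u)) \<and>
         (\<exists>S. finite S \<and> (\<forall>d n. (d, n) \<notin> S \<longrightarrow> (\<forall>X\<in>PQ_comp Q d n. \<xi> X = 0)))}"

text \<open>The component of \<open>\<P>\<^sub>Q\<^sup>\<or>\<close> of cohomological degree \<open>n\<close> is dual to that of \<open>\<P>\<^sub>Q\<close> of degree \<open>-n\<close>.\<close>

definition PQ_dual_comp :: "('i, 'a) pre_digraph \<Rightarrow> ('i \<Rightarrow> nat) \<Rightarrow> int \<Rightarrow> 'i vac_form set" where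
  "PQ_dual_comp Q d n =
     {\<xi> \<in> PQ_dual Q. \<forall>e m. (e, m) \<noteq> (d, - n) \<longrightarrow> (\<forall>X\<in>PQ_comp Q e m. \<xi> X = 0)}"

text \<open>The pairing of \<open>\<zeta> \<otimes> \<xi>\<close> with a representative of an element of \<open>\<P>\<^sub>Q \<otimes> \<P>\<^sub>Q\<close>.\<close>

definition pair2 :: "('i, 'a) pre_digraph \<Rightarrow> 'i vac_form \<Rightarrow> 'i vac_form \<Rightarrow> 'i tensor_sq \<Rightarrow> rat" where
  "pair2 Q \<zeta> \<xi> t =
     (\<Sum>(u, v)\<in>Poly_Mapping.keys t.
        Poly_Mapping.lookup t (u, v) * braid Q (word_deg u) (word_deg v)
          * \<zeta> (vac_class Q (Poly_Mapping.single u 1)) * \<xi> (vac_class Q (Poly_Mapping.single v 1)))"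

definition dual_mult :: "('i, 'a) pre_digraph \<Rightarrow> 'i vac_form \<Rightarrow> 'i vac_form \<Rightarrow> 'i vac_form" where
  "dual_mult Q \<zeta> \<xi> X =
     (if X \<in> PQ Q then (THE c. \<exists>t. vac_coprod Q X = vac_class2 Q t \<and> c = pair2 Q \<zeta> \<xi> t) else 0)"

section \<open>The cohomological Hall algebra as a shuffle algebra\<close>

text \<open>
  Polynomials in the variables \<open>x\<^bsub>i,k\<^esub>\<close>, encoded as pairs \<open>(i, k)\<close>. An element of \<open>\<H>\<^sub>Q\<close> is the
  finitely supported family of its components \<open>h d \<in> \<Lambda>\<^sub>d\<close>.
\<close>

type_synonym 'i xpoly = "('i \<times> nat \<Rightarrow>\<^sub>0 nat) \<Rightarrow>\<^sub>0 rat"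

definition xvar :: "'i \<times> nat \<Rightarrow> 'i xpoly" where
  "xvar v = Poly_Mapping.single (Poly_Mapping.single v 1) 1"

definition xsubst :: "('i \<times> nat \<Rightarrow> 'i xpoly) \<Rightarrow> 'i xpoly \<Rightarrow> 'i xpoly" where
  "xsubst s f =
     (\<Sum>m\<in>Poly_Mapping.keys f. Poly_Mapping.single 0 (Poly_Mapping.lookup f m)
        * (\<Prod>v\<in>Poly_Mapping.keys m. s v ^ Poly_Mapping.lookup m v))"

definition xrename :: "('i \<Rightarrow> nat \<Rightarrow> nat) \<Rightarrow> 'i xpoly \<Rightarrow> 'i xpoly" where
  "xrename \<sigma> = xsubst (\<lambda>(i, k). xvar (i, \<sigma> i k))"

definition xpolys :: "('i \<Rightarrow> nat) \<Rightarrow> 'i xpoly set" where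
  "xpolys d = {f. \<forall>m\<in>Poly_Mapping.keys f. Poly_Mapping.keys m \<subseteq> {(i, k). 1 \<le> k \<and> k \<le> d i}}"

definition colour_perms :: "('i \<Rightarrow> nat) \<Rightarrow> ('i \<Rightarrow> nat \<Rightarrow> nat) set" where
  "colour_perms d = {\<sigma>. \<forall>i. \<sigma> i permutes {1..d i}}"

definition Lam :: "('i \<Rightarrow> nat) \<Rightarrow> 'i xpoly set" where
  "Lam d = {f \<in> xpolys d. \<forall>\<sigma>\<in>colour_perms d. xrename \<sigma> f = f}"

definition colour_shuffles :: "('i \<Rightarrow> nat) \<Rightarrow> ('i \<Rightarrow> nat) \<Rightarrow> ('i \<Rightarrow> nat \<Rightarrow> nat) set" where
  "colour_shuffles d e =
     {\<sigma> \<in> colour_perms (\<lambda>i. d i + e i).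
        \<forall>i. strict_mono_on {1..d i} (\<sigma> i) \<and> strict_mono_on {d i + 1..d i + e i} (\<sigma> i)}"

text \<open>
  \<open>x\<^bsub>i,k\<^esub>\<close> is the variable \<open>(i, k)\<close> and \<open>y\<^bsub>j,l\<^esub>\<close> the variable \<open>(j, d j + l)\<close>. As the kernel may have
  poles along \<open>x = y\<close>, the sum is formed in the field of fractions; it is a polynomial, which
  \<open>shuffle_mult\<close> picks out.
\<close>

definition shuffle_fract ::
  "('i::{finite,linorder}, 'a) pre_digraph \<Rightarrow> ('i \<Rightarrow> nat) \<Rightarrow> ('i \<Rightarrow> nat) \<Rightarrow> 'i xpoly \<Rightarrow> 'i xpoly \<Rightarrow>
     'i xpoly fract" where
  "shuffle_fract Q d e f g =
     (\<Sum>\<sigma>\<in>colour_shuffles d e.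
        to_fract (xrename \<sigma> (f * xrename (\<lambda>j l. d j + l) g))
        * (\<Prod>i\<in>verts Q. \<Prod>j\<in>verts Q. \<Prod>k\<in>{1..d i}. \<Prod>l\<in>{1..e j}.
             to_fract (xrename \<sigma> (xvar (j, d j + l) - xvar (i, k)))
               powi (- euler Q (basis_vec i) (basis_vec j))))"

definition shuffle_mult ::
  "('i::{finite,linorder}, 'a) pre_digraph \<Rightarrow> ('i \<Rightarrow> nat) \<Rightarrow> ('i \<Rightarrow> nat) \<Rightarrow> 'i xpoly \<Rightarrow> 'i xpoly \<Rightarrow>
     'i xpoly" where
  "shuffle_mult Q d e f g = (THE h. to_fract h = shuffle_fract Q d e f g)"

type_synonym 'i coha = "('i \<Rightarrow> nat) \<Rightarrow> 'i xpoly"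

definition HQ :: "('i, 'a) pre_digraph \<Rightarrow> 'i coha set" where
  "HQ Q = {h. finite {d. h d \<noteq> 0} \<and> (\<forall>d. h d \<in> Lam d)}"

text \<open>
  Degree \<open>n\<close> in \<open>\<Lambda>\<^sub>d[-\<chi>(d,d)]\<close> is degree \<open>n - \<chi>(d,d)\<close> in \<open>\<Lambda>\<^sub>d\<close>, where the variables have degree \<open>2\<close>.
\<close>

definition HQ_comp :: "('i, 'a) pre_digraph \<Rightarrow> ('i \<Rightarrow> nat) \<Rightarrow> int \<Rightarrow> 'i coha set" where
  "HQ_comp Q d n =
     {h \<in> HQ Q. (\<forall>e. e \<noteq> d \<longrightarrow> h e = 0) \<and>
        (\<forall>m\<in>Poly_Mapping.keys (h d).
           2 * int (\<Sum>v\<in>Poly_Mapping.keys m. Poly_Mapping.lookup m v) =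
             n - euler Q (\<lambda>i. int (d i)) (\<lambda>i. int (d i)))}"

definition coha_mult :: "('i::{finite,linorder}, 'a) pre_digraph \<Rightarrow> 'i coha \<Rightarrow> 'i coha \<Rightarrow> 'i coha" where
  "coha_mult Q g h c =
     (\<Sum>d | d \<le> c. shuffle_mult Q d (\<lambda>i. c i - d i) (g d) (h (\<lambda>i. c i - d i)))"

section \<open>The map F\<close>

text \<open>
  The positions \<open>t = 0, \<dots>, p - 1\<close> of \<open>xvars d\<close> index the formal variables \<open>z\<close>: the variable at
  position \<open>t\<close> has colour \<open>fst (xvars d ! t)\<close> and is specialised to \<open>x\<^bsub>j,k\<^esub>\<close> with
  \<open>(j, k) = xvars d ! t\<close>.
\<close>

definition xvars :: "('i::{finite,linorder} \<Rightarrow> nat) \<Rightarrow> ('i \<times> nat) list" where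
  "xvars d = concat (map (\<lambda>j. map (Pair j) [1..<d j + 1]) (sorted_list_of_set UNIV))"

definition zcolour :: "('i::{finite,linorder} \<Rightarrow> nat) \<Rightarrow> nat \<Rightarrow> 'i" where
  "zcolour d t = fst (xvars d ! t)"

text \<open>
  The coefficient of \<open>\<Prod>\<^sub>t z\<^sub>t\<^bsup>b t\<^esup>\<close> in \<open>\<langle>\<xi>, Y(i\<^sub>1,z\<^sub>1) \<cdots> Y(i\<^sub>p,z\<^sub>p) 1\<rangle>\<close>; recall that \<open>i(n)\<close> is the
  coefficient of \<open>z\<^bsup>-n-1\<^esup>\<close> in \<open>Y(i,z)\<close>.
\<close>

definition corr_coeff ::
  "('i::{finite,linorder}, 'a) pre_digraph \<Rightarrow> ('i \<Rightarrow> nat) \<Rightarrow> 'i vac_form \<Rightarrow> (nat \<Rightarrow> int) \<Rightarrow> rat" where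
  "corr_coeff Q d \<xi> b =
     \<xi> (vac_class Q (mono_word (map (\<lambda>t. Mode (zcolour d t) (- b t - 1)) [0..<length (xvars d)])))"

text \<open>
  The coefficient of \<open>\<Prod>\<^sub>t z\<^sub>t\<^bsup>a t\<^esup>\<close> in the series \<open>F\<^sub>\<xi>\<close> before specialisation, for the expansion
  \<open>(z\<^sub>k - z\<^sub>l)\<^bsup>N\<^esup> = \<Sum>\<^sub>m (N choose m) (-1)\<^sup>m z\<^sub>k\<^bsup>N-m\<^esup> z\<^sub>l\<^bsup>m\<^esup>\<close>, valid for every integer \<open>N\<close>. The sum ranges
  over the choice \<open>\<mu> k l\<close> of a term \<open>m\<close> in the factor of each pair \<open>k < l\<close>; only finitely many
  choices contribute.
\<close>

definition F_coeff ::
  "('i::{finite,linorder}, 'a) pre_digraph \<Rightarrow> ('i \<Rightarrow> nat) \<Rightarrow> 'i vac_form \<Rightarrow> (nat \<Rightarrow> int) \<Rightarrow> rat" where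
  "F_coeff Q d \<xi> a =
     (let p = length (xvars d); N = (\<lambda>k l. locN Q (zcolour d k) (zcolour d l)) in
      Sum_any (\<lambda>\<mu> :: nat \<Rightarrow> nat \<Rightarrow> nat.
        ((\<Prod>l<p. \<Prod>k<l. (of_int (N k l) gchoose \<mu> k l) * (-1) ^ \<mu> k l)
          * corr_coeff Q d \<xi>
              (\<lambda>t. a t - (\<Sum>l\<in>{t<..<p}. N t l - int (\<mu> t l)) - (\<Sum>k<t. int (\<mu> k t)))
         when (\<forall>k l. \<not> (k < l \<and> l < p) \<longrightarrow> \<mu> k l = 0))))"

definition laurent_coeff :: "('i::{finite,linorder} \<Rightarrow> nat) \<Rightarrow> 'i xpoly \<Rightarrow> (nat \<Rightarrow> int) \<Rightarrow> rat" where
  "laurent_coeff d f a =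
     (if \<forall>t<length (xvars d). a t \<ge> 0
      then Poly_Mapping.lookup f
             (\<Sum>t<length (xvars d). Poly_Mapping.single (xvars d ! t) (nat (a t)))
      else 0)"

text \<open>
  The component of \<open>F\<^sub>\<xi>\<close> in \<open>\<H>\<^bsub>Q,d\<^esub>\<close> is the polynomial that equals the series above; it only involves
  the component of \<open>\<xi>\<close> in \<open>\<P>\<^bsub>Q,d\<^esub>\<^sup>\<or>\<close>, because the vectors it is evaluated on have degree \<open>d\<close>.
\<close>

definition F_map :: "('i::{finite,linorder}, 'a) pre_digraph \<Rightarrow> 'i vac_form \<Rightarrow> 'i coha" where
  "F_map Q \<xi> d = (THE f. f \<in> xpolys d \<and> (\<forall>a. F_coeff Q d \<xi> a = laurent_coeff d f a))"

end

theory Submission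
  imports Defs
begin

text \<open>
  For \<open>\<xi>\<close> in the graded dual, the matrix coefficients \<open>\<langle>\<xi>, Y(i\<^sub>1,z\<^sub>1) \<dots> Y(i\<^sub>p,z\<^sub>p)1\<rangle>\<close> have
  exponents whose tail sums are bounded below, and on such series multiplication by
  \<open>(z\<^sub>k - z\<^sub>l)\<^bsup>N\<^esup>\<close>, expanded in \<open>z\<^sub>l\<close>, is an invertible operator for every integer \<open>N\<close>. By
  locality \<open>F\<^sub>\<xi>\<close> is invariant under simultaneous permutations of colours and variables; since its
  last exponent is non-negative, all are, so \<open>F\<^sub>\<xi>\<close> is a symmetric polynomial, and the inverse
  operators recover \<open>\<xi>\<close> from it. Conversely, a symmetric polynomial defines a functional on the
  free associative algebra on the modes; it is pulled back along the map that sends Lie words to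
  iterated commutators and kills the relations because of the symmetry. Finally, the coproduct of a
  word in the modes is a signed sum over the subsets of its positions. The factors \<open>(z\<^sub>k - z\<^sub>l)\<^bsup>N\<^esup>\<close>
  inside a subset and inside its complement turn the two matrix coefficients into \<open>F\<^sub>\<zeta>\<close> and \<open>F\<^sub>\<xi>\<close>,
  and the signs turn the remaining ones into the kernel of the shuffle product. As only \<open>N \<ge> -1\<close>
  occurs, the identity holds between polynomials after multiplication by all \<open>z\<^sub>k - z\<^sub>l\<close>.
\<close>

section \<open>Powers of differences acting on formal series\<close>

text \<open>At a vertex without loops \<open>locN Q i i = -1\<close>, and the expansion of (z_k -
  z_l)^(-1) in z_l is not symmetric in k and l. There the symmetry of F_\<xi> is not formal:
  locality only says that the modes anticommute, and the quotient of an antisymmetric series by z_k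
  - z_l has to be shown symmetric. The finiteness of the operators looks circular: the bound on the
  sum of all exponents comes from the non-negativity of the exponents of F_\<xi>, and F_\<xi> needs
  bounds to make sense. The index \<open>u\<close> breaks the circle. Bounds on the tails starting
  at position 1 or later suffice to define F_\<xi>, and they concern shorter words, because the
  letters in front can be absorbed into the functional. The bound from position 0 matters for the
  product, where a proper tail of a word may contain a whole subword. Injectivity rests on the words
  in modes spanning, surjectivity on a map out of the tensor algebra. That the shuffle sum is a
  polynomial comes last: the product formula is proved in the field of fractions and then applied to
  preimages under F.\<close>

text \<open>
  A function \<open>c\<close> on exponents stands for the formal series with the coefficient \<open>c b\<close> at
  \<open>\<Prod>t<p. z\<^sub>t\<^bsup>b t\<^esup>\<close>; then \<open>zpow k l N\<close> is multiplication by the expansion of \<open>(z\<^sub>k - z\<^sub>l)\<^bsup>N\<^esup>\<close>.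
  The bound on the tail sums makes the sum in \<open>zpow\<close> finite and is preserved by \<open>zpow\<close>.
\<close>

definition tail_bounded :: "nat \<Rightarrow> nat \<Rightarrow> ((nat \<Rightarrow> int) \<Rightarrow> rat) \<Rightarrow> bool" where
  "tail_bounded u p c \<longleftrightarrow> (\<exists>C. \<forall>b. c b \<noteq> 0 \<longrightarrow> (\<forall>t\<in>{u..<p}. C \<le> (\<Sum>s=t..<p. b s)))"

text \<open>The exponent that the term z_k^(N-m) z_l^m of the expansion carries to
  \<open>b\<close>.\<close>

definition zshift :: "nat \<Rightarrow> nat \<Rightarrow> int \<Rightarrow> nat \<Rightarrow> (nat \<Rightarrow> int) \<Rightarrow> nat \<Rightarrow> int" where
  "zshift k l N m b = (\<lambda>t. b t - (if t = k then N - int m else 0) - (if t = l then int m else 0))"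

definition zpow ::
  "nat \<Rightarrow> nat \<Rightarrow> int \<Rightarrow> ((nat \<Rightarrow> int) \<Rightarrow> rat) \<Rightarrow> (nat \<Rightarrow> int) \<Rightarrow> rat" where
  "zpow k l N c b =
     Sum_any (\<lambda>m. (of_int N gchoose m) * (-1) ^ m * c (zshift k l N m b))"

text \<open>Multiplication by z_k - z_l. Identities between arbitrary integer powers are reduced to
  this operator, which involves no infinite sum.\<close>

definition zdiff :: "nat \<Rightarrow> nat \<Rightarrow> ((nat \<Rightarrow> int) \<Rightarrow> rat) \<Rightarrow> (nat \<Rightarrow> int) \<Rightarrow> rat" where
  "zdiff k l c b =
     c (\<lambda>t. b t - (if t = k then 1 else 0)) - c (\<lambda>t. b t - (if t = l then 1 else 0))"

lemma tail_sum_zshift: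
  assumes "k < p" "l < p"
  shows "(\<Sum>s=t..<p. zshift k l N m b s) =
    (\<Sum>s=t..<p. b s) - (if t \<le> k then N - int m else 0) - (if t \<le> l then int m else 0)"
  unfolding zshift_def sum_subtractf using assms by simp

lemma tail_boundedI:
  "(\<And>b t. c b \<noteq> 0 \<Longrightarrow> u \<le> t \<Longrightarrow> t < p \<Longrightarrow> C \<le> (\<Sum>s=t..<p. b s)) \<Longrightarrow> tail_bounded u p c"
  unfolding tail_bounded_def by (intro exI[of _ C]) auto

lemma tail_boundedD:
  assumes "tail_bounded u p c"
  shows "\<exists>C. \<forall>b t. c b \<noteq> 0 \<longrightarrow> u \<le> t \<longrightarrow> t < p \<longrightarrow> C \<le> (\<Sum>s=t..<p. b s)"
  using assms unfolding tail_bounded_def by fastforce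

lemma tail_bounded_mono: "tail_bounded u p c \<Longrightarrow> u \<le> v \<Longrightarrow> tail_bounded v p c"
  unfolding tail_bounded_def by force

lemma tail_bounded_zero [simp]: "tail_bounded u p (\<lambda>b. 0)"
  by (rule tail_boundedI) simp

lemma tail_bounded_add:
  assumes "tail_bounded u p c" "tail_bounded u p c'"
  shows "tail_bounded u p (\<lambda>b. c b + c' b)"
proof -
  obtain C where C: "\<And>b t. c b \<noteq> 0 \<Longrightarrow> u \<le> t \<Longrightarrow> t < p \<Longrightarrow> C \<le> (\<Sum>s=t..<p. b s)"
    using tail_boundedD[OF assms(1)] by blast
  obtain C' where C': "\<And>b t. c' b \<noteq> 0 \<Longrightarrow> u \<le> t \<Longrightarrow> t < p \<Longrightarrow> C' \<le> (\<Sum>s=t..<p. b s)"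
    using tail_boundedD[OF assms(2)] by blast
  show ?thesis
  proof (rule tail_boundedI)
    fix b t assume "c b + c' b \<noteq> 0" "u \<le> t" "t < p"
    then show "min C C' \<le> (\<Sum>s=t..<p. b s)"
      using C[of b t] C'[of b t] by (cases "c b = 0") auto
  qed
qed

lemma tail_bounded_scale:
  "tail_bounded u p c \<Longrightarrow> tail_bounded u p (\<lambda>b. r * c b)"
  unfolding tail_bounded_def by fastforce

lemma tail_bounded_diff:
  assumes "tail_bounded u p c" "tail_bounded u p c'"
  shows "tail_bounded u p (\<lambda>b. c b - c' b)"
  using tail_bounded_add[OF assms(1) tail_bounded_scale[OF assms(2), of "-1"]] by simp

lemma tail_bounded_sum:
  "finite J \<Longrightarrow> (\<And>i. i \<in> J \<Longrightarrow> tail_bounded u p (c i)) \<Longrightarrow> tail_bounded u p (\<lambda>b. \<Sum>i\<in>J. c i b)"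
  by (induction J rule: finite_induct) (auto intro: tail_bounded_add)

text \<open>The tail that limits the expansion index is the one starting at \<open>l\<close>. As
  \<open>k < l\<close> gives \<open>1 \<le> l\<close>, the condition \<open>u \<le> 1\<close> puts
  it among the bounded tails.\<close>

locale position_pair =
  fixes u p k l :: nat
  assumes u: "u \<le> 1" and kl: "k < l" and lp: "l < p"
begin

text \<open>The m-th term lowers the tail sum from \<open>l\<close> by exactly m: \<open>k\<close>
  lies in front of this tail.\<close>

lemma shift_bound:
  assumes "tail_bounded u p c"
  obtains D where "\<And>m. c (zshift k l N m b) \<noteq> 0 \<Longrightarrow> m \<le> D"
proof -
  obtain C where C: "\<And>b t. c b \<noteq> 0 \<Longrightarrow> u \<le> t \<Longrightarrow> t < p \<Longrightarrow> C \<le> (\<Sum>s=t..<p. b s)"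
    using tail_boundedD[OF assms] by blast
  show thesis
  proof (rule that)
    fix m assume "c (zshift k l N m b) \<noteq> 0"
    from C[OF this, of l] u kl lp have "C \<le> (\<Sum>s=l..<p. b s) - int m"
      by (simp add: tail_sum_zshift)
    then show "m \<le> nat ((\<Sum>s=l..<p. b s) - C)" by simp
  qed
qed

lemma finite_zpow:
  assumes "tail_bounded u p c"
  shows "finite {m. h m * c (zshift k l N m b) \<noteq> 0}"
proof -
  obtain D where "\<And>m. c (zshift k l N m b) \<noteq> 0 \<Longrightarrow> m \<le> D"
    using shift_bound[OF assms] by blast
  then have "{m. h m * c (zshift k l N m b) \<noteq> 0} \<subseteq> {..D}" by auto
  then show ?thesis by (rule finite_subset) simp
qed

lemma zpow_eq_sum:
  assumes "\<And>m. c (zshift k l N m b) \<noteq> 0 \<Longrightarrow> m \<le> D"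
  shows "zpow k l N c b = (\<Sum>m\<le>D. (of_int N gchoose m) * (-1) ^ m * c (zshift k l N m b))"
  unfolding zpow_def by (rule Sum_any.expand_superset) (use assms in auto)

lemma zpow_0 [simp]: "zpow k l 0 c = c"
proof
  fix b
  have "zpow k l 0 c b = (\<Sum>m\<in>{0}. (of_int 0 gchoose m) * (-1) ^ m * c (zshift k l 0 m b))"
    unfolding zpow_def by (rule Sum_any.expand_superset) (auto simp: gbinomial_0_left split: if_splits)
  moreover have "zshift k l 0 0 b = b" by (auto simp: zshift_def)
  ultimately show "zpow k l 0 c b = c b" by simp
qed

lemma tail_bounded_zpow:
  assumes "tail_bounded u p c"
  shows "tail_bounded u p (zpow k l N c)"
proof -
  obtain C where C: "\<And>b t. c b \<noteq> 0 \<Longrightarrow> u \<le> t \<Longrightarrow> t < p \<Longrightarrow> C \<le> (\<Sum>s=t..<p. b s)"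
    using tail_boundedD[OF assms] by blast
  show ?thesis
  proof (rule tail_boundedI)
    fix b t assume nz: "zpow k l N c b \<noteq> 0" and t: "u \<le> t" "t < p"
    from nz obtain m where "(of_int N gchoose m) * (-1) ^ m * c (zshift k l N m b) \<noteq> 0"
      unfolding zpow_def by (rule Sum_any.not_neutral_obtains_not_neutral)
    then have "c (zshift k l N m b) \<noteq> 0" by auto
    from C[OF this t] show "C - \<bar>N\<bar> \<le> (\<Sum>s=t..<p. b s)"
      using kl lp by (auto simp: tail_sum_zshift split: if_splits)
  qed
qed

lemma tail_bounded_zdiff:
  assumes "tail_bounded u p c"
  shows "tail_bounded u p (zdiff k l c)"
proof -
  obtain C where C: "\<And>b t. c b \<noteq> 0 \<Longrightarrow> u \<le> t \<Longrightarrow> t < p \<Longrightarrow> C \<le> (\<Sum>s=t..<p. b s)"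
    using tail_boundedD[OF assms] by blast
  show ?thesis
  proof (rule tail_boundedI)
    fix b t assume "zdiff k l c b \<noteq> 0" and t: "u \<le> t" "t < p"
    then consider "c (\<lambda>t. b t - (if t = k then 1 else 0)) \<noteq> 0" | "c (\<lambda>t. b t - (if t = l then 1 else 0)) \<noteq> 0"
      unfolding zdiff_def by fastforce
    then show "C \<le> (\<Sum>s=t..<p. b s)"
      by cases (drule C[OF _ t], use kl lp in \<open>simp add: sum_subtractf split: if_splits\<close>)+
  qed
qed

text \<open>Pascal's rule for generalised binomial coefficients, once the three sums are cut off at
  a common bound.\<close>

lemma zdiff_zpow:
  assumes "tail_bounded u p c"
  shows "zdiff k l (zpow k l N c) = zpow k l (N + 1) c"
proof
  fix b :: "nat \<Rightarrow> int"
  let ?bk = "\<lambda>t. b t - (if t = k then 1 else 0)" and ?bl = "\<lambda>t. b t - (if t = l then 1 else 0)"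
  let ?c = "\<lambda>m. c (zshift k l (N + 1) m b)"
  obtain D where D: "\<And>m. ?c m \<noteq> 0 \<Longrightarrow> m \<le> D"
    using shift_bound[OF assms, of "N+1" b] by blast
  have k: "zshift k l N m ?bk = zshift k l (N + 1) m b" for m
    by (auto simp: zshift_def)
  have l: "zshift k l N m ?bl = zshift k l (N + 1) (Suc m) b" for m
    using kl by (auto simp: zshift_def)
  have 1: "zpow k l N c ?bk = (\<Sum>m\<le>Suc D. (of_int N gchoose m) * (-1) ^ m * ?c m)"
    by (subst zpow_eq_sum[where D="Suc D"]) (auto simp: k dest: D)
  have 2: "zpow k l N c ?bl = (\<Sum>m\<le>D. (of_int N gchoose m) * (-1) ^ m * ?c (Suc m))"
    by (subst zpow_eq_sum[where D=D]) (auto simp: l dest: D)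
  have 3: "zpow k l (N + 1) c b = (\<Sum>m\<le>Suc D. (of_int (N + 1) gchoose m) * (-1) ^ m * ?c m)"
    by (subst zpow_eq_sum[where D="Suc D"]) (auto dest: D)
  have pascal: "((1 + of_int N :: rat) gchoose Suc m) = (of_int N gchoose m) + (of_int N gchoose Suc m)" for m
    using gbinomial_Suc_Suc[of "of_int N :: rat" m] by (simp add: add.commute)
  show "zdiff k l (zpow k l N c) b = zpow k l (N + 1) c b"
    unfolding zdiff_def 1 2 3 sum.atMost_Suc_shift
    by (simp add: pascal algebra_simps sum.distrib sum_negf sum_subtractf del: gbinomial_Suc)
qed

text \<open>\<open>zshift k l 0 m\<close> is the m-fold step in direction (1, -1) in the coordinates
  k and l.\<close>

lemma zshift_invariant:
  assumes "\<And>b. h b = h (\<lambda>t. b t + (if t = k then 1 else 0) - (if t = l then 1 else 0))"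
  shows "h b = h (zshift k l 0 m b)"
proof (induction m)
  case 0
  have "zshift k l 0 0 b = b" by (auto simp: zshift_def)
  then show ?case by simp
next
  case (Suc m)
  have "(\<lambda>t. zshift k l 0 m b t + (if t = k then 1 else 0) - (if t = l then 1 else 0)) = zshift k l 0 (Suc m) b"
    by (auto simp: zshift_def)
  with Suc show ?case using assms[of "zshift k l 0 m b"] by simp
qed

text \<open>
  The difference \<open>K\<close> of \<open>zpow k l (-1) c\<close> and its image under the swap is constant along the lines
  in direction \<open>(1, -1)\<close> and antisymmetric, so it vanishes.
\<close>

lemma zpow_minus_one_swap:
  assumes c: "tail_bounded u p c" and anti: "\<And>b. c b = - c (b \<circ> Transposition.transpose k l)"
  shows "zpow k l (-1) c b = zpow k l (-1) c (b \<circ> Transposition.transpose k l)"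
proof -
  let ?s = "Transposition.transpose k l" and ?H = "zpow k l (-1) c"
  define K where "K b = ?H b - ?H (b \<circ> ?s)" for b
  have zH: "zdiff k l ?H = c" using zdiff_zpow[OF c, of "-1"] by simp
  have zd: "?H (\<lambda>t. b t - (if t = k then 1 else 0)) = ?H (\<lambda>t. b t - (if t = l then 1 else 0)) + c b" for b
    using fun_cong[OF zH, of b] by (simp add: zdiff_def)
  have s1: "(\<lambda>t. b t - (if t = k then 1 else 0)) \<circ> ?s = (\<lambda>t. (b \<circ> ?s) t - (if t = l then 1 else 0))"
    and s2: "(\<lambda>t. b t - (if t = l then 1 else 0)) \<circ> ?s = (\<lambda>t. (b \<circ> ?s) t - (if t = k then 1 else 0))" for b :: "nat \<Rightarrow> int"
    using kl by (auto simp: fun_eq_iff Transposition.transpose_def)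
  have step': "K (\<lambda>t. b t - (if t = k then 1 else 0)) = K (\<lambda>t. b t - (if t = l then 1 else 0))" for b
    unfolding K_def s1 s2 zd using anti[of b] by (simp add: o_def)
  have step: "K b = K (\<lambda>t. b t + (if t = k then 1 else 0) - (if t = l then 1 else 0))" for b
    using step'[of "\<lambda>t. b t + (if t = k then 1 else 0)"] by simp
  have antiK: "K (b \<circ> ?s) = - K b" for b
    by (simp add: K_def comp_assoc)
  have "K b = 0" if "b k \<le> b l" for b
  proof -
    have "b \<circ> ?s = zshift k l 0 (nat (b l - b k)) b"
      using kl that by (auto simp: fun_eq_iff zshift_def Transposition.transpose_def)
    then have "K (b \<circ> ?s) = K b" using zshift_invariant[of K, OF step] by metis
    then show ?thesis using antiK[of b] by simp
  qed
  from this[of b] this[of "b \<circ> ?s"] antiK[of b] have "K b = 0"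
    by (cases "b k \<le> b l") (auto simp: Transposition.transpose_def)
  then show ?thesis by (simp add: K_def)
qed

text \<open>On all formal series z_k - z_l has a kernel, for instance the formal delta function. A
  series in the kernel is constant along the direction (1, -1), and going far enough along it
  violates the bound on the tail sum from \<open>l\<close>.\<close>

lemma zdiff_inj:
  assumes "tail_bounded u p c" "tail_bounded u p c'" "zdiff k l c = zdiff k l c'"
  shows "c = c'"
proof -
  define h where "h = (\<lambda>b. c b - c' b)"
  obtain C where C: "\<And>b t. h b \<noteq> 0 \<Longrightarrow> u \<le> t \<Longrightarrow> t < p \<Longrightarrow> C \<le> (\<Sum>s=t..<p. b s)"
    using tail_boundedD[OF tail_bounded_diff[OF assms(1,2)]] unfolding h_def by blast
  have step: "h b = h (\<lambda>t. b t + (if t = k then 1 else 0) - (if t = l then 1 else 0))" for b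
    using fun_cong[OF assms(3), of "\<lambda>t. b t + (if t = k then 1 else 0)"]
    unfolding zdiff_def h_def by (simp add: algebra_simps)
  have iter: "h b = h (zshift k l 0 m b)" for m b
    by (rule zshift_invariant) (rule step)
  have "h b = 0" for b
  proof (rule ccontr)
    assume *: "h b \<noteq> 0"
    obtain D where "\<And>m. h (zshift k l 0 m b) \<noteq> 0 \<Longrightarrow> m \<le> D"
      using shift_bound[OF tail_bounded_diff[OF assms(1,2)], of 0 b] unfolding h_def by blast
    then have "Suc D \<le> D" using * iter[of b "Suc D"] by metis
    then show False by simp
  qed
  then show ?thesis by (auto simp: h_def)
qed

lemma zpow_1: "tail_bounded u p c \<Longrightarrow> zpow k l 1 c = zdiff k l c"
  using zdiff_zpow[of c 0] by simp

text \<open>Powers are determined by the zeroth one because \<open>zdiff\<close> is injective on tail-bounded functions.\<close>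

lemma zpow_induct:
  fixes N :: int
  assumes c: "\<And>N::int. tail_bounded u p (c N)" "\<And>N. tail_bounded u p (c' N)"
    and "c 0 = c' 0" "\<And>N. zdiff k l (c N) = c (N + 1)" "\<And>N. zdiff k l (c' N) = c' (N + 1)"
  shows "c N = c' N"
proof (induction N rule: int_induct[where k=0])
  case (step1 i)
  then show ?case using assms(4,5)[of i] by simp
next
  case (step2 i)
  show ?case by (rule zdiff_inj[OF c]) (use step2 assms(4,5)[of "i - 1"] in simp)
qed fact

lemma zpow_zpow:
  assumes "tail_bounded u p c"
  shows "zpow k l N (zpow k l M c) = zpow k l (N + M) c"
proof (rule zpow_induct[where c="\<lambda>N. zpow k l N (zpow k l M c)" and c'="\<lambda>N. zpow k l (N + M) c"])
  show "zdiff k l (zpow k l (N + M) c) = zpow k l (N + 1 + M) c" for N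
    using zdiff_zpow[OF assms, of "N + M"] by (simp add: ac_simps)
qed (simp_all add: assms tail_bounded_zpow zdiff_zpow)

text \<open>Commutation with \<open>zdiff\<close> spreads to all integer powers by
  \<open>zpow_induct\<close>; infinite sums are never exchanged by hand.\<close>

lemma zpow_commute_op:
  assumes "tail_bounded u p c" "\<And>c. tail_bounded u p c \<Longrightarrow> tail_bounded u p (L c)"
    "\<And>c. tail_bounded u p c \<Longrightarrow> zdiff k l (L c) = L (zdiff k l c)"
  shows "zpow k l N (L c) = L (zpow k l N c)"
  by (rule zpow_induct[where c="\<lambda>N. zpow k l N (L c)" and c'="\<lambda>N. L (zpow k l N c)"])
    (simp_all add: assms tail_bounded_zpow zdiff_zpow)

lemma zpow_sum:
  assumes "finite J" "\<And>i. i \<in> J \<Longrightarrow> tail_bounded u p (c i)"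
  shows "zpow k l N (\<lambda>b. \<Sum>i\<in>J. r i * c i b) = (\<lambda>b. \<Sum>i\<in>J. r i * zpow k l N (c i) b)"
proof (rule zpow_induct[where c="\<lambda>N. zpow k l N (\<lambda>b. \<Sum>i\<in>J. r i * c i b)" and c'="\<lambda>N b. \<Sum>i\<in>J. r i * zpow k l N (c i) b"])
  have b: "tail_bounded u p (\<lambda>b. \<Sum>i\<in>J. r i * c i b)"
    using assms by (auto intro!: tail_bounded_sum tail_bounded_scale)
  then show "tail_bounded u p (zpow k l N (\<lambda>b. \<Sum>i\<in>J. r i * c i b))" for N
    by (rule tail_bounded_zpow)
  show "tail_bounded u p (\<lambda>b. \<Sum>i\<in>J. r i * zpow k l N (c i) b)" for N
    using assms by (auto intro!: tail_bounded_sum tail_bounded_scale tail_bounded_zpow)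
  show "zdiff k l (zpow k l N (\<lambda>b. \<Sum>i\<in>J. r i * c i b)) = zpow k l (N + 1) (\<lambda>b. \<Sum>i\<in>J. r i * c i b)" for N
    by (rule zdiff_zpow[OF b])
  show "zdiff k l (\<lambda>b. \<Sum>i\<in>J. r i * zpow k l N (c i) b) = (\<lambda>b. \<Sum>i\<in>J. r i * zpow k l (N + 1) (c i) b)" for N
  proof
    fix b
    have "zpow k l (N + 1) (c i) b = zdiff k l (zpow k l N (c i)) b" if "i \<in> J" for i
      by (simp add: zdiff_zpow[OF assms(2)[OF that]])
    then show "zdiff k l (\<lambda>b. \<Sum>i\<in>J. r i * zpow k l N (c i) b) b = (\<Sum>i\<in>J. r i * zpow k l (N + 1) (c i) b)"
      by (simp add: zdiff_def sum_subtractf right_diff_distrib)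
  qed
qed simp

end

text \<open>\<open>zpow_commute_op\<close> is applied twice: once to pass \<open>zdiff\<close>
  through a power, then to pass a power through a power.\<close>

lemma zpow_commute:
  assumes c: "tail_bounded u p c" and "u \<le> 1" "k < l" "l < p" "k' < l'" "l' < p"
  shows "zpow k l N (zpow k' l' M c) = zpow k' l' M (zpow k l N c)"
proof -
  interpret a: position_pair u p k l by standard fact+
  interpret b: position_pair u p k' l' by standard fact+
  have d: "zdiff k l (zdiff k' l' c) = zdiff k' l' (zdiff k l c)" for c
    unfolding zdiff_def fun_eq_iff by (simp add: algebra_simps)
  have "zdiff k l (zpow k' l' M c) = zpow k' l' M (zdiff k l c)" if "tail_bounded u p c" for c
    by (rule b.zpow_commute_op[symmetric]) (auto simp: that a.tail_bounded_zdiff d)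
  then show ?thesis
    by (intro a.zpow_commute_op) (auto simp: c b.tail_bounded_zpow)
qed

section \<open>Products of powers of differences over sets of pairs\<close>

definition pairs :: "nat \<Rightarrow> (nat \<times> nat) set" where
  "pairs p = {(k, l). k < l \<and> l < p}"

lemma pairs_iff [simp]: "(k, l) \<in> pairs p \<longleftrightarrow> k < l \<and> l < p"
  by (simp add: pairs_def)

lemma finite_pairs [simp]: "finite (pairs p)"
  by (rule finite_subset[of _ "{..<p} \<times> {..<p}"]) (auto simp: pairs_def)

lemma finite_subset_pairs: "A \<subseteq> pairs p \<Longrightarrow> finite A"
  using finite_pairs finite_subset by blast

definition zshifts ::
  "(nat \<times> nat) set \<Rightarrow> (nat \<Rightarrow> nat \<Rightarrow> int) \<Rightarrow> (nat \<Rightarrow> nat \<Rightarrow> nat) \<Rightarrow> (nat \<Rightarrow> int) \<Rightarrow> nat \<Rightarrow> int" where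
  "zshifts A M \<mu> a = (\<lambda>t. a t - (\<Sum>(k, l)\<in>A.
     (if t = k then M k l - int (\<mu> k l) else 0) + (if t = l then int (\<mu> k l) else 0)))"

text \<open>One simultaneous sum over all choices, as in \<open>F_coeff\<close>, and not a
  composition of \<open>zpow\<close>s, which would depend on an order of the pairs.
  \<open>zpows_insert\<close> recovers the composition.\<close>

definition zpows ::
  "(nat \<times> nat) set \<Rightarrow> (nat \<Rightarrow> nat \<Rightarrow> int) \<Rightarrow> ((nat \<Rightarrow> int) \<Rightarrow> rat) \<Rightarrow> (nat \<Rightarrow> int) \<Rightarrow> rat" where
  "zpows A M c a = Sum_any (\<lambda>\<mu> :: nat \<Rightarrow> nat \<Rightarrow> nat.
     (\<Prod>(k, l)\<in>A. (of_int (M k l) gchoose \<mu> k l) * (-1) ^ \<mu> k l) * c (zshifts A M \<mu> a)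
       when (\<forall>k l. (k, l) \<notin> A \<longrightarrow> \<mu> k l = 0))"

definition choice_box :: "(nat \<times> nat) set \<Rightarrow> nat \<Rightarrow> (nat \<Rightarrow> nat \<Rightarrow> nat) set" where
  "choice_box A D = {\<mu>. \<forall>k l. ((k, l) \<in> A \<longrightarrow> \<mu> k l \<le> D) \<and> ((k, l) \<notin> A \<longrightarrow> \<mu> k l = 0)}"

lemma finite_choice_box:
  assumes "finite A"
  shows "finite (choice_box A D)"
proof -
  have "finite {f :: nat \<times> nat \<Rightarrow> nat. \<forall>x. (x \<in> A \<longrightarrow> f x \<in> {..D}) \<and> (x \<notin> A \<longrightarrow> f x = 0)}"
    using assms by (rule finite_set_of_finite_funs) simp
  moreover have "choice_box A D \<subseteq> curry ` {f. \<forall>x. (x \<in> A \<longrightarrow> f x \<in> {..D}) \<and> (x \<notin> A \<longrightarrow> f x = 0)}"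
  proof
    fix \<mu> assume "\<mu> \<in> choice_box A D"
    then have "\<mu> = curry (case_prod \<mu>)" "case_prod \<mu> \<in> {f. \<forall>x. (x \<in> A \<longrightarrow> f x \<in> {..D}) \<and> (x \<notin> A \<longrightarrow> f x = 0)}"
      by (auto simp: choice_box_def)
    then show "\<mu> \<in> curry ` {f. \<forall>x. (x \<in> A \<longrightarrow> f x \<in> {..D}) \<and> (x \<notin> A \<longrightarrow> f x = 0)}" by blast
  qed
  ultimately show ?thesis using finite_surj by blast
qed

lemma tail_sum_zshifts:
  assumes "A \<subseteq> pairs p"
  shows "(\<Sum>s=t..<p. zshifts A M \<mu> a s) = (\<Sum>s=t..<p. a s) -
    (\<Sum>(k, l)\<in>A. (if t \<le> k then M k l - int (\<mu> k l) else 0) + (if t \<le> l then int (\<mu> k l) else 0))"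
proof -
  have "(\<Sum>s=t..<p. \<Sum>(k, l)\<in>A. (if s = k then M k l - int (\<mu> k l) else 0) + (if s = l then int (\<mu> k l) else 0))
      = (\<Sum>(k, l)\<in>A. \<Sum>s=t..<p. (if s = k then M k l - int (\<mu> k l) else 0) + (if s = l then int (\<mu> k l) else 0))"
    by (subst sum.swap) (simp add: case_prod_unfold)
  also have "\<dots> = (\<Sum>(k, l)\<in>A. (if t \<le> k then M k l - int (\<mu> k l) else 0) + (if t \<le> l then int (\<mu> k l) else 0))"
    using assms by (intro sum.cong refl) (auto simp: sum.distrib)
  finally show ?thesis unfolding zshifts_def sum_subtractf by simp
qed

text \<open>Consider the tail sum from \<open>l\<close>. A pair on both sides of the cut takes its
  \<mu> away, a pair inside the tail takes its exponent M away, and the other pairs do not matter.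
  So (k, l) costs \<mu> k l and each remaining pair costs at least -|M|, whatever the choice
  is.\<close>

lemma choice_bound:
  assumes "tail_bounded u p c" "u \<le> 1" "A \<subseteq> pairs p"
  obtains D where "\<And>\<mu> k l. c (zshifts A M \<mu> a) \<noteq> 0 \<Longrightarrow> (k, l) \<in> A \<Longrightarrow> \<mu> k l \<le> D"
proof -
  obtain C where C: "\<And>b t. c b \<noteq> 0 \<Longrightarrow> u \<le> t \<Longrightarrow> t < p \<Longrightarrow> C \<le> (\<Sum>s=t..<p. b s)"
    using tail_boundedD[OF assms(1)] by blast
  define T where "T = (\<Sum>t<p. \<bar>\<Sum>s=t..<p. a s\<bar>)"
  define W where "W = (\<Sum>(k, l)\<in>A. \<bar>M k l\<bar>)"
  have fin: "finite A" using assms(3) by (rule finite_subset_pairs)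
  show thesis
  proof (rule that)
    fix \<mu> k l assume nz: "c (zshifts A M \<mu> a) \<noteq> 0" and kl: "(k, l) \<in> A"
    have lp: "k < l" "l < p" using kl assms(3) by auto
    have "(\<Sum>x\<in>A. (if x = (k, l) then int (\<mu> k l) else 0) - (case x of (k', l') \<Rightarrow> \<bar>M k' l'\<bar>)) \<le>
      (\<Sum>(k', l')\<in>A. (if l \<le> k' then M k' l' - int (\<mu> k' l') else 0) + (if l \<le> l' then int (\<mu> k' l') else 0))"
    proof (rule sum_mono, clarify)
      fix k' l' assume "(k', l') \<in> A"
      then have "k' < l'" using assms(3) by auto
      then show "(if (k', l') = (k, l) then int (\<mu> k l) else 0) - \<bar>M k' l'\<bar> \<le>
        (if l \<le> k' then M k' l' - int (\<mu> k' l') else 0) + (if l \<le> l' then int (\<mu> k' l') else 0)"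
        using lp by auto
    qed
    then have "int (\<mu> k l) - W \<le>
      (\<Sum>(k', l')\<in>A. (if l \<le> k' then M k' l' - int (\<mu> k' l') else 0) + (if l \<le> l' then int (\<mu> k' l') else 0))"
      using fin kl by (simp add: sum_subtractf W_def)
    moreover have "C \<le> (\<Sum>s=l..<p. zshifts A M \<mu> a s)"
      by (rule C[OF nz]) (use lp assms(2) in auto)
    ultimately have "C \<le> (\<Sum>s=l..<p. a s) - (int (\<mu> k l) - W)"
      unfolding tail_sum_zshifts[OF assms(3)] by linarith
    moreover have "(\<Sum>s=l..<p. a s) \<le> T"
    proof -
      have "(\<Sum>s=l..<p. a s) \<le> \<bar>\<Sum>s=l..<p. a s\<bar>" by simp
      also have "\<dots> \<le> T" unfolding T_def by (rule member_le_sum) (use lp in auto)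
      finally show ?thesis .
    qed
    ultimately show "\<mu> k l \<le> nat (T + W - C)" by linarith
  qed
qed

lemma zpows_eq_sum:
  assumes "finite A" "\<And>\<mu> k l. c (zshifts A M \<mu> a) \<noteq> 0 \<Longrightarrow> (k, l) \<in> A \<Longrightarrow> \<mu> k l \<le> D"
  shows "zpows A M c a = (\<Sum>\<mu>\<in>choice_box A D.
     (\<Prod>(k, l)\<in>A. (of_int (M k l) gchoose \<mu> k l) * (-1) ^ \<mu> k l) * c (zshifts A M \<mu> a))"
proof -
  have "zpows A M c a = (\<Sum>\<mu>\<in>choice_box A D.
     (\<Prod>(k, l)\<in>A. (of_int (M k l) gchoose \<mu> k l) * (-1) ^ \<mu> k l) * c (zshifts A M \<mu> a)
       when (\<forall>k l. (k, l) \<notin> A \<longrightarrow> \<mu> k l = 0))"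
    unfolding zpows_def
  proof (rule Sum_any.expand_superset)
    show "finite (choice_box A D)" using assms(1) by (rule finite_choice_box)
  next
    show "{\<mu>. ((\<Prod>(k, l)\<in>A. (of_int (M k l) gchoose \<mu> k l) * (-1) ^ \<mu> k l) * c (zshifts A M \<mu> a)
       when (\<forall>k l. (k, l) \<notin> A \<longrightarrow> \<mu> k l = 0)) \<noteq> 0} \<subseteq> choice_box A D"
      using assms(2) unfolding choice_box_def by (fastforce simp: when_def split: if_splits)
  qed
  also have "\<dots> = (\<Sum>\<mu>\<in>choice_box A D.
     (\<Prod>(k, l)\<in>A. (of_int (M k l) gchoose \<mu> k l) * (-1) ^ \<mu> k l) * c (zshifts A M \<mu> a))"
    by (rule sum.cong) (auto simp: choice_box_def when_def)
  finally show ?thesis .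
qed

lemma zpows_nonzeroE:
  assumes "zpows A M c a \<noteq> 0"
  obtains \<mu> where "c (zshifts A M \<mu> a) \<noteq> 0" "\<And>k l. (k, l) \<notin> A \<Longrightarrow> \<mu> k l = 0"
proof -
  obtain \<mu> where "((\<Prod>(k, l)\<in>A. (of_int (M k l) gchoose \<mu> k l) * (-1) ^ \<mu> k l) * c (zshifts A M \<mu> a)
       when (\<forall>k l. (k, l) \<notin> A \<longrightarrow> \<mu> k l = 0)) \<noteq> 0"
    using assms unfolding zpows_def by (rule Sum_any.not_neutral_obtains_not_neutral)
  then show thesis using that[of \<mu>] by (auto simp: when_def split: if_splits)
qed

lemma zpows_empty [simp]: "zpows {} M c = c"
proof
  fix a
  have "zpows {} M c a = (\<Sum>\<mu>\<in>choice_box {} 0. c (zshifts {} M \<mu> a))"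
    by (subst zpows_eq_sum[where D=0]) auto
  also have "choice_box {} 0 = {\<lambda>k l. 0}" by (auto simp: choice_box_def)
  finally show "zpows {} M c a = c a" by (simp add: zshifts_def)
qed

text \<open>A choice on the enlarged set is a choice on \<open>A\<close> together with an index m
  for the new pair. One bound D from the enlarged set cuts off all three sums.\<close>

lemma zpows_insert:
  assumes c: "tail_bounded u p c" and u: "u \<le> 1" and A: "A \<subseteq> pairs p"
    and pos: "k < l" "l < p" "(k, l) \<notin> A"
  shows "zpows (insert (k, l) A) M c = zpow k l (M k l) (zpows A M c)"
proof
  fix a :: "nat \<Rightarrow> int"
  interpret position_pair u p k l by standard (use u pos in auto)
  have fin: "finite A" using A by (rule finite_subset_pairs)
  have ins: "insert (k, l) A \<subseteq> pairs p" using A pos by simp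
  define pr where "pr = (\<lambda>A \<mu>. \<Prod>(k, l)\<in>A. ((of_int (M k l) gchoose \<mu> k l) * (-1) ^ \<mu> k l :: rat))"
  define up where "up = (\<lambda>m (\<mu> :: nat \<Rightarrow> nat \<Rightarrow> nat). \<mu>(k := (\<mu> k)(l := m)))"
  have up: "up m \<mu> k' l' = (if (k', l') = (k, l) then m else \<mu> k' l')" for m \<mu> k' l'
    by (auto simp: up_def)
  obtain D where D: "\<And>\<mu> k' l'. c (zshifts (insert (k, l) A) M \<mu> a) \<noteq> 0 \<Longrightarrow> (k', l') \<in> insert (k, l) A \<Longrightarrow> \<mu> k' l' \<le> D"
    by (rule choice_bound[OF c u ins, of M a]) blast
  have sh: "zshifts A M \<mu> (zshift k l (M k l) m a) = zshifts (insert (k, l) A) M (up m \<mu>) a" for m \<mu>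
  proof
    fix t
    have "(\<Sum>(k', l')\<in>A. (if t = k' then M k' l' - int (up m \<mu> k' l') else 0) + (if t = l' then int (up m \<mu> k' l') else 0))
      = (\<Sum>(k', l')\<in>A. (if t = k' then M k' l' - int (\<mu> k' l') else 0) + (if t = l' then int (\<mu> k' l') else 0))"
      using pos by (intro sum.cong) (auto simp: up)
    then show "zshifts A M \<mu> (zshift k l (M k l) m a) t = zshifts (insert (k, l) A) M (up m \<mu>) a t"
      using fin pos unfolding zshifts_def zshift_def by (simp add: up)
  qed
  have prup: "pr (insert (k, l) A) (up m \<mu>) = (of_int (M k l) gchoose m) * (-1) ^ m * pr A \<mu>" for m \<mu>
  proof -
    have "pr A (up m \<mu>) = pr A \<mu>"
      unfolding pr_def using pos by (intro prod.cong) (auto simp: up)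
    then show ?thesis unfolding pr_def using fin pos by (simp add: up)
  qed
  have inner: "zpows A M c (zshift k l (M k l) m a) =
    (\<Sum>\<mu>\<in>choice_box A D. pr A \<mu> * c (zshifts (insert (k, l) A) M (up m \<mu>) a))" for m
    unfolding pr_def sh[symmetric]
  proof (rule zpows_eq_sum[OF fin])
    fix \<mu> k' l' assume "c (zshifts A M \<mu> (zshift k l (M k l) m a)) \<noteq> 0" "(k', l') \<in> A"
    then show "\<mu> k' l' \<le> D" using D[of "up m \<mu>" k' l'] pos unfolding sh by (auto simp: up split: if_splits)
  qed
  have "zpow k l (M k l) (zpows A M c) a =
    (\<Sum>m\<le>D. (of_int (M k l) gchoose m) * (-1) ^ m * zpows A M c (zshift k l (M k l) m a))"
  proof (rule zpow_eq_sum)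
    fix m assume "zpows A M c (zshift k l (M k l) m a) \<noteq> 0"
    then obtain \<mu> where "c (zshifts A M \<mu> (zshift k l (M k l) m a)) \<noteq> 0"
      using zpows_nonzeroE by blast
    then show "m \<le> D" using D[of "up m \<mu>" k l] unfolding sh by (simp add: up)
  qed
  also have "\<dots> = (\<Sum>(m, \<mu>)\<in>{..D} \<times> choice_box A D.
      pr (insert (k, l) A) (up m \<mu>) * c (zshifts (insert (k, l) A) M (up m \<mu>) a))"
    unfolding inner sum.cartesian_product[symmetric] sum_distrib_left prup by (simp add: mult.assoc)
  \<comment> \<open>The inverse map resets the entry at (k, l) to 0, the value that every choice in
    \<open>choice_box A D\<close> has there.\<close>
  also have "\<dots> = (\<Sum>\<mu>\<in>choice_box (insert (k, l) A) D. pr (insert (k, l) A) \<mu> * c (zshifts (insert (k, l) A) M \<mu> a))"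
  proof (rule sum.reindex_bij_witness[where j="\<lambda>(m, \<mu>). up m \<mu>" and i="\<lambda>\<mu>. (\<mu> k l, up 0 \<mu>)"])
    fix x assume "x \<in> {..D} \<times> choice_box A D"
    then obtain m \<mu> where x: "x = (m, \<mu>)" "m \<le> D" "\<mu> \<in> choice_box A D" by auto
    have "\<mu> k l = 0" using x pos by (auto simp: choice_box_def)
    then have "up 0 (up m \<mu>) = \<mu>" by (auto simp: fun_eq_iff up)
    then show "((case x of (m, \<mu>) \<Rightarrow> up m \<mu>) k l, up 0 (case x of (m, \<mu>) \<Rightarrow> up m \<mu>)) = x"
      by (simp add: x up)
    show "(case x of (m, \<mu>) \<Rightarrow> up m \<mu>) \<in> choice_box (insert (k, l) A) D"
      using x by (auto simp: choice_box_def up)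
  next
    fix \<mu> assume "\<mu> \<in> choice_box (insert (k, l) A) D"
    then show "(\<mu> k l, up 0 \<mu>) \<in> {..D} \<times> choice_box A D" using pos by (auto simp: choice_box_def up)
    show "(case (\<mu> k l, up 0 \<mu>) of (m, \<mu>) \<Rightarrow> up m \<mu>) = \<mu>" by (auto simp: fun_eq_iff up)
  qed auto
  also have "\<dots> = zpows (insert (k, l) A) M c a"
    unfolding pr_def by (rule zpows_eq_sum[symmetric]) (use fin D in auto)
  finally show "zpows (insert (k, l) A) M c a = zpow k l (M k l) (zpows A M c) a" ..
qed

lemma pairs_induct [consumes 1, case_names empty insert]:
  assumes "A \<subseteq> pairs p" "P {}"
    "\<And>k l A. A \<subseteq> pairs p \<Longrightarrow> k < l \<Longrightarrow> l < p \<Longrightarrow> (k, l) \<notin> A \<Longrightarrow> P A \<Longrightarrow> P (insert (k, l) A)"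
  shows "P A"
proof -
  have "finite A" using assms(1) by (rule finite_subset_pairs)
  then show ?thesis using assms(1)
    by (induction A rule: finite_induct) (auto intro: assms(2,3))
qed

lemma tail_bounded_zpows:
  assumes "A \<subseteq> pairs p" "tail_bounded u p c" "u \<le> 1"
  shows "tail_bounded u p (zpows A M c)"
  using assms(1)
proof (induction rule: pairs_induct)
  case (insert k l A)
  interpret position_pair u p k l by standard (use assms insert in auto)
  show ?case using insert by (simp add: zpows_insert[OF assms(2,3)] tail_bounded_zpow)
qed (use assms in simp)

lemma zpow_zpows:
  assumes "A \<subseteq> pairs p" "tail_bounded u p c" "u \<le> 1" "k < l" "l < p"
  shows "zpow k l N (zpows A M c) = zpows A M (zpow k l N c)"
  using assms(1)
proof (induction rule: pairs_induct)
  case (insert k' l' A)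
  interpret position_pair u p k l by standard (use assms in auto)
  show ?case
    unfolding zpows_insert[OF assms(2,3) insert(1-4)]
      zpows_insert[OF tail_bounded_zpow[OF assms(2)] assms(3) insert(1-4)] insert.IH[symmetric]
    by (rule zpow_commute[OF tail_bounded_zpows[OF insert(1) assms(2,3)] assms(3-5) insert(2,3)])
qed (use assms in simp)

lemma zpows_zpows:
  assumes "A \<subseteq> pairs p" "tail_bounded u p c" "u \<le> 1"
  shows "zpows A M (zpows A M' c) = zpows A (\<lambda>k l. M k l + M' k l) c"
  using assms(1)
proof (induction rule: pairs_induct)
  case (insert k l A)
  interpret position_pair u p k l by standard (use assms insert in auto)
  note b = tail_bounded_zpows[OF insert(1) assms(2,3)]
  show ?case
    unfolding zpows_insert[OF assms(2,3) insert(1-4)]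
      zpows_insert[OF tail_bounded_zpow[OF b] assms(3) insert(1-4)]
      zpow_zpows[OF insert(1) b assms(3) insert(2,3), symmetric] insert.IH
    by (rule zpow_zpow[OF b])
qed simp

lemma zpows_0:
  assumes "A \<subseteq> pairs p" "tail_bounded u p c" "u \<le> 1"
  shows "zpows A (\<lambda>k l. 0) c = c"
  using assms(1)
proof (induction rule: pairs_induct)
  case (insert k l A)
  interpret position_pair u p k l by standard (use assms insert in auto)
  show ?case using insert by (simp add: zpows_insert[OF assms(2,3)])
qed simp

lemma zpows_inverse:
  assumes "A \<subseteq> pairs p" "tail_bounded u p c" "u \<le> 1"
  shows "zpows A M (zpows A (\<lambda>k l. - M k l) c) = c" "zpows A (\<lambda>k l. - M k l) (zpows A M c) = c"
  using zpows_zpows[OF assms] zpows_0[OF assms] by simp_all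

lemma zpows_Un:
  assumes "A \<subseteq> pairs p" "B \<subseteq> pairs p" "A \<inter> B = {}" "tail_bounded u p c" "u \<le> 1"
  shows "zpows (A \<union> B) M c = zpows A M (zpows B M c)"
  using assms(1,3)
proof (induction rule: pairs_induct)
  case (insert k l A)
  then show ?case using assms
    by (simp add: zpows_insert[OF assms(4,5)] zpows_insert[OF tail_bounded_zpows[OF assms(2,4,5)] assms(5)])
qed simp

lemma zpows_cong:
  "(\<And>k l. (k, l) \<in> A \<Longrightarrow> M k l = M' k l) \<Longrightarrow> zpows A M c = zpows A M' c"
proof -
  assume M: "\<And>k l. (k, l) \<in> A \<Longrightarrow> M k l = M' k l"
  have "(\<Prod>(k, l)\<in>A. (of_int (M k l) gchoose \<mu> k l) * (-1) ^ \<mu> k l :: rat) =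
    (\<Prod>(k, l)\<in>A. (of_int (M' k l) gchoose \<mu> k l) * (-1) ^ \<mu> k l)" for \<mu>
    using M by (intro prod.cong) auto
  moreover have "zshifts A M \<mu> a = zshifts A M' \<mu> a" for \<mu> a
    unfolding zshifts_def using M by (intro ext arg_cong2[where f=minus] sum.cong) auto
  ultimately show ?thesis unfolding zpows_def by simp
qed

lemma zpows_sum:
  assumes "A \<subseteq> pairs p" "finite J" "\<And>i. i \<in> J \<Longrightarrow> tail_bounded u p (c i)" "u \<le> 1"
  shows "zpows A M (\<lambda>b. \<Sum>i\<in>J. r i * c i b) = (\<lambda>b. \<Sum>i\<in>J. r i * zpows A M (c i) b)"
  using assms(1)
proof (induction rule: pairs_induct)
  case (insert k l A)
  interpret position_pair u p k l by standard (use assms insert in auto)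
  have "tail_bounded u p (\<lambda>b. \<Sum>i\<in>J. r i * c i b)"
    using assms by (auto intro!: tail_bounded_sum tail_bounded_scale)
  note zi = zpows_insert[OF this assms(4) insert(1-4)]
  show ?case unfolding zi insert.IH
    by (subst zpow_sum[OF assms(2)])
      (use insert assms in \<open>auto simp: tail_bounded_zpows zpows_insert[OF assms(3) assms(4)] intro!: ext sum.cong\<close>)
qed simp

text \<open>The binomial coefficients vanish beyond \<open>N\<close>, which makes the sum finite for
  every \<open>c\<close>.\<close>

lemma zpow_nat:
  "zpow k l (int N) c b = (\<Sum>m\<le>N. of_nat (N choose m) * (-1) ^ m * c (zshift k l (int N) m b))"
proof -
  have "zpow k l (int N) c b = (\<Sum>m\<le>N. (of_int (int N) gchoose m) * (-1) ^ m * c (zshift k l (int N) m b))"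
    unfolding zpow_def
  proof (rule Sum_any.expand_superset)
    have "(of_int (int N) :: rat) gchoose m = 0" if "N < m" for m
      using that by (simp add: binomial_gbinomial[symmetric] binomial_eq_0)
    note zero = this
    show "{m. (rat_of_int (int N) gchoose m) * (-1) ^ m * c (zshift k l (int N) m b) \<noteq> 0} \<subseteq> {..N}"
    proof
      fix m assume "m \<in> {m. (rat_of_int (int N) gchoose m) * (-1) ^ m * c (zshift k l (int N) m b) \<noteq> 0}"
      then have "\<not> N < m" using zero[of m] by auto
      then show "m \<in> {..N}" by simp
    qed
  qed simp
  then show ?thesis by (simp add: binomial_gbinomial)
qed

lemma zpow_comp:
  assumes "inj e"
  shows "zpow (e k) (e l) N (\<lambda>b. c (\<lambda>t. b (e t))) b = zpow k l N c (\<lambda>t. b (e t))"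
  unfolding zpow_def zshift_def using assms by (simp add: inj_eq)

text \<open>The hypothesis on the image of \<open>A\<close> says that \<open>e\<close> keeps each
  pair ordered. This matters because the expansion of a negative power depends on which variable
  comes first.\<close>

lemma zpows_comp:
  assumes "A \<subseteq> pairs p" "inj e" "map_prod e e ` A \<subseteq> pairs q" "u \<le> 1" "v \<le> 1"
    "tail_bounded u p c" "tail_bounded v q (\<lambda>b. c (\<lambda>t. b (e t)))"
  shows "zpows (map_prod e e ` A) M (\<lambda>b. c (\<lambda>t. b (e t))) =
    (\<lambda>b. zpows A (\<lambda>k l. M (e k) (e l)) c (\<lambda>t. b (e t)))"
  using assms(1,3)
proof (induction rule: pairs_induct)
  case (insert k l A)
  have A: "map_prod e e ` A \<subseteq> pairs q" "e k < e l" "e l < q" using insert by auto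
  have n: "(e k, e l) \<notin> map_prod e e ` A" using insert(4) assms(2) by (auto simp: inj_eq)
  have "zpows (map_prod e e ` insert (k, l) A) M (\<lambda>b. c (\<lambda>t. b (e t))) =
      zpow (e k) (e l) (M (e k) (e l)) (\<lambda>b. zpows A (\<lambda>k l. M (e k) (e l)) c (\<lambda>t. b (e t)))"
    unfolding image_insert map_prod_simp zpows_insert[OF assms(7,5) A n] insert.IH[OF A(1)] ..
  also have "\<dots> = (\<lambda>b. zpow k l (M (e k) (e l)) (zpows A (\<lambda>k l. M (e k) (e l)) c) (\<lambda>t. b (e t)))"
    by (rule ext) (rule zpow_comp[OF assms(2)])
  also have "\<dots> = (\<lambda>b. zpows (insert (k, l) A) (\<lambda>k l. M (e k) (e l)) c (\<lambda>t. b (e t)))"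
    unfolding zpows_insert[OF assms(6,4) insert(1-4)] ..
  finally show ?case .
qed simp

section \<open>Correlators and locality\<close>

text \<open>Linear forms on \<open>\<P>\<^sub>Q\<close>, read on representatives and without a
  condition on their support. The bounds on exponents are uniform over all of them.\<close>

definition vac_functional :: "('i, 'a) pre_digraph \<Rightarrow> ('i tensor_alg \<Rightarrow> rat) \<Rightarrow> bool" where
  "vac_functional Q \<phi> \<longleftrightarrow>
     (\<forall>u v. \<phi> (u + v) = \<phi> u + \<phi> v) \<and> (\<forall>c u. \<phi> (Poly_Mapping.map ((*) c) u) = c * \<phi> u) \<and>
     (\<forall>u\<in>vac_ideal Q. \<phi> u = 0)"

definition mode_word :: "nat \<Rightarrow> (nat \<Rightarrow> 'i) \<Rightarrow> (nat \<Rightarrow> int) \<Rightarrow> 'i lie_word list" where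
  "mode_word p cs b = map (\<lambda>t. Mode (cs t) (- b t - 1)) [0..<p]"

definition corr ::
  "('i tensor_alg \<Rightarrow> rat) \<Rightarrow> nat \<Rightarrow> (nat \<Rightarrow> 'i) \<Rightarrow> (nat \<Rightarrow> int) \<Rightarrow> rat" where
  "corr \<phi> p cs b = \<phi> (mono_word (mode_word p cs b))"

text \<open>Defined for every sequence of colours and not only for the ordered sequence
  \<open>zcolour\<close>, so that permutations of the positions can act.\<close>

definition F_series ::
  "('i, 'a) pre_digraph \<Rightarrow> ('i tensor_alg \<Rightarrow> rat) \<Rightarrow> nat \<Rightarrow> (nat \<Rightarrow> 'i) \<Rightarrow> (nat \<Rightarrow> int) \<Rightarrow> rat" where
  "F_series Q \<phi> p cs = zpows (pairs p) (\<lambda>k l. locN Q (cs k) (cs l)) (corr \<phi> p cs)"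

lemma mono_word_mult: "mono_word x * mono_word y = mono_word (x @ y)"
  by (simp add: mult_single plus_word_def)

lemma single_word_mult:
  "Poly_Mapping.single (Word x) c * Poly_Mapping.single (Word y) d = Poly_Mapping.single (Word (x @ y)) (c * d)"
  by (simp add: mult_single plus_word_def)

lemma single_zero_mult:
  "Poly_Mapping.single 0 (c::rat) * Poly_Mapping.single (w::'g word) d = Poly_Mapping.single w (c * d)"
  by (simp add: mult_single)

text \<open>The source of additivity for the maps defined by sums over keys, such as
  \<open>lie_incl\<close>, \<open>tens\<close>, \<open>free_env\<close> and
  \<open>env_coprod\<close>.\<close>

lemma sum_keys_add:
  fixes s t :: "'k \<Rightarrow>\<^sub>0 'b::monoid_add" and f :: "'k \<Rightarrow> 'b \<Rightarrow> 'c::comm_monoid_add"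
  assumes "\<And>k. f k 0 = 0" "\<And>k x y. f k (x + y) = f k x + f k y"
  shows "(\<Sum>k\<in>Poly_Mapping.keys (s + t). f k (Poly_Mapping.lookup (s + t) k)) =
    (\<Sum>k\<in>Poly_Mapping.keys s. f k (Poly_Mapping.lookup s k)) +
    (\<Sum>k\<in>Poly_Mapping.keys t. f k (Poly_Mapping.lookup t k))"
proof -
  let ?K = "Poly_Mapping.keys s \<union> Poly_Mapping.keys t"
  have ext: "(\<Sum>k\<in>Poly_Mapping.keys r. f k (Poly_Mapping.lookup r k)) = (\<Sum>k\<in>?K. f k (Poly_Mapping.lookup r k))"
    if "Poly_Mapping.keys r \<subseteq> ?K" for r
    using that by (intro sum.mono_neutral_left) (auto simp: in_keys_iff assms(1))
  show ?thesis
    by (subst (1 2 3) ext) (use Poly_Mapping.keys_add[of s t] in \<open>auto simp: lookup_add assms(2) sum.distrib\<close>)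
qed

lemma sum_keys_single:
  assumes "f k 0 = 0"
  shows "(\<Sum>k'\<in>Poly_Mapping.keys (Poly_Mapping.single k x). f k' (Poly_Mapping.lookup (Poly_Mapping.single k x) k')) = f k x"
  using assms by (cases "x = 0") auto

lemma poly_mapping_single_sum:
  "(\<Sum>k\<in>Poly_Mapping.keys u. Poly_Mapping.single k (Poly_Mapping.lookup u k)) = u"
proof (rule poly_mapping_eqI)
  fix k
  have "Poly_Mapping.lookup (\<Sum>k\<in>Poly_Mapping.keys u. Poly_Mapping.single k (Poly_Mapping.lookup u k)) k =
    (\<Sum>k'\<in>Poly_Mapping.keys u. if k' = k then Poly_Mapping.lookup u k' else 0)"
    unfolding lookup_sum by (rule sum.cong) (auto simp: lookup_single when_def)
  then show "Poly_Mapping.lookup (\<Sum>k\<in>Poly_Mapping.keys u. Poly_Mapping.single k (Poly_Mapping.lookup u k)) k = Poly_Mapping.lookup u k"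
    by (simp add: in_keys_iff)
qed

text \<open>Reduces an additive identity to monomials; for a multilinear one it is nested, once per
  argument.\<close>

lemma poly_mapping_additive_induct [case_names add single]:
  assumes "\<And>u v. P u \<Longrightarrow> P v \<Longrightarrow> P (u + v)" "\<And>k c. P (Poly_Mapping.single k c)"
  shows "P (u :: 'k \<Rightarrow>\<^sub>0 'b::comm_monoid_add)"
proof -
  have "P (\<Sum>k\<in>K. Poly_Mapping.single k (Poly_Mapping.lookup u k))" if "finite K" for K
    using that
  proof (induction K rule: finite_induct)
    case empty
    then show ?case using assms(2)[of undefined 0] by simp
  qed (simp add: assms)
  from this[of "Poly_Mapping.keys u"] show ?thesis by (simp add: poly_mapping_single_sum)
qed

lemma lie_incl_add: "lie_incl (u + v) = lie_incl u + lie_incl v"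
  unfolding lie_incl_def by (rule sum_keys_add) (simp_all add: single_add)

lemma lie_incl_single [simp]: "lie_incl (Poly_Mapping.single a c) = Poly_Mapping.single (Word [a]) c"
  unfolding lie_incl_def by (rule sum_keys_single) simp

lemma lie_incl_zero [simp]: "lie_incl 0 = 0"
  by (simp add: lie_incl_def)

lemma lie_incl_sum: "lie_incl (\<Sum>k\<in>K. u k) = (\<Sum>k\<in>K. lie_incl (u k))"
  by (induction K rule: infinite_finite_induct) (simp_all add: lie_incl_add)

lemma env_ideal_sum: "(\<And>k. k \<in> K \<Longrightarrow> u k \<in> env_ideal Q) \<Longrightarrow> (\<Sum>k\<in>K. u k) \<in> env_ideal Q"
  by (induction K rule: infinite_finite_induct) (auto intro: env_ideal.zero env_ideal.add)

lemma vac_ideal_left: "u \<in> vac_ideal Q \<Longrightarrow> x * u \<in> vac_ideal Q"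
proof (induction rule: vac_ideal.induct)
  case (add u v)
  then show ?case by (simp add: distrib_left vac_ideal.add)
next
  case (annihilate n y i)
  then show ?case using vac_ideal.annihilate[OF annihilate, of "x * y" i Q] by (simp add: mult.assoc)
qed (blast intro: vac_ideal.intros env_ideal.left)

lemma vac_ideal_0 [simp]: "0 \<in> vac_ideal Q"
  by (intro vac_ideal.env env_ideal.zero)

lemma vac_ideal_uminus: "u \<in> vac_ideal Q \<Longrightarrow> - u \<in> vac_ideal Q"
  using vac_ideal_left[of u Q "-1"] by simp

lemma vac_ideal_diff: "u \<in> vac_ideal Q \<Longrightarrow> v \<in> vac_ideal Q \<Longrightarrow> u - v \<in> vac_ideal Q"
  using vac_ideal.add[OF _ vac_ideal_uminus] by force

lemma vac_class_eq_iff: "vac_class Q u = vac_class Q v \<longleftrightarrow> u - v \<in> vac_ideal Q"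
proof
  assume "vac_class Q u = vac_class Q v"
  moreover have "u \<in> vac_class Q u" by (simp add: vac_class_def)
  ultimately show "u - v \<in> vac_ideal Q" by (simp add: vac_class_def)
next
  assume *: "u - v \<in> vac_ideal Q"
  have "w - u \<in> vac_ideal Q \<longleftrightarrow> w - v \<in> vac_ideal Q" for w
    using vac_ideal.add[OF _ *, of "w - u"] vac_ideal_diff[OF _ *, of "w - v"] by auto
  then show "vac_class Q u = vac_class Q v" by (simp add: vac_class_def)
qed

lemma single_0_commute: "x * Poly_Mapping.single 0 c = Poly_Mapping.single 0 c * (x :: 'g word \<Rightarrow>\<^sub>0 rat)"
  by (induction x rule: poly_mapping_additive_induct)
    (simp_all add: distrib_left distrib_right mult_single mult.commute)

lemma single_0_left_commute: "x * (Poly_Mapping.single 0 c * y) = Poly_Mapping.single 0 c * (x * (y :: 'g word \<Rightarrow>\<^sub>0 rat))"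
  by (metis single_0_commute mult.assoc)

context
  fixes Q :: "('i, 'a) pre_digraph" and \<phi> :: "'i tensor_alg \<Rightarrow> rat"
  assumes phi: "vac_functional Q \<phi>"
begin

lemma vac_functional_add: "\<phi> (u + v) = \<phi> u + \<phi> v"
  using phi by (simp add: vac_functional_def)

lemma vac_functional_scale: "\<phi> (Poly_Mapping.single 0 c * u) = c * \<phi> u"
  using phi by (simp add: vac_functional_def mult_map_scale_conv_mult)

lemma vac_functional_0: "u \<in> vac_ideal Q \<Longrightarrow> \<phi> u = 0"
  using phi by (simp add: vac_functional_def)

lemma vac_functional_zero [simp]: "\<phi> 0 = 0"
  using vac_functional_scale[of 0 0] by simp

lemma vac_functional_single: "\<phi> (Poly_Mapping.single w c) = c * \<phi> (Poly_Mapping.single w 1)"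
  using vac_functional_scale[of c "Poly_Mapping.single w 1"] by (simp add: mult_single)

lemma vac_functional_uminus: "\<phi> (- u) = - \<phi> u"
  using vac_functional_add[of u "- u"] by simp

lemma vac_functional_diff: "\<phi> (u - v) = \<phi> u - \<phi> v"
  using vac_functional_add[of u "- v"] by (simp add: vac_functional_uminus)

lemma vac_functional_sum: "\<phi> (\<Sum>k\<in>K. u k) = (\<Sum>k\<in>K. \<phi> (u k))"
  by (induction K rule: infinite_finite_induct) (simp_all add: vac_functional_add)

lemma vac_functional_left: "vac_functional Q (\<lambda>u. \<phi> (x * u))"
  using phi unfolding vac_functional_def mult_map_scale_conv_mult
  by (auto simp: distrib_left vac_ideal_left single_0_left_commute)

end

locale quiver =
  fixes Q :: "('i::{finite,linorder}, 'a) pre_digraph"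
  assumes fin: "fin_digraph Q" and verts: "verts Q = UNIV" and sym: "symmetric_quiver Q"
begin

abbreviation \<chi> where "\<chi> \<equiv> euler Q"

text \<open>Grouping the arrows by their two ends brings in the cardinalities on which
  \<open>symmetric_quiver\<close> is a condition.\<close>

lemma euler_eq: "euler Q d e = (\<Sum>i\<in>UNIV. d i * e i) -
  (\<Sum>(i, j)\<in>UNIV. int (card {a \<in> arcs Q. tail Q a = i \<and> head Q a = j}) * (d i * e j))"
proof -
  have fa: "finite (arcs Q)" using fin by (rule fin_digraph.finite_arcs)
  have "(\<Sum>a\<in>arcs Q. d (tail Q a) * e (head Q a)) =
    (\<Sum>y\<in>UNIV. \<Sum>a | a \<in> arcs Q \<and> (tail Q a, head Q a) = y. d (tail Q a) * e (head Q a))"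
    by (rule sum.group[symmetric]) (simp_all add: fa)
  also have "\<dots> = (\<Sum>y\<in>UNIV. \<Sum>a | a \<in> arcs Q \<and> (tail Q a, head Q a) = y. d (fst y) * e (snd y))"
    by (intro sum.cong refl) auto
  also have "\<dots> = (\<Sum>(i, j)\<in>UNIV. int (card {a \<in> arcs Q. tail Q a = i \<and> head Q a = j}) * (d i * e j))"
    by (intro sum.cong refl) auto
  finally show ?thesis by (simp add: euler_def verts)
qed

lemma euler_commute: "euler Q d e = euler Q e d"
proof -
  have "(\<Sum>(i, j)\<in>UNIV. int (card {a \<in> arcs Q. tail Q a = i \<and> head Q a = j}) * (d i * e j)) =
    (\<Sum>(i, j)\<in>UNIV. int (card {a \<in> arcs Q. tail Q a = i \<and> head Q a = j}) * (e i * d j))"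
    using sym unfolding symmetric_quiver_def
    by (intro sum.reindex_bij_witness[of _ prod.swap prod.swap]) auto
  then show ?thesis by (simp add: euler_eq mult.commute)
qed

lemma euler_add_left: "euler Q (\<lambda>i. d i + d' i) e = euler Q d e + euler Q d' e"
  by (simp add: euler_def algebra_simps sum.distrib)

lemma euler_add_right: "euler Q e (\<lambda>i. d i + d' i) = euler Q e d + euler Q e d'"
  by (simp add: euler_def algebra_simps sum.distrib)

lemma euler_zero_left [simp]: "euler Q (\<lambda>i. 0) e = 0"
  by (simp add: euler_def)

lemma braid_commute: "braid Q d e = braid Q e d"
  by (simp add: braid_def euler_commute)

lemma braid_add_left: "braid Q (\<lambda>i. d i + d' i) e = braid Q d e * braid Q d' e"
  by (simp add: braid_def euler_add_left power_int_add)

lemma braid_add_right: "braid Q e (\<lambda>i. d i + d' i) = braid Q e d * braid Q e d'"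
  by (simp add: braid_def euler_add_right power_int_add)

lemma braid_zero_left [simp]: "braid Q (\<lambda>i. 0) e = 1"
  by (simp add: braid_def)

lemma braid_zero_right [simp]: "braid Q e (\<lambda>i. 0) = 1"
  by (simp add: braid_def euler_commute[of e])

lemma braid_square [simp]: "braid Q d e * braid Q d e = 1"
  by (simp add: braid_def power_int_add[symmetric] flip: mult_2)

lemma euler_basis: "euler Q (basis_vec i) (basis_vec j) =
  (if i = j then 1 else 0) - int (card {a \<in> arcs Q. tail Q a = i \<and> head Q a = j})"
proof -
  have "(\<Sum>x\<in>UNIV. basis_vec i x * basis_vec j x) = (if i = j then 1 else 0)"
    by (simp add: basis_vec_def if_distrib[of "\<lambda>x. x * _"] cong: if_cong)
  moreover have "(\<Sum>(i', j')\<in>UNIV. int (card {a \<in> arcs Q. tail Q a = i' \<and> head Q a = j'}) * (basis_vec i i' * basis_vec j j'))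
     = (\<Sum>x\<in>UNIV. if x = (i, j) then int (card {a \<in> arcs Q. tail Q a = i \<and> head Q a = j}) else 0)"
    by (rule sum.cong) (auto simp: basis_vec_def split: if_splits)
  ultimately show ?thesis by (simp add: euler_eq)
qed

lemma locN_commute: "locN Q i j = locN Q j i"
  by (simp add: locN_def euler_commute)

text \<open>The number of arrows from i to j minus the Kronecker delta; the value -1 therefore means
  a vertex without loops.\<close>

lemma locN_ge: "- 1 \<le> locN Q i j" and locN_nonneg: "i \<noteq> j \<Longrightarrow> 0 \<le> locN Q i j"
  by (simp_all add: locN_def euler_basis)

lemma braid_basis: "braid Q (basis_vec i) (basis_vec j) = (-1) powi locN Q i j"
  by (simp add: braid_def locN_def power_int_minus_one_minus)

text \<open>\<open>E\<close> adds to the locality relation of the Lie algebra the commutator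
  relations with the same coefficients. The brackets cancel, and products in the two orders remain.
  The context \<open>x\<close>, \<open>y\<close> is harmless because \<open>env_ideal\<close> is
  two-sided.\<close>

lemma vac_functional_locality:
  assumes phi: "vac_functional Q \<phi>" and N: "N = nat (max (locN Q i j) 0)"
  shows "(\<Sum>k\<le>N. (-1) ^ k * of_nat (N choose k) *
      \<phi> (mono_word (x @ [Mode i (m - int k), Mode j (n + int k)] @ y))) =
    braid Q (basis_vec i) (basis_vec j) * (\<Sum>k\<le>N. (-1) ^ k * of_nat (N choose k) *
      \<phi> (mono_word (x @ [Mode j (n + int k), Mode i (m - int k)] @ y)))"
proof -
  let ?\<beta> = "braid Q (basis_vec i) (basis_vec j)"
  let ?c = "\<lambda>k. (-1) ^ k * of_nat (N choose k) :: rat"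
  let ?a = "\<lambda>k. Mode i (m - int k)" and ?b = "\<lambda>k. Mode j (n + int k)"
  define com where "com = (\<lambda>k. mono_word [?a k, ?b k] - Poly_Mapping.single (Word [?b k, ?a k]) ?\<beta>
       - mono_word [Brk (?a k) (?b k)])"
  define E where "E = (\<Sum>k\<le>N. Poly_Mapping.single 0 (?c k) * com k)
    + lie_incl (\<Sum>k\<le>N. Poly_Mapping.single (Brk (?a k) (?b k)) (?c k))"
  have "com k \<in> env_ideal Q" for k
    using env_ideal.commutator[of "?a k" "?b k" Q] by (simp add: com_def)
  then have "E \<in> env_ideal Q" unfolding E_def
    by (intro env_ideal.add env_ideal_sum env_ideal.left env_ideal.lie lie_rel.locality N)
  then have "mono_word x * E * mono_word y \<in> vac_ideal Q"
    by (intro vac_ideal.env env_ideal.left env_ideal.right)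
  moreover have "E = (\<Sum>k\<le>N. Poly_Mapping.single (Word [?a k, ?b k]) (?c k)
      - Poly_Mapping.single (Word [?b k, ?a k]) (?c k * ?\<beta>))"
    by (simp add: E_def com_def lie_incl_sum sum.distrib[symmetric] right_diff_distrib mult_single)
  ultimately have "\<phi> (\<Sum>k\<le>N. Poly_Mapping.single (Word (x @ [?a k, ?b k] @ y)) (?c k)
      - Poly_Mapping.single (Word (x @ [?b k, ?a k] @ y)) (?c k * ?\<beta>)) = 0"
    using vac_functional_0[OF phi]
    by (simp add: sum_distrib_left sum_distrib_right right_diff_distrib left_diff_distrib single_word_mult)
  moreover have "\<phi> (\<Sum>k\<le>N. Poly_Mapping.single (Word (x @ [?a k, ?b k] @ y)) (?c k)
      - Poly_Mapping.single (Word (x @ [?b k, ?a k] @ y)) (?c k * ?\<beta>)) =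
    (\<Sum>k\<le>N. ?c k * \<phi> (mono_word (x @ [?a k, ?b k] @ y)) - ?c k * ?\<beta> * \<phi> (mono_word (x @ [?b k, ?a k] @ y)))"
    unfolding vac_functional_sum[OF phi] vac_functional_diff[OF phi]
    by (intro sum.cong refl arg_cong2[where f=minus] vac_functional_single[OF phi])
  ultimately show ?thesis
    unfolding sum_subtractf sum_distrib_left by (simp add: ac_simps)
qed

end

text \<open>Every term in the expansion of (z_k - z_l)^M has total degree M.\<close>

lemma zpows_homogeneous:
  assumes "A \<subseteq> pairs p" "zpows A M c b \<noteq> 0"
  obtains a where "c a \<noteq> 0" "(\<Sum>t<p. b t) = (\<Sum>t<p. a t) + (\<Sum>(k, l)\<in>A. M k l)"
proof -
  obtain \<mu> where nz: "c (zshifts A M \<mu> b) \<noteq> 0" using assms(2) by (rule zpows_nonzeroE)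
  have "(\<Sum>t<p. zshifts A M \<mu> b t) = (\<Sum>t<p. b t) - (\<Sum>(k, l)\<in>A. M k l)"
    using tail_sum_zshifts[OF assms(1), of M \<mu> b 0] by (simp add: lessThan_atLeast0 cong: sum.cong)
  then show thesis using that[OF nz] by simp
qed

lemma zpows_scale:
  assumes "A \<subseteq> pairs p" "tail_bounded u p c" "u \<le> 1"
  shows "zpows A M (\<lambda>b. r * c b) = (\<lambda>b. r * zpows A M c b)"
  using zpows_sum[of A p "{()}" u "\<lambda>_. c" M "\<lambda>_. r"] assms by simp

lemma zpows_cong_below:
  assumes "A \<subseteq> pairs p" "\<And>b b'. (\<And>t. t < p \<Longrightarrow> b t = b' t) \<Longrightarrow> c b = c' b'" "\<And>t. t < p \<Longrightarrow> b t = b' t"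
  shows "zpows A M c b = zpows A M c' b'"
proof -
  have "c (zshifts A M \<mu> b) = c' (zshifts A M \<mu> b')" for \<mu>
    by (rule assms(2)) (simp add: zshifts_def assms(3))
  then show ?thesis unfolding zpows_def by simp
qed

text \<open>The last variable is never the first one of a pair, and a second variable only occurs
  with non-negative powers.\<close>

lemma zpows_last_nonneg:
  assumes "A \<subseteq> pairs p" "zpows A M c b \<noteq> 0" "\<And>a. c a \<noteq> 0 \<Longrightarrow> 0 \<le> a (p - 1)"
  shows "0 \<le> b (p - 1)"
proof -
  obtain \<mu> where nz: "c (zshifts A M \<mu> b) \<noteq> 0" using assms(2) by (rule zpows_nonzeroE)
  have "0 \<le> (\<Sum>(k, l)\<in>A. (if p - 1 = k then M k l - int (\<mu> k l) else 0) + (if p - 1 = l then int (\<mu> k l) else 0))"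
  proof (rule sum_nonneg, clarify)
    fix k l assume "(k, l) \<in> A"
    then have "k < l" "l < p" using assms(1) by auto
    then show "0 \<le> (if p - 1 = k then M k l - int (\<mu> k l) else 0) + (if p - 1 = l then int (\<mu> k l) else 0)"
      by auto
  qed
  with assms(3)[OF nz] show ?thesis by (simp add: zshifts_def)
qed

text \<open>Adjacent transpositions generate the symmetric group: (i, j+1) is (i, j) conjugated by
  (j, j+1). Colours and exponents move together, so the invariance is assumed for all colour
  sequences at once.\<close>

lemma adjacent_swaps_imp_permutes:
  fixes X :: "(nat \<Rightarrow> 'c) \<Rightarrow> (nat \<Rightarrow> 'b) \<Rightarrow> 'r"
  assumes swap: "\<And>t cs b. Suc t < p \<Longrightarrow>
      X (cs \<circ> Transposition.transpose t (Suc t)) (b \<circ> Transposition.transpose t (Suc t)) = X cs b"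
    and "\<pi> permutes {..<p}"
  shows "X (cs \<circ> \<pi>) (b \<circ> \<pi>) = X cs b"
proof -
  have less: "X (cs \<circ> Transposition.transpose i j) (b \<circ> Transposition.transpose i j) = X cs b"
    if "i < j" "j < p" for i j cs b
    using that
  proof (induction j arbitrary: cs b)
    case (Suc j)
    show ?case
    proof (cases "i = j")
      case True
      then show ?thesis using swap[OF Suc.prems(2), of cs b] by blast
    next
      case False
      let ?s = "Transposition.transpose j (Suc j)" and ?t = "Transposition.transpose i j"
      have "Transposition.transpose i (Suc j) = ?s \<circ> ?t \<circ> ?s"
        using False Suc.prems by (auto simp: fun_eq_iff Transposition.transpose_def)
      moreover have "X (cs \<circ> ?s \<circ> ?t \<circ> ?s) (b \<circ> ?s \<circ> ?t \<circ> ?s) = X (cs \<circ> ?s \<circ> ?t) (b \<circ> ?s \<circ> ?t)"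
        by (rule swap[OF Suc.prems(2)])
      moreover have "X (cs \<circ> ?s \<circ> ?t) (b \<circ> ?s \<circ> ?t) = X (cs \<circ> ?s) (b \<circ> ?s)"
        by (rule Suc.IH) (use False Suc.prems in auto)
      moreover have "X (cs \<circ> ?s) (b \<circ> ?s) = X cs b"
        by (rule swap[OF Suc.prems(2)])
      ultimately show ?thesis by (simp only: comp_assoc)
    qed
  qed simp
  have trans: "X (cs \<circ> Transposition.transpose i j) (b \<circ> Transposition.transpose i j) = X cs b"
    if "i < p" "j < p" "i \<noteq> j" for i j cs b
    using that less[of i j] less[of j i] by (cases "i < j") (auto simp: transpose_commute)
  show ?thesis using assms(2) finite_lessThan
  proof (induction arbitrary: cs b rule: permutes_induct)
    case (swap i j \<pi>)
    have "X (cs \<circ> Transposition.transpose i j \<circ> \<pi>) (b \<circ> Transposition.transpose i j \<circ> \<pi>) =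
      X (cs \<circ> Transposition.transpose i j) (b \<circ> Transposition.transpose i j)"
      by (fact swap)
    also have "\<dots> = X cs b" by (rule trans) (use swap in auto)
    finally show ?case by (simp only: comp_assoc)
  qed simp
qed

lemma mode_word_split:
  assumes "Suc t < p"
  shows "mode_word p cs b = map (\<lambda>s. Mode (cs s) (- b s - 1)) [0..<t] @
     [Mode (cs t) (- b t - 1), Mode (cs (Suc t)) (- b (Suc t) - 1)] @
     map (\<lambda>s. Mode (cs s) (- b s - 1)) [Suc (Suc t)..<p]"
proof -
  have "[0..<p] = [0..<t] @ [t, Suc t] @ [Suc (Suc t)..<p]"
    using assms upt_add_eq_append[of 0 t "p - t"] by (simp add: upt_conv_Cons)
  then show ?thesis unfolding mode_word_def by (metis (no_types, lifting) list.simps(8,9) map_append)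
qed

context quiver
begin

text \<open>The two modes take the form of the locality relation with m = N - b t - 1 and n = - b
  (Suc t) - 1.\<close>

lemma corr_zshift:
  assumes "Suc t < p"
  shows "corr \<phi> p cs (zshift t (Suc t) N k b) =
    \<phi> (mono_word (map (\<lambda>s. Mode (cs s) (- b s - 1)) [0..<t] @
     [Mode (cs t) ((N - b t - 1) - int k), Mode (cs (Suc t)) ((- b (Suc t) - 1) + int k)] @
     map (\<lambda>s. Mode (cs s) (- b s - 1)) [Suc (Suc t)..<p]))"
proof -
  have "map (\<lambda>s. Mode (cs s) (- zshift t (Suc t) N k b s - 1)) [0..<t] = map (\<lambda>s. Mode (cs s) (- b s - 1)) [0..<t]"
    "map (\<lambda>s. Mode (cs s) (- zshift t (Suc t) N k b s - 1)) [Suc (Suc t)..<p] = map (\<lambda>s. Mode (cs s) (- b s - 1)) [Suc (Suc t)..<p]"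
    by (auto simp: zshift_def)
  moreover have "zshift t (Suc t) N k b t = b t - (N - int k)" "zshift t (Suc t) N k b (Suc t) = b (Suc t) - int k"
    by (simp_all add: zshift_def)
  moreover have "- (b t - (N - int k)) - 1 = (N - b t - 1) - int k" "- (b (Suc t) - int k) - 1 = (- b (Suc t) - 1) + int k"
    by simp_all
  ultimately show ?thesis unfolding corr_def mode_word_split[OF assms] by (simp only:)
qed

text \<open>The same two modes in the opposite order, with the index k replaced by N - k.\<close>

lemma corr_zshift_swap:
  assumes "Suc t < p"
  shows "corr \<phi> p (cs \<circ> Transposition.transpose t (Suc t)) (zshift t (Suc t) N k (b \<circ> Transposition.transpose t (Suc t))) =
    \<phi> (mono_word (map (\<lambda>s. Mode (cs s) (- b s - 1)) [0..<t] @
     [Mode (cs (Suc t)) ((- b (Suc t) - 1) + (N - int k)), Mode (cs t) ((N - b t - 1) - (N - int k))] @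
     map (\<lambda>s. Mode (cs s) (- b s - 1)) [Suc (Suc t)..<p]))"
proof -
  let ?s = "Transposition.transpose t (Suc t)"
  have maps: "map (\<lambda>s. Mode ((cs \<circ> ?s) s) (- (b \<circ> ?s) s - 1)) [0..<t] = map (\<lambda>s. Mode (cs s) (- b s - 1)) [0..<t]"
    "map (\<lambda>s. Mode ((cs \<circ> ?s) s) (- (b \<circ> ?s) s - 1)) [Suc (Suc t)..<p] = map (\<lambda>s. Mode (cs s) (- b s - 1)) [Suc (Suc t)..<p]"
    by (auto simp: Transposition.transpose_def)
  show ?thesis unfolding corr_zshift[OF assms] maps by (simp add: algebra_simps)
qed

lemma zpow_corr_nat:
  fixes t p n cs b
  defines "x \<equiv> map (\<lambda>s. Mode (cs s) (- b s - 1)) [0..<t]"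
    and "y \<equiv> map (\<lambda>s. Mode (cs s) (- b s - 1)) [Suc (Suc t)..<p]"
    and "i \<equiv> \<lambda>k. Mode (cs t) ((int n - b t - 1) - int k)"
    and "j \<equiv> \<lambda>k. Mode (cs (Suc t)) ((- b (Suc t) - 1) + int k)"
    and "s \<equiv> Transposition.transpose t (Suc t)"
  assumes t: "Suc t < p"
  shows "zpow t (Suc t) (int n) (corr \<phi> p cs) b =
      (\<Sum>k\<le>n. (-1) ^ k * of_nat (n choose k) * \<phi> (mono_word (x @ [i k, j k] @ y)))" (is ?th1)
    and "zpow t (Suc t) (int n) (corr \<phi> p (cs \<circ> s)) (b \<circ> s) =
      (-1) ^ n * (\<Sum>k\<le>n. (-1) ^ k * of_nat (n choose k) * \<phi> (mono_word (x @ [j k, i k] @ y)))" (is ?th2)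
proof -
  show ?th1
    unfolding zpow_nat corr_zshift[OF t] i_def j_def x_def y_def by (simp add: ac_simps)
  let ?v = "\<lambda>k. \<phi> (mono_word (x @ [j k, i k] @ y))"
  have "(-1) ^ n * (\<Sum>k\<le>n. (-1) ^ k * of_nat (n choose k) * ?v k) =
    (\<Sum>k\<le>n. (-1) ^ n * (-1) ^ k * of_nat (n choose k) * ?v k)"
    by (simp add: sum_distrib_left mult.assoc)
  \<comment> \<open>Reflecting k to n - k undoes the index change of
    \<open>corr_zshift_swap\<close>; the sign (-1)^n is its price.\<close>
  also have "\<dots> = (\<Sum>k\<le>n. of_nat (n choose k) * (-1) ^ k * ?v (n - k))"
  proof (rule sum.reindex_bij_witness[of _ "\<lambda>k. n - k" "\<lambda>k. n - k"])
    fix k assume "k \<in> {..n}"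
    then have k: "k \<le> n" by simp
    have "(-1 :: rat) ^ n = (-1) ^ (n - k) * (-1) ^ k" using k by (simp flip: power_add)
    moreover have "(-1 :: rat) ^ k * (-1) ^ k = 1" by (simp flip: power_mult_distrib)
    ultimately have "(-1 :: rat) ^ n * (-1) ^ k = (-1) ^ (n - k)" by (simp only: mult.assoc mult_1_right)
    then show "of_nat (n choose (n - k)) * (-1) ^ (n - k) * ?v (n - (n - k)) = (-1) ^ n * (-1) ^ k * of_nat (n choose k) * ?v k"
      using k by (simp add: binomial_symmetric[symmetric] mult.commute)
  qed auto
  also have "\<dots> = zpow t (Suc t) (int n) (corr \<phi> p (cs \<circ> s)) (b \<circ> s)"
    unfolding zpow_nat s_def corr_zshift_swap[OF t] i_def j_def x_def y_def
    by (rule sum.cong) (simp_all add: of_nat_diff)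
  finally show ?th2 ..
qed

text \<open>For N \<ge> 0 this is locality: its sign (-1)^N cancels the (-1)^N from exchanging the
  two variables in (z_t - z_(t+1))^N.\<close>

lemma zpow_corr_swap:
  assumes phi: "vac_functional Q \<phi>" and t: "Suc t < p" and b: "tail_bounded 1 p (corr \<phi> p cs)"
  defines "s \<equiv> Transposition.transpose t (Suc t)" and "N \<equiv> locN Q (cs t) (cs (Suc t))"
  shows "zpow t (Suc t) N (corr \<phi> p cs) b = zpow t (Suc t) N (corr \<phi> p (cs \<circ> s)) (b \<circ> s)"
proof -
  let ?i = "cs t" and ?j = "cs (Suc t)"
  show ?thesis
  proof (cases "0 \<le> N")
    case True
    then obtain n where n: "N = int n" using zero_le_imp_eq_int by blast
    have nn: "n = nat (max (locN Q ?i ?j) 0)" using n by (simp add: N_def)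
    show ?thesis
      unfolding n s_def zpow_corr_nat(2)[OF t]
      unfolding zpow_corr_nat(1)[OF t] vac_functional_locality[OF phi nn] braid_basis N_def[symmetric]
      by (simp add: n)
  next
    \<comment> \<open>Now N = -1 and the two colours agree. The locality relation has order 0 and
      sign -1, so the modes anticommute and the correlator is antisymmetric, as
      \<open>zpow_minus_one_swap\<close> requires.\<close>
    case False
    then have N: "N = -1" and ij: "?i = ?j" using locN_ge[of ?i ?j] locN_nonneg[of ?i ?j] unfolding N_def by auto
    then have cs: "cs \<circ> s = cs" by (auto simp: s_def fun_eq_iff Transposition.transpose_def)
    interpret position_pair 1 p t "Suc t" by standard (use t in auto)
    have anti: "corr \<phi> p cs a = - corr \<phi> p cs (a \<circ> s)" for a
    proof -
      have nn: "0 = nat (max (locN Q ?i ?j) 0)" using N N_def by simp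
      have z: "zshift t (Suc t) 0 0 a = a" "zshift t (Suc t) 0 0 (a \<circ> s) = a \<circ> s" by (auto simp: zshift_def)
      have "corr \<phi> p cs (zshift t (Suc t) 0 0 a) = - corr \<phi> p (cs \<circ> s) (zshift t (Suc t) 0 0 (a \<circ> s))"
        unfolding s_def corr_zshift_swap[OF t] unfolding corr_zshift[OF t]
        using vac_functional_locality[OF phi nn, of "map (\<lambda>s. Mode (cs s) (- a s - 1)) [0..<t]" "- a t - 1"
            "- a (Suc t) - 1" "map (\<lambda>s. Mode (cs s) (- a s - 1)) [Suc (Suc t)..<p]"]
        unfolding braid_basis N_def[symmetric] N by simp
      then show ?thesis unfolding z cs .
    qed
    show ?thesis unfolding N cs unfolding s_def by (rule zpow_minus_one_swap[OF b anti[unfolded s_def]])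
  qed
qed

text \<open>Exchanging t and t+1 permutes the remaining pairs and keeps each of them ordered, so
  that all their expansions match. The factor \<open>r\<close> is 1 for \<open>F_series\<close>; the
  converse construction also has -1.\<close>

lemma zpows_swap:
  fixes t p :: nat
  defines "s \<equiv> Transposition.transpose t (Suc t)" and "A \<equiv> pairs p - {(t, Suc t)}"
  assumes t: "Suc t < p" and H: "\<And>b. H' (b \<circ> s) = r * H b"
    and bdd: "tail_bounded 1 p H" "tail_bounded 1 p H'"
  shows "zpows A (\<lambda>k l. M (s k) (s l)) H' (b \<circ> s) = r * zpows A M H b"
proof -
  have s: "inj s" "s (s x) = x" for x by (simp_all add: s_def)
  have A: "A \<subseteq> pairs p" by (auto simp: A_def)
  have sA: "map_prod s s ` A = A"
  proof -
    have in_A: "map_prod s s x \<in> A" if "x \<in> A" for x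
      using that t by (cases x) (auto simp: A_def s_def Transposition.transpose_def)
    have inv: "x = map_prod s s (map_prod s s x)" for x by (cases x) (simp add: s)
    show ?thesis
    proof (intro equalityI subsetI)
      fix x assume "x \<in> A"
      then show "x \<in> map_prod s s ` A" by (intro image_eqI[where x="map_prod s s x"] in_A inv)
    next
      fix x assume "x \<in> map_prod s s ` A"
      then show "x \<in> A" using in_A by (elim imageE) simp
    qed
  qed
  have H': "(\<lambda>b. H' (\<lambda>t. b (s t))) = (\<lambda>b. r * H b)"
    using H by (simp add: comp_def)
  have "zpows (map_prod s s ` A) M (\<lambda>b. H' (\<lambda>t. b (s t))) = (\<lambda>b. zpows A (\<lambda>k l. M (s k) (s l)) H' (\<lambda>t. b (s t)))"
    by (rule zpows_comp[OF A s(1) _ order_refl order_refl bdd(2)])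
      (unfold sA H', rule A, rule tail_bounded_scale[OF bdd(1)])
  then have "(\<lambda>b. r * zpows A M H b) = (\<lambda>b. zpows A (\<lambda>k l. M (s k) (s l)) H' (\<lambda>t. b (s t)))"
    unfolding sA H' zpows_scale[OF A bdd(1) order_refl] .
  then show ?thesis by (simp add: comp_def fun_eq_iff)
qed

lemma zpows_pairs_adjacent:
  assumes "Suc t < p" "tail_bounded 1 p c"
  shows "zpows (pairs p) M c = zpows (pairs p - {(t, Suc t)}) M (zpow t (Suc t) (M t (Suc t)) c)"
proof -
  have A: "pairs p - {(t, Suc t)} \<subseteq> pairs p" "(t, Suc t) \<notin> pairs p - {(t, Suc t)}"
    "pairs p = insert (t, Suc t) (pairs p - {(t, Suc t)})"
    using assms(1) by auto
  show ?thesis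
    by (subst A(3)) (simp only: zpows_insert[OF assms(2) order_refl A(1) lessI assms(1) A(2)]
      zpow_zpows[OF A(1) assms(2) order_refl lessI assms(1)])
qed

text \<open>Only tails from position 1 on are assumed bounded, since the bound on the full sum is
  itself derived from this symmetry.\<close>

lemma F_series_swap:
  assumes phi: "vac_functional Q \<phi>" and t: "Suc t < p" and tb: "\<And>cs. tail_bounded 1 p (corr \<phi> p cs)"
  defines "s \<equiv> Transposition.transpose t (Suc t)"
  shows "F_series Q \<phi> p (cs \<circ> s) (b \<circ> s) = F_series Q \<phi> p cs b"
proof -
  interpret position_pair 1 p t "Suc t" by standard (use t in auto)
  let ?M = "\<lambda>k l. locN Q (cs k) (cs l)"
  have "locN Q (cs (s t)) (cs (s (Suc t))) = ?M t (Suc t)" by (simp add: s_def locN_commute)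
  then show ?thesis
    unfolding F_series_def zpows_pairs_adjacent[OF t tb] comp_apply
    using zpows_swap[OF t, of "zpow t (Suc t) (?M t (Suc t)) (corr \<phi> p (cs \<circ> s))" 1
        "zpow t (Suc t) (?M t (Suc t)) (corr \<phi> p cs)" ?M b]
      zpow_corr_swap[OF phi t tb, of cs] tail_bounded_zpow[OF tb]
    by (simp add: s_def comp_def)
qed

text \<open>A negative last exponent b means that the last letter is the mode -b - 1 \<ge> 0, which
  annihilates the vacuum.\<close>

lemma corr_last_nonneg:
  assumes "vac_functional Q \<phi>" "0 < p" "corr \<phi> p cs b \<noteq> 0"
  shows "0 \<le> b (p - 1)"
proof (rule ccontr)
  assume neg: "\<not> 0 \<le> b (p - 1)"
  have "mode_word p cs b = map (\<lambda>t. Mode (cs t) (- b t - 1)) [0..<p - 1] @ [Mode (cs (p - 1)) (- b (p - 1) - 1)]"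
    unfolding mode_word_def using assms(2) by (cases p) auto
  then have "corr \<phi> p cs b =
    \<phi> (mono_word (map (\<lambda>t. Mode (cs t) (- b t - 1)) [0..<p - 1]) * mono_word [Mode (cs (p - 1)) (- b (p - 1) - 1)])"
    by (simp add: corr_def mono_word_mult)
  also have "\<dots> = 0"
    by (rule vac_functional_0[OF assms(1)], rule vac_ideal.annihilate) (use neg in simp)
  finally show False using assms(3) by simp
qed

text \<open>Adjacent swaps carry position t to the end, where the exponent is non-negative; the
  induction is on the distance to the end.\<close>

lemma F_series_nonneg:
  assumes phi: "vac_functional Q \<phi>" and tb: "\<And>cs. tail_bounded 1 p (corr \<phi> p cs)"
    and "t < p" "F_series Q \<phi> p cs b \<noteq> 0"
  shows "0 \<le> b t"
  using assms(3,4)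
proof (induction "p - Suc t" arbitrary: t cs b)
  case 0
  then have "t = p - 1" "0 < p" by auto
  then show ?case
    using zpows_last_nonneg[of "pairs p" p _ "corr \<phi> p cs" b] corr_last_nonneg[OF phi, of p cs] 0(3)
    unfolding F_series_def by auto
next
  case (Suc n)
  then have t: "Suc t < p" by simp
  from F_series_swap[OF phi t tb, of cs b] Suc.prems
  have "F_series Q \<phi> p (cs \<circ> Transposition.transpose t (Suc t)) (b \<circ> Transposition.transpose t (Suc t)) \<noteq> 0" by simp
  from Suc.hyps(1)[OF _ t this] Suc.hyps(2) show ?case by simp
qed

text \<open>The letters in front of position t are absorbed into the functional, which stays a
  \<open>vac_functional\<close> because \<open>vac_ideal\<close> is a left ideal.\<close>

lemma corr_split:
  "t \<le> p \<Longrightarrow> corr \<phi> p cs b =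
    corr (\<lambda>u. \<phi> (mono_word (map (\<lambda>t. Mode (cs t) (- b t - 1)) [0..<t]) * u)) (p - t) (\<lambda>s. cs (s + t)) (\<lambda>s. b (s + t))"
proof -
  assume t: "t \<le> p"
  have "[0..<p] = [0..<t] @ map (\<lambda>s. s + t) [0..<p - t]"
    using t upt_add_eq_append[of 0 t "p - t"] by (simp add: map_add_upt)
  then show ?thesis
    unfolding corr_def mode_word_def mono_word_mult by (simp add: comp_def)
qed

text \<open>Joint induction on p. A tail from t \<ge> 1 is a full word of length p - t for a
  functional that has absorbed the prefix; the constant has to be uniform in \<phi> because the
  prefix varies with b. These tail bounds make \<open>F_series\<close> invertible, and its exponents
  are non-negative, so the total degree of the correlator is at least minus the sum of the exponents
  N.\<close>

lemma corr_bound_below: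
  "\<exists>C. \<forall>\<phi> b. vac_functional Q \<phi> \<longrightarrow> corr \<phi> p cs b \<noteq> 0 \<longrightarrow> C \<le> (\<Sum>t<p. b t)"
  and corr_tail_bounded_1: "vac_functional Q \<phi> \<Longrightarrow> tail_bounded 1 p (corr \<phi> p cs)"
proof (induction p arbitrary: cs \<phi> rule: less_induct)
  case (less p)
  have tb: "tail_bounded 1 p (corr \<phi> p cs)" if phi: "vac_functional Q \<phi>" for \<phi> cs
  proof -
    have "\<forall>t\<in>{1..<p}. \<exists>C. \<forall>\<phi> b. vac_functional Q \<phi> \<longrightarrow> corr \<phi> (p - t) (\<lambda>s. cs (s + t)) b \<noteq> 0 \<longrightarrow> C \<le> (\<Sum>s<p-t. b s)"
      by (intro ballI less.IH(1)) auto
    then obtain C where C: "\<And>t \<phi> b. t \<in> {1..<p} \<Longrightarrow> vac_functional Q \<phi> \<Longrightarrow>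
        corr \<phi> (p - t) (\<lambda>s. cs (s + t)) b \<noteq> 0 \<Longrightarrow> C t \<le> (\<Sum>s<p-t. b s)"
      unfolding bchoice_iff by blast
    show ?thesis
    proof (rule tail_boundedI)
      fix b t assume nz: "corr \<phi> p cs b \<noteq> 0" and t: "1 \<le> t" "t < p"
      have "C t \<le> (\<Sum>s<p-t. b (s + t))"
      proof (rule C[OF _ vac_functional_left[OF phi]])
        show "corr (\<lambda>u. \<phi> (mono_word (map (\<lambda>t. Mode (cs t) (- b t - 1)) [0..<t]) * u)) (p - t)
            (\<lambda>s. cs (s + t)) (\<lambda>s. b (s + t)) \<noteq> 0"
          using nz corr_split[of t p \<phi> cs b] t by simp
      qed (use t in simp)
      also have "\<dots> = (\<Sum>s=t..<p. b s)"
        using sum.shift_bounds_nat_ivl[of b 0 t "p - t"] t by (simp add: lessThan_atLeast0)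
      finally have "C t \<le> (\<Sum>s=t..<p. b s)" .
      moreover have "- (\<Sum>t<p. \<bar>C t\<bar>) \<le> C t"
        using member_le_sum[of t "{..<p}" "\<lambda>t. \<bar>C t\<bar>"] t by simp
      ultimately show "- (\<Sum>t<p. \<bar>C t\<bar>) \<le> (\<Sum>s=t..<p. b s)" by linarith
    qed
  qed
  {
    case 1
    let ?M = "\<lambda>k l. locN Q (cs k) (cs l)"
    show ?case
    proof (intro exI allI impI)
      fix \<phi> b assume phi: "vac_functional Q \<phi>" and nz: "corr \<phi> p cs b \<noteq> 0"
      have "corr \<phi> p cs = zpows (pairs p) (\<lambda>k l. - ?M k l) (F_series Q \<phi> p cs)"
        unfolding F_series_def by (rule zpows_inverse(2)[symmetric, OF order_refl tb[OF phi] order_refl])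
      with nz obtain a where a: "F_series Q \<phi> p cs a \<noteq> 0"
        and b: "(\<Sum>t<p. b t) = (\<Sum>t<p. a t) + (\<Sum>(k, l)\<in>pairs p. - ?M k l)"
        using zpows_homogeneous[OF order_refl, of p] by metis
      have "0 \<le> (\<Sum>t<p. a t)"
        using F_series_nonneg[OF phi tb[OF phi] _ a] by (intro sum_nonneg) auto
      then show "(\<Sum>(k, l)\<in>pairs p. - ?M k l) \<le> (\<Sum>t<p. b t)" using b by simp
    qed
  next
    case 2
    then show ?case by (rule tb)
  }
qed

lemma corr_tail_bounded:
  assumes phi: "vac_functional Q \<phi>"
  shows "tail_bounded u p (corr \<phi> p cs)"
proof -
  obtain C where C: "\<And>b. corr \<phi> p cs b \<noteq> 0 \<Longrightarrow> C \<le> (\<Sum>t<p. b t)"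
    using corr_bound_below phi by blast
  obtain C' where C': "\<And>b t. corr \<phi> p cs b \<noteq> 0 \<Longrightarrow> 1 \<le> t \<Longrightarrow> t < p \<Longrightarrow> C' \<le> (\<Sum>s=t..<p. b s)"
    using tail_boundedD[OF corr_tail_bounded_1[OF phi]] by blast
  have "tail_bounded 0 p (corr \<phi> p cs)"
  proof (rule tail_boundedI)
    fix b t assume "corr \<phi> p cs b \<noteq> 0" "t < p"
    then show "min C C' \<le> (\<Sum>s=t..<p. b s)"
      using C[of b] C'[of b t] by (cases "t = 0") (auto simp: lessThan_atLeast0)
  qed
  then show ?thesis by (rule tail_bounded_mono) simp
qed

lemma F_series_permutes:
  assumes "vac_functional Q \<phi>" "\<pi> permutes {..<p}"
  shows "F_series Q \<phi> p (cs \<circ> \<pi>) (b \<circ> \<pi>) = F_series Q \<phi> p cs b"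
  using adjacent_swaps_imp_permutes[of p "F_series Q \<phi> p", OF _ assms(2)]
    F_series_swap[OF assms(1) _ corr_tail_bounded[OF assms(1)]] by blast

lemma corr_eq_zpows_F_series:
  assumes "vac_functional Q \<phi>"
  shows "corr \<phi> p cs = zpows (pairs p) (\<lambda>k l. - locN Q (cs k) (cs l)) (F_series Q \<phi> p cs)"
  unfolding F_series_def by (rule zpows_inverse(2)[symmetric, OF order_refl corr_tail_bounded[OF assms] order_refl])

end

section \<open>Lie words as iterated commutators\<close>

lemma single_0_mult_mult: "Poly_Mapping.single 0 c * (Poly_Mapping.single 0 d * x) = Poly_Mapping.single 0 (c * d) * (x :: 'g word \<Rightarrow>\<^sub>0 rat)"
  by (simp add: mult_single flip: mult.assoc)

primrec free_lie :: "('i, 'a) pre_digraph \<Rightarrow> 'i lie_word \<Rightarrow> 'i tensor_alg" where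
  "free_lie Q (Mode i n) = mono_word [Mode i n]"
| "free_lie Q (Brk a b) = free_lie Q a * free_lie Q b -
     Poly_Mapping.single 0 (braid Q (lie_deg a) (lie_deg b)) * (free_lie Q b * free_lie Q a)"

text \<open>The algebra endomorphism that replaces every letter by its iterated commutator of modes.
  Antisymmetry, Jacobi and the commutator relations become identities, so that locality is the only
  relation left to check.\<close>

definition free_env :: "('i, 'a) pre_digraph \<Rightarrow> 'i tensor_alg \<Rightarrow> 'i tensor_alg" where
  "free_env Q u = (\<Sum>w\<in>Poly_Mapping.keys u.
     Poly_Mapping.single 0 (Poly_Mapping.lookup u w) * prod_list (map (free_lie Q) (letters w)))"

lemma free_env_add: "free_env Q (u + v) = free_env Q u + free_env Q v"
  unfolding free_env_def by (rule sum_keys_add) (simp_all add: single_add distrib_right)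

lemma free_env_single:
  "free_env Q (Poly_Mapping.single w c) = Poly_Mapping.single 0 c * prod_list (map (free_lie Q) (letters w))"
  unfolding free_env_def by (rule sum_keys_single) simp

lemma free_env_zero [simp]: "free_env Q 0 = 0"
  by (simp add: free_env_def)

lemma free_env_mult: "free_env Q (u * v) = free_env Q u * free_env Q v"
proof (induction u rule: poly_mapping_additive_induct)
  case (single w c)
  show ?case
  proof (induction v rule: poly_mapping_additive_induct)
    case (single w' c')
    show ?case
      by (simp add: mult_single free_env_single plus_word_def mult.assoc single_0_mult_mult
        single_0_left_commute[of "prod_list (map (free_lie Q) (letters w))" c'])
  qed (simp add: distrib_left free_env_add)
qed (simp add: distrib_right free_env_add)

lemma free_env_uminus: "free_env Q (- u) = - free_env Q u"
  using free_env_add[of Q u "- u"] by (simp add: add_eq_0_iff)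

lemma free_env_diff: "free_env Q (u - v) = free_env Q u - free_env Q v"
  using free_env_add[of Q u "- v"] by (simp add: free_env_uminus)

lemma free_env_sum: "free_env Q (\<Sum>k\<in>K. u k) = (\<Sum>k\<in>K. free_env Q (u k))"
  by (induction K rule: infinite_finite_induct) (simp_all add: free_env_add)

lemma lie_bracket_add_left: "lie_bracket (u + u') v = lie_bracket u v + lie_bracket u' v"
  unfolding lie_bracket_def by (rule sum_keys_add) (simp_all add: single_add distrib_right sum.distrib)

lemma lie_bracket_add_right: "lie_bracket u (v + v') = lie_bracket u v + lie_bracket u v'"
proof -
  have "(\<Sum>b\<in>Poly_Mapping.keys (v + v'). Poly_Mapping.single (Brk a b) (Poly_Mapping.lookup u a * Poly_Mapping.lookup (v + v') b))
     = (\<Sum>b\<in>Poly_Mapping.keys v. Poly_Mapping.single (Brk a b) (Poly_Mapping.lookup u a * Poly_Mapping.lookup v b))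
     + (\<Sum>b\<in>Poly_Mapping.keys v'. Poly_Mapping.single (Brk a b) (Poly_Mapping.lookup u a * Poly_Mapping.lookup v' b))" for a
    by (rule sum_keys_add[where f="\<lambda>b r. Poly_Mapping.single (Brk a b) (Poly_Mapping.lookup u a * r)"])
      (simp_all add: single_add distrib_left)
  then show ?thesis unfolding lie_bracket_def by (simp add: sum.distrib)
qed

lemma lie_bracket_single [simp]:
  "lie_bracket (Poly_Mapping.single a c) (Poly_Mapping.single b d) = Poly_Mapping.single (Brk a b) (c * d)"
  unfolding lie_bracket_def by (cases "c = 0"; cases "d = 0") simp_all

text \<open>
  The commutator of \<open>b\<close> with a relation \<open>r\<close> involves \<open>r\<close> twisted by \<open>a \<mapsto> (-1)\<^bsup>\<chi>(deg b, deg a)\<^esup> a\<close>,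
  so the induction over \<open>lie_rel\<close> has to cover all twists at once.
\<close>

definition lie_twist :: "('i, 'a) pre_digraph \<Rightarrow> ('i \<Rightarrow> int) \<Rightarrow> 'i lie_vec \<Rightarrow> 'i lie_vec" where
  "lie_twist Q d u = (\<Sum>a\<in>Poly_Mapping.keys u.
     Poly_Mapping.single a (braid Q d (lie_deg a) * Poly_Mapping.lookup u a))"

lemma lie_twist_add: "lie_twist Q d (u + v) = lie_twist Q d u + lie_twist Q d v"
  unfolding lie_twist_def by (rule sum_keys_add) (simp_all add: single_add distrib_left)

lemma lie_twist_single [simp]:
  "lie_twist Q d (Poly_Mapping.single a c) = Poly_Mapping.single a (braid Q d (lie_deg a) * c)"
  unfolding lie_twist_def by (rule sum_keys_single) simp

lemma lie_twist_zero [simp]: "lie_twist Q d 0 = 0"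
  by (simp add: lie_twist_def)

lemma lie_twist_uminus: "lie_twist Q d (- u) = - lie_twist Q d u"
  using lie_twist_add[of Q d u "- u"] by (simp add: add_eq_0_iff)

lemma lie_twist_diff: "lie_twist Q d (u - v) = lie_twist Q d u - lie_twist Q d v"
  using lie_twist_add[of Q d u "- v"] by (simp add: lie_twist_uminus)

lemma lie_twist_sum: "lie_twist Q d (\<Sum>k\<in>K. u k) = (\<Sum>k\<in>K. lie_twist Q d (u k))"
  by (induction K rule: infinite_finite_induct) (simp_all add: lie_twist_add)

lemma lie_incl_uminus: "lie_incl (- u) = - lie_incl u"
  using lie_incl_add[of u "- u"] by (simp add: add_eq_0_iff)

lemma lie_incl_diff: "lie_incl (u - v) = lie_incl u - lie_incl v"
  using lie_incl_add[of u "- v"] by (simp add: lie_incl_uminus)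

lemma lookup_map_scale: "Poly_Mapping.lookup (Poly_Mapping.map ((*) (c::rat)) u) k = c * Poly_Mapping.lookup u k"
  by (simp add: Poly_Mapping.map.rep_eq when_def)

lemma map_scale_add:
  "Poly_Mapping.map ((*) (c::rat)) (u + v) = Poly_Mapping.map ((*) c) u + Poly_Mapping.map ((*) c) v"
  by (rule poly_mapping_eqI) (simp add: lookup_map_scale lookup_add distrib_left)

lemma map_scale_single: "Poly_Mapping.map ((*) (c::rat)) (Poly_Mapping.single k d) = Poly_Mapping.single k (c * d)"
  by (rule poly_mapping_eqI) (simp add: lookup_map_scale lookup_single when_def)

context quiver
begin

definition free_twist :: "('i \<Rightarrow> int) \<Rightarrow> 'i lie_vec \<Rightarrow> 'i tensor_alg" where
  "free_twist d u = free_env Q (lie_incl (lie_twist Q d u))"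

lemma free_twist_add: "free_twist d (u + v) = free_twist d u + free_twist d v"
  by (simp add: free_twist_def lie_twist_add lie_incl_add free_env_add)

lemma free_twist_diff: "free_twist d (u - v) = free_twist d u - free_twist d v"
  by (simp add: free_twist_def lie_twist_diff lie_incl_diff free_env_diff)

lemma free_twist_sum: "free_twist d (\<Sum>k\<in>K. u k) = (\<Sum>k\<in>K. free_twist d (u k))"
  by (simp add: free_twist_def lie_twist_sum lie_incl_sum free_env_sum)

lemma free_twist_single:
  "free_twist d (Poly_Mapping.single a c) = Poly_Mapping.single 0 (braid Q d (lie_deg a) * c) * free_lie Q a"
  by (simp add: free_twist_def free_env_single)

lemma free_twist_zero [simp]: "free_twist d 0 = 0"
  by (simp add: free_twist_def)

lemma free_twist_scale:
  "free_twist d (Poly_Mapping.map ((*) c) u) = Poly_Mapping.single 0 c * free_twist d u"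
  by (induction u rule: poly_mapping_additive_induct)
    (simp_all add: map_scale_add free_twist_add distrib_left map_scale_single free_twist_single
      single_0_mult_mult mult.left_commute)

lemma free_twist_bracket_left:
  "free_twist d (lie_bracket (Poly_Mapping.single a c) u) = Poly_Mapping.single 0 (braid Q d (lie_deg a) * c) *
     (free_lie Q a * free_twist d u - free_twist (\<lambda>i. d i + lie_deg a i) u * free_lie Q a)"
proof (induction u rule: poly_mapping_additive_induct)
  case (add u v)
  show ?case by (simp only: lie_bracket_add_right free_twist_add add) (simp only: algebra_simps)
next
  case (single b e)
  define A B where "A = free_lie Q a" and "B = free_lie Q b"
  define x y z where "x = braid Q (lie_deg a) (lie_deg b)" and "y = braid Q d (lie_deg a)"
    and "z = braid Q d (lie_deg b)"
  note defs = x_def[symmetric] y_def[symmetric] z_def[symmetric] A_def[symmetric] B_def[symmetric]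
  have ba: "braid Q (lie_deg b) (lie_deg a) = x" by (simp add: x_def braid_commute)
  have "free_twist d (lie_bracket (Poly_Mapping.single a c) (Poly_Mapping.single b e)) =
      Poly_Mapping.single 0 (y * z * (c * e)) * (A * B - Poly_Mapping.single 0 x * (B * A))"
    by (simp only: lie_bracket_single free_twist_single free_lie.simps lie_deg.simps braid_add_right ba defs)
  also have "\<dots> = Poly_Mapping.single 0 (y * c) * (A * (Poly_Mapping.single 0 (z * e) * B) - Poly_Mapping.single 0 (z * x * e) * B * A)"
    by (simp add: right_diff_distrib single_0_mult_mult mult.assoc single_0_left_commute[of A])
      (simp add: ac_simps)
  finally show ?case
    by (simp only: free_twist_single braid_add_left defs)
qed

lemma free_twist_bracket_right:
  "free_twist d (lie_bracket u (Poly_Mapping.single a c)) = Poly_Mapping.single 0 (braid Q d (lie_deg a) * c) *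
     (free_twist d u * free_lie Q a - free_lie Q a * free_twist (\<lambda>i. d i + lie_deg a i) u)"
proof (induction u rule: poly_mapping_additive_induct)
  case (add u v)
  show ?case by (simp only: lie_bracket_add_left free_twist_add add) (simp only: algebra_simps)
next
  case (single b e)
  define A B where "A = free_lie Q a" and "B = free_lie Q b"
  define x y z where "x = braid Q (lie_deg a) (lie_deg b)" and "y = braid Q d (lie_deg a)"
    and "z = braid Q d (lie_deg b)"
  note defs = x_def[symmetric] y_def[symmetric] z_def[symmetric] A_def[symmetric] B_def[symmetric]
  have ba: "braid Q (lie_deg b) (lie_deg a) = x" by (simp add: x_def braid_commute)
  have "free_twist d (lie_bracket (Poly_Mapping.single b e) (Poly_Mapping.single a c)) =
      Poly_Mapping.single 0 (z * y * (e * c)) * (B * A - Poly_Mapping.single 0 x * (A * B))"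
    by (simp only: lie_bracket_single free_twist_single free_lie.simps lie_deg.simps braid_add_right ba defs)
  also have "\<dots> = Poly_Mapping.single 0 (y * c) * (Poly_Mapping.single 0 (z * e) * B * A - A * (Poly_Mapping.single 0 (z * x * e) * B))"
    by (simp add: right_diff_distrib single_0_mult_mult mult.assoc single_0_left_commute[of A])
      (simp add: ac_simps)
  finally show ?case
    by (simp only: free_twist_single braid_add_left defs)
qed

text \<open>\<open>J\<close> stands for any two-sided ideal that contains the locality relations
  written as commutators. In the other base cases the image is 0: antisymmetry and Jacobi hold for
  braided commutators, as a braiding sign squares to 1.\<close>

lemma free_twist_in_ideal:
  assumes J: "0 \<in> J" "\<And>u v. u \<in> J \<Longrightarrow> v \<in> J \<Longrightarrow> u + v \<in> J"
      "\<And>u x. u \<in> J \<Longrightarrow> x * u \<in> J" "\<And>u x. u \<in> J \<Longrightarrow> u * x \<in> J"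
    and loc: "\<And>N i j m n. N = nat (max (locN Q i j) 0) \<Longrightarrow>
      (\<Sum>k\<le>N. Poly_Mapping.single 0 ((-1) ^ k * of_nat (N choose k)) *
        free_lie Q (Brk (Mode i (m - int k)) (Mode j (n + int k)))) \<in> J"
    and r: "r \<in> lie_rel Q"
  shows "free_twist d r \<in> J"
  using r
proof (induction arbitrary: d rule: lie_rel.induct)
  case (left u v)
  have Jd: "x - y \<in> J" if "x \<in> J" "y \<in> J" for x y
    using J(2)[OF that(1) J(3)[OF that(2), of "-1"]] by simp
  show ?case
    by (induction v rule: poly_mapping_additive_induct)
      (simp_all add: lie_bracket_add_left free_twist_add J(2) free_twist_bracket_left J(3,4) Jd left)
next
  case (right u v)
  have Jd: "x - y \<in> J" if "x \<in> J" "y \<in> J" for x y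
    using J(2)[OF that(1) J(3)[OF that(2), of "-1"]] by simp
  show ?case
    by (induction v rule: poly_mapping_additive_induct)
      (simp_all add: lie_bracket_add_right free_twist_add J(2) free_twist_bracket_right J(3,4) Jd right)
next
  case (antisymmetry a b)
  define x y where "x = braid Q (lie_deg a) (lie_deg b)" and "y = braid Q d (lie_deg a) * braid Q d (lie_deg b)"
  define A B where "A = free_lie Q a" and "B = free_lie Q b"
  have x2: "x * x = 1" by (simp add: x_def)
  have ba: "braid Q (lie_deg b) (lie_deg a) = x" by (simp add: x_def braid_commute)
  have "free_twist d (Poly_Mapping.single (Brk a b) 1
      + Poly_Mapping.single (Brk b a) (braid Q (lie_deg a) (lie_deg b))) =
    Poly_Mapping.single 0 y * (A * B - Poly_Mapping.single 0 x * (B * A)) +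
    Poly_Mapping.single 0 (y * x) * (B * A - Poly_Mapping.single 0 x * (A * B))"
    by (simp add: free_twist_add free_twist_single braid_add_right ba mult.commute flip: x_def A_def B_def)
      (simp add: y_def mult.commute)
  also have "\<dots> = 0"
    by (simp add: right_diff_distrib single_0_mult_mult mult.assoc x2)
  finally show ?case using J(1) by simp
next
  case (jacobi a b c)
  define x y z where "x = braid Q (lie_deg a) (lie_deg b)" and "y = braid Q (lie_deg a) (lie_deg c)"
    and "z = braid Q (lie_deg b) (lie_deg c)"
  define A B C where "A = free_lie Q a" and "B = free_lie Q b" and "C = free_lie Q c"
  define w where "w = braid Q d (lie_deg a) * braid Q d (lie_deg b) * braid Q d (lie_deg c)"
  have x2: "x * x = 1" "x * (x * v) = v" for v
    by (simp_all add: x_def flip: mult.assoc)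
  have ba: "braid Q (lie_deg b) (lie_deg a) = x" by (simp add: x_def braid_commute)
  have fl: "A * (Poly_Mapping.single 0 r * v) = Poly_Mapping.single 0 r * (A * v)"
    "B * (Poly_Mapping.single 0 r * v) = Poly_Mapping.single 0 r * (B * v)"
    "C * (Poly_Mapping.single 0 r * v) = Poly_Mapping.single 0 r * (C * v)" for r v
    by (rule single_0_left_commute)+
  have "free_twist d (Poly_Mapping.single (Brk a (Brk b c)) 1 - Poly_Mapping.single (Brk (Brk a b) c) 1
       - Poly_Mapping.single (Brk b (Brk a c)) (braid Q (lie_deg a) (lie_deg b))) =
    Poly_Mapping.single 0 w *
      (A * (B * C - Poly_Mapping.single 0 z * (C * B))
        - Poly_Mapping.single 0 (x * y) * ((B * C - Poly_Mapping.single 0 z * (C * B)) * A)) -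
    Poly_Mapping.single 0 w *
      ((A * B - Poly_Mapping.single 0 x * (B * A)) * C
        - Poly_Mapping.single 0 (y * z) * (C * (A * B - Poly_Mapping.single 0 x * (B * A)))) -
    Poly_Mapping.single 0 (w * x) *
      (B * (A * C - Poly_Mapping.single 0 y * (C * A))
        - Poly_Mapping.single 0 (x * z) * ((A * C - Poly_Mapping.single 0 y * (C * A)) * B))"
    by (simp only: free_twist_diff free_twist_single free_lie.simps lie_deg.simps braid_add_right braid_add_left ba
      x_def[symmetric] y_def[symmetric] z_def[symmetric] A_def[symmetric] B_def[symmetric] C_def[symmetric])
      (simp add: w_def ac_simps)
  also have "\<dots> = 0"
    by (simp add: right_diff_distrib left_diff_distrib single_0_mult_mult fl mult.assoc)
      (simp add: ac_simps x2)
  finally show ?case using J(1) by simp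
next
  case (locality N i j m n)
  \<comment> \<open>All words of a locality relation have degree e_i + e_j, so the twist is a single
    scalar.\<close>
  have "free_twist d (\<Sum>k\<le>N. Poly_Mapping.single (Brk (Mode i (m - int k)) (Mode j (n + int k)))
        ((-1) ^ k * of_nat (N choose k))) =
     Poly_Mapping.single 0 (braid Q d (\<lambda>x. basis_vec i x + basis_vec j x)) *
     (\<Sum>k\<le>N. Poly_Mapping.single 0 ((-1) ^ k * of_nat (N choose k)) *
        free_lie Q (Brk (Mode i (m - int k)) (Mode j (n + int k))))"
    by (simp add: free_twist_sum free_twist_single sum_distrib_left single_0_mult_mult del: free_lie.simps)
  then show ?case using J(3)[OF loc[OF locality]] by simp
qed (simp_all add: J free_twist_add free_twist_scale)

lemma lie_twist_id: "lie_twist Q (\<lambda>i. 0) u = u"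
  by (induction u rule: poly_mapping_additive_induct) (simp_all add: lie_twist_add)

lemma free_env_in_ideal:
  assumes J: "0 \<in> J" "\<And>u v. u \<in> J \<Longrightarrow> v \<in> J \<Longrightarrow> u + v \<in> J"
      "\<And>u x. u \<in> J \<Longrightarrow> x * u \<in> J" "\<And>u x. u \<in> J \<Longrightarrow> u * x \<in> J"
    and loc: "\<And>N i j m n. N = nat (max (locN Q i j) 0) \<Longrightarrow>
      (\<Sum>k\<le>N. Poly_Mapping.single 0 ((-1) ^ k * of_nat (N choose k)) *
        free_lie Q (Brk (Mode i (m - int k)) (Mode j (n + int k)))) \<in> J"
    and u: "u \<in> env_ideal Q"
  shows "free_env Q u \<in> J"
  using u
proof (induction rule: env_ideal.induct)
  case (lie r)
  show ?case
    using free_twist_in_ideal[OF J loc lie, of "\<lambda>i. 0"] by (simp add: free_twist_def lie_twist_id)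
next
  case (commutator a b)
  have "free_env Q (mono_word [a, b] - Poly_Mapping.single (Word [b, a]) (braid Q (lie_deg a) (lie_deg b))
       - mono_word [Brk a b]) = 0"
    by (simp add: free_env_diff free_env_single mult.assoc)
  then show ?case using J(1) by simp
qed (simp_all add: J free_env_add free_env_mult)

end

section \<open>Functionals from symmetric families\<close>

text \<open>The values of \<open>lie_colour\<close> and \<open>lie_mode\<close> on brackets are
  fillers; they are read only where \<open>is_mode\<close> holds.\<close>

primrec lie_colour :: "'i lie_word \<Rightarrow> 'i" where
  "lie_colour (Mode i n) = i"
| "lie_colour (Brk a b) = lie_colour a"

primrec lie_mode :: "'i lie_word \<Rightarrow> int" where
  "lie_mode (Mode i n) = n"
| "lie_mode (Brk a b) = 0"

primrec is_mode :: "'i lie_word \<Rightarrow> bool" where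
  "is_mode (Mode i n) = True"
| "is_mode (Brk a b) = False"

lemma is_mode_eq: "is_mode a \<Longrightarrow> a = Mode (lie_colour a) (lie_mode a)"
  by (cases a) simp_all

lemma mode_words_eq:
  assumes "\<forall>a\<in>set xs. is_mode a"
  shows "xs = mode_word (length xs) (\<lambda>t. lie_colour (xs ! t)) (\<lambda>t. - lie_mode (xs ! t) - 1)"
  unfolding mode_word_def using assms by (intro nth_equalityI) (auto intro: is_mode_eq)

lemma mono_word_prod_list: "prod_list (map (\<lambda>a. mono_word [a]) xs) = mono_word xs"
  by (induction xs) (simp_all add: mono_word_mult flip: zero_word_def)

text \<open>An abstract candidate for the series F of a functional, with the properties established
  for \<open>F_series\<close>: symmetry, non-negative exponents, and dependence on the first p
  positions only.\<close>

locale equivariant_family = quiver Q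
  for Q :: "('i::{finite,linorder}, 'a) pre_digraph" +
  fixes G :: "nat \<Rightarrow> (nat \<Rightarrow> 'i) \<Rightarrow> (nat \<Rightarrow> int) \<Rightarrow> rat"
  assumes G_swap: "Suc t < p \<Longrightarrow>
      G p (cs \<circ> Transposition.transpose t (Suc t)) (b \<circ> Transposition.transpose t (Suc t)) = G p cs b"
    and G_nonneg: "t < p \<Longrightarrow> G p cs b \<noteq> 0 \<Longrightarrow> 0 \<le> b t"
    and G_cong: "(\<And>t. t < p \<Longrightarrow> cs t = cs' t) \<Longrightarrow> (\<And>t. t < p \<Longrightarrow> b t = b' t) \<Longrightarrow> G p cs b = G p cs' b'"
begin

definition mode_corr :: "nat \<Rightarrow> (nat \<Rightarrow> 'i) \<Rightarrow> (nat \<Rightarrow> int) \<Rightarrow> rat" where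
  "mode_corr p cs = zpows (pairs p) (\<lambda>k l. - locN Q (cs k) (cs l)) (G p cs)"

text \<open>The value 0 on words with a bracket is a default. \<open>functional\<close> evaluates
  only after \<open>free_env\<close>, which leaves words in modes.\<close>

definition mode_val :: "'i lie_word list \<Rightarrow> rat" where
  "mode_val xs = (if \<forall>a\<in>set xs. is_mode a
     then mode_corr (length xs) (\<lambda>t. lie_colour (xs ! t)) (\<lambda>t. - lie_mode (xs ! t) - 1) else 0)"

definition tensor_val :: "'i tensor_alg \<Rightarrow> rat" where
  "tensor_val u = (\<Sum>w\<in>Poly_Mapping.keys u. Poly_Mapping.lookup u w * mode_val (letters w))"

definition functional :: "'i tensor_alg \<Rightarrow> rat" where
  "functional u = tensor_val (free_env Q u)"

lemma tail_bounded_G: "tail_bounded u p (G p cs)"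
  by (rule tail_boundedI[where C=0]) (auto intro!: sum_nonneg dest: G_nonneg)

lemma mode_corr_cong:
  assumes "\<And>t. t < p \<Longrightarrow> cs t = cs' t" "\<And>t. t < p \<Longrightarrow> b t = b' t"
  shows "mode_corr p cs b = mode_corr p cs' b'"
proof -
  have "mode_corr p cs b = zpows (pairs p) (\<lambda>k l. - locN Q (cs' k) (cs' l)) (G p cs) b"
    unfolding mode_corr_def by (rule fun_cong[OF zpows_cong]) (use assms(1) in auto)
  also have "\<dots> = mode_corr p cs' b'"
    unfolding mode_corr_def
  proof (rule zpows_cong_below[OF order_refl])
    fix b b' :: "nat \<Rightarrow> int" assume "\<And>t. t < p \<Longrightarrow> b t = b' t"
    with assms(1) show "G p cs b = G p cs' b'" by (rule G_cong)
  qed (rule assms(2))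
  finally show ?thesis .
qed

lemma mode_val_mode_word: "mode_val (mode_word p cs b) = mode_corr p cs b"
proof -
  have "mode_val (mode_word p cs b) = mode_corr (length (mode_word p cs b)) (\<lambda>t. lie_colour (mode_word p cs b ! t))
      (\<lambda>t. - lie_mode (mode_word p cs b ! t) - 1)"
    by (simp add: mode_val_def mode_word_def)
  also have "\<dots> = mode_corr p cs b"
    unfolding mode_word_def length_map length_upt diff_zero by (rule mode_corr_cong) simp_all
  finally show ?thesis .
qed

lemma tensor_val_add: "tensor_val (u + v) = tensor_val u + tensor_val v"
  unfolding tensor_val_def by (rule sum_keys_add) (simp_all add: distrib_right)

lemma tensor_val_single: "tensor_val (Poly_Mapping.single w c) = c * mode_val (letters w)"
  unfolding tensor_val_def by (rule sum_keys_single) simp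

lemma tensor_val_zero [simp]: "tensor_val 0 = 0"
  by (simp add: tensor_val_def)

lemma tensor_val_uminus: "tensor_val (- u) = - tensor_val u"
  using tensor_val_add[of u "- u"] by simp

lemma tensor_val_diff: "tensor_val (u - v) = tensor_val u - tensor_val v"
  using tensor_val_add[of u "- v"] by (simp add: tensor_val_uminus)

lemma tensor_val_sum: "tensor_val (\<Sum>k\<in>K. u k) = (\<Sum>k\<in>K. tensor_val (u k))"
  by (induction K rule: infinite_finite_induct) (simp_all add: tensor_val_add)

lemma corr_tensor_val: "corr tensor_val p cs = mode_corr p cs"
  by (rule ext) (simp add: corr_def tensor_val_single mode_val_mode_word)

text \<open>\<open>zpow_corr_swap\<close> read backwards. After multiplication by the power n =
  max(N, 0) the pair (t, t+1) carries (z_t - z_(t+1))^(n-N) times the symmetric family: symmetric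
  for N \<ge> 0, antisymmetric for N = -1. The sign \<open>r\<close> records which.\<close>

lemma mode_corr_locality:
  fixes cs :: "nat \<Rightarrow> 'i"
  assumes t: "Suc t < p"
  defines "s \<equiv> Transposition.transpose t (Suc t)" and "n \<equiv> nat (max (locN Q (cs t) (cs (Suc t))) 0)"
  shows "zpow t (Suc t) (int n) (mode_corr p cs) b =
    braid Q (basis_vec (cs t)) (basis_vec (cs (Suc t))) * (-1) ^ n * zpow t (Suc t) (int n) (mode_corr p (cs \<circ> s)) (b \<circ> s)"
proof -
  interpret position_pair 1 p t "Suc t" by standard (use t in auto)
  define N where "N = locN Q (cs t) (cs (Suc t))"
  \<comment> \<open>The exponent left at the pair (t, t+1): n from the locality factor, -N from
    \<open>mode_corr\<close>.\<close>
  define e where "e = int n - N"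
  define r where "r = braid Q (basis_vec (cs t)) (basis_vec (cs (Suc t))) * (-1) ^ n"
  define H where "H = (\<lambda>cs. zpow t (Suc t) e (G p cs))"
  let ?A = "pairs p - {(t, Suc t)}"
  have A: "?A \<subseteq> pairs p" by auto
  have corr_H: "zpow t (Suc t) (int n) (mode_corr p cs') = zpows ?A (\<lambda>k l. - locN Q (cs' k) (cs' l)) (H cs')"
    if "locN Q (cs' t) (cs' (Suc t)) = N" for cs'
    unfolding mode_corr_def zpows_pairs_adjacent[OF t tail_bounded_G] that H_def
    by (subst zpow_zpows[OF A tail_bounded_zpow[OF tail_bounded_G] order_refl lessI t])
      (simp add: zpow_zpow[OF tail_bounded_G] e_def)
  have "e = 0 \<and> r = 1 \<or> e = 1 \<and> r = -1"
  proof (cases "0 \<le> N")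
    case True
    then have "N = int n" by (simp add: n_def N_def)
    then have "e = 0" "r = (-1) ^ n * (-1) ^ n" by (simp_all add: e_def r_def braid_basis flip: N_def)
    then show ?thesis by (simp flip: power_mult_distrib)
  next
    case False
    then have "N = -1" using locN_ge[of "cs t" "cs (Suc t)"] by (simp add: N_def)
    then have "n = 0" "e = 1" by (simp_all add: n_def e_def flip: N_def)
    then show ?thesis using \<open>N = -1\<close> by (simp add: r_def braid_basis flip: N_def)
  qed
  then have H: "H (cs \<circ> s) (b \<circ> s) = r * H cs b" for b
  proof (elim disjE conjE)
    assume "e = 1" "r = -1"
    have s1: "(\<lambda>x. (b \<circ> s) x - (if x = t then 1 else 0)) = (\<lambda>x. b x - (if x = Suc t then 1 else 0)) \<circ> s"
      and s2: "(\<lambda>x. (b \<circ> s) x - (if x = Suc t then 1 else 0)) = (\<lambda>x. b x - (if x = t then 1 else 0)) \<circ> s"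
      by (auto simp: fun_eq_iff s_def Transposition.transpose_def)
    show ?thesis
      unfolding H_def \<open>e = 1\<close> \<open>r = -1\<close> zpow_1[OF tail_bounded_G] zdiff_def s1 s2
      unfolding s_def G_swap[OF t] by simp
  qed (simp add: H_def s_def G_swap[OF t])
  have bdd: "tail_bounded 1 p (H cs')" for cs'
    unfolding H_def by (rule tail_bounded_zpow[OF tail_bounded_G])
  have "zpow t (Suc t) (int n) (mode_corr p (cs \<circ> s)) (b \<circ> s) =
      zpows ?A (\<lambda>k l. - locN Q (cs (s k)) (cs (s l))) (H (cs \<circ> s)) (b \<circ> s)"
    by (subst corr_H) (simp_all add: s_def N_def locN_commute)
  also have "\<dots> = r * zpows ?A (\<lambda>k l. - locN Q (cs k) (cs l)) (H cs) b"
    by (rule zpows_swap[OF t, folded s_def, OF H bdd bdd])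
  also have "zpows ?A (\<lambda>k l. - locN Q (cs k) (cs l)) (H cs) b = zpow t (Suc t) (int n) (mode_corr p cs) b"
    by (subst corr_H) (simp_all add: N_def)
  finally have eq: "zpow t (Suc t) (int n) (mode_corr p (cs \<circ> s)) (b \<circ> s) =
      r * zpow t (Suc t) (int n) (mode_corr p cs) b" .
  have rr: "r * r = 1" using \<open>e = 0 \<and> r = 1 \<or> e = 1 \<and> r = -1\<close> by auto
  show ?thesis unfolding r_def[symmetric] eq mult.assoc[symmetric] rr by simp
qed

text \<open>A word with a bracket in the context makes both sides 0. Otherwise the two sums are the
  two sides of \<open>mode_corr_locality\<close>, written as values on words.\<close>

lemma tensor_val_locality:
  assumes N: "N = nat (max (locN Q i j) 0)"
  shows "(\<Sum>k\<le>N. (-1) ^ k * of_nat (N choose k) *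
      mode_val (xs @ [Mode i (m - int k), Mode j (n + int k)] @ ys)) =
    braid Q (basis_vec i) (basis_vec j) * (\<Sum>k\<le>N. (-1) ^ k * of_nat (N choose k) *
      mode_val (xs @ [Mode j (n + int k), Mode i (m - int k)] @ ys))"
proof (cases "\<forall>a\<in>set xs \<union> set ys. is_mode a")
  case False
  then have "mode_val (xs @ zs @ ys) = 0" for zs by (auto simp: mode_val_def)
  then show ?thesis by (simp only: mult_zero_right sum.neutral_const)
next
  case True
  define t p where "t = length xs" and "p = length xs + 2 + length ys"
  define W where "W = xs @ [Mode i m, Mode j n] @ ys"
  define cs where "cs = (\<lambda>s. lie_colour (W ! s))"
  \<comment> \<open>At position t the exponent solves N - b t - 1 = m, so that
    \<open>zpow_corr_nat\<close> produces the modes m - k; elsewhere it is read off from the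
    letter.\<close>
  define b where "b = (\<lambda>s. if s = t then int N - 1 - m else - lie_mode (W ! s) - 1)"
  have t: "Suc t < p" by (simp add: t_def p_def)
  have at: "cs t = i" "cs (Suc t) = j" "b t = int N - 1 - m" "b (Suc t) = - n - 1"
    by (simp_all add: cs_def b_def W_def t_def nth_append)
  have xs: "map (\<lambda>s. Mode (cs s) (- b s - 1)) [0..<t] = xs"
    using True by (intro nth_equalityI) (auto simp: t_def cs_def b_def W_def nth_append is_mode_eq[symmetric])
  have ys: "map (\<lambda>s. Mode (cs s) (- b s - 1)) [Suc (Suc t)..<p] = ys"
  proof (rule nth_equalityI)
    fix r assume "r < length (map (\<lambda>s. Mode (cs s) (- b s - 1)) [Suc (Suc t)..<p])"
    then have r: "r < length ys" "[Suc (Suc t)..<p] ! r = Suc (Suc t) + r" by (simp_all add: p_def t_def del: upt_Suc)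
    have W: "W ! (Suc (Suc t) + r) = ys ! r" by (simp add: W_def t_def nth_append)
    have "is_mode (ys ! r)" using True r by simp
    then show "map (\<lambda>s. Mode (cs s) (- b s - 1)) [Suc (Suc t)..<p] ! r = ys ! r"
      using is_mode_eq[of "ys ! r"] r W by (simp add: cs_def b_def p_def t_def del: upt_Suc)
  qed (simp add: p_def t_def del: upt_Suc)
  have tv: "tensor_val (mono_word w) = mode_val w" for w by (simp add: tensor_val_single)
  note z = zpow_corr_nat[OF t, of N tensor_val cs b, unfolded xs ys at tv corr_tensor_val]
  have m: "int N - (int N - 1 - m) - 1 = m" "- (- n - 1) - 1 = n" by simp_all
  let ?S = "\<Sum>k\<le>N. (-1) ^ k * of_nat (N choose k) * mode_val (xs @ [Mode j (n + int k), Mode i (m - int k)] @ ys)"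
  have "(\<Sum>k\<le>N. (-1) ^ k * of_nat (N choose k) * mode_val (xs @ [Mode i (m - int k), Mode j (n + int k)] @ ys)) =
    braid Q (basis_vec i) (basis_vec j) * (-1) ^ N * ((-1) ^ N * ?S)"
    using mode_corr_locality[OF t, of cs b] unfolding at N[symmetric] z m by simp
  also have "\<dots> = braid Q (basis_vec i) (basis_vec j) * ((-1) ^ N * (-1) ^ N) * ?S"
    by (simp only: mult.assoc)
  also have "(-1 :: rat) ^ N * (-1) ^ N = 1" by (simp flip: power_mult_distrib)
  finally show ?thesis by simp
qed

lemma tensor_val_env_ideal:
  assumes "u \<in> env_ideal Q"
  shows "tensor_val (x * free_env Q u * y) = 0"
proof -
  \<comment> \<open>The largest two-sided ideal inside the kernel of
    \<open>tensor_val\<close>.\<close>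
  let ?J = "{v. \<forall>x y. tensor_val (x * v * y) = 0}"
  have "free_env Q u \<in> ?J"
    using _ _ _ _ _ assms
  proof (rule free_env_in_ideal)
    fix N i j m n assume N: "N = nat (max (locN Q i j) 0)"
    let ?c = "\<lambda>k. (-1) ^ k * of_nat (N choose k) :: rat" and ?\<beta> = "braid Q (basis_vec i) (basis_vec j)"
    let ?a = "\<lambda>k. Mode i (m - int k)" and ?b = "\<lambda>k. Mode j (n + int k)"
    define L where "L = (\<Sum>k\<le>N. Poly_Mapping.single 0 (?c k) * free_lie Q (Brk (?a k) (?b k)))"
    have L: "L = (\<Sum>k\<le>N. Poly_Mapping.single (Word [?a k, ?b k]) (?c k) - Poly_Mapping.single (Word [?b k, ?a k]) (?c k * ?\<beta>))"
      unfolding L_def by (simp add: single_word_mult right_diff_distrib single_zero_mult)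
    have "tensor_val (Poly_Mapping.single (Word xs) c * L * Poly_Mapping.single (Word ys) d) = 0" for xs c ys d
    proof -
      have "Poly_Mapping.single (Word xs) c * L * Poly_Mapping.single (Word ys) d = (\<Sum>k\<le>N.
          Poly_Mapping.single (Word (xs @ [?a k, ?b k] @ ys)) (c * ?c k * d)
          - Poly_Mapping.single (Word (xs @ [?b k, ?a k] @ ys)) (c * (?c k * ?\<beta>) * d))"
        unfolding L by (simp add: sum_distrib_left sum_distrib_right right_diff_distrib left_diff_distrib single_word_mult)
      then have "tensor_val (Poly_Mapping.single (Word xs) c * L * Poly_Mapping.single (Word ys) d) =
        c * d * ((\<Sum>k\<le>N. ?c k * mode_val (xs @ [?a k, ?b k] @ ys)) - ?\<beta> * (\<Sum>k\<le>N. ?c k * mode_val (xs @ [?b k, ?a k] @ ys)))"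
        unfolding right_diff_distrib sum_distrib_left by (simp add: tensor_val_sum tensor_val_diff tensor_val_single sum_subtractf ac_simps)
      then show ?thesis using tensor_val_locality[OF N, of xs m n ys] by simp
    qed
    then have s: "tensor_val (Poly_Mapping.single w c * L * Poly_Mapping.single w' d) = 0" for w c w' d
      by (metis word.collapse)
    have "tensor_val (x * L * y) = 0" for x y
    proof (induction x rule: poly_mapping_additive_induct)
      case (single w c)
      show ?case by (induction y rule: poly_mapping_additive_induct) (simp_all add: s distrib_left tensor_val_add)
    qed (simp add: distrib_right tensor_val_add)
    then show "L \<in> ?J" by simp
  next
    fix u x assume "u \<in> ?J"
    then have *: "tensor_val (y * u * z) = 0" for y z by simp
    show "x * u \<in> ?J" using *[of "_ * x"] by (simp add: mult.assoc)
    show "u * x \<in> ?J" using *[of _ "x * _"] by (simp add: mult.assoc)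
  qed (simp_all add: distrib_left distrib_right tensor_val_add)
  then show ?thesis by simp
qed

lemma vac_functional_functional: "vac_functional Q functional"
  unfolding vac_functional_def
proof (intro conjI allI ballI)
  show "functional (u + v) = functional u + functional v" for u v
    by (simp add: functional_def free_env_add tensor_val_add)
  show "functional (Poly_Mapping.map ((*) c) u) = c * functional u" for c u
  proof -
    have "tensor_val (Poly_Mapping.single 0 c * v) = c * tensor_val v" for v
      by (induction v rule: poly_mapping_additive_induct)
        (simp_all add: distrib_left tensor_val_add mult_single tensor_val_single)
    moreover have "free_env Q (Poly_Mapping.single 0 c) = Poly_Mapping.single 0 c"
      by (simp add: free_env_single zero_word_def)
    ultimately show ?thesis
      by (simp add: functional_def mult_map_scale_conv_mult free_env_mult)
  qed
  fix u assume "u \<in> vac_ideal Q"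
  then show "functional u = 0"
  proof (induction rule: vac_ideal.induct)
    case (env u)
    then show ?case using tensor_val_env_ideal[OF env, of 1 1] by (simp add: functional_def)
  next
    case (annihilate n x i)
    have "tensor_val (y * mono_word [Mode i n]) = 0" for y
    proof (induction y rule: poly_mapping_additive_induct)
      case (single w c)
      \<comment> \<open>The last letter n \<ge> 0 stands for the exponent -n - 1 < 0, whereas
        inverse powers of differences keep the last exponent of the family non-negative.\<close>
      have "mode_val (letters w @ [Mode i n]) = 0"
      proof (rule ccontr)
        let ?w = "letters w @ [Mode i n]"
        assume nz: "mode_val ?w \<noteq> 0"
        then have "mode_corr (length ?w) (\<lambda>t. lie_colour (?w ! t)) (\<lambda>t. - lie_mode (?w ! t) - 1) \<noteq> 0"
          by (auto simp: mode_val_def split: if_splits)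
        then have "0 \<le> - lie_mode (?w ! (length ?w - 1)) - 1"
          unfolding mode_corr_def by (rule zpows_last_nonneg[OF order_refl]) (auto intro: G_nonneg)
        then show False using annihilate by simp
      qed
      then show ?case by (simp add: mult_single plus_word_def tensor_val_single)
    qed (simp add: distrib_right tensor_val_add)
    then show ?case by (simp add: functional_def free_env_mult free_env_single)
  qed (simp add: functional_def free_env_add tensor_val_add)
qed

lemma corr_functional: "corr functional p cs = mode_corr p cs"
proof -
  have *: "map (free_lie Q) (mode_word p cs b) = map (\<lambda>a. mono_word [a]) (mode_word p cs b)" for b
    by (simp add: mode_word_def)
  have "free_env Q (mono_word (mode_word p cs b)) = mono_word (mode_word p cs b)" for b
    unfolding free_env_single word.sel * mono_word_prod_list by simp
  then show ?thesis
    by (simp add: fun_eq_iff corr_def functional_def tensor_val_single mode_val_mode_word)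
qed

lemma F_series_functional: "F_series Q functional p cs = G p cs"
  unfolding F_series_def corr_functional mode_corr_def
  by (rule zpows_inverse(1)[OF order_refl tail_bounded_G order_refl])

end

context quiver
begin

text \<open>Words in modes span each degree and weight: a commutator relation trades the letter
  \<open>Brk y z\<close> for yz and zy, which have the same degree and weight and smaller total
  size.\<close>

lemma vac_functional_determined:
  assumes phi: "vac_functional Q \<phi>"
    and modes: "\<And>p cs b. word_deg (Word (mode_word p cs b)) = word_deg w \<Longrightarrow>
      word_weight Q (Word (mode_word p cs b)) = word_weight Q w \<Longrightarrow> corr \<phi> p cs b = 0"
  shows "\<phi> (Poly_Mapping.single w c) = 0"
proof -
  have "\<phi> (mono_word xs) = 0"
    if "word_deg (Word xs) = word_deg w" "word_weight Q (Word xs) = word_weight Q w" for xs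
    using that
  proof (induction "sum_list (map size xs)" arbitrary: xs rule: less_induct)
    case less
    show ?case
    proof (cases "\<forall>a\<in>set xs. is_mode a")
      case True
      then show ?thesis using mode_words_eq[OF True] modes less.prems unfolding corr_def by metis
    next
      case False
      then obtain a where a: "a \<in> set xs" "\<not> is_mode a" by blast
      from a(2) obtain y z where "a = Brk y z" by (cases a) simp_all
      with a obtain x1 x2 where xs: "xs = x1 @ [Brk y z] @ x2"
        by (auto dest: split_list)
      let ?\<beta> = "braid Q (lie_deg y) (lie_deg z)"
      have "mono_word x1 * (mono_word [y, z] - Poly_Mapping.single (Word [z, y]) ?\<beta> - mono_word [Brk y z]) * mono_word x2 \<in> vac_ideal Q"
        by (intro vac_ideal.env env_ideal.left env_ideal.right env_ideal.commutator)
      then have "mono_word (x1 @ [y, z] @ x2) - Poly_Mapping.single (Word (x1 @ [z, y] @ x2)) ?\<beta> - mono_word xs \<in> vac_ideal Q"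
        by (simp add: xs right_diff_distrib left_diff_distrib single_word_mult)
      then have "\<phi> (mono_word xs) = \<phi> (mono_word (x1 @ [y, z] @ x2)) - ?\<beta> * \<phi> (mono_word (x1 @ [z, y] @ x2))"
        using vac_functional_0[OF phi] vac_functional_diff[OF phi]
          vac_functional_single[OF phi, of "Word (x1 @ [z, y] @ x2)" ?\<beta>] by force
      moreover have "\<phi> (mono_word (x1 @ [y, z] @ x2)) = 0"
        by (rule less.hyps) (use less.prems in \<open>auto simp: xs word_deg_def word_weight_def fun_eq_iff algebra_simps\<close>)
      moreover have "\<phi> (mono_word (x1 @ [z, y] @ x2)) = 0"
        by (rule less.hyps) (use less.prems in \<open>auto simp: xs word_deg_def word_weight_def fun_eq_iff algebra_simps\<close>)
      ultimately show ?thesis by simp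
    qed
  qed
  from this[of "letters w"] show ?thesis
    using vac_functional_single[OF phi, of w c] by simp
qed

end

section \<open>Symmetric polynomials as coefficient functions\<close>

definition var_set :: "('i \<Rightarrow> nat) \<Rightarrow> ('i \<times> nat) set" where
  "var_set d = {(i, k). 1 \<le> k \<and> k \<le> d i}"

lemma var_set_iff [simp]: "(i, k) \<in> var_set d \<longleftrightarrow> 1 \<le> k \<and> k \<le> d i"
  by (simp add: var_set_def)

lemma var_set_Sigma: "var_set d = Sigma UNIV (\<lambda>i. {1..d i})"
  by auto

lemma xpolys_iff: "f \<in> xpolys d \<longleftrightarrow> (\<forall>m\<in>Poly_Mapping.keys f. Poly_Mapping.keys m \<subseteq> var_set d)"
  by (simp add: xpolys_def var_set_def)

lemma finite_var_set [simp]: "finite (var_set (d :: 'i::finite \<Rightarrow> nat))"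
  by (simp add: var_set_Sigma)

text \<open>The concatenation is increasing in the lexicographic order. Positions can then be
  handled through order and uniqueness of increasing enumerations rather than by index
  arithmetic.\<close>

lemma xvars_eq: "xvars d = sorted_list_of_set (var_set d)"
proof -
  have "sorted_wrt (<) (concat (map (\<lambda>j. map (Pair j) [1..<d j + 1]) js))" if "sorted_wrt (<) js" for js
    using that
  proof (induction js)
    case (Cons j js)
    have "sorted_wrt (<) (map (Pair j) [1..<d j + 1])"
      by (simp add: sorted_wrt_map less_prod_simp del: upt_Suc)
    then show ?case using Cons
      by (auto simp: sorted_wrt_append less_prod_simp simp del: upt_Suc)
  qed simp
  from this[of "sorted_list_of_set UNIV"] have "sorted_wrt (<) (xvars d)"
    by (simp add: xvars_def)
  moreover have "set (xvars d) = var_set d"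
    by (auto simp: xvars_def image_iff simp del: upt_Suc)
  ultimately show ?thesis
    by (metis sorted_list_of_set.idem_if_sorted_distinct strict_sorted_iff)
qed

lemma set_xvars [simp]: "set (xvars d) = var_set d"
  and distinct_xvars [simp]: "distinct (xvars d)"
  and length_xvars: "length (xvars d) = card (var_set d)"
  by (simp_all add: xvars_eq)

lemma card_var_set: "card (var_set d) = (\<Sum>i\<in>UNIV. d (i :: 'i::finite))"
  by (simp add: var_set_Sigma)

lemma bij_xvars: "bij_betw ((!) (xvars d)) {..<length (xvars d)} (var_set d)"
  by (rule bij_betw_nth) simp_all

definition exps_mon :: "('i::{finite,linorder} \<Rightarrow> nat) \<Rightarrow> (nat \<Rightarrow> int) \<Rightarrow> ('i \<times> nat \<Rightarrow>\<^sub>0 nat)" where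
  "exps_mon d a = (\<Sum>t<length (xvars d). Poly_Mapping.single (xvars d ! t) (nat (a t)))"

definition mon_exps :: "('i::{finite,linorder} \<Rightarrow> nat) \<Rightarrow> ('i \<times> nat \<Rightarrow>\<^sub>0 nat) \<Rightarrow> nat \<Rightarrow> int" where
  "mon_exps d m t = int (Poly_Mapping.lookup m (xvars d ! t))"

lemma laurent_coeff_eq:
  "laurent_coeff d f a = (if \<forall>t<length (xvars d). 0 \<le> a t then Poly_Mapping.lookup f (exps_mon d a) else 0)"
  unfolding laurent_coeff_def exps_mon_def ..

lemma lookup_exps_mon:
  assumes "t < length (xvars d)"
  shows "Poly_Mapping.lookup (exps_mon d a) (xvars d ! t) = nat (a t)"
proof -
  have "Poly_Mapping.lookup (exps_mon d a) (xvars d ! t) = (\<Sum>s<length (xvars d). if s = t then nat (a t) else 0)"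
    unfolding exps_mon_def lookup_sum
    by (rule sum.cong) (use assms in \<open>auto simp: lookup_single when_def nth_eq_iff_index_eq\<close>)
  then show ?thesis using assms by simp
qed

lemma keys_exps_mon: "Poly_Mapping.keys (exps_mon d a) \<subseteq> var_set d"
proof -
  have "Poly_Mapping.keys (exps_mon d a) \<subseteq> (\<Union>t<length (xvars d). Poly_Mapping.keys (Poly_Mapping.single (xvars d ! t) (nat (a t))))"
    unfolding exps_mon_def by (rule keys_sum)
  also have "\<dots> \<subseteq> var_set d"
    using nth_mem[of _ "xvars d"] by (auto split: if_splits)
  finally show ?thesis .
qed

lemma lookup_exps_mon_0: "v \<notin> var_set d \<Longrightarrow> Poly_Mapping.lookup (exps_mon d a) v = 0"
  using keys_exps_mon by (metis in_keys_iff subsetD)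

lemma exps_mon_mon_exps:
  assumes "Poly_Mapping.keys m \<subseteq> var_set d"
  shows "exps_mon d (mon_exps d m) = m"
proof (rule poly_mapping_eqI)
  fix v
  show "Poly_Mapping.lookup (exps_mon d (mon_exps d m)) v = Poly_Mapping.lookup m v"
  proof (cases "v \<in> var_set d")
    case True
    then obtain t where "t < length (xvars d)" "v = xvars d ! t"
      unfolding set_xvars[symmetric] in_set_conv_nth by blast
    then show ?thesis by (simp add: lookup_exps_mon mon_exps_def)
  next
    case False
    then have "v \<notin> Poly_Mapping.keys m" using assms by blast
    then show ?thesis using False by (simp add: lookup_exps_mon_0 in_keys_iff)
  qed
qed

lemma exps_mon_cong: "(\<And>t. t < length (xvars d) \<Longrightarrow> a t = b t) \<Longrightarrow> exps_mon d a = exps_mon d b"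
  by (simp add: exps_mon_def)

lemma mon_exps_exps_mon:
  "t < length (xvars d) \<Longrightarrow> 0 \<le> a t \<Longrightarrow> mon_exps d (exps_mon d a) t = a t"
  by (simp add: mon_exps_def lookup_exps_mon)

lemma laurent_coeff_mon_exps:
  "Poly_Mapping.keys m \<subseteq> var_set d \<Longrightarrow> laurent_coeff d f (mon_exps d m) = Poly_Mapping.lookup f m"
  by (simp add: laurent_coeff_eq exps_mon_mon_exps) (simp add: mon_exps_def)

lemma laurent_coeff_cong:
  "(\<And>t. t < length (xvars d) \<Longrightarrow> a t = b t) \<Longrightarrow> laurent_coeff d f a = laurent_coeff d f b"
  using exps_mon_cong[of d a b] by (auto simp: laurent_coeff_eq)

lemma laurent_coeff_inject:
  assumes "f \<in> xpolys d" "g \<in> xpolys d" "laurent_coeff d f = laurent_coeff d g"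
  shows "f = g"
proof (rule poly_mapping_eqI)
  fix m
  show "Poly_Mapping.lookup f m = Poly_Mapping.lookup g m"
  proof (cases "Poly_Mapping.keys m \<subseteq> var_set d")
    case True
    then show ?thesis using laurent_coeff_mon_exps[of m d] assms(3) by metis
  next
    case False
    then have "m \<notin> Poly_Mapping.keys f" "m \<notin> Poly_Mapping.keys g"
      using assms(1,2) unfolding xpolys_def var_set_def by auto
    then show ?thesis by (simp add: in_keys_iff)
  qed
qed

lemma laurent_coeff_add: "laurent_coeff d (f + g) a = laurent_coeff d f a + laurent_coeff d g a"
  by (auto simp: laurent_coeff_eq lookup_add)

lemma laurent_coeff_zero [simp]: "laurent_coeff d 0 a = 0"
  by (simp add: laurent_coeff_eq)

lemma laurent_coeff_sum: "laurent_coeff d (\<Sum>k\<in>K. f k) a = (\<Sum>k\<in>K. laurent_coeff d (f k) a)"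
  by (induction K rule: infinite_finite_induct) (simp_all add: laurent_coeff_add)

lemma laurent_coeff_scale: "laurent_coeff d (Poly_Mapping.single 0 c * f) a = c * laurent_coeff d f a"
proof -
  have "Poly_Mapping.lookup (Poly_Mapping.single 0 c * f) m = c * Poly_Mapping.lookup f m" for m
    by (simp add: mult_map_scale_conv_mult[symmetric] Poly_Mapping.map.rep_eq when_def)
  then show ?thesis by (auto simp: laurent_coeff_eq)
qed

text \<open>Non-negative exponents with bounded sum leave finitely many monomials. The congruence
  condition is there because exponents are functions on all of nat.\<close>

lemma laurent_coeff_surj:
  assumes nonneg: "\<And>a t. F a \<noteq> 0 \<Longrightarrow> t < length (xvars d) \<Longrightarrow> 0 \<le> a t"
    and cong: "\<And>a b. (\<And>t. t < length (xvars d) \<Longrightarrow> a t = b t) \<Longrightarrow> F a = F b"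
    and bound: "\<And>a. F a \<noteq> 0 \<Longrightarrow> (\<Sum>t<length (xvars d). a t) \<le> D"
  obtains f where "f \<in> xpolys d" "laurent_coeff d f = F"
proof -
  let ?p = "length (xvars d)"
  define g where "g m = (if Poly_Mapping.keys m \<subseteq> var_set d then F (mon_exps d m) else 0)" for m
  have "finite {m. g m \<noteq> 0}"
  proof (rule finite_subset)
    let ?E = "{a. \<forall>t. (t \<in> {..<?p} \<longrightarrow> a t \<in> {0..D}) \<and> (t \<notin> {..<?p} \<longrightarrow> a t = 0)}"
    show "finite (exps_mon d ` ?E)"
      by (intro finite_imageI finite_set_of_finite_funs) simp_all
    show "{m. g m \<noteq> 0} \<subseteq> exps_mon d ` ?E"
    proof
      fix m assume "m \<in> {m. g m \<noteq> 0}"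
      then have m: "Poly_Mapping.keys m \<subseteq> var_set d" "F (mon_exps d m) \<noteq> 0"
        by (auto simp: g_def split: if_splits)
      \<comment> \<open>Beyond the end of \<open>xvars d\<close> the values of
        \<open>mon_exps\<close> are unspecified; cutting them to 0 brings the exponent into the
        finite set \<open>?E\<close>.\<close>
      define a where "a = (\<lambda>t. if t < ?p then mon_exps d m t else 0)"
      have "exps_mon d a = exps_mon d (mon_exps d m)"
        by (rule exps_mon_cong) (simp add: a_def)
      also have "\<dots> = m" by (rule exps_mon_mon_exps[OF m(1)])
      finally have "m = exps_mon d a" ..
      moreover have "a \<in> ?E"
      proof -
        have "mon_exps d m t \<le> D" if "t < ?p" for t
        proof -
          have "mon_exps d m t \<le> (\<Sum>t<?p. mon_exps d m t)"
            by (rule member_le_sum) (use that in \<open>auto simp: mon_exps_def\<close>)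
          then show ?thesis using bound[OF m(2)] by simp
        qed
        then show ?thesis by (auto simp: a_def mon_exps_def)
      qed
      ultimately show "m \<in> exps_mon d ` ?E" by blast
    qed
  qed
  then have lookup: "Poly_Mapping.lookup (Abs_poly_mapping g) = g"
    by (rule lookup_Abs_poly_mapping)
  show thesis
  proof (rule that)
    show "Abs_poly_mapping g \<in> xpolys d"
      unfolding xpolys_iff
    proof
      fix m assume "m \<in> Poly_Mapping.keys (Abs_poly_mapping g)"
      then have "g m \<noteq> 0" by (simp add: in_keys_iff lookup)
      then show "Poly_Mapping.keys m \<subseteq> var_set d" by (metis g_def)
    qed
    show "laurent_coeff d (Abs_poly_mapping g) = F"
    proof
      fix a
      show "laurent_coeff d (Abs_poly_mapping g) a = F a"
      proof (cases "\<forall>t<?p. 0 \<le> a t")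
        case True
        have "F (mon_exps d (exps_mon d a)) = F a"
          by (rule cong) (use True in \<open>simp add: mon_exps_exps_mon\<close>)
        then show ?thesis using True by (simp add: laurent_coeff_eq lookup g_def keys_exps_mon)
      next
        case False
        then show ?thesis using nonneg by (auto simp: laurent_coeff_eq)
      qed
    qed
  qed
qed

lemma lookup_xvar_mult:
  "Poly_Mapping.lookup (xvar v * f) m =
    (if 0 < Poly_Mapping.lookup m v then Poly_Mapping.lookup f (m - Poly_Mapping.single v 1) else 0)"
proof (induction f rule: poly_mapping_additive_induct)
  case (add f g)
  then show ?case by (simp add: distrib_left lookup_add)
next
  case (single n c)
  have "Poly_Mapping.single v 1 + n = m \<longleftrightarrow> 0 < Poly_Mapping.lookup m v \<and> n = m - Poly_Mapping.single v 1"
  proof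
    assume "0 < Poly_Mapping.lookup m v \<and> n = m - Poly_Mapping.single v 1"
    then show "Poly_Mapping.single v 1 + n = m"
      by (intro poly_mapping_eqI) (auto simp: lookup_add lookup_minus lookup_single when_def)
  qed (auto simp: lookup_add)
  then show ?case by (auto simp: xvar_def mult_single lookup_single when_def)
qed

lemma laurent_coeff_xvar_mult:
  assumes "t < length (xvars d)"
  shows "laurent_coeff d (xvar (xvars d ! t) * f) a = laurent_coeff d f (\<lambda>s. a s - (if s = t then 1 else 0))"
proof (cases "\<forall>s<length (xvars d). 0 \<le> a s - (if s = t then 1 else 0)")
  case True
  then have a: "0 \<le> a s" if "s < length (xvars d)" for s using that by (force split: if_splits)
  have at: "1 \<le> a t" using True assms by force
  have "exps_mon d a - Poly_Mapping.single (xvars d ! t) 1 = exps_mon d (\<lambda>s. a s - (if s = t then 1 else 0))"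
  proof (rule poly_mapping_eqI)
    fix v
    show "Poly_Mapping.lookup (exps_mon d a - Poly_Mapping.single (xvars d ! t) 1) v =
      Poly_Mapping.lookup (exps_mon d (\<lambda>s. a s - (if s = t then 1 else 0))) v"
    proof (cases "v \<in> var_set d")
      case True
      then obtain s where "s < length (xvars d)" "v = xvars d ! s"
        unfolding set_xvars[symmetric] in_set_conv_nth by blast
      then show ?thesis using assms at
        by (auto simp: lookup_minus lookup_exps_mon lookup_single when_def nth_eq_iff_index_eq)
    next
      case False
      then have "v \<noteq> xvars d ! t" using assms nth_mem[of t "xvars d"] by auto
      then show ?thesis using False by (simp add: lookup_minus lookup_single lookup_exps_mon_0)
    qed
  qed
  then show ?thesis using True a at assms by (simp add: laurent_coeff_eq lookup_xvar_mult lookup_exps_mon)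
next
  case False
  then obtain s where s: "s < length (xvars d)" "a s - (if s = t then 1 else 0) < 0" by (auto simp: not_le)
  show ?thesis
  proof (cases "\<forall>s<length (xvars d). 0 \<le> a s")
    case True
    then have "s = t" "a t = 0" using s by (auto split: if_splits)
    then show ?thesis using False assms True by (simp add: laurent_coeff_eq lookup_xvar_mult lookup_exps_mon)
  next
    case neg: False
    show ?thesis unfolding laurent_coeff_eq if_not_P[OF False] if_not_P[OF neg] ..
  qed
qed

lemma laurent_coeff_diff: "laurent_coeff d (f - g) a = laurent_coeff d f a - laurent_coeff d g a"
  by (auto simp: laurent_coeff_eq lookup_minus)

lemma laurent_coeff_zdiff:
  assumes "k < length (xvars d)" "l < length (xvars d)"
  shows "laurent_coeff d ((xvar (xvars d ! k) - xvar (xvars d ! l)) * f) = zdiff k l (laurent_coeff d f)"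
  by (rule ext) (simp add: zdiff_def left_diff_distrib laurent_coeff_diff laurent_coeff_xvar_mult assms)

section \<open>Renaming of variables\<close>

definition mon_rename :: "('v \<Rightarrow> 'w) \<Rightarrow> ('v \<Rightarrow>\<^sub>0 nat) \<Rightarrow> ('w \<Rightarrow>\<^sub>0 nat)" where
  "mon_rename \<tau> m = (\<Sum>v\<in>Poly_Mapping.keys m. Poly_Mapping.single (\<tau> v) (Poly_Mapping.lookup m v))"

lemma mon_rename_add: "mon_rename \<tau> (m + n) = mon_rename \<tau> m + mon_rename \<tau> n"
  unfolding mon_rename_def by (rule sum_keys_add) (simp_all add: single_add)

lemma mon_rename_single [simp]: "mon_rename \<tau> (Poly_Mapping.single v k) = Poly_Mapping.single (\<tau> v) k"
  unfolding mon_rename_def by (rule sum_keys_single) simp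

lemma mon_rename_zero [simp]: "mon_rename \<tau> 0 = 0"
  by (simp add: mon_rename_def)

lemma mon_rename_sum: "mon_rename \<tau> (\<Sum>k\<in>K. m k) = (\<Sum>k\<in>K. mon_rename \<tau> (m k))"
  by (induction K rule: infinite_finite_induct) (simp_all add: mon_rename_add)

lemma lookup_mon_rename:
  assumes "inj \<tau>"
  shows "Poly_Mapping.lookup (mon_rename \<tau> m) (\<tau> v) = Poly_Mapping.lookup m v"
proof -
  have "Poly_Mapping.lookup (mon_rename \<tau> m) (\<tau> v) = (\<Sum>w\<in>Poly_Mapping.keys m. if w = v then Poly_Mapping.lookup m v else 0)"
    unfolding mon_rename_def lookup_sum
    by (rule sum.cong) (use assms in \<open>auto simp: lookup_single when_def inj_eq\<close>)
  then show ?thesis by (simp add: in_keys_iff)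
qed

lemma keys_mon_rename: "Poly_Mapping.keys (mon_rename \<tau> m) \<subseteq> \<tau> ` Poly_Mapping.keys m"
proof -
  have "Poly_Mapping.keys (mon_rename \<tau> m) \<subseteq> (\<Union>v\<in>Poly_Mapping.keys m. Poly_Mapping.keys (Poly_Mapping.single (\<tau> v) (Poly_Mapping.lookup m v)))"
    unfolding mon_rename_def by (rule keys_sum)
  then show ?thesis by (auto split: if_splits)
qed

lemma inj_mon_rename: "inj \<tau> \<Longrightarrow> inj (mon_rename \<tau>)"
proof (rule injI)
  fix m n assume "inj \<tau>" "mon_rename \<tau> m = mon_rename \<tau> n"
  then show "m = n" using lookup_mon_rename[of \<tau>] by (metis poly_mapping_eqI)
qed

definition var_rename :: "('i \<times> nat \<Rightarrow> 'i \<times> nat) \<Rightarrow> 'i xpoly \<Rightarrow> 'i xpoly" where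
  "var_rename \<tau> f = (\<Sum>m\<in>Poly_Mapping.keys f. Poly_Mapping.single (mon_rename \<tau> m) (Poly_Mapping.lookup f m))"

lemma xvar_power: "xvar v ^ k = Poly_Mapping.single (Poly_Mapping.single v k) 1"
  by (induction k) (simp_all add: xvar_def mult_single flip: single_add)

lemma prod_single_one:
  "(\<Prod>v\<in>V. Poly_Mapping.single (g v) (1::rat)) = Poly_Mapping.single (\<Sum>v\<in>V. g v :: 'i \<times> nat \<Rightarrow>\<^sub>0 nat) 1"
  by (induction V rule: infinite_finite_induct) (simp_all add: mult_single)

lemma xsubst_xvar: "xsubst (\<lambda>v. xvar (\<tau> v)) f = var_rename \<tau> f"
  unfolding xsubst_def var_rename_def xvar_power prod_single_one mon_rename_def by (simp add: mult_single)

lemma xrename_eq: "xrename \<sigma> = var_rename (\<lambda>(i, k). (i, \<sigma> i k))"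
  unfolding xrename_def using xsubst_xvar[of "\<lambda>(i, k). (i, \<sigma> i k)"] by (simp add: fun_eq_iff case_prod_unfold)

lemma var_rename_add: "var_rename \<tau> (f + g) = var_rename \<tau> f + var_rename \<tau> g"
  unfolding var_rename_def by (rule sum_keys_add) (simp_all add: single_add)

lemma var_rename_single: "var_rename \<tau> (Poly_Mapping.single m c) = Poly_Mapping.single (mon_rename \<tau> m) c"
  unfolding var_rename_def by (rule sum_keys_single) simp

lemma var_rename_zero [simp]: "var_rename \<tau> 0 = 0"
  by (simp add: var_rename_def)

lemma var_rename_diff: "var_rename \<tau> (f - g) = var_rename \<tau> f - var_rename \<tau> g"
  using var_rename_add[of \<tau> "f - g" g] by simp

lemma var_rename_xvar: "var_rename \<tau> (xvar v) = xvar (\<tau> v)"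
  by (simp add: xvar_def var_rename_single)

lemma lookup_var_rename:
  assumes "inj \<tau>"
  shows "Poly_Mapping.lookup (var_rename \<tau> f) (mon_rename \<tau> m) = Poly_Mapping.lookup f m"
proof -
  have "Poly_Mapping.lookup (var_rename \<tau> f) (mon_rename \<tau> m) = (\<Sum>n\<in>Poly_Mapping.keys f. if n = m then Poly_Mapping.lookup f m else 0)"
    unfolding var_rename_def lookup_sum
    by (rule sum.cong) (use inj_mon_rename[OF assms] in \<open>auto simp: lookup_single when_def inj_eq\<close>)
  then show ?thesis by (simp add: in_keys_iff)
qed

lemma keys_var_rename: "Poly_Mapping.keys (var_rename \<tau> f) \<subseteq> mon_rename \<tau> ` Poly_Mapping.keys f"
proof -
  have "Poly_Mapping.keys (var_rename \<tau> f) \<subseteq> (\<Union>m\<in>Poly_Mapping.keys f. Poly_Mapping.keys (Poly_Mapping.single (mon_rename \<tau> m) (Poly_Mapping.lookup f m)))"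
    unfolding var_rename_def by (rule keys_sum)
  then show ?thesis by (auto split: if_splits)
qed

lemma var_rename_xpolys:
  assumes "f \<in> xpolys d" "\<tau> ` var_set d \<subseteq> var_set e"
  shows "var_rename \<tau> f \<in> xpolys e"
  unfolding xpolys_iff
proof (intro ballI subsetI)
  fix n v assume n: "n \<in> Poly_Mapping.keys (var_rename \<tau> f)" and v: "v \<in> Poly_Mapping.keys n"
  obtain m where m: "n = mon_rename \<tau> m" "m \<in> Poly_Mapping.keys f" using subsetD[OF keys_var_rename n] by (elim imageE)
  from subsetD[OF keys_mon_rename v[unfolded m(1)]]
  obtain w where "v = \<tau> w" "w \<in> Poly_Mapping.keys m" by (elim imageE)
  then show "v \<in> var_set e" using assms m unfolding xpolys_iff by blast
qed

lemma xpolys_mono: "f \<in> xpolys d \<Longrightarrow> var_set d \<subseteq> var_set e \<Longrightarrow> f \<in> xpolys e"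
  unfolding xpolys_iff by blast

lemma xpolys_add: "f \<in> xpolys d \<Longrightarrow> g \<in> xpolys d \<Longrightarrow> f + g \<in> xpolys d"
  unfolding xpolys_iff using Poly_Mapping.keys_add[of f g] by blast

lemma xpolys_diff: "f \<in> xpolys d \<Longrightarrow> g \<in> xpolys d \<Longrightarrow> f - g \<in> xpolys d"
  unfolding xpolys_iff using keys_diff[of f g] by blast

lemma xpolys_zero [simp]: "0 \<in> xpolys d"
  by (simp add: xpolys_iff)

lemma xpolys_one [simp]: "1 \<in> xpolys d"
  by (simp add: xpolys_iff)

lemma xpolys_sum: "(\<And>k. k \<in> K \<Longrightarrow> f k \<in> xpolys d) \<Longrightarrow> (\<Sum>k\<in>K. f k) \<in> xpolys d"
  by (induction K rule: infinite_finite_induct) (simp_all add: xpolys_add)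

lemma xpolys_mult: "f \<in> xpolys d \<Longrightarrow> g \<in> xpolys d \<Longrightarrow> f * g \<in> xpolys d"
proof -
  assume f: "f \<in> xpolys d" and g: "g \<in> xpolys d"
  show ?thesis unfolding xpolys_iff
  proof
    fix m assume "m \<in> Poly_Mapping.keys (f * g)"
    then obtain a b where "m = a + b" "a \<in> Poly_Mapping.keys f" "b \<in> Poly_Mapping.keys g"
      using keys_mult[of f g] by blast
    then show "Poly_Mapping.keys m \<subseteq> var_set d"
      using f g Poly_Mapping.keys_add[of a b] unfolding xpolys_iff by blast
  qed
qed

lemma xpolys_prod: "(\<And>k. k \<in> K \<Longrightarrow> f k \<in> xpolys d) \<Longrightarrow> (\<Prod>k\<in>K. f k) \<in> xpolys d"
  by (induction K rule: infinite_finite_induct) (simp_all add: xpolys_mult)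

lemma xpolys_power: "f \<in> xpolys d \<Longrightarrow> f ^ n \<in> xpolys d"
  by (induction n) (simp_all add: xpolys_mult)

lemma xpolys_xvar: "v \<in> var_set d \<Longrightarrow> xvar v \<in> xpolys d"
  by (simp add: xpolys_iff xvar_def)

text \<open>With disjoint sets of variables a monomial splits in only one way, so a single pair of
  terms contributes.\<close>

lemma lookup_mult_disjoint:
  fixes f g :: "'i xpoly"
  assumes f: "\<And>m. m \<in> Poly_Mapping.keys f \<Longrightarrow> Poly_Mapping.keys m \<subseteq> A"
    and g: "\<And>m. m \<in> Poly_Mapping.keys g \<Longrightarrow> Poly_Mapping.keys m \<subseteq> B"
    and "A \<inter> B = {}" "Poly_Mapping.keys m \<subseteq> A" "Poly_Mapping.keys n \<subseteq> B"
  shows "Poly_Mapping.lookup (f * g) (m + n) = Poly_Mapping.lookup f m * Poly_Mapping.lookup g n"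
proof -
  have split: "m' + n' = m + n \<longleftrightarrow> m' = m \<and> n' = n"
    if "Poly_Mapping.keys m' \<subseteq> A" "Poly_Mapping.keys n' \<subseteq> B" for m' n'
  proof
    assume eq: "m' + n' = m + n"
    have "Poly_Mapping.lookup m' v = Poly_Mapping.lookup m v \<and> Poly_Mapping.lookup n' v = Poly_Mapping.lookup n v" for v
    proof -
      have "Poly_Mapping.lookup m' v + Poly_Mapping.lookup n' v = Poly_Mapping.lookup m v + Poly_Mapping.lookup n v"
        using eq by (metis lookup_add)
      moreover have "v \<notin> A \<Longrightarrow> Poly_Mapping.lookup m' v = 0 \<and> Poly_Mapping.lookup m v = 0"
        "v \<notin> B \<Longrightarrow> Poly_Mapping.lookup n' v = 0 \<and> Poly_Mapping.lookup n v = 0"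
        using that assms(4,5) by (metis in_keys_iff subsetD)+
      moreover have "v \<notin> A \<or> v \<notin> B" using assms(3) by blast
      ultimately show ?thesis by auto
    qed
    then show "m' = m \<and> n' = n" by (metis poly_mapping_eqI)
  qed simp
  have "f * g = (\<Sum>m'\<in>Poly_Mapping.keys f. \<Sum>n'\<in>Poly_Mapping.keys g.
      Poly_Mapping.single (m' + n') (Poly_Mapping.lookup f m' * Poly_Mapping.lookup g n'))"
    by (subst (1 2) poly_mapping_single_sum[symmetric]) (simp add: sum_product mult_single del: sum_keys_single)
  then have "Poly_Mapping.lookup (f * g) (m + n) = (\<Sum>m'\<in>Poly_Mapping.keys f. \<Sum>n'\<in>Poly_Mapping.keys g.
      if m' = m then if n' = n then Poly_Mapping.lookup f m * Poly_Mapping.lookup g n else 0 else 0)"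
    by (simp add: lookup_sum) (intro sum.cong refl, auto simp: lookup_single when_def split[OF f g])
  also have "\<dots> = (\<Sum>m'\<in>Poly_Mapping.keys f. if m' = m then
      (\<Sum>n'\<in>Poly_Mapping.keys g. if n' = n then Poly_Mapping.lookup f m * Poly_Mapping.lookup g n else 0) else 0)"
    by (intro sum.cong refl) auto
  also have "\<dots> = Poly_Mapping.lookup f m * Poly_Mapping.lookup g n"
    by (simp add: in_keys_iff)
  finally show ?thesis .
qed

text \<open>\<open>\<pi>\<close> is \<open>\<tau>\<close> read on positions. The variable at t goes
  to the one at \<pi> t, hence the exponent of the original variable is found in \<open>b\<close> at
  \<pi> t.\<close>

lemma laurent_coeff_var_rename:
  assumes tau: "inj \<tau>" and pi: "\<pi> permutes {..<length (xvars d)}"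
    and rel: "\<And>t. t < length (xvars d) \<Longrightarrow> xvars d ! (\<pi> t) = \<tau> (xvars d ! t)"
  shows "laurent_coeff d (var_rename \<tau> f) b = laurent_coeff d f (b \<circ> \<pi>)"
proof -
  let ?p = "length (xvars d)"
  have nn: "(\<forall>t<?p. 0 \<le> (b \<circ> \<pi>) t) \<longleftrightarrow> (\<forall>t<?p. 0 \<le> b t)"
  proof -
    have "(\<forall>t\<in>{..<?p}. 0 \<le> b (\<pi> t)) \<longleftrightarrow> (\<forall>t\<in>\<pi> ` {..<?p}. 0 \<le> b t)" by blast
    then show ?thesis unfolding permutes_image[OF pi] Ball_def lessThan_iff comp_apply .
  qed
  have "exps_mon d b = (\<Sum>t<?p. Poly_Mapping.single (xvars d ! (\<pi> t)) (nat (b (\<pi> t))))"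
    unfolding exps_mon_def by (rule sum.permute[OF pi, unfolded comp_def])
  also have "\<dots> = mon_rename \<tau> (exps_mon d (b \<circ> \<pi>))"
    by (simp add: exps_mon_def mon_rename_sum rel)
  finally show ?thesis by (simp only: laurent_coeff_eq nn lookup_var_rename[OF tau])
qed

lemma zpows_add:
  assumes "A \<subseteq> pairs p" "tail_bounded u p c" "tail_bounded u p c'" "u \<le> 1"
  shows "zpows A M (\<lambda>b. c b + c' b) = (\<lambda>b. zpows A M c b + zpows A M c' b)"
  using zpows_sum[OF assms(1), of "{True, False}" u "\<lambda>i. if i then c else c'" M "\<lambda>_. 1"] assms by simp

lemma corr_cong:
  assumes "\<And>t. t < p \<Longrightarrow> cs t = cs' t" "\<And>t. t < p \<Longrightarrow> b t = b' t"
  shows "corr \<phi> p cs b = corr \<phi> p cs' b'"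
proof -
  have "mode_word p cs b = mode_word p cs' b'"
    unfolding mode_word_def using assms by (intro map_cong) auto
  then show ?thesis by (simp add: corr_def)
qed

lemma F_series_cong:
  assumes "\<And>t. t < p \<Longrightarrow> cs t = cs' t" "\<And>t. t < p \<Longrightarrow> b t = b' t"
  shows "F_series Q \<phi> p cs b = F_series Q \<phi> p cs' b'"
proof -
  have "F_series Q \<phi> p cs b = zpows (pairs p) (\<lambda>k l. locN Q (cs' k) (cs' l)) (corr \<phi> p cs) b"
    unfolding F_series_def by (rule fun_cong[OF zpows_cong]) (use assms(1) in auto)
  also have "\<dots> = F_series Q \<phi> p cs' b'"
    unfolding F_series_def
  proof (rule zpows_cong_below[OF order_refl])
    fix b b' :: "nat \<Rightarrow> int" assume "\<And>t. t < p \<Longrightarrow> b t = b' t"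
    with assms(1) show "corr \<phi> p cs b = corr \<phi> p cs' b'" by (rule corr_cong)
  qed (rule assms(2))
  finally show ?thesis .
qed

section \<open>Colour sequences and their arrangement\<close>

definition colour_count :: "nat \<Rightarrow> (nat \<Rightarrow> 'i) \<Rightarrow> 'i \<Rightarrow> nat" where
  "colour_count p cs i = card {t. t < p \<and> cs t = i}"

lemma colour_count_0 [simp]: "colour_count 0 cs = (\<lambda>i. 0)"
  by (simp add: colour_count_def fun_eq_iff)

lemma colour_count_Suc: "colour_count (Suc p) cs i = colour_count p cs i + (if cs p = i then 1 else 0)"
proof -
  have "{t. t < Suc p \<and> cs t = i} = {t. t < p \<and> cs t = i} \<union> (if cs p = i then {p} else {})"
    by (auto simp: less_Suc_eq)
  then show ?thesis by (simp add: colour_count_def card_insert_if)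
qed

lemma count_colours: "count (mset (map cs [0..<p])) i = colour_count p cs i"
  by (induction p) (simp_all add: colour_count_Suc)

lemma colour_count_permutes:
  assumes "\<pi> permutes {..<p}"
  shows "colour_count p (cs \<circ> \<pi>) = colour_count p cs"
proof
  fix i
  have "{t. t < p \<and> cs (\<pi> t) = i} = \<pi> -` {t. t < p \<and> cs t = i}"
    using permutes_in_image[OF assms] by auto
  then have "{t. t < p \<and> cs t = i} = \<pi> ` {t. t < p \<and> cs (\<pi> t) = i}"
    by (simp only: surj_image_vimage_eq[OF permutes_surj[OF assms]])
  then show "colour_count p (cs \<circ> \<pi>) i = colour_count p cs i"
    unfolding colour_count_def comp_apply by (simp add: card_image inj_on_subset[OF permutes_inj[OF assms]])
qed

lemma colour_count_cong: "(\<And>t. t < p \<Longrightarrow> cs t = cs' t) \<Longrightarrow> colour_count p cs = colour_count p cs'"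
  by (rule ext) (auto simp: colour_count_def intro!: arg_cong[where f=card])

lemma map_zcolour: "map (zcolour d) [0..<length (xvars d)] = map fst (xvars d)"
  by (rule nth_equalityI) (simp_all add: zcolour_def)

lemma colour_count_zcolour: "colour_count (length (xvars d)) (zcolour d) = d"
proof
  fix i
  have "colour_count (length (xvars d)) (zcolour d) i = count (mset (map fst (xvars d))) i"
    by (simp add: map_zcolour flip: count_colours)
  also have "\<dots> = length (filter (\<lambda>v. fst v = i) (xvars d))"
  proof -
    have "count (mset (map fst xs)) i = length (filter (\<lambda>v. fst v = i) xs)" for xs :: "('a \<times> nat) list"
      by (induction xs) auto
    then show ?thesis .
  qed
  also have "\<dots> = card {v \<in> var_set d. fst v = i}"
    by (subst distinct_card[symmetric]) simp_all
  also have "{v \<in> var_set d. fst v = i} = Pair i ` {1..d i}" by auto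
  also have "card \<dots> = d i" by (subst card_image) (auto simp: inj_on_def)
  finally show "colour_count (length (xvars d)) (zcolour d) i = d i" .
qed

lemma sum_colour_count: "(\<Sum>i\<in>UNIV. colour_count p cs (i :: 'i::finite)) = p"
  by (induction p) (simp_all add: colour_count_Suc sum.distrib)

lemma length_xvars_colour_count: "length (xvars (colour_count p cs)) = p"
  by (simp add: length_xvars card_var_set sum_colour_count)

text \<open>\<open>\<pi> t\<close> is the place of the letter t in the sequence ordered by colour.
  It is unique up to permutations within the colours, under which elements of \<open>Lam\<close> are
  invariant.\<close>

definition arranges :: "nat \<Rightarrow> (nat \<Rightarrow> 'i::{finite,linorder}) \<Rightarrow> (nat \<Rightarrow> nat) \<Rightarrow> bool" where
  "arranges p cs \<pi> \<longleftrightarrow> \<pi> permutes {..<p} \<and> (\<forall>t<p. cs t = zcolour (colour_count p cs) (\<pi> t))"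

lemma arranges_exists: "\<exists>\<pi>. arranges p cs \<pi>"
proof -
  let ?d = "colour_count p cs"
  have "count (mset (map cs [0..<p])) i = count (mset (map (zcolour ?d) [0..<p])) i" for i
    unfolding count_colours using colour_count_zcolour[of ?d] by (simp add: length_xvars_colour_count)
  then have "mset (map cs [0..<p]) = mset (map (zcolour ?d) [0..<p])"
    by (rule multiset_eqI)
  then obtain \<pi> where pi: "\<pi> permutes {..<p}"
    and eq: "permute_list \<pi> (map (zcolour ?d) [0..<p]) = map cs [0..<p]"
    using mset_eq_permutation[of "map cs [0..<p]" "map (zcolour ?d) [0..<p]"] by auto
  have "cs t = zcolour ?d (\<pi> t)" if "t < p" for t
  proof -
    have "\<pi> t < p" using permutes_in_image[OF pi] that by auto
    then show ?thesis using arg_cong[OF eq, of "\<lambda>xs. xs ! t"] that by (simp add: permute_list_def)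
  qed
  then show ?thesis using pi unfolding arranges_def by blast
qed

lemma arranges_zcolour: "arranges (length (xvars d)) (zcolour d) id"
  by (simp add: arranges_def permutes_id colour_count_zcolour)

lemma permutes_of_bij: "bij p \<Longrightarrow> (\<And>x. x \<notin> S \<Longrightarrow> p x = x) \<Longrightarrow> p permutes S"
  unfolding permutes_def by (simp add: bij_iff)

lemma var_perm_of_colour_perm:
  assumes "\<sigma> \<in> colour_perms d"
  shows "(\<lambda>(i, k). (i, \<sigma> i k)) permutes var_set d"
proof -
  have s: "\<sigma> i permutes {1..d i}" for i using assms by (simp add: colour_perms_def)
  show ?thesis
  proof (rule permutes_of_bij)
    show "bij (\<lambda>(i, k). (i, \<sigma> i k))"
    proof (rule bijI)
      show "inj (\<lambda>(i, k). (i, \<sigma> i k))"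
        using permutes_inj[OF s] by (auto simp: inj_def)
      show "surj (\<lambda>(i, k). (i, \<sigma> i k))"
      proof (rule surjI)
        show "(\<lambda>(i, k). (i, \<sigma> i k)) ((\<lambda>(i, k). (i, inv (\<sigma> i) k)) x) = x" for x
          using permutes_inverses(1)[OF s] by (cases x) simp
      qed
    qed
    show "(\<lambda>(i, k). (i, \<sigma> i k)) x = x" if "x \<notin> var_set d" for x
      using that permutes_not_in[OF s] by (cases x) force
  qed
qed

lemma colour_perm_of_var_perm:
  assumes tau: "\<tau> permutes var_set d" and fst: "\<And>v. fst (\<tau> v) = fst v"
  shows "(\<lambda>i k. snd (\<tau> (i, k))) \<in> colour_perms d"
proof -
  have e: "\<tau> (i, k) = (i, snd (\<tau> (i, k)))" for i k using fst[of "(i, k)"] by (simp add: prod_eq_iff)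
  have "(\<lambda>k. snd (\<tau> (i, k))) permutes {1..d i}" for i
  proof (rule permutes_of_bij)
    show "bij (\<lambda>k. snd (\<tau> (i, k)))"
    proof (rule bijI)
      show "inj (\<lambda>k. snd (\<tau> (i, k)))"
      proof (rule injI)
        fix k l assume "snd (\<tau> (i, k)) = snd (\<tau> (i, l))"
        then have "\<tau> (i, k) = \<tau> (i, l)" using e[of i k] e[of i l] by simp
        then show "k = l" using permutes_inj[OF tau] by (simp add: inj_eq)
      qed
      show "surj (\<lambda>k. snd (\<tau> (i, k)))"
      proof (rule surjI)
        fix k
        have "\<tau> (inv \<tau> (i, k)) = (i, k)" using permutes_inverses(1)[OF tau] .
        moreover have "fst (inv \<tau> (i, k)) = i" using fst[of "inv \<tau> (i, k)"] calculation by simp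
        ultimately show "snd (\<tau> (i, snd (inv \<tau> (i, k)))) = k" by (metis prod.collapse snd_conv)
      qed
    qed
    show "snd (\<tau> (i, k)) = k" if "k \<notin> {1..d i}" for k
      using permutes_not_in[OF tau, of "(i, k)"] that by auto
  qed
  then show ?thesis by (simp add: colour_perms_def)
qed

text \<open>With \<open>Lam_I\<close>, this translates invariance under colourwise permutations of
  variables into invariance of coefficients under colour-preserving permutations of
  positions.\<close>

lemma Lam_permutes:
  assumes f: "f \<in> Lam d" and pi: "\<pi> permutes {..<length (xvars d)}"
    and col: "\<And>t. t < length (xvars d) \<Longrightarrow> zcolour d (\<pi> t) = zcolour d t"
  shows "laurent_coeff d f (b \<circ> \<pi>) = laurent_coeff d f b"
proof -
  let ?p = "length (xvars d)" and ?x = "(!) (xvars d)"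
  \<comment> \<open>The permutation of variables conjugate to \<open>\<pi>\<close> under the
    enumeration \<open>xvars d\<close>, extended by the identity.\<close>
  define \<tau> where "\<tau> v = (if v \<in> var_set d then ?x (\<pi> (inv_into {..<?p} ?x v)) else v)" for v
  have tau: "\<tau> permutes var_set d"
    unfolding \<tau>_def using permutes_bij_inv_into[OF pi bij_xvars] by simp
  have rel: "?x (\<pi> t) = \<tau> (?x t)" if "t < ?p" for t
  proof -
    have "inv_into {..<?p} ?x (?x t) = t"
      using bij_betw_inv_into_left[OF bij_xvars] that by simp
    moreover have "?x t \<in> var_set d" using nth_mem[OF that] by simp
    ultimately show ?thesis by (simp add: \<tau>_def)
  qed
  have fst: "fst (\<tau> v) = fst v" for v
  proof (cases "v \<in> var_set d")
    case True
    then obtain t where t: "t < ?p" "v = ?x t" unfolding set_xvars[symmetric] in_set_conv_nth by blast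
    then show ?thesis using rel[OF t(1)] col[OF t(1)] by (simp add: zcolour_def)
  qed (simp add: \<tau>_def)
  have "xrename (\<lambda>i k. snd (\<tau> (i, k))) f = f"
    using f colour_perm_of_var_perm[OF tau fst] by (simp add: Lam_def)
  moreover have "(\<lambda>(i, k). (i, snd (\<tau> (i, k)))) = \<tau>"
    using fst by (auto simp: fun_eq_iff prod_eq_iff)
  ultimately have "var_rename \<tau> f = f" by (simp add: xrename_eq)
  then show ?thesis
    using laurent_coeff_var_rename[OF permutes_inj[OF tau] pi rel, of f b] by simp
qed

lemma Lam_I:
  assumes f: "f \<in> xpolys d"
    and inv: "\<And>\<pi> b. \<pi> permutes {..<length (xvars d)} \<Longrightarrow>
      (\<And>t. t < length (xvars d) \<Longrightarrow> zcolour d (\<pi> t) = zcolour d t) \<Longrightarrow>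
      laurent_coeff d f (b \<circ> \<pi>) = laurent_coeff d f b"
  shows "f \<in> Lam d"
  unfolding Lam_def
proof (intro CollectI conjI ballI f)
  fix \<sigma> assume "\<sigma> \<in> colour_perms d"
  then have tau: "(\<lambda>(i, k). (i, \<sigma> i k)) permutes var_set d" by (rule var_perm_of_colour_perm)
  let ?\<tau> = "\<lambda>(i, k). (i, \<sigma> i k)" and ?p = "length (xvars d)" and ?x = "(!) (xvars d)"
  let ?y = "inv_into {..<?p} ?x"
  define \<pi> where "\<pi> t = (if t \<in> {..<?p} then ?y (?\<tau> (inv_into (var_set d) ?y t)) else t)" for t
  have pi: "\<pi> permutes {..<?p}"
    unfolding \<pi>_def using permutes_bij_inv_into[OF tau bij_betw_inv_into[OF bij_xvars]] .
  have rel: "?x (\<pi> t) = ?\<tau> (?x t)" if "t < ?p" for t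
  proof -
    have "inv_into (var_set d) ?y t = ?x t"
      using inv_into_inv_into_eq[OF bij_xvars] that by simp
    moreover have "?\<tau> (?x t) \<in> var_set d"
      using permutes_in_image[OF tau] nth_mem[OF that] by simp
    ultimately show ?thesis using that bij_betw_inv_into_right[OF bij_xvars] by (simp add: \<pi>_def)
  qed
  have "zcolour d (\<pi> t) = zcolour d t" if "t < ?p" for t
    using rel[OF that] by (simp add: zcolour_def case_prod_unfold)
  then have "laurent_coeff d (xrename \<sigma> f) = laurent_coeff d f"
    unfolding xrename_eq using laurent_coeff_var_rename[OF permutes_inj[OF tau] pi rel, of f] inv[OF pi]
    by (intro ext) simp
  moreover have "xrename \<sigma> f \<in> xpolys d"
    unfolding xrename_eq by (rule var_rename_xpolys[OF f]) (simp add: permutes_image[OF tau])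
  ultimately show "xrename \<sigma> f = f" using laurent_coeff_inject f by blast
qed

lemma sum_lookup_mon_exps:
  assumes "Poly_Mapping.keys m \<subseteq> var_set d"
  shows "(\<Sum>t<length (xvars d). mon_exps d m t) = int (\<Sum>v\<in>Poly_Mapping.keys m. Poly_Mapping.lookup m v)"
proof -
  have "(\<Sum>t<length (xvars d). mon_exps d m t) = (\<Sum>v\<in>var_set d. int (Poly_Mapping.lookup m v))"
    unfolding mon_exps_def by (rule sum.reindex_bij_betw[OF bij_xvars])
  also have "\<dots> = (\<Sum>v\<in>Poly_Mapping.keys m. int (Poly_Mapping.lookup m v))"
    by (rule sum.mono_neutral_right) (use assms in \<open>auto simp: in_keys_iff\<close>)
  finally show ?thesis by simp
qed

lemma sum_exps_mon:
  assumes "\<And>t. t < length (xvars d) \<Longrightarrow> 0 \<le> a t"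
  shows "(\<Sum>t<length (xvars d). a t) = int (\<Sum>v\<in>Poly_Mapping.keys (exps_mon d a). Poly_Mapping.lookup (exps_mon d a) v)"
  unfolding sum_lookup_mon_exps[OF keys_exps_mon, symmetric]
  by (rule sum.cong) (simp_all add: mon_exps_exps_mon assms)

lemma prod_pairs: "(\<Prod>l<p. \<Prod>k<l. g k l) = (\<Prod>(k, l)\<in>pairs p. g k l)"
proof -
  have "(\<Prod>l<p. \<Prod>k<l. g k l) = (\<Prod>(l, k)\<in>Sigma {..<p} (\<lambda>l. {..<l}). g k l)"
    by (rule prod.Sigma) auto
  also have "\<dots> = (\<Prod>(k, l)\<in>pairs p. g k l)"
    by (rule prod.reindex_bij_witness[of _ prod.swap prod.swap]) auto
  finally show ?thesis .
qed

text \<open>At t \<ge> p the sum over k < t on the right is empty of contributions only because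
  \<mu> vanishes off the pairs.\<close>

lemma zshifts_pairs:
  assumes "\<And>k l. \<not> (k < l \<and> l < p) \<Longrightarrow> \<mu> k l = 0"
  shows "zshifts (pairs p) N \<mu> a = (\<lambda>t. a t - (\<Sum>l\<in>{t<..<p}. N t l - int (\<mu> t l)) - (\<Sum>k<t. int (\<mu> k t)))"
proof
  fix t
  have "(\<Sum>(k, l)\<in>pairs p. if t = k then N k l - int (\<mu> k l) else 0) =
    (\<Sum>(k, l)\<in>Pair t ` {t<..<p}. N k l - int (\<mu> k l))"
    by (rule sum.mono_neutral_cong_right) auto
  also have "\<dots> = (\<Sum>l\<in>{t<..<p}. N t l - int (\<mu> t l))"
    by (subst sum.reindex) (auto simp: inj_on_def)
  finally have 1: "(\<Sum>(k, l)\<in>pairs p. if t = k then N k l - int (\<mu> k l) else 0) = (\<Sum>l\<in>{t<..<p}. N t l - int (\<mu> t l))" .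
  have "(\<Sum>(k, l)\<in>pairs p. if t = l then int (\<mu> k l) else 0) = (\<Sum>(k, l)\<in>(\<lambda>k. (k, t)) ` {..<t}. int (\<mu> k l))"
  proof (cases "t < p")
    case True
    then show ?thesis by (intro sum.mono_neutral_cong_right) auto
  next
    case False
    then have "(\<Sum>(k, l)\<in>(\<lambda>k. (k, t)) ` {..<t}. int (\<mu> k l)) = 0"
      using assms by (intro sum.neutral) auto
    moreover have "(\<Sum>(k, l)\<in>pairs p. if t = l then int (\<mu> k l) else 0) = 0"
      using False by (intro sum.neutral) auto
    ultimately show ?thesis by simp
  qed
  also have "\<dots> = (\<Sum>k<t. int (\<mu> k t))"
    by (subst sum.reindex) (auto simp: inj_on_def)
  finally have 2: "(\<Sum>(k, l)\<in>pairs p. if t = l then int (\<mu> k l) else 0) = (\<Sum>k<t. int (\<mu> k t))" .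
  have "(\<Sum>(k, l)\<in>pairs p. (if t = k then N k l - int (\<mu> k l) else 0) + (if t = l then int (\<mu> k l) else 0)) =
      (\<Sum>l\<in>{t<..<p}. N t l - int (\<mu> t l)) + (\<Sum>k<t. int (\<mu> k t))"
    unfolding 1[symmetric] 2[symmetric] sum.distrib[symmetric] by (rule sum.cong) auto
  then show "zshifts (pairs p) N \<mu> a t = a t - (\<Sum>l\<in>{t<..<p}. N t l - int (\<mu> t l)) - (\<Sum>k<t. int (\<mu> k t))"
    unfolding zshifts_def by simp
qed

lemma F_coeff_eq:
  "F_coeff Q d \<xi> = F_series Q (\<lambda>u. \<xi> (vac_class Q u)) (length (xvars d)) (zcolour d)"
proof
  fix a
  have cc: "corr_coeff Q d \<xi> = corr (\<lambda>u. \<xi> (vac_class Q u)) (length (xvars d)) (zcolour d)"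
    by (rule ext) (simp add: corr_coeff_def corr_def mode_word_def)
  show "F_coeff Q d \<xi> a = F_series Q (\<lambda>u. \<xi> (vac_class Q u)) (length (xvars d)) (zcolour d) a"
    unfolding F_coeff_def F_series_def zpows_def Let_def cc prod_pairs
  proof (rule arg_cong[where f=Sum_any], rule ext, rule when_cong)
    fix \<mu> :: "nat \<Rightarrow> nat \<Rightarrow> nat"
    assume "\<forall>k l. (k, l) \<notin> pairs (length (xvars d)) \<longrightarrow> \<mu> k l = 0"
    then have "\<And>k l. \<not> (k < l \<and> l < length (xvars d)) \<Longrightarrow> \<mu> k l = 0" by simp
    note zshifts_pairs[OF this]
    then show "(\<Prod>(k, l)\<in>pairs (length (xvars d)). (of_int (locN Q (zcolour d k) (zcolour d l)) gchoose \<mu> k l) * (-1) ^ \<mu> k l) *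
        corr (\<lambda>u. \<xi> (vac_class Q u)) (length (xvars d)) (zcolour d)
          (\<lambda>t. a t - (\<Sum>l\<in>{t<..<length (xvars d)}. locN Q (zcolour d t) (zcolour d l) - int (\<mu> t l)) - (\<Sum>k<t. int (\<mu> k t))) =
      (\<Prod>(k, l)\<in>pairs (length (xvars d)). (of_int (locN Q (zcolour d k) (zcolour d l)) gchoose \<mu> k l) * (-1) ^ \<mu> k l) *
        corr (\<lambda>u. \<xi> (vac_class Q u)) (length (xvars d)) (zcolour d)
          (zshifts (pairs (length (xvars d))) (\<lambda>k l. locN Q (zcolour d k) (zcolour d l)) \<mu> a)"
      by simp
  qed simp
qed

lemma word_deg_mode_word: "word_deg (Word (mode_word p cs b)) = (\<lambda>i. int (colour_count p cs i))"
proof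
  fix i
  show "word_deg (Word (mode_word p cs b)) i = int (colour_count p cs i)"
    by (induction p) (simp_all add: word_deg_def mode_word_def colour_count_Suc basis_vec_def)
qed

lemma vac_functional_keys:
  assumes phi: "vac_functional Q \<phi>" and "\<And>w. w \<in> Poly_Mapping.keys u \<Longrightarrow> \<phi> (Poly_Mapping.single w 1) = 0"
  shows "\<phi> u = 0"
proof -
  have "\<phi> u = (\<Sum>w\<in>Poly_Mapping.keys u. Poly_Mapping.lookup u w * \<phi> (Poly_Mapping.single w 1))"
    by (subst poly_mapping_single_sum[symmetric])
      (simp only: vac_functional_sum[OF phi] vac_functional_single[OF phi, of _ "Poly_Mapping.lookup u _"])
  then show ?thesis using assms(2) by simp
qed

section \<open>The isomorphism of graded vector spaces\<close>

lemma PQ_dual_vac_functional: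
  assumes "\<xi> \<in> PQ_dual Q"
  shows "vac_functional Q (\<lambda>u. \<xi> (vac_class Q u))"
proof -
  have add: "\<xi> (vac_class Q (u + v)) = \<xi> (vac_class Q u) + \<xi> (vac_class Q v)" for u v
    using assms by (simp add: PQ_dual_def)
  have scale: "\<xi> (vac_class Q (Poly_Mapping.map ((*) c) u)) = c * \<xi> (vac_class Q u)" for c u
    using assms by (simp add: PQ_dual_def)
  have zero: "\<xi> (vac_class Q 0) = 0" using add[of 0 0] by simp
  have vac: "\<xi> (vac_class Q u) = 0" if "u \<in> vac_ideal Q" for u
  proof -
    have "vac_class Q u = vac_class Q 0" using that by (simp add: vac_class_eq_iff)
    then show ?thesis by (simp only: zero)
  qed
  show ?thesis unfolding vac_functional_def
    by (intro conjI allI ballI add scale vac)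
qed

definition lift_functional :: "('i, 'a) pre_digraph \<Rightarrow> ('i tensor_alg \<Rightarrow> rat) \<Rightarrow> 'i vac_form" where
  "lift_functional Q \<phi> X = (if X \<in> PQ Q then \<phi> (SOME u. X = vac_class Q u) else 0)"

lemma lift_functional_class:
  assumes "vac_functional Q \<phi>"
  shows "lift_functional Q \<phi> (vac_class Q u) = \<phi> u"
proof -
  have "vac_class Q u = vac_class Q (SOME v. vac_class Q u = vac_class Q v)"
    by (rule someI[of _ u]) simp
  then have "u - (SOME v. vac_class Q u = vac_class Q v) \<in> vac_ideal Q"
    by (simp only: vac_class_eq_iff)
  then have "\<phi> u = \<phi> (SOME v. vac_class Q u = vac_class Q v)"
    using vac_functional_0[OF assms] vac_functional_diff[OF assms] by force
  then show ?thesis by (simp add: lift_functional_def PQ_def)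
qed

lemma PQ_dual_eqI:
  assumes "\<xi> \<in> PQ_dual Q" "\<zeta> \<in> PQ_dual Q" "\<And>u. \<xi> (vac_class Q u) = \<zeta> (vac_class Q u)"
  shows "\<xi> = \<zeta>"
proof
  fix X
  show "\<xi> X = \<zeta> X"
    using assms by (cases "X \<in> PQ Q") (auto simp: PQ_def PQ_dual_def)
qed

context quiver
begin

section \<open>Degrees of words in modes\<close>

definition total_N :: "nat \<Rightarrow> (nat \<Rightarrow> 'i) \<Rightarrow> int" where
  "total_N p cs = (\<Sum>(k, l)\<in>pairs p. locN Q (cs k) (cs l))"

text \<open>-2 times the weight, written so that the bracket is the polynomial degree of the
  corresponding term of F_\<xi>; the Euler form in front is the shift in
  \<open>\<H>\<^sub>Q\<close>.\<close>

definition coh_degree :: "nat \<Rightarrow> (nat \<Rightarrow> 'i) \<Rightarrow> (nat \<Rightarrow> int) \<Rightarrow> int" where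
  "coh_degree p cs b = - euler Q (\<lambda>i. int (colour_count p cs i)) (\<lambda>i. int (colour_count p cs i))
     - 2 * ((\<Sum>t<p. b t) + total_N p cs)"

lemma pairs_Suc: "pairs (Suc p) = pairs p \<union> (\<lambda>k. (k, p)) ` {..<p}"
  by (auto simp: pairs_def)

text \<open>Bilinear expansion over the letters: each unordered pair of positions occurs twice by
  symmetry and contributes -N each time.\<close>

lemma euler_colour_count:
  "euler Q (\<lambda>i. int (colour_count p cs i)) (\<lambda>i. int (colour_count p cs i)) =
    (\<Sum>t<p. euler Q (basis_vec (cs t)) (basis_vec (cs t))) - 2 * total_N p cs"
proof (induction p)
  case 0
  then show ?case by (simp add: total_N_def pairs_def)
next
  case (Suc p)
  let ?d = "\<lambda>p i. int (colour_count p cs i)" and ?e = "basis_vec (cs p)"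
  have d: "?d (Suc p) = (\<lambda>i. ?d p i + ?e i)"
    by (auto simp: colour_count_Suc basis_vec_def fun_eq_iff)
  have cross: "euler Q (?d q) ?e = (\<Sum>k<q. euler Q (basis_vec (cs k)) ?e)" for q
  proof (induction q)
    case (Suc q)
    have "?d (Suc q) = (\<lambda>i. ?d q i + basis_vec (cs q) i)"
      by (auto simp: colour_count_Suc basis_vec_def fun_eq_iff)
    then show ?case using Suc by (simp add: euler_add_left)
  qed simp
  have "total_N (Suc p) cs = total_N p cs + (\<Sum>k<p. locN Q (cs k) (cs p))"
    unfolding total_N_def pairs_Suc
    by (subst sum.union_disjoint) (auto simp: sum.reindex inj_on_def)
  moreover have "(\<Sum>k<p. locN Q (cs k) (cs p)) = - euler Q (?d p) ?e"
    by (simp add: cross locN_def sum_negf)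
  ultimately show ?case using Suc
    by (simp add: d euler_add_left euler_add_right euler_commute[of ?e "?d p"])
qed

lemma weight_mode_word: "- 2 * word_weight Q (Word (mode_word p cs b)) = of_int (coh_degree p cs b)"
proof -
  have "- 2 * word_weight Q (Word (mode_word p cs b)) =
    - of_int (\<Sum>t<p. euler Q (basis_vec (cs t)) (basis_vec (cs t))) - 2 * of_int (\<Sum>t<p. b t)"
    by (induction p) (simp_all add: word_weight_def mode_word_def algebra_simps)
  then show ?thesis by (simp add: coh_degree_def euler_colour_count)
qed

lemma vac_functional_PQ_comp:
  assumes phi: "vac_functional Q \<phi>"
    and modes: "\<And>p cs b. colour_count p cs = d \<Longrightarrow> coh_degree p cs b = n \<Longrightarrow> corr \<phi> p cs b = 0"
    and u: "\<forall>w\<in>Poly_Mapping.keys u. word_deg w = (\<lambda>i. int (d i)) \<and> - 2 * word_weight Q w = of_int n"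
  shows "\<phi> u = 0"
proof (rule vac_functional_keys[OF phi])
  fix w assume w: "w \<in> Poly_Mapping.keys u"
  show "\<phi> (Poly_Mapping.single w 1) = 0"
  proof (rule vac_functional_determined[OF phi])
    fix p cs b
    assume "word_deg (Word (mode_word p cs b)) = word_deg w"
      and "word_weight Q (Word (mode_word p cs b)) = word_weight Q w"
    then have "(\<lambda>i. int (colour_count p cs i)) = (\<lambda>i. int (d i))"
      and "of_int (coh_degree p cs b) = (of_int n :: rat)"
      using u w by (simp_all add: word_deg_mode_word flip: weight_mode_word)
    then show "corr \<phi> p cs b = 0" by (intro modes) (auto simp: fun_eq_iff)
  qed
qed

text \<open>The support condition can be tested on mode words, since these span each component by
  \<open>vac_functional_determined\<close>.\<close>

lemma lift_functional_PQ_dual: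
  assumes phi: "vac_functional Q \<phi>" and "finite S"
    and modes: "\<And>p cs b. corr \<phi> p cs b \<noteq> 0 \<Longrightarrow> (colour_count p cs, coh_degree p cs b) \<in> S"
  shows "lift_functional Q \<phi> \<in> PQ_dual Q"
proof -
  have "lift_functional Q \<phi> X = 0" if dn: "(d, n) \<notin> S" and X: "X \<in> PQ_comp Q d n" for d n X
  proof -
    obtain u where "X = vac_class Q u"
      and u: "\<forall>w\<in>Poly_Mapping.keys u. word_deg w = (\<lambda>i. int (d i)) \<and> - 2 * word_weight Q w = of_int n"
      using X unfolding PQ_comp_def by blast
    then show ?thesis
      using vac_functional_PQ_comp[OF phi _ u] modes dn by (auto simp: lift_functional_class[OF phi])
  qed
  moreover have "lift_functional Q \<phi> X = 0" if "X \<notin> PQ Q" for X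
    using that by (simp add: lift_functional_def)
  ultimately show ?thesis
    using phi assms(2) unfolding PQ_dual_def
    by (auto simp: lift_functional_class[OF phi] vac_functional_add[OF phi] vac_functional_def)
qed

lemma mode_word_in_PQ_comp:
  "vac_class Q (mono_word (mode_word p cs b)) \<in> PQ_comp Q (colour_count p cs) (coh_degree p cs b)"
  unfolding PQ_comp_def by (rule imageI) (simp add: word_deg_mode_word flip: weight_mode_word)

abbreviation form :: "'i vac_form \<Rightarrow> 'i tensor_alg \<Rightarrow> rat" where
  "form \<xi> u \<equiv> \<xi> (vac_class Q u)"

lemma PQ_dual_support:
  assumes "\<xi> \<in> PQ_dual Q"
  obtains S where "finite S" "\<And>p cs b. corr (form \<xi>) p cs b \<noteq> 0 \<Longrightarrow> (colour_count p cs, coh_degree p cs b) \<in> S"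
proof -
  obtain S where S: "finite S" "\<forall>d n. (d, n) \<notin> S \<longrightarrow> (\<forall>X\<in>PQ_comp Q d n. \<xi> X = 0)"
    using assms by (auto simp: PQ_dual_def)
  show thesis
    by (rule that[OF S(1)]) (use S(2) mode_word_in_PQ_comp in \<open>unfold corr_def, blast\<close>)
qed

lemma F_series_degree:
  assumes "F_series Q \<phi> p cs a \<noteq> 0"
  obtains b where "corr \<phi> p cs b \<noteq> 0" "(\<Sum>t<p. a t) = (\<Sum>t<p. b t) + total_N p cs"
  using zpows_homogeneous[OF order_refl assms[unfolded F_series_def]] unfolding total_N_def by metis

text \<open>This makes the definite description in \<open>F_map\<close> meaningful: the series has
  non-negative exponents and, as \<xi> lives on finitely many components, bounded degree.\<close>

lemma F_map_spec:
  assumes xi: "\<xi> \<in> PQ_dual Q"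
  shows "F_map Q \<xi> d \<in> xpolys d"
    and "laurent_coeff d (F_map Q \<xi> d) = F_series Q (form \<xi>) (length (xvars d)) (zcolour d)"
proof -
  let ?p = "length (xvars d)"
  let ?F = "F_series Q (form \<xi>) ?p (zcolour d)"
  have phi: "vac_functional Q (form \<xi>)" using xi by (rule PQ_dual_vac_functional)
  obtain S where S: "finite S"
    "\<And>p cs b. corr (form \<xi>) p cs b \<noteq> 0 \<Longrightarrow> (colour_count p cs, coh_degree p cs b) \<in> S"
    using PQ_dual_support[OF xi] by blast
  define E where "E = euler Q (\<lambda>i. int (d i)) (\<lambda>i. int (d i))"
  \<comment> \<open>A term of degree D in F comes from a component of degree n = -E - 2 D, so D =
    (-E - n) div 2; the sum of the absolute values over \<open>S\<close> dominates all of
    these.\<close>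
  have bound: "(\<Sum>t<?p. a t) \<le> (\<Sum>(e, n)\<in>S. \<bar>(- E - n) div 2\<bar>)" if nz: "?F a \<noteq> 0" for a
  proof -
    obtain b where b: "corr (form \<xi>) ?p (zcolour d) b \<noteq> 0" "(\<Sum>t<?p. a t) = (\<Sum>t<?p. b t) + total_N ?p (zcolour d)"
      using F_series_degree[OF nz] .
    from S(2)[OF b(1)] have "(d, - E - 2 * (\<Sum>t<?p. a t)) \<in> S"
      by (simp add: coh_degree_def colour_count_zcolour b(2) E_def)
    then have "(case (d, - E - 2 * (\<Sum>t<?p. a t)) of (e, n) \<Rightarrow> \<bar>(- E - n) div 2\<bar>) \<le> (\<Sum>(e, n)\<in>S. \<bar>(- E - n) div 2\<bar>)"
      by (rule member_le_sum) (use S(1) in auto)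
    then show ?thesis by simp
  qed
  obtain f where f: "f \<in> xpolys d" "laurent_coeff d f = ?F"
  proof (rule laurent_coeff_surj[of ?F d])
    show "?F a \<noteq> 0 \<Longrightarrow> t < ?p \<Longrightarrow> 0 \<le> a t" for a t
      by (rule F_series_nonneg[OF phi corr_tail_bounded[OF phi]])
    show "(\<And>t. t < ?p \<Longrightarrow> a t = b t) \<Longrightarrow> ?F a = ?F b" for a b
      by (rule F_series_cong) simp_all
  qed (use bound in auto)
  have "F_map Q \<xi> d = f"
    unfolding F_map_def F_coeff_eq
    by (rule the_equality) (use f laurent_coeff_inject in \<open>auto simp: fun_eq_iff\<close>)
  then show "F_map Q \<xi> d \<in> xpolys d" "laurent_coeff d (F_map Q \<xi> d) = ?F" using f by simp_all
qed

lemma F_map_eqI: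
  assumes "\<xi> \<in> PQ_dual Q" "f \<in> xpolys d"
    "F_series Q (form \<xi>) (length (xvars d)) (zcolour d) = laurent_coeff d f"
  shows "F_map Q \<xi> d = f"
  using F_map_spec[OF assms(1), of d] assms(2,3) by (intro laurent_coeff_inject) simp_all

text \<open>The ordered colour sequence determines the series of every other sequence, so the
  polynomials \<open>F_map Q \<xi> d\<close> carry all correlators.\<close>

lemma F_series_arranges:
  assumes xi: "\<xi> \<in> PQ_dual Q" and pi: "arranges p cs \<pi>"
  shows "F_series Q (form \<xi>) p cs b =
    laurent_coeff (colour_count p cs) (F_map Q \<xi> (colour_count p cs)) (b \<circ> inv \<pi>)"
proof -
  let ?d = "colour_count p cs"
  have perm: "\<pi> permutes {..<p}" using pi by (simp add: arranges_def)
  have "F_series Q (form \<xi>) p cs b = F_series Q (form \<xi>) p (zcolour ?d \<circ> \<pi>) (b \<circ> inv \<pi> \<circ> \<pi>)"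
    by (rule F_series_cong) (use pi permutes_inverses(2)[OF perm] in \<open>simp_all add: arranges_def\<close>)
  also have "\<dots> = F_series Q (form \<xi>) p (zcolour ?d) (b \<circ> inv \<pi>)"
    by (rule F_series_permutes[OF PQ_dual_vac_functional[OF xi] perm])
  finally show ?thesis by (simp add: F_map_spec[OF xi] length_xvars_colour_count)
qed

text \<open>Inverting the powers of differences, a nonzero correlator forces a monomial of F_\<xi>
  in the matching degree. Injectivity and the comparison of gradings both rest on this.\<close>

lemma corr_degree_F_map:
  assumes xi: "\<xi> \<in> PQ_dual Q" and nz: "corr (form \<xi>) p cs b \<noteq> 0"
  obtains m where "m \<in> Poly_Mapping.keys (F_map Q \<xi> (colour_count p cs))"
    "coh_degree p cs b = - euler Q (\<lambda>i. int (colour_count p cs i)) (\<lambda>i. int (colour_count p cs i))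
      - 2 * int (\<Sum>v\<in>Poly_Mapping.keys m. Poly_Mapping.lookup m v)"
proof -
  let ?d = "colour_count p cs"
  have "zpows (pairs p) (\<lambda>k l. - locN Q (cs k) (cs l)) (F_series Q (form \<xi>) p cs) b \<noteq> 0"
    using nz corr_eq_zpows_F_series[OF PQ_dual_vac_functional[OF xi]] by metis
  then obtain a where a: "F_series Q (form \<xi>) p cs a \<noteq> 0"
    "(\<Sum>t<p. b t) = (\<Sum>t<p. a t) + (\<Sum>(k, l)\<in>pairs p. - locN Q (cs k) (cs l))"
    using zpows_homogeneous[OF order_refl] by blast
  obtain \<pi> where pi: "arranges p cs \<pi>" using arranges_exists by blast
  then have perm: "\<pi> permutes {..<p}" by (simp add: arranges_def)
  let ?a = "a \<circ> inv \<pi>"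
  have nz': "laurent_coeff ?d (F_map Q \<xi> ?d) ?a \<noteq> 0"
    using a(1) F_series_arranges[OF xi pi] by simp
  then have nn: "0 \<le> ?a t" if "t < length (xvars ?d)" for t
    using that unfolding laurent_coeff_eq by (meson)
  have "exps_mon ?d ?a \<in> Poly_Mapping.keys (F_map Q \<xi> ?d)"
    using nz' by (auto simp: laurent_coeff_eq in_keys_iff split: if_splits)
  moreover have "(\<Sum>t<p. a t) = (\<Sum>t<p. ?a t)"
    by (rule sum.permute[OF permutes_inv[OF perm]])
  moreover have "(\<Sum>t<p. ?a t) = int (\<Sum>v\<in>Poly_Mapping.keys (exps_mon ?d ?a). Poly_Mapping.lookup (exps_mon ?d ?a) v)"
    using sum_exps_mon[of ?d ?a] nn unfolding length_xvars_colour_count by simp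
  moreover have "(\<Sum>(k, l)\<in>pairs p. - locN Q (cs k) (cs l)) = - total_N p cs"
    unfolding total_N_def by (simp add: case_prod_unfold sum_negf)
  ultimately show thesis using that[of "exps_mon ?d ?a"] a(2) by (simp add: coh_degree_def)
qed

lemma PQ_dual_add: "\<zeta> \<in> PQ_dual Q \<Longrightarrow> \<xi> \<in> PQ_dual Q \<Longrightarrow> (\<lambda>X. \<zeta> X + \<xi> X) \<in> PQ_dual Q"
proof -
  assume z: "\<zeta> \<in> PQ_dual Q" and x: "\<xi> \<in> PQ_dual Q"
  obtain S T where "finite S" "\<forall>d n. (d, n) \<notin> S \<longrightarrow> (\<forall>X\<in>PQ_comp Q d n. \<zeta> X = 0)"
    "finite T" "\<forall>d n. (d, n) \<notin> T \<longrightarrow> (\<forall>X\<in>PQ_comp Q d n. \<xi> X = 0)"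
    using z x by (auto simp: PQ_dual_def)
  then have "\<exists>S. finite S \<and> (\<forall>d n. (d, n) \<notin> S \<longrightarrow> (\<forall>X\<in>PQ_comp Q d n. \<zeta> X + \<xi> X = 0))"
    by (intro exI[of _ "S \<union> T"]) auto
  then show ?thesis using z x by (auto simp: PQ_dual_def distrib_left)
qed

lemma PQ_dual_scale: "\<xi> \<in> PQ_dual Q \<Longrightarrow> (\<lambda>X. c * \<xi> X) \<in> PQ_dual Q"
  unfolding PQ_dual_def by (auto simp: distrib_left)

lemma F_map_add:
  assumes "\<zeta> \<in> PQ_dual Q" "\<xi> \<in> PQ_dual Q"
  shows "F_map Q (\<lambda>X. \<zeta> X + \<xi> X) = (\<lambda>d. F_map Q \<zeta> d + F_map Q \<xi> d)"
proof
  fix d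
  note tb = corr_tail_bounded[OF PQ_dual_vac_functional[OF assms(1)], of 1]
    corr_tail_bounded[OF PQ_dual_vac_functional[OF assms(2)], of 1]
  show "F_map Q (\<lambda>X. \<zeta> X + \<xi> X) d = F_map Q \<zeta> d + F_map Q \<xi> d"
  proof (rule F_map_eqI[OF PQ_dual_add[OF assms]])
    show "F_map Q \<zeta> d + F_map Q \<xi> d \<in> xpolys d"
      by (intro xpolys_add F_map_spec assms)
    have c: "corr (\<lambda>u. form \<zeta> u + form \<xi> u) (length (xvars d)) (zcolour d) =
      (\<lambda>b. corr (form \<zeta>) (length (xvars d)) (zcolour d) b + corr (form \<xi>) (length (xvars d)) (zcolour d) b)"
      by (simp add: corr_def fun_eq_iff)
    show "F_series Q (\<lambda>u. form \<zeta> u + form \<xi> u) (length (xvars d)) (zcolour d) = laurent_coeff d (F_map Q \<zeta> d + F_map Q \<xi> d)"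
      unfolding F_series_def c zpows_add[OF order_refl tb order_refl]
      by (simp add: fun_eq_iff laurent_coeff_add F_map_spec assms F_series_def)
  qed
qed

lemma F_map_scale:
  assumes "\<xi> \<in> PQ_dual Q"
  shows "F_map Q (\<lambda>X. c * \<xi> X) = (\<lambda>d. Poly_Mapping.map ((*) c) (F_map Q \<xi> d))"
proof
  fix d
  note tb = corr_tail_bounded[OF PQ_dual_vac_functional[OF assms], of 1]
  show "F_map Q (\<lambda>X. c * \<xi> X) d = Poly_Mapping.map ((*) c) (F_map Q \<xi> d)"
    unfolding mult_map_scale_conv_mult
  proof (rule F_map_eqI[OF PQ_dual_scale[OF assms]])
    show "Poly_Mapping.single 0 c * F_map Q \<xi> d \<in> xpolys d"
      by (intro xpolys_mult F_map_spec assms) (simp add: xpolys_iff)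
    have c: "corr (\<lambda>u. c * form \<xi> u) (length (xvars d)) (zcolour d) =
      (\<lambda>b. c * corr (form \<xi>) (length (xvars d)) (zcolour d) b)"
      by (simp add: corr_def fun_eq_iff)
    show "F_series Q (\<lambda>u. c * form \<xi> u) (length (xvars d)) (zcolour d) = laurent_coeff d (Poly_Mapping.single 0 c * F_map Q \<xi> d)"
      unfolding F_series_def c zpows_scale[OF order_refl tb order_refl]
      by (simp add: fun_eq_iff laurent_coeff_scale F_map_spec assms F_series_def)
  qed
qed

section \<open>Injectivity, surjectivity and the grading\<close>

lemma F_map_inj: "inj_on (F_map Q) (PQ_dual Q)"
proof (rule inj_onI)
  fix \<xi> \<zeta> assume x: "\<xi> \<in> PQ_dual Q" and z: "\<zeta> \<in> PQ_dual Q" and eq: "F_map Q \<xi> = F_map Q \<zeta>"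
  define \<eta> where "\<eta> = (\<lambda>X. \<xi> X + (-1) * \<zeta> X)"
  have e: "\<eta> \<in> PQ_dual Q" unfolding \<eta>_def by (intro PQ_dual_add PQ_dual_scale x z)
  have "F_map Q \<eta> d = 0" for d
    unfolding \<eta>_def F_map_add[OF x PQ_dual_scale[OF z]] F_map_scale[OF z] eq mult_map_scale_conv_mult
    by (simp add: single_uminus)
  then have "corr (form \<eta>) p cs b = 0" for p cs b
    using corr_degree_F_map[OF e, of p cs b] by fastforce
  then have "form \<eta> (Poly_Mapping.single w 1) = 0" for w
    using vac_functional_determined[OF PQ_dual_vac_functional[OF e]] by blast
  then have "form \<eta> u = 0" for u
    using vac_functional_keys[OF PQ_dual_vac_functional[OF e]] by blast
  then show "\<xi> = \<zeta>" by (intro PQ_dual_eqI[OF x z]) (simp add: \<eta>_def)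
qed

lemma F_map_HQ:
  assumes xi: "\<xi> \<in> PQ_dual Q"
  shows "F_map Q \<xi> \<in> HQ Q"
  unfolding HQ_def
proof (intro CollectI conjI allI)
  obtain S where S: "finite S"
    "\<And>p cs b. corr (form \<xi>) p cs b \<noteq> 0 \<Longrightarrow> (colour_count p cs, coh_degree p cs b) \<in> S"
    using PQ_dual_support[OF xi] by blast
  have "{d. F_map Q \<xi> d \<noteq> 0} \<subseteq> fst ` S"
  proof
    fix d assume "d \<in> {d. F_map Q \<xi> d \<noteq> 0}"
    then have "laurent_coeff d (F_map Q \<xi> d) \<noteq> laurent_coeff d 0"
      using laurent_coeff_inject[OF F_map_spec(1)[OF xi] xpolys_zero] by auto
    then obtain a where "F_series Q (form \<xi>) (length (xvars d)) (zcolour d) a \<noteq> 0"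
      by (auto simp: fun_eq_iff F_map_spec[OF xi])
    then obtain b where "corr (form \<xi>) (length (xvars d)) (zcolour d) b \<noteq> 0"
      by (rule F_series_degree)
    from S(2)[OF this] show "d \<in> fst ` S" by (force simp: colour_count_zcolour)
  qed
  then show "finite {d. F_map Q \<xi> d \<noteq> 0}" using S(1) finite_surj by blast
  fix d
  show "F_map Q \<xi> d \<in> Lam d"
  proof (rule Lam_I[OF F_map_spec(1)[OF xi]])
    fix \<pi> b assume pi: "\<pi> permutes {..<length (xvars d)}"
      and col: "\<And>t. t < length (xvars d) \<Longrightarrow> zcolour d (\<pi> t) = zcolour d t"
    have "F_series Q (form \<xi>) (length (xvars d)) (zcolour d) (b \<circ> \<pi>) =
      F_series Q (form \<xi>) (length (xvars d)) (zcolour d \<circ> \<pi>) (b \<circ> \<pi>)"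
      by (rule F_series_cong) (simp_all add: col)
    also have "\<dots> = F_series Q (form \<xi>) (length (xvars d)) (zcolour d) b"
      by (rule F_series_permutes[OF PQ_dual_vac_functional[OF xi] pi])
    finally show "laurent_coeff d (F_map Q \<xi> d) (b \<circ> \<pi>) = laurent_coeff d (F_map Q \<xi> d) b"
      by (simp add: F_map_spec[OF xi])
  qed
qed

text \<open>The inverse of \<open>F_series_arranges\<close>: the polynomial of the ordered sequence
  is transported to all colour sequences. \<open>family_of_eq\<close> removes the dependence on the
  choice.\<close>

definition family_of :: "'i coha \<Rightarrow> nat \<Rightarrow> (nat \<Rightarrow> 'i) \<Rightarrow> (nat \<Rightarrow> int) \<Rightarrow> rat" where
  "family_of h p cs b = laurent_coeff (colour_count p cs) (h (colour_count p cs)) (b \<circ> inv (SOME \<pi>. arranges p cs \<pi>))"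

text \<open>Two arrangements of the same sequence differ by a permutation that preserves the colours
  of the ordered sequence, and \<open>h\<close> is invariant under it.\<close>

lemma family_of_eq:
  assumes h: "h (colour_count p cs) \<in> Lam (colour_count p cs)" and pi: "arranges p cs \<pi>"
  shows "family_of h p cs b = laurent_coeff (colour_count p cs) (h (colour_count p cs)) (b \<circ> inv \<pi>)"
proof -
  let ?d = "colour_count p cs"
  define \<rho> where "\<rho> = (SOME \<pi>. arranges p cs \<pi>)"
  have rho: "arranges p cs \<rho>" unfolding \<rho>_def using arranges_exists by (rule someI_ex)
  have p: "\<pi> permutes {..<p}" and r: "\<rho> permutes {..<p}" using pi rho by (simp_all add: arranges_def)
  have "laurent_coeff ?d (h ?d) (b \<circ> inv \<pi> \<circ> (\<pi> \<circ> inv \<rho>)) = laurent_coeff ?d (h ?d) (b \<circ> inv \<pi>)"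
  proof (rule Lam_permutes[OF h])
    show "(\<pi> \<circ> inv \<rho>) permutes {..<length (xvars ?d)}"
      unfolding length_xvars_colour_count using p r by (intro permutes_compose permutes_inv)
    fix t assume "t < length (xvars ?d)"
    then have t: "t < p" by (simp add: length_xvars_colour_count)
    then have "inv \<rho> t < p" using permutes_in_image[OF permutes_inv[OF r], of t] by simp
    then show "zcolour ?d ((\<pi> \<circ> inv \<rho>) t) = zcolour ?d t"
      using pi rho permutes_inverses(1)[OF r, of t] unfolding arranges_def comp_apply by metis
  qed
  moreover have "b \<circ> inv \<pi> \<circ> (\<pi> \<circ> inv \<rho>) = b \<circ> inv \<rho>"
    using permutes_inverses(2)[OF p] by (simp add: fun_eq_iff)
  ultimately show ?thesis by (simp add: family_of_def \<rho>_def)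
qed

lemma equivariant_family_of:
  assumes h: "h \<in> HQ Q"
  shows "equivariant_family Q (family_of h)"
proof
  have L: "h d \<in> Lam d" for d using h by (simp add: HQ_def)
  {
    fix t p and cs :: "nat \<Rightarrow> 'i" and b :: "nat \<Rightarrow> int" assume t: "Suc t < p"
    let ?s = "Transposition.transpose t (Suc t)"
    have s: "?s permutes {..<p}" using t by (intro permutes_swap_id) auto
    obtain \<pi> where pi: "arranges p cs \<pi>" using arranges_exists by blast
    then have p: "\<pi> permutes {..<p}" by (simp add: arranges_def)
    have cc: "colour_count p (cs \<circ> ?s) = colour_count p cs" by (rule colour_count_permutes[OF s])
    have "arranges p (cs \<circ> ?s) (\<pi> \<circ> ?s)"
      unfolding arranges_def cc
    proof (intro conjI allI impI)
      show "(\<pi> \<circ> ?s) permutes {..<p}" using p s by (rule permutes_compose[rotated])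
      fix r assume "r < p"
      then have "?s r < p" using permutes_in_image[OF s, of r] by simp
      then show "(cs \<circ> ?s) r = zcolour (colour_count p cs) ((\<pi> \<circ> ?s) r)" using pi by (simp add: arranges_def)
    qed
    from family_of_eq[of h, OF L this, of "b \<circ> ?s"]
    have "family_of h p (cs \<circ> ?s) (b \<circ> ?s) = laurent_coeff (colour_count p cs) (h (colour_count p cs)) (b \<circ> ?s \<circ> inv (\<pi> \<circ> ?s))"
      by (simp only: cc)
    also have "b \<circ> ?s \<circ> inv (\<pi> \<circ> ?s) = b \<circ> inv \<pi>"
      using permutes_bij[OF p] permutes_bij[OF s] by (simp add: o_inv_distrib fun_eq_iff)
    finally show "family_of h p (cs \<circ> ?s) (b \<circ> ?s) = family_of h p cs b"
      unfolding family_of_eq[of h, OF L pi] .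
  next
    fix t p and cs :: "nat \<Rightarrow> 'i" and b :: "nat \<Rightarrow> int" assume t: "t < p" and nz: "family_of h p cs b \<noteq> 0"
    obtain \<pi> where pi: "arranges p cs \<pi>" using arranges_exists by blast
    then have p: "\<pi> permutes {..<p}" by (simp add: arranges_def)
    have "\<pi> t < p" using permutes_in_image[OF p, of t] t by simp
    moreover have "\<forall>t<length (xvars (colour_count p cs)). 0 \<le> (b \<circ> inv \<pi>) t"
      using nz unfolding family_of_eq[of h, OF L pi] laurent_coeff_eq by meson
    ultimately have "0 \<le> (b \<circ> inv \<pi>) (\<pi> t)" unfolding length_xvars_colour_count by blast
    then show "0 \<le> b t" by (simp add: permutes_inverses(2)[OF p])
  next
    fix p :: nat and cs cs' :: "nat \<Rightarrow> 'i" and b b' :: "nat \<Rightarrow> int"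
    assume cs: "\<And>t. t < p \<Longrightarrow> cs t = cs' t" and b: "\<And>t. t < p \<Longrightarrow> b t = b' t"
    obtain \<pi> where pi: "arranges p cs \<pi>" using arranges_exists by blast
    then have p: "\<pi> permutes {..<p}" by (simp add: arranges_def)
    have cc: "colour_count p cs = colour_count p cs'" using cs by (rule colour_count_cong)
    have pi': "arranges p cs' \<pi>" using pi cs by (simp add: arranges_def cc)
    show "family_of h p cs b = family_of h p cs' b'"
      unfolding family_of_eq[of h, OF L pi] family_of_eq[of h, OF L pi'] cc
    proof (rule laurent_coeff_cong)
      fix t assume "t < length (xvars (colour_count p cs'))"
      then have "inv \<pi> t < p" using permutes_in_image[OF permutes_inv[OF p], of t] by (simp add: length_xvars_colour_count)
      then show "(b \<circ> inv \<pi>) t = (b' \<circ> inv \<pi>) t" using b by simp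
    qed
  }
qed

text \<open>The functional of the family attached to \<open>h\<close> has this family as its
  \<open>F_series\<close>; for the ordered sequence that is \<open>h\<close> itself.\<close>

lemma F_map_surj:
  assumes h: "h \<in> HQ Q"
  shows "\<exists>\<xi>\<in>PQ_dual Q. F_map Q \<xi> = h"
proof -
  interpret equivariant_family Q "family_of h" by (rule equivariant_family_of[OF h])
  have L: "h d \<in> Lam d" "finite {d. h d \<noteq> 0}" for d using h by (simp_all add: HQ_def)
  define \<xi> where "\<xi> = lift_functional Q functional"
  \<comment> \<open>The components of \<open>\<P>\<^sub>Q\<close> that correspond to the finitely
    many monomials of \<open>h\<close>.\<close>
  define S where "S = (\<Union>d\<in>{d. h d \<noteq> 0}. (\<lambda>m. (d, - euler Q (\<lambda>i. int (d i)) (\<lambda>i. int (d i))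
      - 2 * int (\<Sum>v\<in>Poly_Mapping.keys m. Poly_Mapping.lookup m v))) ` Poly_Mapping.keys (h d))"
  have form: "form \<xi> = functional"
    by (simp add: \<xi>_def fun_eq_iff lift_functional_class[OF vac_functional_functional])
  have xi: "\<xi> \<in> PQ_dual Q"
    unfolding \<xi>_def
  proof (rule lift_functional_PQ_dual[OF vac_functional_functional])
    show "finite S" unfolding S_def using L(2) by simp
    fix p cs b assume "corr functional p cs b \<noteq> 0"
    then obtain a where a: "family_of h p cs a \<noteq> 0"
      "(\<Sum>t<p. b t) = (\<Sum>t<p. a t) + (\<Sum>(k, l)\<in>pairs p. - locN Q (cs k) (cs l))"
      unfolding corr_functional mode_corr_def using zpows_homogeneous[OF order_refl] by blast
    let ?d = "colour_count p cs"
    obtain \<pi> where pi: "arranges p cs \<pi>" using arranges_exists by blast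
    then have perm: "\<pi> permutes {..<p}" by (simp add: arranges_def)
    let ?a = "a \<circ> inv \<pi>"
    have nz: "laurent_coeff ?d (h ?d) ?a \<noteq> 0" using a(1) family_of_eq[of h, OF L(1) pi] by simp
    then have nn: "0 \<le> ?a t" if "t < length (xvars ?d)" for t
      using that unfolding laurent_coeff_eq by meson
    have key: "exps_mon ?d ?a \<in> Poly_Mapping.keys (h ?d)"
      using nz by (auto simp: laurent_coeff_eq in_keys_iff split: if_splits)
    then have "h ?d \<noteq> 0" by auto
    have "(\<Sum>t<p. a t) = (\<Sum>t<p. ?a t)"
      by (rule sum.permute[OF permutes_inv[OF perm]])
    moreover have "(\<Sum>t<p. ?a t) = int (\<Sum>v\<in>Poly_Mapping.keys (exps_mon ?d ?a). Poly_Mapping.lookup (exps_mon ?d ?a) v)"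
      using sum_exps_mon[of ?d ?a] nn unfolding length_xvars_colour_count by simp
    moreover have "(\<Sum>(k, l)\<in>pairs p. - locN Q (cs k) (cs l)) = - total_N p cs"
      unfolding total_N_def by (simp add: case_prod_unfold sum_negf)
    ultimately have "coh_degree p cs b = - euler Q (\<lambda>i. int (?d i)) (\<lambda>i. int (?d i))
        - 2 * int (\<Sum>v\<in>Poly_Mapping.keys (exps_mon ?d ?a). Poly_Mapping.lookup (exps_mon ?d ?a) v)"
      using a(2) by (simp add: coh_degree_def)
    then show "(?d, coh_degree p cs b) \<in> S"
      unfolding S_def using key \<open>h ?d \<noteq> 0\<close> by blast
  qed
  have "F_map Q \<xi> d = h d" for d
  proof (rule F_map_eqI[OF xi])
    show "h d \<in> xpolys d" using L(1)[of d] by (simp add: Lam_def)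
    show "F_series Q (form \<xi>) (length (xvars d)) (zcolour d) = laurent_coeff d (h d)"
      unfolding form F_series_functional
      using family_of_eq[of h, OF L(1) arranges_zcolour[of d]] by (simp add: fun_eq_iff colour_count_zcolour)
  qed
  then show ?thesis using xi by blast
qed

lemma F_map_bij: "bij_betw (F_map Q) (PQ_dual Q) (HQ Q)"
  unfolding bij_betw_def using F_map_inj F_map_HQ F_map_surj by blast

text \<open>Dual degree n means degree -n on \<open>\<P>\<^sub>Q\<close>, and there -n =
  -\<chi>(d,d) - 2|m| for a monomial m; this is the degree condition 2|m| = n - \<chi>(d,d) of
  \<open>HQ_comp\<close>.\<close>

lemma F_map_comp: "F_map Q ` PQ_dual_comp Q d n = HQ_comp Q d n"
proof (intro equalityI subsetI)
  fix h assume "h \<in> F_map Q ` PQ_dual_comp Q d n"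
  then obtain \<xi> where h: "h = F_map Q \<xi>" and xi: "\<xi> \<in> PQ_dual Q"
    and z: "\<And>e m X. (e, m) \<noteq> (d, - n) \<Longrightarrow> X \<in> PQ_comp Q e m \<Longrightarrow> \<xi> X = 0"
    by (auto simp: PQ_dual_comp_def)
  have deg: "e = d \<and> 2 * int (\<Sum>v\<in>Poly_Mapping.keys m. Poly_Mapping.lookup m v) = n - euler Q (\<lambda>i. int (d i)) (\<lambda>i. int (d i))"
    if m: "m \<in> Poly_Mapping.keys (F_map Q \<xi> e)" for e m
  proof -
    have vs: "Poly_Mapping.keys m \<subseteq> var_set e" using m F_map_spec(1)[OF xi, of e] by (simp add: xpolys_iff)
    have "laurent_coeff e (F_map Q \<xi> e) (mon_exps e m) \<noteq> 0"
      using m by (simp add: laurent_coeff_mon_exps[OF vs] in_keys_iff)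
    then have "F_series Q (form \<xi>) (length (xvars e)) (zcolour e) (mon_exps e m) \<noteq> 0"
      by (simp add: F_map_spec[OF xi])
    then obtain b where b: "corr (form \<xi>) (length (xvars e)) (zcolour e) b \<noteq> 0"
      "(\<Sum>t<length (xvars e). mon_exps e m t) = (\<Sum>t<length (xvars e). b t) + total_N (length (xvars e)) (zcolour e)"
      by (rule F_series_degree)
    have "(colour_count (length (xvars e)) (zcolour e), coh_degree (length (xvars e)) (zcolour e) b) = (d, - n)"
      using z[OF _ mode_word_in_PQ_comp] b(1) unfolding corr_def by blast
    then show ?thesis using b(2)[symmetric] sum_lookup_mon_exps[OF vs]
      by (auto simp: coh_degree_def colour_count_zcolour)
  qed
  have "F_map Q \<xi> e = 0" if "e \<noteq> d" for e
    using deg[of _ e] that by (metis keys_eq_empty all_not_in_conv)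
  then show "h \<in> HQ_comp Q d n"
    unfolding HQ_comp_def h using F_map_HQ[OF xi] deg[of _ d] by simp
next
  fix h assume h: "h \<in> HQ_comp Q d n"
  then obtain \<xi> where xi: "\<xi> \<in> PQ_dual Q" and F: "F_map Q \<xi> = h"
    using F_map_surj[of h] by (auto simp: HQ_comp_def)
  note phi = PQ_dual_vac_functional[OF xi]
  have "\<xi> X = 0" if ne: "(e, m) \<noteq> (d, - n)" and X: "X \<in> PQ_comp Q e m" for e m X
  proof -
    obtain u where X: "X = vac_class Q u"
      and u: "\<forall>w\<in>Poly_Mapping.keys u. word_deg w = (\<lambda>i. int (e i)) \<and> - 2 * word_weight Q w = of_int m"
      using X unfolding PQ_comp_def by blast
    show ?thesis
      unfolding X
    proof (rule vac_functional_PQ_comp[OF phi _ u])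
      fix p cs b assume cs: "colour_count p cs = e" "coh_degree p cs b = m"
      show "corr (form \<xi>) p cs b = 0"
      proof (rule ccontr)
        assume "corr (form \<xi>) p cs b \<noteq> 0"
        then obtain k where k: "k \<in> Poly_Mapping.keys (h e)"
          "m = - euler Q (\<lambda>i. int (e i)) (\<lambda>i. int (e i)) - 2 * int (\<Sum>v\<in>Poly_Mapping.keys k. Poly_Mapping.lookup k v)"
          using corr_degree_F_map[OF xi, of p cs b] unfolding cs F by blast
        then have "h e \<noteq> 0" by auto
        then have "e = d" using h by (auto simp: HQ_comp_def)
        moreover have "2 * int (\<Sum>v\<in>Poly_Mapping.keys k. Poly_Mapping.lookup k v) = n - euler Q (\<lambda>i. int (d i)) (\<lambda>i. int (d i))"
          using h k(1) \<open>e = d\<close> unfolding HQ_comp_def by blast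
        ultimately show False using k(2) ne by simp
      qed
    qed
  qed
  then have "\<xi> \<in> PQ_dual_comp Q d n" using xi by (auto simp: PQ_dual_comp_def)
  then show "h \<in> F_map Q ` PQ_dual_comp Q d n" using F by blast
qed

end

section \<open>The coproduct\<close>

lemma tens_add_left: "tens (u + u') v = tens u v + tens u' v"
  unfolding tens_def by (rule sum_keys_add) (simp_all add: single_add distrib_right sum.distrib)

lemma tens_add_right: "tens u (v + v') = tens u v + tens u v'"
proof -
  have "(\<Sum>b\<in>Poly_Mapping.keys (v + v'). Poly_Mapping.single (a, b) (Poly_Mapping.lookup u a * Poly_Mapping.lookup (v + v') b))
     = (\<Sum>b\<in>Poly_Mapping.keys v. Poly_Mapping.single (a, b) (Poly_Mapping.lookup u a * Poly_Mapping.lookup v b))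
     + (\<Sum>b\<in>Poly_Mapping.keys v'. Poly_Mapping.single (a, b) (Poly_Mapping.lookup u a * Poly_Mapping.lookup v' b))" for a
    by (rule sum_keys_add[where f="\<lambda>b r. Poly_Mapping.single (a, b) (Poly_Mapping.lookup u a * r)"])
      (simp_all add: single_add distrib_left)
  then show ?thesis unfolding tens_def by (simp add: sum.distrib)
qed

lemma tens_single [simp]:
  "tens (Poly_Mapping.single a c) (Poly_Mapping.single b d) = Poly_Mapping.single (a, b) (c * d)"
  unfolding tens_def by (cases "c = 0"; cases "d = 0") simp_all

lemma tens_zero [simp]: "tens 0 v = 0" "tens u 0 = 0"
  by (simp_all add: tens_def)

lemma one_word: "(1 :: 'g word \<Rightarrow>\<^sub>0 rat) = Poly_Mapping.single 0 1"
  by simp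

lemma tens_one_right: "tens (Poly_Mapping.single a c) 1 = Poly_Mapping.single (a, 0) c"
  unfolding one_word by (simp del: single_one)

lemma tens_one_left: "tens 1 (Poly_Mapping.single a c) = Poly_Mapping.single (0, a) c"
  unfolding one_word by (simp del: single_one)

lemma tens_uminus_left: "tens (- u) v = - tens u v"
  using tens_add_left[of u "- u" v] by (simp add: add_eq_0_iff)

lemma tens_uminus_right: "tens u (- v) = - tens u v"
  using tens_add_right[of u v "- v"] by (simp add: add_eq_0_iff)

lemma tens_diff_left: "tens (u - u') v = tens u v - tens u' v"
  using tens_add_left[of u "- u'" v] by (simp add: tens_uminus_left)

lemma tens_diff_right: "tens u (v - v') = tens u v - tens u v'"
  using tens_add_right[of u v "- v'"] by (simp add: tens_uminus_right)

lemma tens_mult_eq: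
  "tens_mult Q s t = (\<Sum>k\<in>Poly_Mapping.keys s. \<Sum>k'\<in>Poly_Mapping.keys t.
     Poly_Mapping.single (fst k + fst k', snd k + snd k')
       (braid Q (word_deg (snd k)) (word_deg (fst k')) * Poly_Mapping.lookup s k * Poly_Mapping.lookup t k'))"
  by (simp add: tens_mult_def case_prod_unfold)

lemma tens_mult_add_left: "tens_mult Q (s + s') t = tens_mult Q s t + tens_mult Q s' t"
  unfolding tens_mult_eq by (rule sum_keys_add) (simp_all add: algebra_simps single_add sum.distrib)

lemma tens_mult_add_right: "tens_mult Q s (t + t') = tens_mult Q s t + tens_mult Q s t'"
proof -
  have "(\<Sum>k'\<in>Poly_Mapping.keys (t + t'). Poly_Mapping.single (fst k + fst k', snd k + snd k')
       (braid Q (word_deg (snd k)) (word_deg (fst k')) * Poly_Mapping.lookup s k * Poly_Mapping.lookup (t + t') k')) =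
    (\<Sum>k'\<in>Poly_Mapping.keys t. Poly_Mapping.single (fst k + fst k', snd k + snd k')
       (braid Q (word_deg (snd k)) (word_deg (fst k')) * Poly_Mapping.lookup s k * Poly_Mapping.lookup t k')) +
    (\<Sum>k'\<in>Poly_Mapping.keys t'. Poly_Mapping.single (fst k + fst k', snd k + snd k')
       (braid Q (word_deg (snd k)) (word_deg (fst k')) * Poly_Mapping.lookup s k * Poly_Mapping.lookup t' k'))" for k
    by (rule sum_keys_add[where f="\<lambda>k' r. Poly_Mapping.single (fst k + fst k', snd k + snd k')
       (braid Q (word_deg (snd k)) (word_deg (fst k')) * Poly_Mapping.lookup s k * r)"])
      (simp_all add: distrib_left single_add)
  then show ?thesis unfolding tens_mult_eq by (simp add: sum.distrib)
qed

lemma tens_mult_single: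
  "tens_mult Q (Poly_Mapping.single (u, v) c) (Poly_Mapping.single (u', v') c') =
    Poly_Mapping.single (u + u', v + v') (braid Q (word_deg v) (word_deg u') * c * c')"
  unfolding tens_mult_eq by (cases "c = 0"; cases "c' = 0") simp_all

lemma tens_mult_zero [simp]: "tens_mult Q 0 t = 0" "tens_mult Q s 0 = 0"
  by (simp_all add: tens_mult_def)

lemma tens_mult_sum_right: "tens_mult Q s (\<Sum>k\<in>K. t k) = (\<Sum>k\<in>K. tens_mult Q s (t k))"
  by (induction K rule: infinite_finite_induct) (simp_all add: tens_mult_add_right)

lemma word_deg_add: "word_deg (u + v) = (\<lambda>i. word_deg u i + word_deg v i)"
  by (simp add: word_deg_def plus_word_def fun_eq_iff)

lemma word_deg_zero [simp]: "word_deg 0 = (\<lambda>i. 0)"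
  by (simp add: word_deg_def zero_word_def fun_eq_iff)

lemma word_deg_single [simp]: "word_deg (Word [a]) = lie_deg a"
  by (simp add: word_deg_def fun_eq_iff)

lemma single_pair_induct [case_names add single]:
  assumes "\<And>u v. P u \<Longrightarrow> P v \<Longrightarrow> P (u + v)" "\<And>x y c. P (Poly_Mapping.single (x, y) c)"
  shows "P (u :: ('k \<times> 'l) \<Rightarrow>\<^sub>0 rat)"
  by (induction u rule: poly_mapping_additive_induct) (auto simp: assms)

text \<open>In the braided product (x \<otimes> y)(u \<otimes> v) the factor y passes u and
  multiplies each word of u by its own sign. This operator collects these signs for y of degree
  d.\<close>

definition alg_twist :: "('i, 'a) pre_digraph \<Rightarrow> ('i \<Rightarrow> int) \<Rightarrow> 'i tensor_alg \<Rightarrow> 'i tensor_alg" where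
  "alg_twist Q d u = (\<Sum>w\<in>Poly_Mapping.keys u.
     Poly_Mapping.single w (braid Q d (word_deg w) * Poly_Mapping.lookup u w))"

lemma alg_twist_add: "alg_twist Q d (u + v) = alg_twist Q d u + alg_twist Q d v"
  unfolding alg_twist_def by (rule sum_keys_add) (simp_all add: single_add distrib_left)

lemma alg_twist_single: "alg_twist Q d (Poly_Mapping.single w c) = Poly_Mapping.single w (braid Q d (word_deg w) * c)"
  unfolding alg_twist_def by (rule sum_keys_single) simp

lemma alg_twist_zero [simp]: "alg_twist Q d 0 = 0"
  by (simp add: alg_twist_def)

lemma alg_twist_uminus: "alg_twist Q d (- u) = - alg_twist Q d u"
  using alg_twist_add[of Q d u "- u"] by (simp add: add_eq_0_iff)

lemma alg_twist_diff: "alg_twist Q d (u - v) = alg_twist Q d u - alg_twist Q d v"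
  using alg_twist_add[of Q d u "- v"] by (simp add: alg_twist_uminus)

lemma alg_twist_lie_incl: "alg_twist Q d (lie_incl r) = lie_incl (lie_twist Q d r)"
  by (induction r rule: poly_mapping_additive_induct)
    (simp_all add: lie_incl_add alg_twist_add lie_twist_add alg_twist_single)

text \<open>Kept general in \<open>K\<close> because it serves for \<open>env_ideal\<close> as well
  as for \<open>vac_ideal\<close>, where it gives \<open>vac_ideal2\<close>.\<close>

inductive_set tens_span :: "'i tensor_alg set \<Rightarrow> 'i tensor_sq set" for K :: "'i tensor_alg set" where
  left: "u \<in> K \<Longrightarrow> tens u v \<in> tens_span K"
| right: "v \<in> K \<Longrightarrow> tens u v \<in> tens_span K"
| add: "s \<in> tens_span K \<Longrightarrow> t \<in> tens_span K \<Longrightarrow> s + t \<in> tens_span K"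

lemma vac_ideal2_eq: "vac_ideal2 Q = tens_span (vac_ideal Q)"
proof (intro equalityI subsetI)
  show "s \<in> tens_span (vac_ideal Q)" if "s \<in> vac_ideal2 Q" for s
    using that by induction (auto intro: tens_span.intros)
  show "s \<in> vac_ideal2 Q" if "s \<in> tens_span (vac_ideal Q)" for s
    using that by induction (auto intro: vac_ideal2.intros)
qed

lemma tens_span_mono: "s \<in> tens_span K \<Longrightarrow> K \<subseteq> L \<Longrightarrow> s \<in> tens_span L"
  by (induction rule: tens_span.induct) (auto intro: tens_span.intros)

context quiver
begin

lemma alg_twist_mult: "alg_twist Q d (u * v) = alg_twist Q d u * alg_twist Q d v"
proof (induction u rule: poly_mapping_additive_induct)
  case (single w c)
  show ?case
  proof (induction v rule: poly_mapping_additive_induct)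
    case (single w' c')
    show ?case by (simp add: mult_single alg_twist_single word_deg_add braid_add_right ac_simps)
  qed (simp add: distrib_left alg_twist_add)
qed (simp add: distrib_right alg_twist_add)

lemma lie_twist_bracket: "lie_twist Q d (lie_bracket u v) = lie_bracket (lie_twist Q d u) (lie_twist Q d v)"
proof (induction u rule: poly_mapping_additive_induct)
  case (single a c)
  show ?case
  proof (induction v rule: poly_mapping_additive_induct)
    case (single b e)
    show ?case by (simp add: braid_add_right ac_simps)
  qed (simp add: lie_bracket_add_right lie_twist_add)
qed (simp add: lie_bracket_add_left lie_twist_add)

lemma lie_twist_scale: "lie_twist Q d (Poly_Mapping.map ((*) c) u) = Poly_Mapping.map ((*) c) (lie_twist Q d u)"
  by (induction u rule: poly_mapping_additive_induct)
    (simp_all add: map_scale_add lie_twist_add map_scale_single mult.left_commute)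

lemma map_scale_diff:
  "Poly_Mapping.map ((*) (c::rat)) (u - v) = Poly_Mapping.map ((*) c) u - Poly_Mapping.map ((*) c) v"
  by (rule poly_mapping_eqI) (simp add: lookup_map_scale lookup_minus right_diff_distrib)

lemma map_scale_sum:
  "Poly_Mapping.map ((*) (c::rat)) (\<Sum>k\<in>K. u k) = (\<Sum>k\<in>K. Poly_Mapping.map ((*) c) (u k))"
  by (rule poly_mapping_eqI) (simp add: lookup_map_scale lookup_sum sum_distrib_left)

text \<open>Antisymmetry, Jacobi and locality are homogeneous, so a twist rescales them; the closure
  rules are respected because a twist is an automorphism of the bracket. The ideals
  \<open>env_ideal\<close> and \<open>vac_ideal\<close> follow the same pattern.\<close>

lemma lie_rel_twist:
  assumes "r \<in> lie_rel Q"
  shows "lie_twist Q d r \<in> lie_rel Q"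
  using assms
proof (induction rule: lie_rel.induct)
  case (antisymmetry a b)
  let ?r = "Poly_Mapping.single (Brk a b) 1 + Poly_Mapping.single (Brk b a) (braid Q (lie_deg a) (lie_deg b))"
  have "lie_twist Q d ?r = Poly_Mapping.map ((*) (braid Q d (lie_deg a) * braid Q d (lie_deg b))) ?r"
    by (simp add: lie_twist_add map_scale_add map_scale_single braid_add_right mult.commute)
  then show ?case by (simp only: lie_rel.scale lie_rel.antisymmetry)
next
  case (jacobi a b c)
  let ?r = "Poly_Mapping.single (Brk a (Brk b c)) 1 - Poly_Mapping.single (Brk (Brk a b) c) 1
       - Poly_Mapping.single (Brk b (Brk a c)) (braid Q (lie_deg a) (lie_deg b))"
  have "lie_twist Q d ?r = Poly_Mapping.map ((*) (braid Q d (lie_deg a) * braid Q d (lie_deg b) * braid Q d (lie_deg c))) ?r"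
    by (simp add: lie_twist_diff map_scale_diff map_scale_single braid_add_right ac_simps)
  then show ?case by (simp only: lie_rel.scale lie_rel.jacobi)
next
  case (locality N i j m n)
  let ?r = "\<Sum>k\<le>N. Poly_Mapping.single (Brk (Mode i (m - int k)) (Mode j (n + int k))) ((-1) ^ k * of_nat (N choose k)) :: 'i lie_vec"
  have "lie_twist Q d ?r = Poly_Mapping.map ((*) (braid Q d (basis_vec i) * braid Q d (basis_vec j))) ?r"
    by (simp add: lie_twist_sum map_scale_sum map_scale_single braid_add_right)
  then show ?case by (simp only: lie_rel.scale lie_rel.locality[OF locality])
qed (simp_all add: lie_rel.intros lie_twist_add lie_twist_scale lie_twist_bracket)

lemma env_ideal_twist:
  assumes "u \<in> env_ideal Q"
  shows "alg_twist Q d u \<in> env_ideal Q"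
  using assms
proof (induction rule: env_ideal.induct)
  case (commutator a b)
  let ?r = "mono_word [a, b] - Poly_Mapping.single (Word [b, a]) (braid Q (lie_deg a) (lie_deg b)) - mono_word [Brk a b]"
  have "word_deg (Word [a, b]) = (\<lambda>i. lie_deg a i + lie_deg b i)" "word_deg (Word [b, a]) = (\<lambda>i. lie_deg b i + lie_deg a i)"
    by (simp_all add: word_deg_def fun_eq_iff)
  then have "alg_twist Q d ?r = Poly_Mapping.single 0 (braid Q d (lie_deg a) * braid Q d (lie_deg b)) * ?r"
    by (simp add: alg_twist_diff alg_twist_single right_diff_distrib single_zero_mult braid_add_right mult.commute)
  then show ?case by (simp only: env_ideal.left env_ideal.commutator)
qed (simp_all add: env_ideal.intros alg_twist_add alg_twist_mult alg_twist_lie_incl lie_rel_twist)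

lemma vac_ideal_twist:
  assumes "u \<in> vac_ideal Q"
  shows "alg_twist Q d u \<in> vac_ideal Q"
  using assms
proof (induction rule: vac_ideal.induct)
  case (annihilate n x i)
  have "alg_twist Q d (x * mono_word [Mode i n]) =
    Poly_Mapping.single 0 (braid Q d (basis_vec i)) * alg_twist Q d x * mono_word [Mode i n]"
    by (simp add: alg_twist_mult alg_twist_single mult.assoc)
      (simp add: single_0_left_commute[symmetric] single_zero_mult)
  then show ?case by (simp only: vac_ideal.annihilate[OF annihilate])
qed (simp_all add: vac_ideal.add vac_ideal.env alg_twist_add env_ideal_twist)

text \<open>For u \<otimes> v with u in \<open>K\<close> the product contains a twist of u, hence
  the assumption that \<open>K\<close> is stable under twists. For v in \<open>K\<close> the sign
  depends only on the word in the first factor.\<close>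

lemma tens_span_left:
  assumes K: "0 \<in> K" "\<And>u x. u \<in> K \<Longrightarrow> x * u \<in> K" "\<And>u d. u \<in> K \<Longrightarrow> alg_twist Q d u \<in> K"
    and s: "s \<in> tens_span K"
  shows "tens_mult Q t s \<in> tens_span K"
  using s
proof (induction rule: tens_span.induct)
  case (left u v)
  show ?case
  proof (induction t rule: single_pair_induct)
    case (single x y c)
    show ?case
    proof (induction v rule: poly_mapping_additive_induct)
      case (single v' e)
      have "tens_mult Q (Poly_Mapping.single (x, y) c) (tens u (Poly_Mapping.single v' e)) =
        tens (Poly_Mapping.single x (c * e) * alg_twist Q (word_deg y) u) (Poly_Mapping.single (y + v') 1)"
        by (induction u rule: poly_mapping_additive_induct)
          (simp_all add: tens_add_left tens_mult_add_right alg_twist_add distrib_left alg_twist_single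
            tens_mult_single mult_single ac_simps)
      then show ?case using left by (simp add: tens_span.left K)
    qed (simp add: tens_add_right tens_mult_add_right tens_span.add)
  qed (simp add: tens_mult_add_left tens_span.add)
next
  case (right v u)
  show ?case
  proof (induction t rule: single_pair_induct)
    case (single x y c)
    show ?case
    proof (induction u rule: poly_mapping_additive_induct)
      case (single u' e)
      have "tens_mult Q (Poly_Mapping.single (x, y) c) (tens (Poly_Mapping.single u' e) v) =
        tens (Poly_Mapping.single (x + u') (c * e * braid Q (word_deg y) (word_deg u'))) (Poly_Mapping.single y 1 * v)"
        by (induction v rule: poly_mapping_additive_induct)
          (simp_all add: tens_add_right tens_mult_add_right distrib_left tens_mult_single mult_single ac_simps)
      then show ?case using right by (simp add: tens_span.right K)
    qed (simp add: tens_add_left tens_mult_add_right tens_span.add)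
  qed (simp add: tens_mult_add_left tens_span.add)
qed (simp add: tens_mult_add_right tens_span.add)

lemma tens_span_right:
  assumes K: "0 \<in> K" "\<And>u x. u \<in> K \<Longrightarrow> u * x \<in> K" "\<And>u d. u \<in> K \<Longrightarrow> alg_twist Q d u \<in> K"
    and s: "s \<in> tens_span K"
  shows "tens_mult Q s t \<in> tens_span K"
  using s
proof (induction rule: tens_span.induct)
  case (left u v)
  show ?case
  proof (induction t rule: single_pair_induct)
    case (single x y c)
    show ?case
    proof (induction v rule: poly_mapping_additive_induct)
      case (single v' e)
      have "tens_mult Q (tens u (Poly_Mapping.single v' e)) (Poly_Mapping.single (x, y) c) =
        tens (u * Poly_Mapping.single x (c * e * braid Q (word_deg v') (word_deg x))) (Poly_Mapping.single (v' + y) 1)"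
        by (induction u rule: poly_mapping_additive_induct)
          (simp_all add: tens_add_left tens_mult_add_left distrib_right tens_mult_single mult_single ac_simps)
      then show ?case using left by (simp add: tens_span.left K)
    qed (simp add: tens_add_right tens_mult_add_left tens_span.add)
  qed (simp add: tens_mult_add_right tens_span.add)
next
  case (right v u)
  show ?case
  proof (induction t rule: single_pair_induct)
    case (single x y c)
    show ?case
    proof (induction u rule: poly_mapping_additive_induct)
      case (single u' e)
      have "tens_mult Q (tens (Poly_Mapping.single u' e) v) (Poly_Mapping.single (x, y) c) =
        tens (Poly_Mapping.single (u' + x) (c * e)) (alg_twist Q (word_deg x) v * Poly_Mapping.single y 1)"
        by (induction v rule: poly_mapping_additive_induct)
          (simp_all add: tens_add_right tens_mult_add_left distrib_right alg_twist_add alg_twist_single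
            tens_mult_single mult_single ac_simps braid_commute[of "word_deg x"])
      then show ?case using right by (simp add: tens_span.right K)
    qed (simp add: tens_add_left tens_mult_add_left tens_span.add)
  qed (simp add: tens_mult_add_right tens_span.add)
qed (simp add: tens_mult_add_left tens_span.add)

lemma tens_mult_assoc: "tens_mult Q (tens_mult Q s t) r = tens_mult Q s (tens_mult Q t r)"
proof (induction s rule: single_pair_induct)
  case (single x y c)
  show ?case
  proof (induction t rule: single_pair_induct)
    case (single x' y' c')
    show ?case
    proof (induction r rule: single_pair_induct)
      case (single x'' y'' c'')
      show ?case
        by (simp add: tens_mult_single word_deg_add braid_add_left braid_add_right add.assoc) (simp add: ac_simps)
    qed (simp add: tens_mult_add_right)
  qed (simp add: tens_mult_add_left tens_mult_add_right)
qed (simp add: tens_mult_add_left)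

lemma tens_one_one: "tens 1 1 = Poly_Mapping.single (0, 0) 1"
  unfolding one_word by (simp del: single_one)

lemma tens_mult_one [simp]: "tens_mult Q (tens 1 1) t = t" "tens_mult Q t (tens 1 1) = t"
  unfolding tens_one_one
  by (induction t rule: single_pair_induct) (simp_all add: tens_mult_add_left tens_mult_add_right tens_mult_single)

lemma tens_mult_scalar: "tens_mult Q s (tens_mult Q (Poly_Mapping.single (0, 0) c) t) =
  tens_mult Q (Poly_Mapping.single (0, 0) c) (tens_mult Q s t)"
proof -
  have "tens_mult Q s (Poly_Mapping.single (0, 0) c) = tens_mult Q (Poly_Mapping.single (0, 0) c) s"
    by (induction s rule: single_pair_induct) (simp_all add: tens_mult_add_left tens_mult_add_right tens_mult_single mult.commute)
  then show ?thesis by (simp flip: tens_mult_assoc)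
qed

section \<open>The canonical coproduct and its descent to the quotients\<close>

definition primitive :: "'i lie_word \<Rightarrow> 'i tensor_sq" where
  "primitive a = Poly_Mapping.single (Word [a], 0) 1 + Poly_Mapping.single (0, Word [a]) 1"

definition word_coprod :: "'i lie_word list \<Rightarrow> 'i tensor_sq" where
  "word_coprod xs = foldr (\<lambda>a. tens_mult Q (primitive a)) xs (tens 1 1)"

lemma word_coprod_append: "word_coprod (xs @ ys) = tens_mult Q (word_coprod xs) (word_coprod ys)"
  by (induction xs) (simp_all add: word_coprod_def tens_mult_assoc)

lemma env_coprod_eq: "env_coprod Q x = (\<Sum>w\<in>Poly_Mapping.keys x.
    tens_mult Q (Poly_Mapping.single (0, 0) (Poly_Mapping.lookup x w)) (word_coprod (letters w)))"
  by (simp add: env_coprod_def word_coprod_def primitive_def tens_one_left tens_one_right)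

lemma env_coprod_add: "env_coprod Q (x + y) = env_coprod Q x + env_coprod Q y"
  unfolding env_coprod_eq by (rule sum_keys_add) (simp_all add: single_add tens_mult_add_left)

lemma env_coprod_single: "env_coprod Q (Poly_Mapping.single w c) =
    tens_mult Q (Poly_Mapping.single (0, 0) c) (word_coprod (letters w))"
  unfolding env_coprod_eq by (rule sum_keys_single) simp

lemma env_coprod_zero [simp]: "env_coprod Q 0 = 0"
  by (simp add: env_coprod_eq)

lemma env_coprod_uminus: "env_coprod Q (- u) = - env_coprod Q u"
  using env_coprod_add[of u "- u"] by (simp add: add_eq_0_iff)

lemma env_coprod_diff: "env_coprod Q (u - v) = env_coprod Q u - env_coprod Q v"
  using env_coprod_add[of u "- v"] by (simp add: env_coprod_uminus)

lemma env_coprod_mult: "env_coprod Q (x * y) = tens_mult Q (env_coprod Q x) (env_coprod Q y)"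
proof (induction x rule: poly_mapping_additive_induct)
  case (single w c)
  show ?case
  proof (induction y rule: poly_mapping_additive_induct)
    case (single w' c')
    have "tens_mult Q (Poly_Mapping.single (0, 0) c) (tens_mult Q (Poly_Mapping.single (0, 0) c') t) =
      tens_mult Q (Poly_Mapping.single (0, 0) (c * c')) t" for t
      by (simp add: tens_mult_single flip: tens_mult_assoc)
    then show ?case
      by (simp add: mult_single env_coprod_single plus_word_def word_coprod_append tens_mult_assoc
        tens_mult_scalar[of "word_coprod (letters w)"])
  qed (simp add: distrib_left env_coprod_add tens_mult_add_right)
qed (simp add: distrib_right env_coprod_add tens_mult_add_left)

lemma tens_mult_scalar_single: "tens_mult Q (Poly_Mapping.single (0, 0) c) (Poly_Mapping.single k d) = Poly_Mapping.single k (c * d)"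
  by (cases k) (simp add: tens_mult_single)

lemma env_coprod_lie_incl: "env_coprod Q (lie_incl r) = tens (lie_incl r) 1 + tens 1 (lie_incl r)"
proof (induction r rule: poly_mapping_additive_induct)
  case (single a c)
  show ?case
    by (simp add: env_coprod_single word_coprod_def primitive_def tens_mult_add_right tens_mult_scalar_single
      tens_one_left tens_one_right)
qed (simp add: lie_incl_add env_coprod_add tens_add_left tens_add_right)

text \<open>The mixed terms cancel: b \<otimes> a appears with opposite signs, and a \<otimes> b
  with the coefficient 1 - x * x, where x is a braiding sign.\<close>

lemma env_coprod_commutator:
  defines "u \<equiv> \<lambda>a b. mono_word [a, b] - Poly_Mapping.single (Word [b, a]) (braid Q (lie_deg a) (lie_deg b)) - mono_word [Brk a b]"
  shows "env_coprod Q (u a b) = tens (u a b) 1 + tens 1 (u a b)"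
proof -
  define x where "x = braid Q (lie_deg a) (lie_deg b)"
  have ba: "braid Q (lie_deg b) (lie_deg a) = x" by (simp add: x_def braid_commute)
  have x2: "x * x = 1" by (simp add: x_def)
  have app: "Word [c] + Word [e] = Word [c, e]" for c e :: "'i lie_word" by (simp add: plus_word_def)
  have wc1: "word_coprod [c] = primitive c" for c by (simp add: word_coprod_def)
  have wc2: "word_coprod [c, e] = tens_mult Q (primitive c) (primitive e)" for c e by (simp add: word_coprod_def)
  show ?thesis
    by (simp add: u_def env_coprod_diff env_coprod_single wc1 wc2 primitive_def tens_mult_add_left tens_mult_add_right
      tens_mult_single app tens_diff_left tens_diff_right tens_one_left tens_one_right ba x2 flip: x_def)
qed

text \<open>The generators of the ideal are primitive, and the span is stable under multiplication
  from both sides.\<close>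

lemma env_coprod_env_ideal: "u \<in> env_ideal Q \<Longrightarrow> env_coprod Q u \<in> tens_span (env_ideal Q)"
proof (induction rule: env_ideal.induct)
  case zero
  then show ?case using tens_span.left[OF env_ideal.zero, of 0 Q] by simp
next
  case (left u x)
  then show ?case unfolding env_coprod_mult
    by (intro tens_span_left env_ideal.zero env_ideal.left env_ideal_twist)
next
  case (right u x)
  then show ?case unfolding env_coprod_mult
    by (intro tens_span_right env_ideal.zero env_ideal.right env_ideal_twist)
next
  case (lie r)
  then show ?case unfolding env_coprod_lie_incl
    by (intro tens_span.add tens_span.left tens_span.right env_ideal.lie)
next
  case (commutator a b)
  show ?case unfolding env_coprod_commutator
    by (intro tens_span.add tens_span.left tens_span.right env_ideal.commutator)
qed (simp add: env_coprod_add tens_span.add)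

lemma vac_ideal2_left: "s \<in> vac_ideal2 Q \<Longrightarrow> tens_mult Q t s \<in> vac_ideal2 Q"
  unfolding vac_ideal2_eq by (intro tens_span_left vac_ideal_0 vac_ideal_left vac_ideal_twist)

lemma vac_ideal2_0: "0 \<in> vac_ideal2 Q"
  using vac_ideal2.left[OF vac_ideal_0, of 0 Q] by simp

lemma vac_ideal2_uminus: "s \<in> vac_ideal2 Q \<Longrightarrow> - s \<in> vac_ideal2 Q"
proof -
  assume s: "s \<in> vac_ideal2 Q"
  have "tens_mult Q (Poly_Mapping.single (0, 0) (-1)) t = - t" for t
    by (induction t rule: single_pair_induct) (simp_all only: tens_mult_add_right tens_mult_single, simp_all add: single_uminus)
  then show ?thesis using vac_ideal2_left[OF s, of "Poly_Mapping.single (0, 0) (-1)"] by simp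
qed

lemma vac_ideal2_diff: "s \<in> vac_ideal2 Q \<Longrightarrow> t \<in> vac_ideal2 Q \<Longrightarrow> s - t \<in> vac_ideal2 Q"
  using vac_ideal2.add[OF _ vac_ideal2_uminus] by force

lemma vac_class2_eq_iff: "vac_class2 Q s = vac_class2 Q t \<longleftrightarrow> s - t \<in> vac_ideal2 Q"
proof
  assume "vac_class2 Q s = vac_class2 Q t"
  moreover have "s \<in> vac_class2 Q s" by (simp add: vac_class2_def vac_ideal2_0)
  ultimately show "s - t \<in> vac_ideal2 Q" by (simp add: vac_class2_def)
next
  assume *: "s - t \<in> vac_ideal2 Q"
  have "w - s \<in> vac_ideal2 Q \<longleftrightarrow> w - t \<in> vac_ideal2 Q" for w
    using vac_ideal2.add[OF _ *, of "w - s"] vac_ideal2_diff[OF _ *, of "w - t"] by auto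
  then show "vac_class2 Q s = vac_class2 Q t" by (simp add: vac_class2_def)
qed

lemma env_coprod_vac_ideal: "u \<in> vac_ideal Q \<Longrightarrow> env_coprod Q u \<in> vac_ideal2 Q"
proof (induction rule: vac_ideal.induct)
  case (env u)
  then show ?case unfolding vac_ideal2_eq
    using tens_span_mono[OF env_coprod_env_ideal] vac_ideal.env by blast
next
  case (annihilate n x i)
  have m: "mono_word [Mode i n] \<in> vac_ideal Q" using vac_ideal.annihilate[OF annihilate, of 1 i Q] by simp
  have "env_coprod Q (mono_word [Mode i n]) = tens (mono_word [Mode i n]) 1 + tens 1 (mono_word [Mode i n])"
    using env_coprod_lie_incl[of "Poly_Mapping.single (Mode i n) 1"] by simp
  then show ?case unfolding env_coprod_mult
    using vac_ideal2.add[OF vac_ideal2.left[OF m] vac_ideal2.right[OF m]] vac_ideal2_left by simp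
qed (simp add: env_coprod_add vac_ideal2.add)

text \<open>Existence: \<open>env_coprod\<close> maps \<open>vac_ideal\<close> into
  \<open>vac_ideal2\<close> and so descends to cosets. Uniqueness: the class of 1 generates, and its
  image is prescribed.\<close>

lemma vac_coprod_class: "vac_coprod Q (vac_class Q u) = vac_class2 Q (env_coprod Q u)"
proof -
  define \<delta>\<^sub>0 where "\<delta>\<^sub>0 X = (if X \<in> PQ Q then vac_class2 Q (env_coprod Q (SOME u. X = vac_class Q u)) else {})" for X
  have d0: "\<delta>\<^sub>0 (vac_class Q u) = vac_class2 Q (env_coprod Q u)" for u
  proof -
    have "vac_class Q u = vac_class Q (SOME v. vac_class Q u = vac_class Q v)"
      by (rule someI[of _ u]) simp
    then have "env_coprod Q (u - (SOME v. vac_class Q u = vac_class Q v)) \<in> vac_ideal2 Q"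
      by (intro env_coprod_vac_ideal) (simp only: vac_class_eq_iff)
    then show ?thesis by (simp add: \<delta>\<^sub>0_def PQ_def vac_class2_eq_iff env_coprod_diff vac_ideal2_diff[of 0, simplified]
      vac_ideal2_uminus[of "env_coprod Q u - _", simplified])
  qed
  have env1: "env_coprod Q 1 = tens 1 1"
    unfolding one_word[where 'g="'i lie_word"] env_coprod_single
    by (simp add: word_coprod_def zero_word_def tens_one_one[unfolded one_word] del: single_one)
  have "is_vac_coprod Q \<delta>\<^sub>0"
    unfolding is_vac_coprod_def
  proof (intro conjI allI impI ballI)
    show "\<delta>\<^sub>0 X = {}" if "X \<notin> PQ Q" for X using that by (simp add: \<delta>\<^sub>0_def)
    show "\<delta>\<^sub>0 X \<in> range (vac_class2 Q)" if "X \<in> PQ Q" for X using that by (simp add: \<delta>\<^sub>0_def)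
    show "\<delta>\<^sub>0 (vac_class Q (u + v)) = vac_class2 Q (s + t)"
      if "\<delta>\<^sub>0 (vac_class Q u) = vac_class2 Q s \<and> \<delta>\<^sub>0 (vac_class Q v) = vac_class2 Q t" for u v s t
    proof -
      have "env_coprod Q (u + v) - (s + t) = (env_coprod Q u - s) + (env_coprod Q v - t)"
        by (simp add: env_coprod_add)
      also have "\<dots> \<in> vac_ideal2 Q"
        using that unfolding d0 vac_class2_eq_iff by (intro vac_ideal2.add) auto
      finally show ?thesis unfolding d0 vac_class2_eq_iff .
    qed
    show "\<delta>\<^sub>0 (vac_class Q (x * u)) = vac_class2 Q (tens_mult Q (env_coprod Q x) t)"
      if "\<delta>\<^sub>0 (vac_class Q u) = vac_class2 Q t" for x u t
    proof -
      have "tens_mult Q (env_coprod Q x) (env_coprod Q u - t) + tens_mult Q (env_coprod Q x) t = env_coprod Q (x * u)"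
        by (simp add: env_coprod_mult flip: tens_mult_add_right)
      then have "env_coprod Q (x * u) - tens_mult Q (env_coprod Q x) t = tens_mult Q (env_coprod Q x) (env_coprod Q u - t)"
        by (simp add: algebra_simps)
      also have "\<dots> \<in> vac_ideal2 Q"
        using that unfolding d0 vac_class2_eq_iff by (rule vac_ideal2_left)
      finally show ?thesis unfolding d0 vac_class2_eq_iff .
    qed
    show "\<delta>\<^sub>0 (vac_class Q 1) = vac_class2 Q (tens 1 1)" by (simp only: d0 env1)
  qed
  moreover have "\<delta> = \<delta>\<^sub>0" if "is_vac_coprod Q \<delta>" for \<delta>
  proof
    fix X
    show "\<delta> X = \<delta>\<^sub>0 X"
    proof (cases "X \<in> PQ Q")
      case True
      then obtain u where u: "X = vac_class Q u" by (auto simp: PQ_def)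
      have "\<delta> (vac_class Q (u * 1)) = vac_class2 Q (tens_mult Q (env_coprod Q u) (tens 1 1))"
        using that unfolding is_vac_coprod_def by blast
      then show ?thesis by (simp add: u d0)
    next
      case False
      then show ?thesis using that by (simp add: is_vac_coprod_def \<delta>\<^sub>0_def)
    qed
  qed
  ultimately have "vac_coprod Q = \<delta>\<^sub>0" unfolding vac_coprod_def by (rule the_equality)
  then show ?thesis by (simp add: d0)
qed

section \<open>The dual product as a signed sum over subsets\<close>

lemma pair2_eq: "pair2 Q \<zeta> \<xi> t = (\<Sum>k\<in>Poly_Mapping.keys t. Poly_Mapping.lookup t k *
    (braid Q (word_deg (fst k)) (word_deg (snd k)) * form \<zeta> (Poly_Mapping.single (fst k) 1) * form \<xi> (Poly_Mapping.single (snd k) 1)))"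
  by (simp add: pair2_def case_prod_unfold mult.assoc)

lemma pair2_add: "pair2 Q \<zeta> \<xi> (s + t) = pair2 Q \<zeta> \<xi> s + pair2 Q \<zeta> \<xi> t"
  unfolding pair2_eq by (rule sum_keys_add) (simp_all add: distrib_right)

lemma pair2_single: "pair2 Q \<zeta> \<xi> (Poly_Mapping.single (u, v) c) = c *
    (braid Q (word_deg u) (word_deg v) * form \<zeta> (Poly_Mapping.single u 1) * form \<xi> (Poly_Mapping.single v 1))"
  unfolding pair2_eq by (subst sum_keys_single) simp_all

lemma pair2_zero [simp]: "pair2 Q \<zeta> \<xi> 0 = 0"
  by (simp add: pair2_def)

lemma pair2_uminus: "pair2 Q \<zeta> \<xi> (- s) = - pair2 Q \<zeta> \<xi> s"
  using pair2_add[of \<zeta> \<xi> s "- s"] by simp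

lemma pair2_diff: "pair2 Q \<zeta> \<xi> (s - t) = pair2 Q \<zeta> \<xi> s - pair2 Q \<zeta> \<xi> t"
  using pair2_add[of \<zeta> \<xi> s "- t"] by (simp add: pair2_uminus)

lemma pair2_sum: "pair2 Q \<zeta> \<xi> (\<Sum>k\<in>K. t k) = (\<Sum>k\<in>K. pair2 Q \<zeta> \<xi> (t k))"
  by (induction K rule: infinite_finite_induct) (simp_all add: pair2_add)

lemma pair2_scalar: "pair2 Q \<zeta> \<xi> (tens_mult Q (Poly_Mapping.single (0, 0) c) t) = c * pair2 Q \<zeta> \<xi> t"
  by (induction t rule: single_pair_induct)
    (simp_all add: tens_mult_add_right pair2_add distrib_left tens_mult_scalar_single pair2_single)

text \<open>The braiding sign in the pairing turns into a twist of the argument from the ideal, and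
  \<open>vac_ideal\<close> is stable under twists.\<close>

lemma pair2_vac_ideal2:
  assumes z: "vac_functional Q (form \<zeta>)" and x: "vac_functional Q (form \<xi>)" and s: "s \<in> vac_ideal2 Q"
  shows "pair2 Q \<zeta> \<xi> s = 0"
  using s
proof (induction rule: vac_ideal2.induct)
  case (left u v)
  show ?case
  proof (induction v rule: poly_mapping_additive_induct)
    case (single w e)
    have "pair2 Q \<zeta> \<xi> (tens u (Poly_Mapping.single w e)) =
      e * form \<xi> (Poly_Mapping.single w 1) * form \<zeta> (alg_twist Q (word_deg w) u)"
    proof (induction u rule: poly_mapping_additive_induct)
      case (single w' c)
      show ?case
        using vac_functional_single[OF z, of w' "braid Q (word_deg w) (word_deg w') * c"]
        by (simp add: pair2_single alg_twist_single braid_commute[of "word_deg w"])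
    qed (simp add: tens_add_left pair2_add alg_twist_add vac_functional_add[OF z] distrib_left)
    then show ?case using vac_functional_0[OF z vac_ideal_twist[OF left]] by simp
  qed (simp add: tens_add_right pair2_add)
next
  case (right v u)
  show ?case
  proof (induction u rule: poly_mapping_additive_induct)
    case (single w e)
    have "pair2 Q \<zeta> \<xi> (tens (Poly_Mapping.single w e) v) =
      e * form \<zeta> (Poly_Mapping.single w 1) * form \<xi> (alg_twist Q (word_deg w) v)"
    proof (induction v rule: poly_mapping_additive_induct)
      case (single w' c)
      show ?case
        using vac_functional_single[OF x, of w' "braid Q (word_deg w) (word_deg w') * c"]
        by (simp add: pair2_single alg_twist_single)
    qed (simp add: tens_add_right pair2_add alg_twist_add vac_functional_add[OF x] distrib_left)
    then show ?case using vac_functional_0[OF x vac_ideal_twist[OF right]] by simp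
  qed (simp add: tens_add_left pair2_add)
qed (simp add: pair2_add)

lemma vac_functional_pair2:
  assumes z: "vac_functional Q (form \<zeta>)" and x: "vac_functional Q (form \<xi>)"
  shows "vac_functional Q (\<lambda>u. pair2 Q \<zeta> \<xi> (env_coprod Q u))"
proof -
  have "env_coprod Q (Poly_Mapping.single 0 c * u) = tens_mult Q (Poly_Mapping.single (0, 0) c) (env_coprod Q u)" for c u
    by (simp add: env_coprod_mult env_coprod_single) (simp add: zero_word_def word_coprod_def tens_mult_assoc)
  then show ?thesis
    unfolding vac_functional_def mult_map_scale_conv_mult
    by (auto simp: env_coprod_add pair2_add pair2_scalar intro: pair2_vac_ideal2[OF z x env_coprod_vac_ideal])
qed

lemma dual_mult_eq:
  assumes z: "vac_functional Q (form \<zeta>)" and x: "vac_functional Q (form \<xi>)"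
  shows "dual_mult Q \<zeta> \<xi> = lift_functional Q (\<lambda>u. pair2 Q \<zeta> \<xi> (env_coprod Q u))"
proof
  fix X
  show "dual_mult Q \<zeta> \<xi> X = lift_functional Q (\<lambda>u. pair2 Q \<zeta> \<xi> (env_coprod Q u)) X"
  proof (cases "X \<in> PQ Q")
    case True
    then obtain u where u: "X = vac_class Q u" by (auto simp: PQ_def)
    have "(THE c. \<exists>t. vac_coprod Q X = vac_class2 Q t \<and> c = pair2 Q \<zeta> \<xi> t) = pair2 Q \<zeta> \<xi> (env_coprod Q u)"
    proof (rule the_equality)
      show "\<exists>t. vac_coprod Q X = vac_class2 Q t \<and> pair2 Q \<zeta> \<xi> (env_coprod Q u) = pair2 Q \<zeta> \<xi> t"
        using vac_coprod_class u by blast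
      fix c assume "\<exists>t. vac_coprod Q X = vac_class2 Q t \<and> c = pair2 Q \<zeta> \<xi> t"
      then obtain t where "env_coprod Q u - t \<in> vac_ideal2 Q" "c = pair2 Q \<zeta> \<xi> t"
        by (auto simp: u vac_coprod_class vac_class2_eq_iff)
      then show "c = pair2 Q \<zeta> \<xi> (env_coprod Q u)"
        using pair2_vac_ideal2[OF z x, of "env_coprod Q u - t"] by (simp add: pair2_diff)
    qed
    then show ?thesis using True
      by (simp add: dual_mult_def u lift_functional_class[OF vac_functional_pair2[OF z x]])
  next
    case False
    then show ?thesis by (simp add: dual_mult_def lift_functional_def)
  qed
qed

text \<open>The coproduct contributes a sign for each unselected letter followed by a selected one,
  and the pairing one for each selected and unselected letter in either order. Their product retains
  the pairs in which the selected letter comes first.\<close>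

primrec shuffle_sign :: "'i lie_word list \<Rightarrow> nat set \<Rightarrow> rat" where
  "shuffle_sign [] S = 1"
| "shuffle_sign (a # xs) S = (if 0 \<in> S then braid Q (lie_deg a) (word_deg (Word (nths xs (- {j. Suc j \<in> S})))) else 1)
     * shuffle_sign xs {j. Suc j \<in> S}"

lemma sum_Pow_Suc: "(\<Sum>S\<in>Pow {..<Suc n}. g S) = (\<Sum>S\<in>Pow {..<n}. g (Suc ` S) + g (insert 0 (Suc ` S)))"
proof -
  have "Pow {..<Suc n} = (`) Suc ` Pow {..<n} \<union> (\<lambda>S. insert 0 (Suc ` S)) ` Pow {..<n}"
    unfolding lessThan_Suc_eq_insert_0 Pow_insert image_Pow_surj[OF refl, symmetric] image_image ..
  moreover have "(`) Suc ` Pow {..<n} \<inter> (\<lambda>S. insert 0 (Suc ` S)) ` Pow {..<n} = {}" by blast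
  moreover have "inj_on ((`) Suc) (Pow {..<n})" "inj_on (\<lambda>S. insert 0 (Suc ` S)) (Pow {..<n})"
    by (auto simp: inj_on_def inj_image_eq_iff insert_ident)
  ultimately show ?thesis by (simp add: sum.union_disjoint sum.reindex sum.distrib)
qed

lemma nths_Cons_Suc_image:
  "nths (a # xs) (insert 0 (Suc ` S)) = a # nths xs S" "nths (a # xs) (- insert 0 (Suc ` S)) = nths xs (- S)"
  "nths (a # xs) (Suc ` S) = nths xs S" "nths (a # xs) (- Suc ` S) = a # nths xs (- S)"
proof -
  have "{j. Suc j \<in> insert 0 (Suc ` S)} = S" "{j. Suc j \<in> - insert 0 (Suc ` S)} = - S"
    "{j. Suc j \<in> Suc ` S} = S" "{j. Suc j \<in> - Suc ` S} = - S"
    by auto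
  then show "nths (a # xs) (insert 0 (Suc ` S)) = a # nths xs S" "nths (a # xs) (- insert 0 (Suc ` S)) = nths xs (- S)"
    "nths (a # xs) (Suc ` S) = nths xs S" "nths (a # xs) (- Suc ` S) = a # nths xs (- S)"
    unfolding nths_Cons by (simp_all only:) auto
qed

lemma pair2_word_coprod:
  "pair2 Q \<zeta> \<xi> (word_coprod xs) = (\<Sum>S\<in>Pow {..<length xs}. shuffle_sign xs S *
     (form \<zeta> (mono_word (nths xs S)) * form \<xi> (mono_word (nths xs (- S)))))"
proof -
  obtain sg where sg: "\<And>xs. word_coprod xs = (\<Sum>S\<in>Pow {..<length xs}.
      Poly_Mapping.single (Word (nths xs S), Word (nths xs (- S))) (sg xs S))"
    "\<And>xs S. sg xs S * braid Q (word_deg (Word (nths xs S))) (word_deg (Word (nths xs (- S)))) = shuffle_sign xs S"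
  proof -
    \<comment> \<open>The sign of the coproduct alone. Multiplying by the pairing sign again removes
      it, because braiding signs square to 1.\<close>
    define sg where "sg xs S = shuffle_sign xs S * braid Q (word_deg (Word (nths xs S))) (word_deg (Word (nths xs (- S))))" for xs S
    have deg: "word_deg (Word (a # ys)) = (\<lambda>i. lie_deg a i + word_deg (Word ys) i)" for a :: "'i lie_word" and ys
      by (simp add: word_deg_def fun_eq_iff)
    have sg1: "sg (a # xs) (insert 0 (Suc ` S)) = sg xs S"
      and sg0: "sg (a # xs) (Suc ` S) = braid Q (lie_deg a) (word_deg (Word (nths xs S))) * sg xs S" for a xs S
    proof -
      have s: "{j. Suc j \<in> insert 0 (Suc ` S)} = S" "{j. Suc j \<in> Suc ` S} = S" by auto
      show "sg (a # xs) (insert 0 (Suc ` S)) = sg xs S"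
        unfolding sg_def nths_Cons_Suc_image shuffle_sign.simps s deg braid_add_left
        using braid_square[of "lie_deg a" "word_deg (Word (nths xs (- S)))"] by (simp add: ac_simps)
      show "sg (a # xs) (Suc ` S) = braid Q (lie_deg a) (word_deg (Word (nths xs S))) * sg xs S"
        unfolding sg_def nths_Cons_Suc_image shuffle_sign.simps s deg braid_add_right
        by (simp add: braid_commute[of "word_deg (Word (nths xs S))" "lie_deg a"] image_iff)
    qed
    have "word_coprod xs = (\<Sum>S\<in>Pow {..<length xs}.
      Poly_Mapping.single (Word (nths xs S), Word (nths xs (- S))) (sg xs S))" for xs
    proof (induction xs)
      case Nil
      then show ?case by (simp add: word_coprod_def tens_one_one sg_def flip: zero_word_def)
    next
      case (Cons a xs)
      have "word_coprod (a # xs) = tens_mult Q (primitive a) (word_coprod xs)" by (simp add: word_coprod_def)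
      also have "\<dots> = (\<Sum>S\<in>Pow {..<length xs}. tens_mult Q (primitive a)
          (Poly_Mapping.single (Word (nths xs S), Word (nths xs (- S))) (sg xs S)))"
        by (simp only: Cons tens_mult_sum_right)
      also have "\<dots> = (\<Sum>S\<in>Pow {..<length xs}.
          Poly_Mapping.single (Word (nths xs S), Word (a # nths xs (- S))) (sg (a # xs) (Suc ` S)) +
          Poly_Mapping.single (Word (a # nths xs S), Word (nths xs (- S))) (sg (a # xs) (insert 0 (Suc ` S))))"
      proof (rule sum.cong[OF refl])
        fix S
        have w: "Word [a] + Word ys = Word (a # ys)" for ys by (simp add: plus_word_def)
        show "tens_mult Q (primitive a) (Poly_Mapping.single (Word (nths xs S), Word (nths xs (- S))) (sg xs S)) =
          Poly_Mapping.single (Word (nths xs S), Word (a # nths xs (- S))) (sg (a # xs) (Suc ` S)) +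
          Poly_Mapping.single (Word (a # nths xs S), Word (nths xs (- S))) (sg (a # xs) (insert 0 (Suc ` S)))"
          unfolding sg0 sg1 primitive_def tens_mult_add_left tens_mult_single w by (simp add: add.commute)
      qed
      also have "\<dots> = (\<Sum>S\<in>Pow {..<length (a # xs)}.
          Poly_Mapping.single (Word (nths (a # xs) S), Word (nths (a # xs) (- S))) (sg (a # xs) S))"
        by (simp only: length_Cons sum_Pow_Suc nths_Cons_Suc_image)
      finally show ?case .
    qed
    moreover have "sg xs S * braid Q (word_deg (Word (nths xs S))) (word_deg (Word (nths xs (- S)))) = shuffle_sign xs S" for xs S
      by (simp add: sg_def mult.assoc)
    ultimately show thesis by (rule that)
  qed
  show ?thesis
    unfolding sg(1) pair2_sum pair2_single
    by (rule sum.cong) (simp_all add: sg(2)[symmetric] mult.assoc)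
qed

lemma prod_pairs_Suc_shift:
  "(\<Prod>(k, l)\<in>pairs (Suc n). g k l) = (\<Prod>l<n. g 0 (Suc l)) * (\<Prod>(k, l)\<in>pairs n. g (Suc k) (Suc l))"
  for g :: "nat \<Rightarrow> nat \<Rightarrow> rat"
  unfolding prod_pairs[symmetric]
  by (subst prod.lessThan_Suc_shift) (simp add: prod.lessThan_Suc_shift prod.distrib del: prod.lessThan_Suc)

lemma braid_word_deg_nths:
  "braid Q d (word_deg (Word (nths xs B))) = (\<Prod>l<length xs. if l \<in> B then braid Q d (lie_deg (xs ! l)) else 1)"
proof (induction xs arbitrary: B)
  case Nil
  then show ?case by (simp add: word_deg_def)
next
  case (Cons a xs)
  have "word_deg (Word (a # ys)) = (\<lambda>i. lie_deg a i + word_deg (Word ys) i)" for ys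
    by (simp add: word_deg_def fun_eq_iff)
  then show ?case using Cons[of "{j. Suc j \<in> B}"]
    by (simp add: nths_Cons braid_add_right prod.lessThan_Suc_shift del: prod.lessThan_Suc cong: if_cong)
qed

lemma shuffle_sign_eq: "shuffle_sign xs S = (\<Prod>(k, l)\<in>pairs (length xs).
    if k \<in> S \<and> l \<notin> S then braid Q (lie_deg (xs ! k)) (lie_deg (xs ! l)) else 1)"
proof (induction xs arbitrary: S)
  case Nil
  then show ?case by (simp add: pairs_def)
next
  case (Cons a xs)
  show ?case
    unfolding length_Cons prod_pairs_Suc_shift
    by (simp add: Cons braid_word_deg_nths case_prod_unfold cong: if_cong)
qed

end

section \<open>The dual product of two functionals\<close>

text \<open>Beyond the cardinality of \<open>S\<close> the values are chosen so that the map is injective on all of \<open>nat\<close>.\<close>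

definition subpos :: "nat \<Rightarrow> nat set \<Rightarrow> nat \<Rightarrow> nat" where
  "subpos p S n = (if n < card S then sorted_list_of_set S ! n else p + n)"

context
  fixes p :: nat and S :: "nat set"
  assumes S: "S \<subseteq> {..<p}"
begin

lemma finite_subpos: "finite S"
  using S finite_subset by blast

lemma bij_subpos: "bij_betw (subpos p S) {..<card S} S"
proof -
  have "bij_betw ((!) (sorted_list_of_set S)) {..<card S} S"
    by (rule bij_betw_nth) (simp_all add: finite_subpos)
  then show ?thesis by (rule bij_betw_cong[THEN iffD1, rotated]) (simp add: subpos_def)
qed

lemma subpos_in: "n < card S \<Longrightarrow> subpos p S n \<in> S"
  using bij_betwE[OF bij_subpos] by simp

lemma subpos_less: "n < card S \<Longrightarrow> subpos p S n < p"
  using subpos_in S by auto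

lemma subpos_mono: "m < n \<Longrightarrow> n < card S \<Longrightarrow> subpos p S m < subpos p S n"
  using sorted_wrt_nth_less[OF sorted_list_of_set.strict_sorted_key_list_of_set, of m n S] by (simp add: subpos_def finite_subpos)

lemma inj_subpos: "inj (subpos p S)"
proof (rule injI)
  fix m n assume eq: "subpos p S m = subpos p S n"
  have ge: "p \<le> subpos p S k" if "\<not> k < card S" for k using that by (simp add: subpos_def)
  show "m = n"
  proof (cases "m < card S")
    case True
    then have "n < card S" using eq subpos_less[of m] ge[of n] by fastforce
    then show ?thesis using eq True bij_betw_imp_inj_on[OF bij_subpos] by (auto dest: inj_onD)
  next
    case False
    then have "\<not> n < card S" using eq subpos_less[of n] ge[of m] by fastforce
    then show ?thesis using eq False by (simp add: subpos_def)
  qed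
qed

lemma subpos_pairs: "map_prod (subpos p S) (subpos p S) ` pairs (card S) = {(k, l) \<in> pairs p. k \<in> S \<and> l \<in> S}"
proof (intro equalityI subsetI)
  fix x assume "x \<in> map_prod (subpos p S) (subpos p S) ` pairs (card S)"
  then show "x \<in> {(k, l) \<in> pairs p. k \<in> S \<and> l \<in> S}"
    using subpos_in subpos_less subpos_mono by fastforce
next
  fix x assume "x \<in> {(k, l) \<in> pairs p. k \<in> S \<and> l \<in> S}"
  then obtain k l where x: "x = (k, l)" "k < l" "k \<in> S" "l \<in> S" by auto
  obtain m n where mn: "m < card S" "n < card S" "k = subpos p S m" "l = subpos p S n"
    using x bij_betw_imp_surj_on[OF bij_subpos] by (metis imageE lessThan_iff)
  have "m < n"
  proof (rule ccontr)
    assume "\<not> m < n"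
    then have "n < m \<or> n = m" by auto
    then show False using subpos_mono[of n m] mn x by auto
  qed
  then show "x \<in> map_prod (subpos p S) (subpos p S) ` pairs (card S)"
    using x mn by (intro image_eqI[of _ _ "(m, n)"]) auto
qed

text \<open>An increasing enumeration of \<open>S\<close> meets {t..<p} in a final segment, possibly
  empty; \<open>t'\<close> is where this segment begins.\<close>

lemma tail_sum_subpos:
  obtains t' where "t' \<le> card S" "(\<Sum>s\<in>S \<inter> {t..<p}. b s) = (\<Sum>j=t'..<card S. b (subpos p S j))"
proof -
  define t' where "t' = (LEAST j. card S \<le> j \<or> t \<le> subpos p S j)"
  have le: "t' \<le> card S" unfolding t'_def by (rule Least_le) simp
  have t': "card S \<le> t' \<or> t \<le> subpos p S t'" unfolding t'_def
    using LeastI[of "\<lambda>j. card S \<le> j \<or> t \<le> subpos p S j" "card S"] by simp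
  have "subpos p S j < t" if "j < t'" for j
    using not_less_Least[of j "\<lambda>j. card S \<le> j \<or> t \<le> subpos p S j"] that unfolding t'_def[symmetric] by auto
  moreover have "t \<le> subpos p S j" if "t' \<le> j" "j < card S" for j
    using t' subpos_mono[of t' j] that by (cases "j = t'") auto
  ultimately have iff: "t \<le> subpos p S j \<longleftrightarrow> t' \<le> j" if "j < card S" for j
    using that by (metis not_le)
  have "bij_betw (subpos p S) {t'..<card S} (S \<inter> {t..<p})"
  proof (rule bij_betw_subset[OF bij_subpos])
    show "subpos p S ` {t'..<card S} = S \<inter> {t..<p}"
    proof (intro equalityI subsetI)
      fix x assume "x \<in> S \<inter> {t..<p}"
      then obtain j where "j < card S" "x = subpos p S j" "t \<le> x"
        using bij_betw_imp_surj_on[OF bij_subpos] by (metis IntE atLeastLessThan_iff imageE lessThan_iff)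
      then show "x \<in> subpos p S ` {t'..<card S}" using iff by auto
    qed (use iff subpos_in subpos_less in auto)
  qed auto
  from sum.reindex_bij_betw[OF this, of b] show thesis using that[OF le] by simp
qed

end

lemma nths_upt: "nths [0..<p] S = sorted_list_of_set (S \<inter> {..<p})"
proof -
  have "sorted_wrt (<) (nths [0..<p] S)"
    by (simp add: strict_sorted_iff sorted_nths distinct_nthsI)
  moreover have "set (nths [0..<p] S) = S \<inter> {..<p}"
    by (auto simp: set_nths) (metis add_0 nth_upt)
  ultimately show ?thesis by (metis sorted_list_of_set.idem_if_sorted_distinct strict_sorted_iff)
qed

lemma nths_mode_word:
  defines "e \<equiv> \<lambda>S p. subpos p (S \<inter> {..<p})"
  shows "nths (mode_word p cs b) S = mode_word (card (S \<inter> {..<p})) (\<lambda>t. cs (e S p t)) (\<lambda>t. b (e S p t))"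
  unfolding mode_word_def nths_map nths_upt
  by (rule nth_equalityI) (simp_all add: e_def subpos_def)

text \<open>A tail sum splits into a tail sum of each subsequence. Either one may be a full sum,
  which calls for the bounds from 0, or empty, which calls for the minimum with 0.\<close>

lemma tail_bounded_comp_mult:
  assumes S: "S \<subseteq> {..<p}" and c1: "tail_bounded 0 (card S) c1" and c2: "tail_bounded 0 (card ({..<p} - S)) c2"
  shows "tail_bounded u p (\<lambda>b. c1 (\<lambda>t. b (subpos p S t)) * c2 (\<lambda>t. b (subpos p ({..<p} - S) t)))"
proof -
  have S': "{..<p} - S \<subseteq> {..<p}" by auto
  obtain C1 where C1: "\<And>b t. c1 b \<noteq> 0 \<Longrightarrow> t < card S \<Longrightarrow> C1 \<le> (\<Sum>s=t..<card S. b s)"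
    using tail_boundedD[OF c1] by blast
  obtain C2 where C2: "\<And>b t. c2 b \<noteq> 0 \<Longrightarrow> t < card ({..<p} - S) \<Longrightarrow> C2 \<le> (\<Sum>s=t..<card ({..<p} - S). b s)"
    using tail_boundedD[OF c2] by blast
  show ?thesis
  proof (rule tail_boundedI)
    fix b t assume nz: "c1 (\<lambda>t. b (subpos p S t)) * c2 (\<lambda>t. b (subpos p ({..<p} - S) t)) \<noteq> 0"
    obtain t1 where t1: "t1 \<le> card S" "(\<Sum>s\<in>S \<inter> {t..<p}. b s) = (\<Sum>j=t1..<card S. b (subpos p S j))"
      using tail_sum_subpos[OF S] .
    obtain t2 where t2: "t2 \<le> card ({..<p} - S)"
      "(\<Sum>s\<in>({..<p} - S) \<inter> {t..<p}. b s) = (\<Sum>j=t2..<card ({..<p} - S). b (subpos p ({..<p} - S) j))"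
      using tail_sum_subpos[OF S'] .
    have "min C1 0 \<le> (\<Sum>s\<in>S \<inter> {t..<p}. b s)"
      unfolding t1(2) using C1[of "\<lambda>t. b (subpos p S t)" t1] nz t1(1) by (cases "t1 = card S") auto
    moreover have "min C2 0 \<le> (\<Sum>s\<in>({..<p} - S) \<inter> {t..<p}. b s)"
      unfolding t2(2) using C2[of "\<lambda>t. b (subpos p ({..<p} - S) t)" t2] nz t2(1) by (cases "t2 = card ({..<p} - S)") auto
    moreover have "(\<Sum>s=t..<p. b s) = (\<Sum>s\<in>S \<inter> {t..<p}. b s) + (\<Sum>s\<in>({..<p} - S) \<inter> {t..<p}. b s)"
      by (subst sum.union_disjoint[symmetric]) (auto intro!: sum.cong)
    ultimately show "min C1 0 + min C2 0 \<le> (\<Sum>s=t..<p. b s)" by linarith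
  qed
qed

lemma zpow_comp_mult:
  assumes "inj e" and "tail_bounded u p c" "u \<le> 1" "k < l" "l < p"
    and r: "\<And>N m b. r (zshift (e k) (e l) N m b) = (r b :: rat)"
  shows "zpow (e k) (e l) N (\<lambda>b. c (\<lambda>t. b (e t)) * r b) = (\<lambda>b. zpow k l N c (\<lambda>t. b (e t)) * r b)"
proof
  fix b
  interpret position_pair u p k l by standard (use assms in auto)
  have sh: "(\<lambda>t. zshift (e k) (e l) N m b (e t)) = zshift k l N m (\<lambda>t. b (e t))" for m
    using assms(1) by (simp add: zshift_def inj_eq)
  show "zpow (e k) (e l) N (\<lambda>b. c (\<lambda>t. b (e t)) * r b) b = zpow k l N c (\<lambda>t. b (e t)) * r b"
    unfolding zpow_def r sh Sum_any_left_distrib[OF finite_zpow[OF assms(2)]] by (simp only: mult.assoc)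
qed

lemma zpows_comp_mult:
  assumes "A \<subseteq> pairs p" "inj e" "map_prod e e ` A \<subseteq> pairs q" "u \<le> 1" "v \<le> 1"
    "tail_bounded u p c" "tail_bounded v q (\<lambda>b. c (\<lambda>t. b (e t)) * r b)"
    and r: "\<And>k l N m b. (k, l) \<in> A \<Longrightarrow> r (zshift (e k) (e l) N m b) = r b"
  shows "zpows (map_prod e e ` A) M (\<lambda>b. c (\<lambda>t. b (e t)) * r b) =
    (\<lambda>b. zpows A (\<lambda>k l. M (e k) (e l)) c (\<lambda>t. b (e t)) * r b)"
  using assms(1,3) r
proof (induction rule: pairs_induct)
  case (insert k l A)
  have A: "map_prod e e ` A \<subseteq> pairs q" "e k < e l" "e l < q" using insert.prems(1) by auto
  have n: "(e k, e l) \<notin> map_prod e e ` A" using insert(4) assms(2) by (auto simp: inj_eq)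
  have IH: "zpows (map_prod e e ` A) M (\<lambda>b. c (\<lambda>t. b (e t)) * r b) =
      (\<lambda>b. zpows A (\<lambda>k l. M (e k) (e l)) c (\<lambda>t. b (e t)) * r b)"
    by (rule insert.IH[OF A(1)]) (use insert.prems(2) in auto)
  have "zpows (map_prod e e ` insert (k, l) A) M (\<lambda>b. c (\<lambda>t. b (e t)) * r b) =
      zpow (e k) (e l) (M (e k) (e l)) (\<lambda>b. zpows A (\<lambda>k l. M (e k) (e l)) c (\<lambda>t. b (e t)) * r b)"
    unfolding image_insert map_prod_simp zpows_insert[OF assms(7,5) A n] IH ..
  also have "\<dots> = (\<lambda>b. zpow k l (M (e k) (e l)) (zpows A (\<lambda>k l. M (e k) (e l)) c) (\<lambda>t. b (e t)) * r b)"
    by (rule zpow_comp_mult[OF assms(2) tail_bounded_zpows[OF insert(1) assms(6,4)] assms(4) insert(2,3)])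
      (use insert.prems(2) in auto)
  also have "\<dots> = (\<lambda>b. zpows (insert (k, l) A) (\<lambda>k l. M (e k) (e l)) c (\<lambda>t. b (e t)) * r b)"
    unfolding zpows_insert[OF assms(6,4) insert(1-4)] ..
  finally show ?case .
qed simp

definition cross_pairs :: "nat \<Rightarrow> nat set \<Rightarrow> (nat \<times> nat) set" where
  "cross_pairs p S = {(k, l) \<in> pairs p. (k \<in> S) \<noteq> (l \<in> S)}"

text \<open>The pairs inside \<open>S\<close>, those inside its complement and the cross pairs
  partition \<open>pairs p\<close>. The powers of the first two kinds act on one factor
  only.\<close>

lemma zpows_comp_mult_pairs:
  fixes S p
  defines "S' \<equiv> {..<p} - S"
  assumes S: "S \<subseteq> {..<p}" and c1: "tail_bounded 0 (card S) c1" and c2: "tail_bounded 0 (card S') c2"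
  shows "zpows (pairs p) M (\<lambda>b. c1 (\<lambda>t. b (subpos p S t)) * c2 (\<lambda>t. b (subpos p S' t))) =
    zpows (cross_pairs p S) M (\<lambda>b.
      zpows (pairs (card S)) (\<lambda>k l. M (subpos p S k) (subpos p S l)) c1 (\<lambda>t. b (subpos p S t)) *
      zpows (pairs (card S')) (\<lambda>k l. M (subpos p S' k) (subpos p S' l)) c2 (\<lambda>t. b (subpos p S' t)))"
proof -
  have S': "S' \<subseteq> {..<p}" by (auto simp: S'_def)
  let ?e = "subpos p S" and ?e' = "subpos p S'"
  let ?A = "map_prod ?e ?e ` pairs (card S)" and ?B = "map_prod ?e' ?e' ` pairs (card S')"
  let ?c = "\<lambda>b. c1 (\<lambda>t. b (?e t)) * c2 (\<lambda>t. b (?e' t))"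
  have tb: "tail_bounded 0 p ?c" unfolding S'_def by (rule tail_bounded_comp_mult[OF S c1 c2[unfolded S'_def]])
  have sub: "?A \<subseteq> pairs p" "?B \<subseteq> pairs p" "cross_pairs p S \<subseteq> pairs p"
    unfolding subpos_pairs[OF S] subpos_pairs[OF S'] cross_pairs_def by auto
  have disj: "cross_pairs p S \<inter> (?A \<union> ?B) = {}" "?A \<inter> ?B = {}" "pairs p = cross_pairs p S \<union> (?A \<union> ?B)"
    unfolding subpos_pairs[OF S] subpos_pairs[OF S'] cross_pairs_def unfolding S'_def by auto
  define c2' where "c2' = zpows (pairs (card S')) (\<lambda>k l. M (?e' k) (?e' l)) c2"
  have tb2: "tail_bounded 0 (card S') c2'" unfolding c2'_def by (rule tail_bounded_zpows[OF order_refl c2]) simp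
  \<comment> \<open>Beyond both cardinalities the two enumerations have the same filler p + n, hence
    the condition that one of the indices is in range.\<close>
  have disjoint: "?e x \<noteq> ?e' y" if "x < card S \<or> y < card S'" for x y
  proof -
    have "?e x \<in> S \<or> p \<le> ?e x" "?e' y \<in> S' \<or> p \<le> ?e' y"
      using subpos_in[OF S, of x] subpos_in[OF S', of y] by (auto simp: subpos_def)
    moreover have "?e x \<in> S \<or> ?e' y \<in> S'" using that subpos_in[OF S, of x] subpos_in[OF S', of y] by auto
    ultimately show ?thesis using S S' by (fastforce simp: S'_def)
  qed
  have swap: "(\<lambda>b. c1 (\<lambda>t. b (?e t)) * f b) = (\<lambda>b. f b * c1 (\<lambda>t. b (?e t)))" for f :: "(nat \<Rightarrow> int) \<Rightarrow> rat"
    by (simp add: mult.commute)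
  have "zpows ?B M ?c = (\<lambda>b. c2' (\<lambda>t. b (?e' t)) * c1 (\<lambda>t. b (?e t)))"
    unfolding swap c2'_def
  proof (rule zpows_comp_mult[OF order_refl inj_subpos[OF S'] sub(2) _ _ c2])
    show "tail_bounded 0 p (\<lambda>b. c2 (\<lambda>t. b (?e' t)) * c1 (\<lambda>t. b (?e t)))" using tb unfolding swap .
    fix k l N m b assume "(k, l) \<in> pairs (card S')"
    then have "k < card S'" "l < card S'" by auto
    then have "zshift (?e' k) (?e' l) N m b (?e t) = b (?e t)" for t
      using disjoint[of t k] disjoint[of t l] by (simp add: zshift_def)
    then show "c1 (\<lambda>t. zshift (?e' k) (?e' l) N m b (?e t)) = c1 (\<lambda>t. b (?e t))" by simp
  qed simp_all
  also have "\<dots> = (\<lambda>b. c1 (\<lambda>t. b (?e t)) * c2' (\<lambda>t. b (?e' t)))" by (simp add: mult.commute)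
  finally have B: "zpows ?B M ?c = (\<lambda>b. c1 (\<lambda>t. b (?e t)) * c2' (\<lambda>t. b (?e' t)))" .
  have A: "zpows ?A M (\<lambda>b. c1 (\<lambda>t. b (?e t)) * c2' (\<lambda>t. b (?e' t))) =
    (\<lambda>b. zpows (pairs (card S)) (\<lambda>k l. M (?e k) (?e l)) c1 (\<lambda>t. b (?e t)) * c2' (\<lambda>t. b (?e' t)))"
  proof (rule zpows_comp_mult[OF order_refl inj_subpos[OF S] sub(1) _ _ c1])
    show "tail_bounded 0 p (\<lambda>b. c1 (\<lambda>t. b (?e t)) * c2' (\<lambda>t. b (?e' t)))"
      unfolding S'_def by (rule tail_bounded_comp_mult[OF S c1 tb2[unfolded S'_def]])
    fix k l N m b assume "(k, l) \<in> pairs (card S)"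
    then have "k < card S" "l < card S" by auto
    then have "zshift (?e k) (?e l) N m b (?e' t) = b (?e' t)" for t
      using disjoint[of k t] disjoint[of l t] by (simp add: zshift_def)
    then show "c2' (\<lambda>t. zshift (?e k) (?e l) N m b (?e' t)) = c2' (\<lambda>t. b (?e' t))" by simp
  qed simp_all
  have "zpows (pairs p) M ?c = zpows (cross_pairs p S) M (zpows (?A \<union> ?B) M ?c)"
    unfolding disj(3) by (rule zpows_Un[OF sub(3) _ disj(1) tb]) (use sub in simp_all)
  also have "zpows (?A \<union> ?B) M ?c = zpows ?A M (zpows ?B M ?c)"
    by (rule zpows_Un[OF sub(1,2) disj(2) tb]) simp
  finally show ?thesis unfolding B A unfolding c2'_def .
qed

context quiver
begin

definition product_functional :: "'i vac_form \<Rightarrow> 'i vac_form \<Rightarrow> 'i tensor_alg \<Rightarrow> rat" where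
  "product_functional \<zeta> \<xi> u = pair2 Q \<zeta> \<xi> (env_coprod Q u)"

definition subset_sign :: "nat \<Rightarrow> (nat \<Rightarrow> 'i) \<Rightarrow> nat set \<Rightarrow> rat" where
  "subset_sign p cs S = (\<Prod>(k, l)\<in>pairs p.
     if k \<in> S \<and> l \<notin> S then braid Q (basis_vec (cs k)) (basis_vec (cs l)) else 1)"

lemma corr_product_functional:
  "corr (product_functional \<zeta> \<xi>) p cs b = (\<Sum>S\<in>Pow {..<p}. subset_sign p cs S *
    (corr (form \<zeta>) (card S) (\<lambda>t. cs (subpos p S t)) (\<lambda>t. b (subpos p S t)) *
     corr (form \<xi>) (card ({..<p} - S)) (\<lambda>t. cs (subpos p ({..<p} - S) t)) (\<lambda>t. b (subpos p ({..<p} - S) t))))"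
proof -
  have "Poly_Mapping.single (0 :: 'i lie_word word, 0 :: 'i lie_word word) 1 = tens 1 (1 :: 'i tensor_alg)"
    by (simp add: tens_one_one)
  then have "corr (product_functional \<zeta> \<xi>) p cs b = pair2 Q \<zeta> \<xi> (word_coprod (mode_word p cs b))"
    by (simp add: corr_def product_functional_def env_coprod_single)
  also have "\<dots> = (\<Sum>S\<in>Pow {..<p}. subset_sign p cs S *
     (form \<zeta> (mono_word (nths (mode_word p cs b) S)) * form \<xi> (mono_word (nths (mode_word p cs b) (- S)))))"
    unfolding pair2_word_coprod
  proof (rule sum.cong)
    fix S assume "S \<in> Pow {..<p}"
    have "shuffle_sign (mode_word p cs b) S = subset_sign p cs S"
      unfolding shuffle_sign_eq subset_sign_def
      by (rule prod.cong) (auto simp: mode_word_def)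
    then show "shuffle_sign (mode_word p cs b) S * (form \<zeta> (mono_word (nths (mode_word p cs b) S)) * form \<xi> (mono_word (nths (mode_word p cs b) (- S)))) =
      subset_sign p cs S * (form \<zeta> (mono_word (nths (mode_word p cs b) S)) * form \<xi> (mono_word (nths (mode_word p cs b) (- S))))"
      by simp
  qed (simp add: mode_word_def)
  also have "\<dots> = (\<Sum>S\<in>Pow {..<p}. subset_sign p cs S *
    (corr (form \<zeta>) (card S) (\<lambda>t. cs (subpos p S t)) (\<lambda>t. b (subpos p S t)) *
     corr (form \<xi>) (card ({..<p} - S)) (\<lambda>t. cs (subpos p ({..<p} - S) t)) (\<lambda>t. b (subpos p ({..<p} - S) t))))"
  proof (rule sum.cong[OF refl])
    fix S assume "S \<in> Pow {..<p}"
    then have "S \<inter> {..<p} = S" "- S \<inter> {..<p} = {..<p} - S" by auto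
    then show "subset_sign p cs S * (form \<zeta> (mono_word (nths (mode_word p cs b) S)) * form \<xi> (mono_word (nths (mode_word p cs b) (- S)))) =
      subset_sign p cs S * (corr (form \<zeta>) (card S) (\<lambda>t. cs (subpos p S t)) (\<lambda>t. b (subpos p S t)) *
       corr (form \<xi>) (card ({..<p} - S)) (\<lambda>t. cs (subpos p ({..<p} - S) t)) (\<lambda>t. b (subpos p ({..<p} - S) t)))"
      unfolding corr_def nths_mode_word by simp
  qed
  finally show ?thesis .
qed

lemma F_series_product_functional:
  assumes z: "vac_functional Q (form \<zeta>)" and x: "vac_functional Q (form \<xi>)"
  shows "F_series Q (product_functional \<zeta> \<xi>) p cs = (\<lambda>b. \<Sum>S\<in>Pow {..<p}. subset_sign p cs S *
    zpows (cross_pairs p S) (\<lambda>k l. locN Q (cs k) (cs l)) (\<lambda>b.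
     F_series Q (form \<zeta>) (card S) (\<lambda>t. cs (subpos p S t)) (\<lambda>t. b (subpos p S t)) *
     F_series Q (form \<xi>) (card ({..<p} - S)) (\<lambda>t. cs (subpos p ({..<p} - S) t)) (\<lambda>t. b (subpos p ({..<p} - S) t))) b)"
proof -
  let ?c = "\<lambda>S b. corr (form \<zeta>) (card S) (\<lambda>t. cs (subpos p S t)) (\<lambda>t. b (subpos p S t)) *
     corr (form \<xi>) (card ({..<p} - S)) (\<lambda>t. cs (subpos p ({..<p} - S) t)) (\<lambda>t. b (subpos p ({..<p} - S) t))"
  have "F_series Q (product_functional \<zeta> \<xi>) p cs =
    zpows (pairs p) (\<lambda>k l. locN Q (cs k) (cs l)) (\<lambda>b. \<Sum>S\<in>Pow {..<p}. subset_sign p cs S * ?c S b)"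
    unfolding F_series_def by (rule arg_cong[where f="zpows _ _"]) (rule ext, rule corr_product_functional)
  also have "\<dots> = (\<lambda>b. \<Sum>S\<in>Pow {..<p}. subset_sign p cs S * zpows (pairs p) (\<lambda>k l. locN Q (cs k) (cs l)) (?c S) b)"
  proof (rule zpows_sum[OF order_refl])
    fix S assume "S \<in> Pow {..<p}"
    then show "tail_bounded 0 p (?c S)"
      by (intro tail_bounded_comp_mult corr_tail_bounded z x) auto
  qed simp_all
  also have "\<dots> = (\<lambda>b. \<Sum>S\<in>Pow {..<p}. subset_sign p cs S *
    zpows (cross_pairs p S) (\<lambda>k l. locN Q (cs k) (cs l)) (\<lambda>b.
     F_series Q (form \<zeta>) (card S) (\<lambda>t. cs (subpos p S t)) (\<lambda>t. b (subpos p S t)) *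
     F_series Q (form \<xi>) (card ({..<p} - S)) (\<lambda>t. cs (subpos p ({..<p} - S) t)) (\<lambda>t. b (subpos p ({..<p} - S) t))) b)"
  proof (rule ext, rule sum.cong[OF refl])
    fix b S assume "S \<in> Pow {..<p}"
    then have S: "S \<subseteq> {..<p}" by simp
    show "subset_sign p cs S * zpows (pairs p) (\<lambda>k l. locN Q (cs k) (cs l)) (?c S) b = subset_sign p cs S *
      zpows (cross_pairs p S) (\<lambda>k l. locN Q (cs k) (cs l)) (\<lambda>b.
       F_series Q (form \<zeta>) (card S) (\<lambda>t. cs (subpos p S t)) (\<lambda>t. b (subpos p S t)) *
       F_series Q (form \<xi>) (card ({..<p} - S)) (\<lambda>t. cs (subpos p ({..<p} - S) t)) (\<lambda>t. b (subpos p ({..<p} - S) t))) b"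
      unfolding F_series_def by (subst zpows_comp_mult_pairs[OF S corr_tail_bounded[OF z] corr_tail_bounded[OF x]]) (rule refl)
  qed
  finally show ?thesis .
qed

text \<open>As a sum over single letters the degree is visibly additive when a word is split into
  two subwords.\<close>

lemma coh_degree_eq: "coh_degree p cs b = (\<Sum>t<p. - euler Q (basis_vec (cs t)) (basis_vec (cs t)) - 2 * b t)"
  unfolding coh_degree_def euler_colour_count by (simp add: sum_subtractf sum_negf sum_distrib_left)

lemma sum_subpos_split:
  assumes "S \<subseteq> {..<p}"
  shows "(\<Sum>t<p. g t) = (\<Sum>t<card S. g (subpos p S t)) + (\<Sum>t<card ({..<p} - S). g (subpos p ({..<p} - S) t))"
proof -
  have "(\<Sum>t<p. g t) = (\<Sum>t\<in>S. g t) + (\<Sum>t\<in>{..<p} - S. g t)"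
    by (metis assms finite_lessThan sum.subset_diff add.commute)
  then show ?thesis
    using sum.reindex_bij_betw[OF bij_subpos[OF assms], of g] sum.reindex_bij_betw[OF bij_subpos[of "{..<p} - S" p], of g] by simp
qed

lemma colour_count_sum: "colour_count p cs i = (\<Sum>t<p. if cs t = i then 1 else 0)"
  by (induction p) (simp_all add: colour_count_Suc)

text \<open>Colour counts and degrees add up over a subset and its complement, so the support lies
  in the image of the product of the two finite supports under addition.\<close>

lemma dual_mult_PQ_dual:
  assumes z: "\<zeta> \<in> PQ_dual Q" and x: "\<xi> \<in> PQ_dual Q"
  shows "dual_mult Q \<zeta> \<xi> \<in> PQ_dual Q" and "form (dual_mult Q \<zeta> \<xi>) = product_functional \<zeta> \<xi>"
proof -
  note zf = PQ_dual_vac_functional[OF z] and xf = PQ_dual_vac_functional[OF x]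
  note phi = vac_functional_pair2[OF zf xf]
  obtain S where S: "finite S" "\<And>p cs b. corr (form \<zeta>) p cs b \<noteq> 0 \<Longrightarrow> (colour_count p cs, coh_degree p cs b) \<in> S"
    using PQ_dual_support[OF z] by blast
  obtain T where T: "finite T" "\<And>p cs b. corr (form \<xi>) p cs b \<noteq> 0 \<Longrightarrow> (colour_count p cs, coh_degree p cs b) \<in> T"
    using PQ_dual_support[OF x] by blast
  let ?add = "\<lambda>((d, n), (e, m)). ((\<lambda>i. d i + e i), n + m) :: ('i \<Rightarrow> nat) \<times> int"
  have "lift_functional Q (\<lambda>u. pair2 Q \<zeta> \<xi> (env_coprod Q u)) \<in> PQ_dual Q"
  proof (rule lift_functional_PQ_dual[OF phi])
    show "finite (?add ` (S \<times> T))" using S(1) T(1) by simp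
    fix p cs b assume "corr (\<lambda>u. pair2 Q \<zeta> \<xi> (env_coprod Q u)) p cs b \<noteq> 0"
    then have "corr (product_functional \<zeta> \<xi>) p cs b \<noteq> 0" by (simp add: product_functional_def corr_def)
    then obtain W where W: "W \<subseteq> {..<p}"
      "corr (form \<zeta>) (card W) (\<lambda>t. cs (subpos p W t)) (\<lambda>t. b (subpos p W t)) \<noteq> 0"
      "corr (form \<xi>) (card ({..<p} - W)) (\<lambda>t. cs (subpos p ({..<p} - W) t)) (\<lambda>t. b (subpos p ({..<p} - W) t)) \<noteq> 0"
      unfolding corr_product_functional by (rule sum.not_neutral_contains_not_neutral) auto
    have "colour_count p cs = (\<lambda>i. colour_count (card W) (\<lambda>t. cs (subpos p W t)) i +
        colour_count (card ({..<p} - W)) (\<lambda>t. cs (subpos p ({..<p} - W) t)) i)"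
      unfolding colour_count_sum by (rule ext) (rule sum_subpos_split[OF W(1)])
    moreover have "coh_degree p cs b = coh_degree (card W) (\<lambda>t. cs (subpos p W t)) (\<lambda>t. b (subpos p W t)) +
        coh_degree (card ({..<p} - W)) (\<lambda>t. cs (subpos p ({..<p} - W) t)) (\<lambda>t. b (subpos p ({..<p} - W) t))"
      unfolding coh_degree_eq by (rule sum_subpos_split[OF W(1)])
    ultimately have "(colour_count p cs, coh_degree p cs b) =
      ?add ((colour_count (card W) (\<lambda>t. cs (subpos p W t)), coh_degree (card W) (\<lambda>t. cs (subpos p W t)) (\<lambda>t. b (subpos p W t))),
        (colour_count (card ({..<p} - W)) (\<lambda>t. cs (subpos p ({..<p} - W) t)),
         coh_degree (card ({..<p} - W)) (\<lambda>t. cs (subpos p ({..<p} - W) t)) (\<lambda>t. b (subpos p ({..<p} - W) t))))"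
      by simp
    then show "(colour_count p cs, coh_degree p cs b) \<in> ?add ` (S \<times> T)"
      using S(2)[OF W(2)] T(2)[OF W(3)] by (intro image_eqI) auto
  qed
  then show "dual_mult Q \<zeta> \<xi> \<in> PQ_dual Q" by (simp only: dual_mult_eq[OF zf xf])
  show "form (dual_mult Q \<zeta> \<xi>) = product_functional \<zeta> \<xi>"
    unfolding dual_mult_eq[OF zf xf] lift_functional_class[OF phi] product_functional_def ..
qed

end

section \<open>The shuffle product\<close>

lemma tail_bounded_laurent_coeff: "tail_bounded u (length (xvars d)) (laurent_coeff d f)"
proof (rule tail_boundedI[where C=0])
  fix b t assume "laurent_coeff d f b \<noteq> 0"
  then have "\<forall>t<length (xvars d). 0 \<le> b t" unfolding laurent_coeff_eq by meson
  then show "0 \<le> (\<Sum>s=t..<length (xvars d). b s)" by (auto intro: sum_nonneg)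
qed

text \<open>With natural exponents the operators are multiplication of polynomials; this carries the
  identities between series over to polynomials.\<close>

lemma zpow_laurent_coeff:
  assumes "k < l" "l < length (xvars d)"
  shows "zpow k l (int n) (laurent_coeff d f) =
    laurent_coeff d ((xvar (xvars d ! k) - xvar (xvars d ! l)) ^ n * f)"
proof (induction n)
  case 0
  interpret position_pair 1 "length (xvars d)" k l by standard (use assms in auto)
  show ?case by simp
next
  case (Suc n)
  interpret position_pair 1 "length (xvars d)" k l by standard (use assms in auto)
  have "zpow k l (int (Suc n)) (laurent_coeff d f) = zdiff k l (zpow k l (int n) (laurent_coeff d f))"
    by (simp add: zdiff_zpow[OF tail_bounded_laurent_coeff] add.commute)
  also have "\<dots> = laurent_coeff d ((xvar (xvars d ! k) - xvar (xvars d ! l)) * ((xvar (xvars d ! k) - xvar (xvars d ! l)) ^ n * f))"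
    unfolding Suc by (rule laurent_coeff_zdiff[symmetric]) (use assms in auto)
  finally show ?case by (simp add: mult.assoc)
qed

lemma zpows_laurent_coeff:
  assumes "A \<subseteq> pairs (length (xvars d))"
  shows "zpows A (\<lambda>k l. int (n k l)) (laurent_coeff d f) =
    laurent_coeff d ((\<Prod>(k, l)\<in>A. (xvar (xvars d ! k) - xvar (xvars d ! l)) ^ n k l) * f)"
  using assms
proof (induction rule: pairs_induct)
  case (insert k l A)
  have "finite A" using insert(1) by (rule finite_subset_pairs)
  then show ?case
    unfolding zpows_insert[OF tail_bounded_laurent_coeff order_refl insert(1-4)] insert.IH
      zpow_laurent_coeff[OF insert(2,3)]
    using insert(4) by (simp add: mult.assoc)
qed simp

section \<open>Shuffles as subsets of positions\<close>

lemma sorted_eqI: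
  fixes xs ys :: "'a::linorder list"
  assumes "sorted_wrt (<) xs" "sorted_wrt (<) ys" "set xs = set ys"
  shows "xs = ys"
  using assms by (metis sorted_list_of_set.idem_if_sorted_distinct strict_sorted_iff)

text \<open>List \<open>A\<close> in increasing order and its complement after it. The offset k - 1
  is due to lists being indexed from 0 and variables from 1.\<close>

lemma shuffle_exists:
  assumes A: "A \<subseteq> {1..n}"
  shows "\<exists>\<pi>. \<pi> permutes {1..n} \<and> strict_mono_on {1..card A} \<pi> \<and> strict_mono_on {card A + 1..n} \<pi> \<and> \<pi> ` {1..card A} = A"
proof -
  have fin: "finite A" using A finite_subset by blast
  let ?B = "{1..n} - A" and ?a = "card A"
  have cB: "card ?B = n - ?a" using A by (simp add: card_Diff_subset fin)
  have an: "?a \<le> n" using card_mono[OF _ A] by simp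
  define xs where "xs = sorted_list_of_set A @ sorted_list_of_set ?B"
  have xs: "length xs = n" "distinct xs" "set xs = {1..n}"
    using A an by (auto simp: xs_def fin cB[simplified])
  define \<pi> where "\<pi> k = (if k \<in> {1..n} then xs ! (k - 1) else k)" for k
  have 1: "\<pi> k = sorted_list_of_set A ! (k - 1)" if "k \<in> {1..?a}" for k
    using that an by (auto simp: \<pi>_def xs_def nth_append)
  have 2: "\<pi> k = sorted_list_of_set ?B ! (k - 1 - ?a)" if "k \<in> {?a + 1..n}" for k
    using that by (auto simp: \<pi>_def xs_def nth_append)
  have "bij_betw \<pi> {1..n} {1..n}"
  proof -
    have "bij_betw (\<lambda>k. k - 1) {1..n} {..<n}"
      by (rule bij_betwI[where g=Suc]) auto
    moreover have "bij_betw ((!) xs) {..<n} {1..n}"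
      by (rule bij_betw_nth) (simp_all add: xs)
    ultimately have "bij_betw ((!) xs \<circ> (\<lambda>k. k - 1)) {1..n} {1..n}" by (rule bij_betw_trans)
    then show ?thesis by (rule bij_betw_cong[THEN iffD1, rotated]) (simp add: \<pi>_def)
  qed
  then have "\<pi> permutes {1..n}" by (rule bij_imp_permutes) (auto simp: \<pi>_def)
  moreover have "strict_mono_on {1..?a} \<pi>"
  proof (rule strict_mono_onI)
    fix r s assume rs: "r \<in> {1..?a}" "s \<in> {1..?a}" "r < s"
    then show "\<pi> r < \<pi> s"
      unfolding 1[OF rs(1)] 1[OF rs(2)] by (intro sorted_wrt_nth_less[OF strict_sorted_list_of_set]) auto
  qed
  moreover have "strict_mono_on {?a + 1..n} \<pi>"
  proof (rule strict_mono_onI)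
    fix r s assume rs: "r \<in> {?a + 1..n}" "s \<in> {?a + 1..n}" "r < s"
    then show "\<pi> r < \<pi> s"
      unfolding 2[OF rs(1)] 2[OF rs(2)] by (intro sorted_wrt_nth_less[OF strict_sorted_list_of_set]) (auto simp: cB[simplified])
  qed
  moreover have "\<pi> ` {1..?a} = A"
  proof -
    have "\<pi> ` {1..?a} = (!) (sorted_list_of_set A) ` ((\<lambda>k. k - 1) ` {1..?a})"
      unfolding image_image using 1 by (intro image_cong) auto
    also have "(\<lambda>k. k - 1) ` {1..?a} = {..<?a}" by (rule bij_betw_imp_surj_on, rule bij_betwI[where g=Suc]) auto
    also have "(!) (sorted_list_of_set A) ` {..<?a} = A"
      using nth_image[of ?a "sorted_list_of_set A"] fin by (simp add: lessThan_atLeast0)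
    finally show ?thesis .
  qed
  ultimately show ?thesis by blast
qed

lemma strict_mono_on_unique:
  fixes f g :: "nat \<Rightarrow> nat"
  assumes "strict_mono_on {a..<b} f" "strict_mono_on {a..<b} g" "f ` {a..<b} = g ` {a..<b}" "k \<in> {a..<b}"
  shows "f k = g k"
proof -
  have s: "sorted_wrt (<) (map h [a..<b])" if "strict_mono_on {a..<b} h" for h :: "nat \<Rightarrow> nat"
    unfolding sorted_wrt_map
    by (rule sorted_wrt_mono_rel[OF _ sorted_wrt_upt]) (auto intro: strict_mono_onD[OF that])
  have "map f [a..<b] = map g [a..<b]"
    by (rule sorted_eqI[OF s[OF assms(1)] s[OF assms(2)]]) (simp add: assms(3))
  then show ?thesis using assms(4) by simp
qed

text \<open>An increasing map on an interval is determined by its image, and the image of the second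
  block is the complement of that of the first.\<close>

lemma shuffle_unique:
  fixes \<pi> \<rho> :: "nat \<Rightarrow> nat"
  assumes "\<pi> permutes {1..n}" "strict_mono_on {1..a} \<pi>" "strict_mono_on {a + 1..n} \<pi>"
    and "\<rho> permutes {1..n}" "strict_mono_on {1..a} \<rho>" "strict_mono_on {a + 1..n} \<rho>"
    and im: "\<pi> ` {1..a} = \<rho> ` {1..a}" and "a \<le> n"
  shows "\<pi> = \<rho>"
proof
  fix k
  have e: "{1..a} = {1..<Suc a}" "{a + 1..n} = {a + 1..<Suc n}" by auto
  have c: "h ` {a + 1..n} = {1..n} - h ` {1..a}" if "h permutes {1..n}" for h
  proof -
    have "{a + 1..n} = {1..n} - {1..a}" using assms(8) by auto
    then show ?thesis using image_set_diff[OF permutes_inj[OF that]] permutes_image[OF that] by metis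
  qed
  consider "k \<in> {1..a}" | "k \<in> {a + 1..n}" | "k \<notin> {1..n}" by fastforce
  then show "\<pi> k = \<rho> k"
  proof cases
    case 1
    then show ?thesis using strict_mono_on_unique[of 1 "Suc a" \<pi> \<rho> k] assms(2,5) im unfolding e by blast
  next
    case 2
    then show ?thesis using strict_mono_on_unique[of "a + 1" "Suc n" \<pi> \<rho> k] assms(3,6) c[OF assms(1)] c[OF assms(4)] im
      unfolding e by simp
  next
    case 3
    then show ?thesis using permutes_not_in assms(1,4) by metis
  qed
qed

abbreviation var_perm :: "('i \<Rightarrow> nat \<Rightarrow> nat) \<Rightarrow> 'i \<times> nat \<Rightarrow> 'i \<times> nat" where
  "var_perm \<sigma> \<equiv> \<lambda>(i, k). (i, \<sigma> i k)"

abbreviation var_shift :: "('i \<Rightarrow> nat) \<Rightarrow> 'i \<times> nat \<Rightarrow> 'i \<times> nat" where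
  "var_shift d \<equiv> \<lambda>(j, l). (j, d j + l)"

lemma inj_var_shift: "inj (var_shift d)"
  by (auto simp: inj_def)

definition positions :: "('i::{finite,linorder} \<Rightarrow> nat) \<Rightarrow> ('i \<times> nat) set \<Rightarrow> nat set" where
  "positions c W = {t. t < length (xvars c) \<and> xvars c ! t \<in> W}"

lemma positions_subset: "positions c W \<subseteq> {..<length (xvars c)}"
  by (auto simp: positions_def)

lemma image_positions: "W \<subseteq> var_set c \<Longrightarrow> (!) (xvars c) ` positions c W = W"
proof (intro equalityI subsetI)
  fix w assume "W \<subseteq> var_set c" "w \<in> W"
  then have "w \<in> set (xvars c)" by auto
  then obtain t where "t < length (xvars c)" "w = xvars c ! t" unfolding in_set_conv_nth by blast
  then show "w \<in> (!) (xvars c) ` positions c W" using \<open>w \<in> W\<close> by (auto simp: positions_def)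
qed (auto simp: positions_def)

lemma sorted_xvars: "sorted_wrt (<) (xvars c)"
  by (simp add: xvars_eq)

text \<open>\<open>vs\<close> and the variables at the positions of \<open>W\<close> are increasing
  enumerations of the same set.\<close>

lemma xvars_subpos:
  assumes W: "set vs = W" "W \<subseteq> var_set c" and vs: "sorted_wrt (<) vs"
  shows "card (positions c W) = length vs"
    and "t < length vs \<Longrightarrow> xvars c ! subpos (length (xvars c)) (positions c W) t = vs ! t"
proof -
  let ?S = "positions c W" and ?p = "length (xvars c)"
  let ?ws = "map (\<lambda>t. xvars c ! subpos ?p ?S t) [0..<card ?S]"
  note sub = positions_subset[of c W]
  have "sorted_wrt (<) ?ws"
    unfolding sorted_wrt_map
    by (rule sorted_wrt_mono_rel[OF _ sorted_wrt_upt])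
      (auto intro!: sorted_wrt_nth_less[OF sorted_xvars] subpos_mono[OF sub] subpos_less[OF sub])
  moreover have "set ?ws = W"
  proof -
    have "set ?ws = (!) (xvars c) ` (subpos ?p ?S ` {..<card ?S})" by (auto simp: image_iff)
    also have "\<dots> = W" unfolding bij_betw_imp_surj_on[OF bij_subpos[OF sub]] by (rule image_positions[OF W(2)])
    finally show ?thesis .
  qed
  ultimately have eq: "?ws = vs" using sorted_eqI vs W(1) by metis
  then show "card ?S = length vs" by (metis diff_zero length_map length_upt)
  then show "xvars c ! subpos ?p ?S t = vs ! t" if "t < length vs"
    using arg_cong[OF eq, of "\<lambda>xs. xs ! t"] that by simp
qed

locale shuffle =
  fixes d e :: "'i::{finite,linorder} \<Rightarrow> nat" and \<sigma> :: "'i \<Rightarrow> nat \<Rightarrow> nat"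
  assumes \<sigma>: "\<sigma> \<in> colour_shuffles d e"
begin

abbreviation c :: "'i \<Rightarrow> nat" where "c \<equiv> \<lambda>i. d i + e i"
abbreviation p :: nat where "p \<equiv> length (xvars c)"

text \<open>The variables to which the shuffle sends the x-variables; \<open>S\<close> is the set of
  their positions, and the y-variables occupy the complement.\<close>

definition W :: "('i \<times> nat) set" where "W = var_perm \<sigma> ` var_set d"
definition S :: "nat set" where "S = positions c W"

lemma var_perm_permutes: "var_perm \<sigma> permutes var_set c"
  using \<sigma> var_perm_of_colour_perm by (auto simp: colour_shuffles_def)

lemma W_subset: "W \<subseteq> var_set c"
proof -
  have "var_set d \<subseteq> var_set c" by auto
  then show ?thesis unfolding W_def using permutes_image[OF var_perm_permutes] by blast
qed

lemma S_subset: "S \<subseteq> {..<p}"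
  unfolding S_def by (rule positions_subset)

lemma W_complement: "var_set c - W = (\<lambda>v. var_perm \<sigma> (var_shift d v)) ` var_set e"
proof -
  have "var_set c - var_set d = var_shift d ` var_set e"
  proof (intro equalityI subsetI)
    fix v assume "v \<in> var_set c - var_set d"
    then show "v \<in> var_shift d ` var_set e"
      by (cases v) (auto intro!: image_eqI[of _ _ "(fst v, snd v - d (fst v))"])
  qed auto
  then show ?thesis
    using image_set_diff[OF permutes_inj[OF var_perm_permutes], of "var_set c" "var_set d"]
      permutes_image[OF var_perm_permutes] by (simp add: W_def image_image)
qed

lemma S_complement: "{..<p} - S = positions c (var_set c - W)"
proof -
  have "xvars c ! t \<in> var_set c" if "t < p" for t using nth_mem[OF that] by simp
  then show ?thesis by (auto simp: S_def positions_def)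
qed

text \<open>A shuffle is increasing on the x-block of each colour and keeps colours, so it respects
  the lexicographic order there. The enumeration of \<open>S\<close> thus agrees with that of
  \<open>xvars d\<close> without a further permutation.\<close>

lemma sorted_first: "sorted_wrt (<) (map (var_perm \<sigma>) (xvars d))"
proof -
  have "\<sigma> i k < \<sigma> i l" if "k \<in> {1..d i}" "l \<in> {1..d i}" "k < l" for i k l
    using \<sigma> that unfolding colour_shuffles_def by (blast dest: strict_mono_onD)
  then have "var_perm \<sigma> v < var_perm \<sigma> w" if "v \<in> var_set d" "w \<in> var_set d" "v < w" for v w
    using that by (cases v; cases w) (auto simp: less_prod_simp)
  then show ?thesis unfolding sorted_wrt_map by (intro sorted_wrt_mono_rel[OF _ sorted_xvars]) simp
qed

lemma sorted_second: "sorted_wrt (<) (map (\<lambda>v. var_perm \<sigma> (var_shift d v)) (xvars e))"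
proof -
  have "\<sigma> i k < \<sigma> i l" if "k \<in> {d i + 1..c i}" "l \<in> {d i + 1..c i}" "k < l" for i k l
    using \<sigma> that unfolding colour_shuffles_def by (blast dest: strict_mono_onD)
  then have "var_perm \<sigma> (var_shift d v) < var_perm \<sigma> (var_shift d w)"
    if "v \<in> var_set e" "w \<in> var_set e" "v < w" for v w
    using that by (cases v; cases w) (auto simp: less_prod_simp)
  then show ?thesis unfolding sorted_wrt_map by (intro sorted_wrt_mono_rel[OF _ sorted_xvars]) simp
qed

lemma card_S: "card S = length (xvars d)"
  unfolding S_def using xvars_subpos(1)[OF _ W_subset sorted_first] by (simp add: W_def)

lemma xvars_S: "t < card S \<Longrightarrow> xvars c ! subpos p S t = var_perm \<sigma> (xvars d ! t)"
  using xvars_subpos(2)[OF _ W_subset sorted_first, of t] unfolding S_def[symmetric] card_S by (simp add: W_def)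

lemma card_S': "card ({..<p} - S) = length (xvars e)"
  unfolding S_complement using xvars_subpos(1)[OF _ Diff_subset[of "var_set c" W] sorted_second]
  by (simp add: W_complement)

lemma xvars_S': "t < card ({..<p} - S) \<Longrightarrow>
    xvars c ! subpos p ({..<p} - S) t = var_perm \<sigma> (var_shift d (xvars e ! t))"
  using xvars_subpos(2)[OF _ Diff_subset[of "var_set c" W] sorted_second, of t] unfolding card_S'
  unfolding S_complement by (simp add: W_complement)

lemma zcolour_S: "t < card S \<Longrightarrow> zcolour c (subpos p S t) = zcolour d t"
  using xvars_S[of t] by (simp add: zcolour_def case_prod_unfold)

lemma zcolour_S': "t < card ({..<p} - S) \<Longrightarrow> zcolour c (subpos p ({..<p} - S) t) = zcolour e t"
  using xvars_S'[of t] by (simp add: zcolour_def case_prod_unfold)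

lemma sum_split:
  "(\<Sum>t<p. g t) = (\<Sum>t<card S. g (subpos p S t)) + (\<Sum>t<card ({..<p} - S). g (subpos p ({..<p} - S) t))"
  for g :: "nat \<Rightarrow> 'r::comm_monoid_add"
proof -
  have "(\<Sum>t<p. g t) = (\<Sum>t\<in>S. g t) + (\<Sum>t\<in>{..<p} - S. g t)"
    by (metis S_subset finite_lessThan sum.subset_diff add.commute)
  then show ?thesis
    using sum.reindex_bij_betw[OF bij_subpos[OF S_subset], of g]
      sum.reindex_bij_betw[OF bij_subpos[of "{..<p} - S" p], of g] by simp
qed

definition shuffled :: "'i xpoly \<Rightarrow> 'i xpoly \<Rightarrow> 'i xpoly" where
  "shuffled f g = xrename \<sigma> (f * xrename (\<lambda>j l. d j + l) g)"

lemma shuffled_xpolys: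
  assumes "f \<in> xpolys d" "g \<in> xpolys e"
  shows "shuffled f g \<in> xpolys c"
proof -
  have "var_rename (var_shift d) g \<in> xpolys c"
    by (rule var_rename_xpolys[OF assms(2)]) auto
  moreover have "f \<in> xpolys c" by (rule xpolys_mono[OF assms(1)]) auto
  ultimately have "f * var_rename (var_shift d) g \<in> xpolys c" by (intro xpolys_mult)
  then show ?thesis unfolding shuffled_def xrename_eq
    by (rule var_rename_xpolys) (simp add: permutes_image[OF var_perm_permutes])
qed

text \<open>After the shift the two polynomials have disjoint sets of variables, so coefficients
  multiply. A negative exponent sits at a position of one of the two factors and annihilates
  it.\<close>

lemma laurent_coeff_shuffled:
  assumes f: "f \<in> xpolys d" and g: "g \<in> xpolys e"
  shows "laurent_coeff c (shuffled f g) a =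
    laurent_coeff d f (\<lambda>t. a (subpos p S t)) * laurent_coeff e g (\<lambda>t. a (subpos p ({..<p} - S) t))"
proof (cases "\<forall>t<p. 0 \<le> a t")
  case True
  let ?a1 = "\<lambda>t. a (subpos p S t)" and ?a2 = "\<lambda>t. a (subpos p ({..<p} - S) t)"
  have nn1: "\<forall>t<length (xvars d). 0 \<le> ?a1 t"
    using True subpos_less[OF S_subset] by (simp add: card_S)
  have nn2: "\<forall>t<length (xvars e). 0 \<le> ?a2 t"
    using True subpos_less[of "{..<p} - S" p] by (simp add: card_S')
  have "exps_mon c a = mon_rename (var_perm \<sigma>) (exps_mon d ?a1 + mon_rename (var_shift d) (exps_mon e ?a2))"
    unfolding exps_mon_def sum_split
    by (simp add: mon_rename_add mon_rename_sum xvars_S xvars_S' card_S[symmetric] card_S'[symmetric])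
  moreover have "Poly_Mapping.lookup (f * var_rename (var_shift d) g) (exps_mon d ?a1 + mon_rename (var_shift d) (exps_mon e ?a2)) =
      Poly_Mapping.lookup f (exps_mon d ?a1) * Poly_Mapping.lookup (var_rename (var_shift d) g) (mon_rename (var_shift d) (exps_mon e ?a2))"
  proof (rule lookup_mult_disjoint)
    show "Poly_Mapping.keys m \<subseteq> var_set d" if "m \<in> Poly_Mapping.keys f" for m
      using that f by (simp add: xpolys_iff)
    show "Poly_Mapping.keys m \<subseteq> var_shift d ` var_set e" if m: "m \<in> Poly_Mapping.keys (var_rename (var_shift d) g)" for m
    proof -
      obtain n where n: "m = mon_rename (var_shift d) n" "n \<in> Poly_Mapping.keys g"
        using subsetD[OF keys_var_rename m] by (elim imageE)
      then have "Poly_Mapping.keys n \<subseteq> var_set e" using g by (simp add: xpolys_iff)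
      then show ?thesis unfolding n(1) using keys_mon_rename[of "var_shift d" n] by (meson image_mono order_trans)
    qed
    show "var_set d \<inter> var_shift d ` var_set e = {}" by auto
    show "Poly_Mapping.keys (exps_mon d ?a1) \<subseteq> var_set d" by (rule keys_exps_mon)
    show "Poly_Mapping.keys (mon_rename (var_shift d) (exps_mon e ?a2)) \<subseteq> var_shift d ` var_set e"
      using keys_mon_rename[of "var_shift d"] keys_exps_mon[of e] by (meson image_mono order_trans)
  qed
  ultimately show ?thesis
    unfolding laurent_coeff_eq if_P[OF True] if_P[OF nn1] if_P[OF nn2] shuffled_def xrename_eq
    by (simp add: lookup_var_rename[OF permutes_inj[OF var_perm_permutes]] lookup_var_rename[OF inj_var_shift])
next
  case False
  then obtain t where t: "t < p" "a t < 0" by (auto simp: not_le)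
  have "laurent_coeff d f (\<lambda>t. a (subpos p S t)) = 0 \<or> laurent_coeff e g (\<lambda>t. a (subpos p ({..<p} - S) t)) = 0"
  proof (cases "t \<in> S")
    case True
    then have "t \<in> subpos p S ` {..<card S}" unfolding bij_betw_imp_surj_on[OF bij_subpos[OF S_subset]] .
    then obtain j where "j < card S" "t = subpos p S j" by blast
    then have "\<not> (\<forall>t<length (xvars d). 0 \<le> a (subpos p S t))" using t by (auto simp: card_S not_le)
    then show ?thesis unfolding laurent_coeff_eq by (simp only: if_False simp_thms)
  next
    case False
    then have "t \<in> {..<p} - S" using t by simp
    then have "t \<in> subpos p ({..<p} - S) ` {..<card ({..<p} - S)}"
      unfolding bij_betw_imp_surj_on[OF bij_subpos[OF Diff_subset]] .
    then obtain j where "j < card ({..<p} - S)" "t = subpos p ({..<p} - S) j" by blast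
    then have "\<not> (\<forall>t<length (xvars e). 0 \<le> a (subpos p ({..<p} - S) t))" using t by (auto simp: card_S' not_le)
    then show ?thesis unfolding laurent_coeff_eq by (simp only: if_False simp_thms)
  qed
  then show ?thesis using False by (auto simp: laurent_coeff_eq)
qed

lemma prod_var_set: "(\<Prod>v\<in>var_set d. g (var_perm \<sigma> v)) = (\<Prod>k\<in>S. g (xvars c ! k))"
  for g :: "'i \<times> nat \<Rightarrow> 'r::comm_monoid_mult"
proof -
  have "(\<Prod>v\<in>var_set d. g (var_perm \<sigma> v)) = (\<Prod>t<length (xvars d). g (var_perm \<sigma> (xvars d ! t)))"
    by (rule prod.reindex_bij_betw[OF bij_xvars, symmetric])
  also have "\<dots> = (\<Prod>t<card S. g (xvars c ! subpos p S t))"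
    by (rule prod.cong) (simp_all add: card_S xvars_S)
  also have "\<dots> = (\<Prod>k\<in>S. g (xvars c ! k))"
    by (rule prod.reindex_bij_betw[OF bij_subpos[OF S_subset]])
  finally show ?thesis .
qed

lemma prod_var_set': "(\<Prod>v\<in>var_set e. g (var_perm \<sigma> (var_shift d v))) = (\<Prod>k\<in>{..<p} - S. g (xvars c ! k))"
  for g :: "'i \<times> nat \<Rightarrow> 'r::comm_monoid_mult"
proof -
  have "(\<Prod>v\<in>var_set e. g (var_perm \<sigma> (var_shift d v))) = (\<Prod>t<length (xvars e). g (var_perm \<sigma> (var_shift d (xvars e ! t))))"
    by (rule prod.reindex_bij_betw[OF bij_xvars, symmetric])
  also have "\<dots> = (\<Prod>t<card ({..<p} - S). g (xvars c ! subpos p ({..<p} - S) t))"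
    by (rule prod.cong) (simp_all add: card_S' xvars_S')
  also have "\<dots> = (\<Prod>k\<in>{..<p} - S. g (xvars c ! k))"
    by (rule prod.reindex_bij_betw[OF bij_subpos]) auto
  finally show ?thesis .
qed

end

text \<open>Matches the sum over subsets that comes from the coproduct with the sum over d and over
  shuffles that defines the product: the colours of a subset are counted by d, and in each colour
  the subset is the image of the first block.\<close>

lemma shuffle_bij:
  fixes c :: "'i::{finite,linorder} \<Rightarrow> nat"
  shows "bij_betw (\<lambda>(d, \<sigma>). positions c (var_perm \<sigma> ` var_set d))
    (Sigma {d. d \<le> c} (\<lambda>d. colour_shuffles d (\<lambda>i. c i - d i))) (Pow {..<length (xvars c)})"
proof (rule bij_betw_imageI)
  let ?J = "Sigma {d. d \<le> c} (\<lambda>d. colour_shuffles d (\<lambda>i. c i - d i))"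
  have cd: "(\<lambda>i. d i + (c i - d i)) = c" if "d \<le> c" for d
    using that by (auto simp: le_fun_def)
  have sh: "\<sigma> i permutes {1..c i}" "strict_mono_on {1..d i} (\<sigma> i)" "strict_mono_on {d i + 1..c i} (\<sigma> i)" "d i \<le> c i"
    if "(d, \<sigma>) \<in> ?J" for d \<sigma> i
    using that by (auto simp: colour_shuffles_def colour_perms_def le_fun_def)
  have sub: "var_perm \<sigma> ` var_set d \<subseteq> var_set c" if "(d, \<sigma>) \<in> ?J" for d \<sigma>
    using shuffle.W_subset[of d "\<lambda>i. c i - d i" \<sigma>] that cd[of d] by (simp add: shuffle.intro shuffle.W_def)
  have colour: "{k. (i, k) \<in> var_perm \<sigma> ` var_set d} = \<sigma> i ` {1..d i}" for \<sigma> :: "'i \<Rightarrow> nat \<Rightarrow> nat" and d i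
  proof (intro equalityI subsetI)
    fix k assume "k \<in> \<sigma> i ` {1..d i}"
    then obtain x where "x \<in> {1..d i}" "k = \<sigma> i x" by blast
    then have "(i, k) \<in> var_perm \<sigma> ` var_set d" by (intro image_eqI[of _ _ "(i, x)"]) auto
    then show "k \<in> {k. (i, k) \<in> var_perm \<sigma> ` var_set d}" by simp
  qed auto
  show "inj_on (\<lambda>(d, \<sigma>). positions c (var_perm \<sigma> ` var_set d)) ?J"
  proof (rule inj_onI, clarify)
    fix d \<sigma> d' \<sigma>'
    assume J: "d \<le> c" "\<sigma> \<in> colour_shuffles d (\<lambda>i. c i - d i)" "d' \<le> c" "\<sigma>' \<in> colour_shuffles d' (\<lambda>i. c i - d' i)"
      and eq: "positions c (var_perm \<sigma> ` var_set d) = positions c (var_perm \<sigma>' ` var_set d')"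
    have x: "(d, \<sigma>) \<in> ?J" and y: "(d', \<sigma>') \<in> ?J" using J by auto
    have "var_perm \<sigma> ` var_set d = (!) (xvars c) ` positions c (var_perm \<sigma> ` var_set d)"
      by (rule image_positions[OF sub[OF x], symmetric])
    also have "\<dots> = var_perm \<sigma>' ` var_set d'"
      unfolding eq by (rule image_positions[OF sub[OF y]])
    finally have im: "\<sigma> i ` {1..d i} = \<sigma>' i ` {1..d' i}" for i
      unfolding colour[symmetric] by (simp only:)
    have "d i = d' i" for i
      using arg_cong[OF im, of card i] permutes_inj_on[OF sh(1)[OF x]] permutes_inj_on[OF sh(1)[OF y]]
      by (simp add: card_image)
    then have d: "d = d'" by auto
    have "\<sigma> i = \<sigma>' i" for i
      by (rule shuffle_unique[OF sh(1-3)[OF x] sh(1-3)[OF y, folded d] im[folded d] sh(4)[OF x]])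
    then show "d = d' \<and> \<sigma> = \<sigma>'" using d by auto
  qed
  show "(\<lambda>(d, \<sigma>). positions c (var_perm \<sigma> ` var_set d)) ` ?J = Pow {..<length (xvars c)}"
  proof (intro equalityI subsetI)
    fix T assume "T \<in> Pow {..<length (xvars c)}"
    then have T: "T \<subseteq> {..<length (xvars c)}" by simp
    define W where "W = (!) (xvars c) ` T"
    define Wi where "Wi i = {k. (i, k) \<in> W}" for i
    define d where "d i = card (Wi i)" for i
    have "xvars c ! t \<in> var_set c" if "t < length (xvars c)" for t using nth_mem[OF that] by simp
    then have W: "W \<subseteq> var_set c" using T unfolding W_def by auto
    then have Wi: "Wi i \<subseteq> {1..c i}" for i unfolding Wi_def by auto
    obtain \<sigma> where s: "\<And>i. \<sigma> i permutes {1..c i} \<and> strict_mono_on {1..d i} (\<sigma> i) \<and> strict_mono_on {d i + 1..c i} (\<sigma> i) \<and> \<sigma> i ` {1..d i} = Wi i"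
      using shuffle_exists[OF Wi] unfolding d_def[symmetric] by metis
    have dc: "d \<le> c" unfolding le_fun_def d_def using card_mono[OF _ Wi] by force
    have "\<sigma> \<in> colour_shuffles d (\<lambda>i. c i - d i)"
      using s unfolding colour_shuffles_def colour_perms_def cd[OF dc] using dc by (auto simp: le_fun_def)
    moreover have "var_perm \<sigma> ` var_set d = W"
    proof (rule set_eqI)
      fix v :: "'i \<times> nat"
      have "{k. (fst v, k) \<in> var_perm \<sigma> ` var_set d} = {k. (fst v, k) \<in> W}"
        using s[of "fst v"] by (simp only: colour Wi_def)
      from set_eq_iff[THEN iffD1, OF this, rule_format, of "snd v"]
      show "v \<in> var_perm \<sigma> ` var_set d \<longleftrightarrow> v \<in> W" by (simp only: mem_Collect_eq prod.collapse)
    qed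
    moreover have "positions c W = T"
    proof -
      have "t \<in> T" if "t < length (xvars c)" "xvars c ! t \<in> W" for t
      proof -
        from that(2) obtain u where u: "u \<in> T" "xvars c ! t = xvars c ! u" unfolding W_def by (rule imageE)
        then have "t = u" using nth_eq_iff_index_eq[OF distinct_xvars that(1)] T by auto
        then show ?thesis using u by (simp only:)
      qed
      then show ?thesis using T by (auto simp: positions_def W_def)
    qed
    ultimately show "T \<in> (\<lambda>(d, \<sigma>). positions c (var_perm \<sigma> ` var_set d)) ` ?J"
      using dc by (intro image_eqI[of _ _ "(d, \<sigma>)"]) auto
  qed (auto simp: positions_def)
qed

lemma finite_colour_shuffles: "finite (colour_shuffles (d :: 'i::finite \<Rightarrow> nat) e)"
proof (rule finite_subset)
  show "colour_shuffles d e \<subseteq> PiE UNIV (\<lambda>i. {\<pi>. \<pi> permutes {1..d i + e i}})"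
    by (auto simp: colour_shuffles_def colour_perms_def)
  show "finite (PiE UNIV (\<lambda>i. {\<pi>. \<pi> permutes {1..d i + e i}}))"
    by (intro finite_PiE finite_permutations) simp_all
qed

lemma finite_fun_le: "finite {d. d \<le> (c :: 'i::finite \<Rightarrow> nat)}"
proof (rule finite_subset)
  show "{d. d \<le> c} \<subseteq> PiE UNIV (\<lambda>i. {..c i})" by (auto simp: le_fun_def)
  show "finite (PiE UNIV (\<lambda>i. {..c i}))" by (intro finite_PiE) simp_all
qed

section \<open>The product formula in the field of fractions\<close>

lemma to_fract_prod: "to_fract (\<Prod>k\<in>K. f k) = (\<Prod>k\<in>K. to_fract (f k))"
  by (induction K rule: infinite_finite_induct) simp_all

lemma to_fract_power: "to_fract (f ^ n) = to_fract f ^ n"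
  by (induction n) simp_all

lemma xvar_inject: "xvar v = xvar w \<longleftrightarrow> v = w"
proof
  assume "xvar v = xvar w"
  then have "Poly_Mapping.lookup (xvar w) (Poly_Mapping.single v 1) = (1 :: rat)"
    by (metis lookup_single_eq xvar_def)
  then have "Poly_Mapping.single w (1::nat) = Poly_Mapping.single v 1"
    by (auto simp: xvar_def lookup_single when_def split: if_splits)
  then have "Poly_Mapping.lookup (Poly_Mapping.single w (1::nat)) v = 1" by simp
  then show "v = w" by (simp add: lookup_single when_def split: if_splits)
qed simp

lemma prod_shuffle_kernel:
  fixes g :: "'i::finite \<times> nat \<Rightarrow> 'i \<times> nat \<Rightarrow> 'r::comm_monoid_mult"
  shows "(\<Prod>i\<in>UNIV. \<Prod>j\<in>UNIV. \<Prod>k\<in>{1..d i}. \<Prod>l\<in>{1..e j}. g (i, k) (j, l)) =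
    (\<Prod>v\<in>var_set d. \<Prod>w\<in>var_set e. g v w)"
proof -
  have "(\<Prod>i\<in>UNIV. \<Prod>j\<in>UNIV. \<Prod>k\<in>{1..d i}. \<Prod>l\<in>{1..e j}. g (i, k) (j, l)) =
    (\<Prod>i\<in>UNIV. \<Prod>k\<in>{1..d i}. \<Prod>j\<in>UNIV. \<Prod>l\<in>{1..e j}. g (i, k) (j, l))"
    by (rule prod.cong[OF refl]) (rule prod.swap)
  also have "\<dots> = (\<Prod>i\<in>UNIV. \<Prod>k\<in>{1..d i}. \<Prod>w\<in>var_set e. g (i, k) w)"
    unfolding var_set_Sigma by (subst prod.Sigma) (simp_all add: case_prod_unfold)
  also have "\<dots> = (\<Prod>v\<in>var_set d. \<Prod>w\<in>var_set e. g v w)"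
    unfolding var_set_Sigma[of d] by (subst prod.Sigma) (simp_all add: case_prod_unfold)
  finally show ?thesis .
qed

text \<open>A cross pair has exactly one end in \<open>S\<close>; the product on the left lists this
  end first, \<open>cross_pairs\<close> the smaller one.\<close>

lemma prod_cross_pairs:
  fixes g :: "nat \<Rightarrow> nat \<Rightarrow> 'r::comm_monoid_mult"
  assumes "S \<subseteq> {..<p}"
  shows "(\<Prod>k\<in>S. \<Prod>l\<in>{..<p} - S. g k l) = (\<Prod>(k, l)\<in>cross_pairs p S. if k \<in> S then g k l else g l k)"
proof -
  have "finite S" using assms finite_subset by blast
  then have "(\<Prod>k\<in>S. \<Prod>l\<in>{..<p} - S. g k l) = (\<Prod>(k, l)\<in>S \<times> ({..<p} - S). g k l)"
    by (subst prod.Sigma) simp_all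
  also have "\<dots> = (\<Prod>(k, l)\<in>cross_pairs p S. if k \<in> S then g k l else g l k)"
    by (rule prod.reindex_bij_witness[of _ "\<lambda>(k, l). if k \<in> S then (k, l) else (l, k)" "\<lambda>(k, l). if k < l then (k, l) else (l, k)"])
      (use assms in \<open>auto simp: cross_pairs_def not_less le_less split: if_splits\<close>)
  finally show ?thesis .
qed

context quiver
begin

abbreviation zfract :: "('i \<Rightarrow> nat) \<Rightarrow> nat \<Rightarrow> nat \<Rightarrow> 'i xpoly fract" where
  "zfract c k l \<equiv> to_fract (xvar (xvars c ! k) - xvar (xvars c ! l))"

abbreviation zN :: "('i \<Rightarrow> nat) \<Rightarrow> nat \<Rightarrow> nat \<Rightarrow> int" where
  "zN c k l \<equiv> locN Q (zcolour c k) (zcolour c l)"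

text \<open>The kernel read on positions: k in \<open>S\<close> carries an x-variable and l in the
  complement a y-variable, whence z_l - z_k.\<close>

lemma shuffle_fract_eq:
  fixes d e f g
  defines "c \<equiv> \<lambda>i. d i + e i"
  shows "shuffle_fract Q d e f g = (\<Sum>\<sigma>\<in>colour_shuffles d e. to_fract (shuffle.shuffled d \<sigma> f g) *
     (\<Prod>k\<in>shuffle.S d e \<sigma>. \<Prod>l\<in>{..<length (xvars c)} - shuffle.S d e \<sigma>. zfract c l k powi zN c k l))"
  unfolding shuffle_fract_def
proof (rule sum.cong[OF refl])
  fix \<sigma> assume "\<sigma> \<in> colour_shuffles d e"
  then interpret shuffle d e \<sigma> by (rule shuffle.intro)
  have x: "to_fract (xrename \<sigma> (xvar (j, d j + l) - xvar (i, k))) powi (- euler Q (basis_vec i) (basis_vec j)) =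
      to_fract (xvar (var_perm \<sigma> (var_shift d (j, l))) - xvar (var_perm \<sigma> (i, k)))
        powi locN Q (fst (var_perm \<sigma> (i, k))) (fst (var_perm \<sigma> (var_shift d (j, l))))" for i j k l
    by (simp add: xrename_eq var_rename_diff var_rename_xvar locN_def)
  have "(\<Prod>i\<in>verts Q. \<Prod>j\<in>verts Q. \<Prod>k\<in>{1..d i}. \<Prod>l\<in>{1..e j}.
      to_fract (xrename \<sigma> (xvar (j, d j + l) - xvar (i, k))) powi (- euler Q (basis_vec i) (basis_vec j))) =
    (\<Prod>v\<in>var_set d. \<Prod>w\<in>var_set e. to_fract (xvar (var_perm \<sigma> (var_shift d w)) - xvar (var_perm \<sigma> v))
        powi locN Q (fst (var_perm \<sigma> v)) (fst (var_perm \<sigma> (var_shift d w))))"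
    unfolding x verts by (rule prod_shuffle_kernel)
  also have "\<dots> = (\<Prod>v\<in>var_set d. \<Prod>l\<in>{..<p} - S. to_fract (xvar (xvars c ! l) - xvar (var_perm \<sigma> v))
        powi locN Q (fst (var_perm \<sigma> v)) (fst (xvars c ! l)))"
    unfolding c_def by (rule prod.cong[OF refl]) (rule prod_var_set')
  also have "\<dots> = (\<Prod>k\<in>S. \<Prod>l\<in>{..<p} - S. to_fract (xvar (xvars c ! l) - xvar (xvars c ! k))
        powi locN Q (fst (xvars c ! k)) (fst (xvars c ! l)))"
    unfolding c_def by (rule prod_var_set)
  finally show "to_fract (xrename \<sigma> (f * xrename (\<lambda>j l. d j + l) g)) *
      (\<Prod>i\<in>verts Q. \<Prod>j\<in>verts Q. \<Prod>k\<in>{1..d i}. \<Prod>l\<in>{1..e j}.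
         to_fract (xrename \<sigma> (xvar (j, d j + l) - xvar (i, k))) powi (- euler Q (basis_vec i) (basis_vec j))) =
    to_fract (shuffled f g) * (\<Prod>k\<in>S. \<Prod>l\<in>{..<length (xvars c)} - S. zfract c l k powi zN c k l)"
    by (simp add: shuffled_def zcolour_def c_def)
qed

abbreviation scalar :: "rat \<Rightarrow> 'i xpoly fract" where
  "scalar r \<equiv> to_fract (Poly_Mapping.single 0 r)"

lemma scalar_prod: "scalar (\<Prod>k\<in>K. r k) = (\<Prod>k\<in>K. scalar (r k))"
proof -
  have "Poly_Mapping.single 0 (\<Prod>k\<in>K. r k) = (\<Prod>k\<in>K. Poly_Mapping.single 0 (r k) :: 'i xpoly)"
    by (induction K rule: infinite_finite_induct) (simp_all add: mult_single[of 0 _ 0, simplified, symmetric])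
  then show ?thesis by (simp add: to_fract_prod)
qed

lemma scalar_sign: "scalar ((-1) powi n) = (-1) powi n"
  by (cases "even n") (simp_all add: single_uminus)

text \<open>For k < l with k in \<open>S\<close> the sign (-1)^N turns (z_k - z_l)^N into (z_l -
  z_k)^N. With l in \<open>S\<close> there is no sign, and z_k - z_l is already y minus x. So the
  kernel appears with the right orientation in both cases.\<close>

lemma subset_sign_cross:
  assumes S: "S \<subseteq> {..<length (xvars c)}"
  shows "scalar (subset_sign (length (xvars c)) (zcolour c) S) *
      (\<Prod>(k, l)\<in>cross_pairs (length (xvars c)) S. zfract c k l powi zN c k l) =
    (\<Prod>k\<in>S. \<Prod>l\<in>{..<length (xvars c)} - S. zfract c l k powi zN c k l)"
proof -
  let ?p = "length (xvars c)"
  let ?X = "cross_pairs ?p S"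
  have "subset_sign ?p (zcolour c) S = (\<Prod>(k, l)\<in>?X. if k \<in> S then (-1) powi zN c k l else 1)"
    unfolding subset_sign_def braid_basis by (rule prod.mono_neutral_cong_right) (auto simp: cross_pairs_def split: if_splits)
  then have "scalar (subset_sign ?p (zcolour c) S) = (\<Prod>(k, l)\<in>?X. if k \<in> S then (-1) powi zN c k l else 1)"
    unfolding case_prod_unfold by (simp add: scalar_prod if_distrib[of scalar] scalar_sign cong: if_cong)
  then have "scalar (subset_sign ?p (zcolour c) S) * (\<Prod>(k, l)\<in>?X. zfract c k l powi zN c k l) =
    (\<Prod>(k, l)\<in>?X. (if k \<in> S then (-1) powi zN c k l else 1) * zfract c k l powi zN c k l)"
    unfolding case_prod_unfold by (simp add: prod.distrib)
  also have "\<dots> = (\<Prod>(k, l)\<in>?X. if k \<in> S then zfract c l k powi zN c k l else zfract c k l powi zN c l k)"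
  proof (rule prod.cong[OF refl], clarify)
    fix k l
    have "(-1) powi zN c k l * zfract c k l powi zN c k l = (- zfract c k l) powi zN c k l"
      by (simp add: power_int_mult_distrib[symmetric])
    also have "- zfract c k l = zfract c l k" by simp
    finally show "(if k \<in> S then (-1) powi zN c k l else 1) * zfract c k l powi zN c k l =
        (if k \<in> S then zfract c l k powi zN c k l else zfract c k l powi zN c l k)"
      by (simp add: locN_commute[of "zcolour c l"])
  qed
  also have "\<dots> = (\<Prod>k\<in>S. \<Prod>l\<in>{..<?p} - S. zfract c l k powi zN c k l)"
    by (rule prod_cross_pairs[OF S, symmetric])
  finally show ?thesis .
qed

text \<open>The operators on series expand z_k - z_l in a fixed direction, whereas fractions know no
  direction. Multiplying by all differences removes the poles, and the two sides can then be
  compared as polynomials.\<close>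

lemma F_map_dual_mult_fract:
  assumes z: "\<zeta> \<in> PQ_dual Q" and x: "\<xi> \<in> PQ_dual Q"
  shows "to_fract (F_map Q (dual_mult Q \<zeta> \<xi>) c) =
    (\<Sum>d | d \<le> c. shuffle_fract Q d (\<lambda>i. c i - d i) (F_map Q \<zeta> d) (F_map Q \<xi> (\<lambda>i. c i - d i)))"
proof -
  let ?p = "length (xvars c)" and ?J = "Sigma {d. d \<le> c} (\<lambda>d. colour_shuffles d (\<lambda>i. c i - d i))"
  define e where "e d = (\<lambda>i. c i - d i)" for d
  define T where "T = (\<lambda>(d, \<sigma>). positions c (var_perm \<sigma> ` var_set d))"
  define P where "P = (\<lambda>(d, \<sigma>). shuffle.shuffled d \<sigma> (F_map Q \<zeta> d) (F_map Q \<xi> (e d)))"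
  define X where "X k l = xvar (xvars c ! k) - xvar (xvars c ! l)" for k l
  \<comment> \<open>The cross exponents extended by 0 to all pairs, so that they can be added to the
    constant exponent 1.\<close>
  define M where "M j k l = (if (k, l) \<in> cross_pairs ?p (T j) then zN c k l else 0)" for j k l
  define F where "F = F_map Q (dual_mult Q \<zeta> \<xi>) c"
  let ?sgn = "\<lambda>j. subset_sign ?p (zcolour c) (T j)"
  have cross: "cross_pairs ?p S \<subseteq> pairs ?p" for S by (auto simp: cross_pairs_def)
  have finJ: "finite ?J" by (intro finite_SigmaI finite_fun_le finite_colour_shuffles)
  have shuf: "shuffle d (e d) \<sigma>" "(\<lambda>i. d i + e d i) = c" if "(d, \<sigma>) \<in> ?J" for d \<sigma>
    using that by (auto simp: shuffle_def e_def le_fun_def)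
  have TS: "T (d, \<sigma>) = shuffle.S d (e d) \<sigma>" if "(d, \<sigma>) \<in> ?J" for d \<sigma>
    using shuf[OF that] by (simp add: T_def shuffle.S_def shuffle.W_def)
  have Pin: "P j \<in> xpolys c" if "j \<in> ?J" for j
  proof (cases j)
    case (Pair d \<sigma>)
    then have dJ: "(d, \<sigma>) \<in> ?J" using that by simp
    show ?thesis
      using shuffle.shuffled_xpolys[OF shuf(1)[OF dJ] F_map_spec(1)[OF z] F_map_spec(1)[OF x]]
      unfolding shuf(2)[OF dJ] Pair P_def by simp
  qed
  have pieces: "F_series Q (form \<zeta>) (card (T j)) (\<lambda>t. zcolour c (subpos ?p (T j) t)) (\<lambda>t. b (subpos ?p (T j) t)) *
     F_series Q (form \<xi>) (card ({..<?p} - T j)) (\<lambda>t. zcolour c (subpos ?p ({..<?p} - T j) t)) (\<lambda>t. b (subpos ?p ({..<?p} - T j) t)) =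
     laurent_coeff c (P j) b" if "j \<in> ?J" for j b
  proof (cases j)
    case (Pair d \<sigma>)
    then have dJ: "(d, \<sigma>) \<in> ?J" using that by simp
    interpret shuffle d "e d" \<sigma> using shuf(1)[OF dJ] .
    note c = shuf(2)[OF dJ]
    have "F_series Q (form \<zeta>) (card S) (\<lambda>t. zcolour c (subpos ?p S t)) (\<lambda>t. b (subpos ?p S t)) =
      F_series Q (form \<zeta>) (length (xvars d)) (zcolour d) (\<lambda>t. b (subpos ?p S t))"
      unfolding card_S by (rule F_series_cong) (use zcolour_S in \<open>simp_all add: c card_S\<close>)
    moreover have "F_series Q (form \<xi>) (card ({..<?p} - S)) (\<lambda>t. zcolour c (subpos ?p ({..<?p} - S) t)) (\<lambda>t. b (subpos ?p ({..<?p} - S) t)) =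
      F_series Q (form \<xi>) (length (xvars (e d))) (zcolour (e d)) (\<lambda>t. b (subpos ?p ({..<?p} - S) t))"
      unfolding card_S'[unfolded c] by (rule F_series_cong) (use zcolour_S' in \<open>simp_all add: c card_S'[unfolded c]\<close>)
    ultimately show ?thesis
      unfolding Pair TS[OF dJ] P_def
      using laurent_coeff_shuffled[OF F_map_spec(1)[OF z, of d] F_map_spec(1)[OF x, of "e d"], of b, unfolded c]
      by (simp add: F_map_spec(2)[OF z] F_map_spec(2)[OF x])
  qed
  have dz: "dual_mult Q \<zeta> \<xi> \<in> PQ_dual Q" by (rule dual_mult_PQ_dual(1)[OF z x])
  have "laurent_coeff c F = F_series Q (product_functional \<zeta> \<xi>) ?p (zcolour c)"
    unfolding F_def F_map_spec(2)[OF dz] dual_mult_PQ_dual(2)[OF z x] ..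
  also have "\<dots> = (\<lambda>b. \<Sum>j\<in>?J. ?sgn j * zpows (cross_pairs ?p (T j)) (zN c) (laurent_coeff c (P j)) b)"
  proof
    fix b
    have "F_series Q (product_functional \<zeta> \<xi>) ?p (zcolour c) b = (\<Sum>j\<in>?J. ?sgn j *
      zpows (cross_pairs ?p (T j)) (zN c) (\<lambda>b.
       F_series Q (form \<zeta>) (card (T j)) (\<lambda>t. zcolour c (subpos ?p (T j) t)) (\<lambda>t. b (subpos ?p (T j) t)) *
       F_series Q (form \<xi>) (card ({..<?p} - T j)) (\<lambda>t. zcolour c (subpos ?p ({..<?p} - T j) t)) (\<lambda>t. b (subpos ?p ({..<?p} - T j) t))) b)"
      unfolding F_series_product_functional[OF PQ_dual_vac_functional[OF z] PQ_dual_vac_functional[OF x]]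
      by (rule sum.reindex_bij_betw[OF shuffle_bij[of c, folded T_def], symmetric])
    also have "\<dots> = (\<Sum>j\<in>?J. ?sgn j * zpows (cross_pairs ?p (T j)) (zN c) (laurent_coeff c (P j)) b)"
      by (rule sum.cong[OF refl]) (simp only: pieces)
    finally show "F_series Q (product_functional \<zeta> \<xi>) ?p (zcolour c) b =
      (\<Sum>j\<in>?J. ?sgn j * zpows (cross_pairs ?p (T j)) (zN c) (laurent_coeff c (P j)) b)" .
  qed
  finally have LF: "laurent_coeff c F = (\<lambda>b. \<Sum>j\<in>?J. ?sgn j * zpows (cross_pairs ?p (T j)) (zN c) (laurent_coeff c (P j)) b)" .
  note tbl = tail_bounded_laurent_coeff[of 1]
  have extend: "zpows (cross_pairs ?p S) (zN c) h = zpows (pairs ?p) (\<lambda>k l. if (k, l) \<in> cross_pairs ?p S then zN c k l else 0) h"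
    if h: "tail_bounded 1 ?p h" for S h
  proof -
    let ?M = "\<lambda>k l. if (k, l) \<in> cross_pairs ?p S then zN c k l else 0"
    have "pairs ?p = cross_pairs ?p S \<union> (pairs ?p - cross_pairs ?p S)" using cross by blast
    then have "zpows (pairs ?p) ?M h = zpows (cross_pairs ?p S) ?M (zpows (pairs ?p - cross_pairs ?p S) ?M h)"
      using zpows_Un[OF cross[of S] Diff_subset[of "pairs ?p" "cross_pairs ?p S"] _ h order_refl, of ?M] by auto
    also have "zpows (pairs ?p - cross_pairs ?p S) ?M h = zpows (pairs ?p - cross_pairs ?p S) (\<lambda>k l. 0) h"
      by (rule zpows_cong) auto
    also have "\<dots> = h" by (rule zpows_0[OF Diff_subset h order_refl])
    also have "zpows (cross_pairs ?p S) ?M h = zpows (cross_pairs ?p S) (zN c) h"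
      by (rule zpows_cong) auto
    finally show ?thesis ..
  qed
  \<comment> \<open>As N \<ge> -1, one additional factor z_k - z_l per pair makes every exponent a
    natural number.\<close>
  have M_ge: "0 \<le> 1 + M j k l" for j k l using locN_ge[of "zcolour c k" "zcolour c l"] by (auto simp: M_def)
  have "laurent_coeff c ((\<Prod>(k, l)\<in>pairs ?p. X k l) * F) = zpows (pairs ?p) (\<lambda>k l. 1) (laurent_coeff c F)"
    using zpows_laurent_coeff[OF order_refl, of c "\<lambda>k l. 1" F] by (simp add: X_def)
  also have "\<dots> = (\<lambda>b. \<Sum>j\<in>?J. ?sgn j * zpows (pairs ?p) (\<lambda>k l. 1) (zpows (cross_pairs ?p (T j)) (zN c) (laurent_coeff c (P j))) b)"
    unfolding LF by (rule zpows_sum[OF order_refl finJ tail_bounded_zpows[OF cross tbl order_refl] order_refl])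
  also have "\<dots> = (\<lambda>b. \<Sum>j\<in>?J. ?sgn j * laurent_coeff c ((\<Prod>(k, l)\<in>pairs ?p. X k l ^ nat (1 + M j k l)) * P j) b)"
  proof (rule ext, rule sum.cong[OF refl])
    fix b j
    have "zpows (pairs ?p) (\<lambda>k l. 1) (zpows (cross_pairs ?p (T j)) (zN c) (laurent_coeff c (P j))) =
      zpows (pairs ?p) (\<lambda>k l. 1 + M j k l) (laurent_coeff c (P j))"
      unfolding extend[OF tbl] M_def by (rule zpows_zpows[OF order_refl tbl order_refl])
    also have "\<dots> = zpows (pairs ?p) (\<lambda>k l. int (nat (1 + M j k l))) (laurent_coeff c (P j))"
      using M_ge by (intro zpows_cong) simp
    also have "\<dots> = laurent_coeff c ((\<Prod>(k, l)\<in>pairs ?p. X k l ^ nat (1 + M j k l)) * P j)"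
      unfolding X_def by (rule zpows_laurent_coeff[OF order_refl])
    finally show "?sgn j * zpows (pairs ?p) (\<lambda>k l. 1) (zpows (cross_pairs ?p (T j)) (zN c) (laurent_coeff c (P j))) b =
      ?sgn j * laurent_coeff c ((\<Prod>(k, l)\<in>pairs ?p. X k l ^ nat (1 + M j k l)) * P j) b" by simp
  qed
  also have "\<dots> = laurent_coeff c (\<Sum>j\<in>?J. Poly_Mapping.single 0 (?sgn j) * ((\<Prod>(k, l)\<in>pairs ?p. X k l ^ nat (1 + M j k l)) * P j))"
    by (rule ext) (simp only: laurent_coeff_sum laurent_coeff_scale)
  finally have L: "laurent_coeff c ((\<Prod>(k, l)\<in>pairs ?p. X k l) * F) =
    laurent_coeff c (\<Sum>j\<in>?J. Poly_Mapping.single 0 (?sgn j) * ((\<Prod>(k, l)\<in>pairs ?p. X k l ^ nat (1 + M j k l)) * P j))" .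
  have Xin: "X k l \<in> xpolys c" if "(k, l) \<in> pairs ?p" for k l
    using that nth_mem[of _ "xvars c"] unfolding X_def by (intro xpolys_diff xpolys_xvar) auto
  have prodin: "(\<Prod>(k, l)\<in>pairs ?p. X k l ^ n k l) \<in> xpolys c" for n
    by (rule xpolys_prod) (use Xin in \<open>auto intro: xpolys_power\<close>)
  have "(\<Prod>(k, l)\<in>pairs ?p. X k l) * F = (\<Sum>j\<in>?J. Poly_Mapping.single 0 (?sgn j) * ((\<Prod>(k, l)\<in>pairs ?p. X k l ^ nat (1 + M j k l)) * P j))"
  proof (rule laurent_coeff_inject[OF _ _ L])
    show "(\<Prod>(k, l)\<in>pairs ?p. X k l) * F \<in> xpolys c"
      using prodin[of "\<lambda>k l. 1"] F_map_spec(1)[OF dz] unfolding F_def by (intro xpolys_mult) simp_all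
    show "(\<Sum>j\<in>?J. Poly_Mapping.single 0 (?sgn j) * ((\<Prod>(k, l)\<in>pairs ?p. X k l ^ nat (1 + M j k l)) * P j)) \<in> xpolys c"
      by (intro xpolys_sum xpolys_mult prodin Pin) (simp_all add: xpolys_iff)
  qed
  then have "to_fract ((\<Prod>(k, l)\<in>pairs ?p. X k l) * F) =
    to_fract (\<Sum>j\<in>?J. Poly_Mapping.single 0 (?sgn j) * ((\<Prod>(k, l)\<in>pairs ?p. X k l ^ nat (1 + M j k l)) * P j))"
    by (simp only:)
  then have fr: "(\<Prod>(k, l)\<in>pairs ?p. zfract c k l) * to_fract F =
    (\<Sum>j\<in>?J. scalar (?sgn j) * ((\<Prod>(k, l)\<in>pairs ?p. zfract c k l ^ nat (1 + M j k l)) * to_fract (P j)))"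
    unfolding case_prod_unfold to_fract_mult to_fract_sum to_fract_prod to_fract_power X_def .
  have nz: "zfract c k l \<noteq> 0" if "(k, l) \<in> pairs ?p" for k l
  proof -
    have "xvars c ! k \<noteq> xvars c ! l" using that by (simp add: nth_eq_iff_index_eq)
    then show ?thesis by (simp add: xvar_inject)
  qed
  have pw: "(\<Prod>(k, l)\<in>pairs ?p. zfract c k l ^ nat (1 + M j k l)) =
    (\<Prod>(k, l)\<in>pairs ?p. zfract c k l) * (\<Prod>(k, l)\<in>cross_pairs ?p (T j). zfract c k l powi zN c k l)" for j
  proof -
    have "(\<Prod>(k, l)\<in>pairs ?p. zfract c k l ^ nat (1 + M j k l)) = (\<Prod>(k, l)\<in>pairs ?p. zfract c k l * zfract c k l powi M j k l)"
    proof (rule prod.cong[OF refl], clarify)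
      fix k l assume "(k, l) \<in> pairs ?p"
      have "zfract c k l ^ nat (1 + M j k l) = zfract c k l powi (1 + M j k l)"
        using M_ge[of j k l] by (simp add: power_int_def)
      also have "\<dots> = zfract c k l * zfract c k l powi M j k l"
        by (simp only: power_int_add[OF disjI1[OF nz[OF \<open>(k, l) \<in> pairs ?p\<close>]]] power_int_1_right)
      finally show "zfract c k l ^ nat (1 + M j k l) = zfract c k l * zfract c k l powi M j k l" .
    qed
    also have "\<dots> = (\<Prod>(k, l)\<in>pairs ?p. zfract c k l) * (\<Prod>(k, l)\<in>pairs ?p. zfract c k l powi M j k l)"
      unfolding case_prod_unfold by (rule prod.distrib)
    also have "(\<Prod>(k, l)\<in>pairs ?p. zfract c k l powi M j k l) = (\<Prod>(k, l)\<in>cross_pairs ?p (T j). zfract c k l powi zN c k l)"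
      by (rule prod.mono_neutral_cong_right) (use cross in \<open>auto simp: M_def\<close>)
    finally show ?thesis .
  qed
  \<comment> \<open>The common denominator. It is nonzero because distinct positions carry distinct
    variables, so it can be cancelled.\<close>
  define V where "V = (\<Prod>(k, l)\<in>pairs ?p. zfract c k l)"
  have "V \<noteq> 0" unfolding V_def using nz by (simp add: prod_zero_iff) force
  have "V * to_fract F = V * (\<Sum>j\<in>?J. to_fract (P j) * (scalar (?sgn j) * (\<Prod>(k, l)\<in>cross_pairs ?p (T j). zfract c k l powi zN c k l)))"
    unfolding fr[folded V_def] pw V_def[symmetric] sum_distrib_left by (rule sum.cong[OF refl]) (simp only: ac_simps)
  then have "to_fract F = (\<Sum>j\<in>?J. to_fract (P j) * (scalar (?sgn j) * (\<Prod>(k, l)\<in>cross_pairs ?p (T j). zfract c k l powi zN c k l)))"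
    using \<open>V \<noteq> 0\<close> by simp
  also have "\<dots> = (\<Sum>j\<in>?J. to_fract (P j) * (\<Prod>k\<in>T j. \<Prod>l\<in>{..<?p} - T j. zfract c l k powi zN c k l))"
  proof (rule sum.cong[OF refl])
    fix j assume "j \<in> ?J"
    then have "T j \<subseteq> {..<?p}" using positions_subset by (auto simp: T_def)
    then show "to_fract (P j) * (scalar (?sgn j) * (\<Prod>(k, l)\<in>cross_pairs ?p (T j). zfract c k l powi zN c k l)) =
      to_fract (P j) * (\<Prod>k\<in>T j. \<Prod>l\<in>{..<?p} - T j. zfract c l k powi zN c k l)"
      by (simp only: subset_sign_cross)
  qed
  also have "\<dots> = (\<Sum>d | d \<le> c. \<Sum>\<sigma>\<in>colour_shuffles d (e d).
      to_fract (P (d, \<sigma>)) * (\<Prod>k\<in>T (d, \<sigma>). \<Prod>l\<in>{..<?p} - T (d, \<sigma>). zfract c l k powi zN c k l))"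
    unfolding e_def by (subst sum.Sigma) (auto simp: finite_fun_le finite_colour_shuffles intro!: sum.cong)
  also have "\<dots> = (\<Sum>d | d \<le> c. shuffle_fract Q d (e d) (F_map Q \<zeta> d) (F_map Q \<xi> (e d)))"
  proof (rule sum.cong[OF refl])
    fix d assume "d \<in> {d. d \<le> c}"
    then have J: "(d, \<sigma>) \<in> ?J" if "\<sigma> \<in> colour_shuffles d (e d)" for \<sigma> using that by (simp add: e_def)
    have c: "(\<lambda>i. d i + e d i) = c" using \<open>d \<in> {d. d \<le> c}\<close> by (auto simp: e_def le_fun_def)
    show "(\<Sum>\<sigma>\<in>colour_shuffles d (e d).
      to_fract (P (d, \<sigma>)) * (\<Prod>k\<in>T (d, \<sigma>). \<Prod>l\<in>{..<?p} - T (d, \<sigma>). zfract c l k powi zN c k l)) =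
      shuffle_fract Q d (e d) (F_map Q \<zeta> d) (F_map Q \<xi> (e d))"
      unfolding shuffle_fract_eq c by (rule sum.cong[OF refl]) (simp add: TS[OF J] P_def)
  qed
  finally show ?thesis unfolding F_def e_def .
qed

text \<open>By surjectivity f and g are values of F, each placed in a single component, so the
  fraction is the image of the polynomial \<open>F_map Q (dual_mult Q \<zeta> \<xi>) ?c\<close>.
  This gives a meaning to the definite description in \<open>shuffle_mult\<close>.\<close>

lemma shuffle_mult_fract:
  assumes f: "f \<in> Lam d" and g: "g \<in> Lam e"
  shows "to_fract (shuffle_mult Q d e f g) = shuffle_fract Q d e f g"
proof -
  define h where "h d f = (\<lambda>d'. if d' = d then f else 0)" for d :: "'i \<Rightarrow> nat" and f :: "'i xpoly"
  have zero: "0 \<in> Lam d" for d :: "'i \<Rightarrow> nat" by (simp add: Lam_def xrename_eq)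
  have "h d f \<in> HQ Q" if "f \<in> Lam d" for d f
    unfolding HQ_def using that zero by (auto simp: h_def intro: finite_subset[of _ "{d}"])
  then obtain \<zeta> \<xi> where z: "\<zeta> \<in> PQ_dual Q" "F_map Q \<zeta> = h d f" and x: "\<xi> \<in> PQ_dual Q" "F_map Q \<xi> = h e g"
    using F_map_surj f g by metis
  let ?c = "\<lambda>i. d i + e i"
  have null: "shuffle_fract Q d' e' f' g' = 0" if "f' = 0 \<or> g' = 0" for d' e' and f' g' :: "'i xpoly"
  proof -
    have zero: "xrename \<rho> 0 = 0" for \<rho> :: "'i \<Rightarrow> nat \<Rightarrow> nat" by (simp add: xrename_eq)
    then have "f' * xrename (\<lambda>j l. d' j + l) g' = 0" using that by auto
    then show ?thesis unfolding shuffle_fract_def by (simp only: zero) simp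
  qed
  have "to_fract (F_map Q (dual_mult Q \<zeta> \<xi>) ?c) =
    (\<Sum>d' | d' \<le> ?c. shuffle_fract Q d' (\<lambda>i. ?c i - d' i) (h d f d') (h e g (\<lambda>i. ?c i - d' i)))"
    unfolding F_map_dual_mult_fract[OF z(1) x(1)] z(2) x(2) ..
  \<comment> \<open>For d' other than d the first factor \<open>h d f d'\<close> is 0.\<close>
  also have "\<dots> = (\<Sum>d'\<in>{d}. shuffle_fract Q d' (\<lambda>i. ?c i - d' i) (h d f d') (h e g (\<lambda>i. ?c i - d' i)))"
    by (rule sum.mono_neutral_right[OF finite_fun_le]) (auto simp: le_fun_def h_def intro: null)
  also have "\<dots> = shuffle_fract Q d e f g" by (simp add: h_def)
  finally have eq: "to_fract (F_map Q (dual_mult Q \<zeta> \<xi>) ?c) = shuffle_fract Q d e f g" .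
  have "shuffle_mult Q d e f g = F_map Q (dual_mult Q \<zeta> \<xi>) ?c"
    unfolding shuffle_mult_def eq[symmetric] by (rule the_equality) simp_all
  then show ?thesis using eq by simp
qed

lemma F_map_dual_mult:
  assumes z: "\<zeta> \<in> PQ_dual Q" and x: "\<xi> \<in> PQ_dual Q"
  shows "F_map Q (dual_mult Q \<zeta> \<xi>) = coha_mult Q (F_map Q \<zeta>) (F_map Q \<xi>)"
proof
  fix c
  have L: "F_map Q \<zeta> d \<in> Lam d" "F_map Q \<xi> d \<in> Lam d" for d
    using F_map_HQ[OF z] F_map_HQ[OF x] by (simp_all add: HQ_def)
  have "to_fract (F_map Q (dual_mult Q \<zeta> \<xi>) c) = to_fract (coha_mult Q (F_map Q \<zeta>) (F_map Q \<xi>) c)"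
    unfolding F_map_dual_mult_fract[OF z x] coha_mult_def by (simp add: shuffle_mult_fract L)
  then show "F_map Q (dual_mult Q \<zeta> \<xi>) c = coha_mult Q (F_map Q \<zeta>) (F_map Q \<xi>) c" by simp
qed

end

theorem theorem5p6:
  fixes Q :: "('i::{finite,linorder}, 'a) pre_digraph"
  assumes "fin_digraph Q" and "verts Q = UNIV" and "symmetric_quiver Q"
  shows "bij_betw (F_map Q) (PQ_dual Q) (HQ Q) \<and>
    (\<forall>\<zeta>\<in>PQ_dual Q. \<forall>\<xi>\<in>PQ_dual Q.
       F_map Q (\<lambda>X. \<zeta> X + \<xi> X) = (\<lambda>d. F_map Q \<zeta> d + F_map Q \<xi> d)) \<and>
    (\<forall>c. \<forall>\<xi>\<in>PQ_dual Q.
       F_map Q (\<lambda>X. c * \<xi> X) = (\<lambda>d. Poly_Mapping.map ((*) c) (F_map Q \<xi> d))) \<and>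
    (\<forall>d n. F_map Q ` PQ_dual_comp Q d n = HQ_comp Q d n) \<and>
    (\<forall>\<zeta>\<in>PQ_dual Q. \<forall>\<xi>\<in>PQ_dual Q.
       dual_mult Q \<zeta> \<xi> \<in> PQ_dual Q \<and>
       F_map Q (dual_mult Q \<zeta> \<xi>) = coha_mult Q (F_map Q \<zeta>) (F_map Q \<xi>))"
proof -
  interpret quiver Q by (rule quiver.intro) fact+
  show ?thesis
    by (intro conjI ballI allI F_map_bij F_map_add F_map_scale F_map_comp dual_mult_PQ_dual(1) F_map_dual_mult)
qed

end
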